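(* There exists a Banach space $Y$ such that $Y\widehat{\otimes}Y$ has finite cotype but $Y\widehat{\otimes}Y\widehat{\otimes}Y$ does not have finite cotype.
   Context: All Banach spaces are over $\mathbb{R}$. Projective tensor product: for Banach spaces $X,Y$, $X\widehat{\otimes}Y$ is the completion of the algebraic tensor product $X\otimes Y$ under the norm $\|z\|_{X\widehat{\otimes}Y}=\inf\{\sum_{i=1}^N\|x_i\|_X\|y_i\|_Y:\ N\in\mathbb{N},\ x_i\in X,\ y_i\in Y,\ z=\sum_{i=1}^N x_i\otimes y_i\}$. Threefold products are obtained by iterating this (associative) operation. Cotype: for $q\in[2,\infty)$, a Banach space $X$ has cotype $q$ if there is $C\in(0,\infty)$ such that for every $N\in\mathbb{N}$ and all $x_1,\dots,x_N\in X$, $$\left(\sum_{i=1}^N\|x_i\|_X^q\right)^{1/q}\le C\left(\mathbb{E}\left[\left\|\sum_{i=1}^N\varepsilon_ix_i\right\|_X^2\right]\right)^{1/2},$$ with $\varepsilon=(\varepsilon_1,\dots,\varepsilon_N)$ uniform on $\{-1,1\}^N$. $X$ has finite cotype if it has cotype $q$ for some $q\in[2,\infty)$. *)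

theory Defs
  imports
    "HOL-Algebra.Module"
    "HOL-Algebra.AbelCoset"
    "HOL-Library.Poly_Mapping"
    "HOL-Probability.Probability"
begin

section \<open>Real Banach spaces as records\<close>

text \<open>
  Quantifying existentially over Banach spaces, and iterating the projective tensor product,
  requires spaces that are values rather than types of class \<open>banach\<close>. A real vector space is
  therefore a module in the sense of HOL-Algebra over the field of real numbers. The record fields
  \<open>mult\<close> and \<open>one\<close> that modules inherit from rings play no role and are left \<open>undefined\<close>.
  With carriers inside \<open>nat \<Rightarrow> real\<close>, such records represent every Banach space of cardinality at
  most the continuum (in particular every separable one) up to isometric isomorphism.
\<close>

definition real_scalars :: "real ring" where
  "real_scalars = \<lparr>carrier = UNIV, monoid.mult = (*), one = 1, zero = 0, add = (+)\<rparr>"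

record 'v normed_rec = "(real, 'v) module" +
  vnorm :: "'v \<Rightarrow> real"

locale real_normed_space = Module.module real_scalars V for V :: "'v normed_rec" (structure) +
  assumes vnorm_eq_0: "x \<in> carrier V \<Longrightarrow> vnorm V x = 0 \<longleftrightarrow> x = \<zero>"
    and vnorm_triangle:
      "\<lbrakk>x \<in> carrier V; y \<in> carrier V\<rbrakk> \<Longrightarrow> vnorm V (x \<oplus> y) \<le> vnorm V x + vnorm V y"
    and vnorm_smult: "x \<in> carrier V \<Longrightarrow> vnorm V (c \<odot> x) = \<bar>c\<bar> * vnorm V x"

text \<open>
  The library locale \<open>Metric_space\<close> demands symmetry and nonnegativity of the distance even outside
  the carrier, hence the default value.
\<close>

definition vdist :: "'v normed_rec \<Rightarrow> 'v \<Rightarrow> 'v \<Rightarrow> real" where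
  "vdist V x y = (if x \<in> carrier V \<and> y \<in> carrier V then vnorm V (x \<ominus>\<^bsub>V\<^esub> y) else 0)"

definition banach_space :: "'v normed_rec \<Rightarrow> bool" where
  "banach_space V \<longleftrightarrow>
     real_normed_space V \<and> Metric_space.mcomplete (carrier V) (vdist V)"

section \<open>Quotients and completions\<close>

definition quot_module ::
  "(real, 'v, 'm) module_scheme \<Rightarrow> 'v set \<Rightarrow> (real, 'v set) module" where
  "quot_module M N =
     \<lparr>carrier = a_rcosets\<^bsub>M\<^esub> N, monoid.mult = undefined, one = undefined,
      zero = N, add = set_add M,
      module.smult = (\<lambda>c A. \<Union>a\<in>A. N +>\<^bsub>M\<^esub> (c \<odot>\<^bsub>M\<^esub> a))\<rparr>"

definition cauchy_module :: "'v normed_rec \<Rightarrow> (real, nat \<Rightarrow> 'v) module" where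
  "cauchy_module V =
     \<lparr>carrier = {\<sigma>. Metric_space.MCauchy (carrier V) (vdist V) \<sigma>},
      monoid.mult = undefined, one = undefined,
      zero = (\<lambda>n. \<zero>\<^bsub>V\<^esub>), add = (\<lambda>\<sigma> \<tau> n. \<sigma> n \<oplus>\<^bsub>V\<^esub> \<tau> n),
      module.smult = (\<lambda>c \<sigma> n. c \<odot>\<^bsub>V\<^esub> \<sigma> n)\<rparr>"

definition null_seqs :: "'v normed_rec \<Rightarrow> (nat \<Rightarrow> 'v) set" where
  "null_seqs V = {\<sigma> \<in> carrier (cauchy_module V). (\<lambda>n. vnorm V (\<sigma> n)) \<longlonglongrightarrow> 0}"

definition completion :: "'v normed_rec \<Rightarrow> (nat \<Rightarrow> 'v) set normed_rec" where
  "completion V =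
     module.extend (quot_module (cauchy_module V) (null_seqs V))
       (normed_rec.fields (\<lambda>A. THE r. \<forall>\<sigma>\<in>A. (\<lambda>n. vnorm V (\<sigma> n)) \<longlonglongrightarrow> r))"

section \<open>Projective tensor products\<close>

text \<open>
  The algebraic tensor product is the free vector space on pairs modulo the subspace generated by
  the bilinearity relations.
\<close>

definition free_module :: "'i set \<Rightarrow> (real, 'i \<Rightarrow>\<^sub>0 real) module" where
  "free_module I =
     \<lparr>carrier = {f. Poly_Mapping.keys f \<subseteq> I}, monoid.mult = undefined, one = undefined,
      zero = 0, add = (+), module.smult = (\<lambda>c. Poly_Mapping.map ((*) c))\<rparr>"

definition submodule_hull ::
  "(real, 'v, 'm) module_scheme \<Rightarrow> 'v set \<Rightarrow> 'v set" where
  "submodule_hull M S = \<Inter>{N. submodule N real_scalars M \<and> S \<subseteq> N}"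

definition bilinear_relations ::
  "'a normed_rec \<Rightarrow> 'b normed_rec \<Rightarrow> ('a \<times> 'b \<Rightarrow>\<^sub>0 real) set" where
  "bilinear_relations X Y =
     (let e = (\<lambda>x y c. Poly_Mapping.single (x, y) (c :: real)) in
       {e (x \<oplus>\<^bsub>X\<^esub> x') y 1 - e x y 1 - e x' y 1 | x x' y.
          x \<in> carrier X \<and> x' \<in> carrier X \<and> y \<in> carrier Y} \<union>
       {e x (y \<oplus>\<^bsub>Y\<^esub> y') 1 - e x y 1 - e x y' 1 | x y y'.
          x \<in> carrier X \<and> y \<in> carrier Y \<and> y' \<in> carrier Y} \<union>
       {e (c \<odot>\<^bsub>X\<^esub> x) y 1 - e x y c | c x y. x \<in> carrier X \<and> y \<in> carrier Y} \<union>
       {e x (c \<odot>\<^bsub>Y\<^esub> y) 1 - e x y c | c x y. x \<in> carrier X \<and> y \<in> carrier Y})"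

definition tensor_relations ::
  "'a normed_rec \<Rightarrow> 'b normed_rec \<Rightarrow> ('a \<times> 'b \<Rightarrow>\<^sub>0 real) set" where
  "tensor_relations X Y =
     submodule_hull (free_module (carrier X \<times> carrier Y)) (bilinear_relations X Y)"

definition alg_tensor ::
  "'a normed_rec \<Rightarrow> 'b normed_rec \<Rightarrow> (real, ('a \<times> 'b \<Rightarrow>\<^sub>0 real) set) module" where
  "alg_tensor X Y =
     quot_module (free_module (carrier X \<times> carrier Y)) (tensor_relations X Y)"

definition pure_tensor ::
  "'a normed_rec \<Rightarrow> 'b normed_rec \<Rightarrow> 'a \<Rightarrow> 'b \<Rightarrow> ('a \<times> 'b \<Rightarrow>\<^sub>0 real) set" where
  "pure_tensor X Y x y =
     tensor_relations X Y +>\<^bsub>free_module (carrier X \<times> carrier Y)\<^esub> Poly_Mapping.single (x, y) 1"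

definition proj_norm ::
  "'a normed_rec \<Rightarrow> 'b normed_rec \<Rightarrow> ('a \<times> 'b \<Rightarrow>\<^sub>0 real) set \<Rightarrow> real" where
  "proj_norm X Y z =
     Inf {\<Sum>i<N. vnorm X (x i) * vnorm Y (y i) | (N :: nat) x y.
            (\<forall>i<N. x i \<in> carrier X \<and> y i \<in> carrier Y) \<and>
            z = finsum (alg_tensor X Y) (\<lambda>i. pure_tensor X Y (x i) (y i)) {..<N}}"

definition proj_tensor ::
  "'a normed_rec \<Rightarrow> 'b normed_rec \<Rightarrow> (nat \<Rightarrow> ('a \<times> 'b \<Rightarrow>\<^sub>0 real) set) set normed_rec" where
  "proj_tensor X Y =
     completion (module.extend (alg_tensor X Y) (normed_rec.fields (proj_norm X Y)))"

section \<open>Cotype\<close>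

definition has_cotype :: "real \<Rightarrow> 'v normed_rec \<Rightarrow> bool" where
  "has_cotype q V \<longleftrightarrow>
     (\<exists>C>0. \<forall>(N :: nat) x. (\<forall>i<N. x i \<in> carrier V) \<longrightarrow>
        (\<Sum>i<N. vnorm V (x i) powr q) powr (1 / q) \<le>
        C * sqrt (measure_pmf.expectation (pmf_of_set ({..<N} \<rightarrow>\<^sub>E {-1, 1 :: real}))
                    (\<lambda>\<epsilon>. (vnorm V (finsum V (\<lambda>i. \<epsilon> i \<odot>\<^bsub>V\<^esub> x i) {..<N}))\<^sup>2)))"

definition finite_cotype :: "'v normed_rec \<Rightarrow> bool" where
  "finite_cotype V \<longleftrightarrow> (\<exists>q\<ge>2. has_cotype q V)"

end

theory Submission
  imports Defs "HOL-Number_Theory.Cong"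
begin

text \<open>
  The space is \<open>Y = \<ell>\<^sub>3\<close>.

  The projective square has cotype 6. By Grothendieck's inequality the projective norm of a matrix is
  equivalent to its norm of factorization through a Hilbert space, and by Hahn--Banach the latter is
  attained at a bilinear form \<open>B\<close> dominated by \<open>(\<Sum> f x\<^sup>2 + \<Sum> g y\<^sup>2) / 2\<close> with \<open>f, g\<close> in the unit ball of
  \<open>\<ell>\<^sub>3\<close>. For matrices \<open>z\<^sub>i\<close> with forms \<open>B\<^sub>i\<close> and weights \<open>f\<^sub>i, g\<^sub>i\<close>, the weights
  \<open>f = (\<Sum> \<lambda>\<^sub>i\<^sup>3 f\<^sub>i\<^sup>3)\<^sup>1\<^sup>/\<^sup>3\<close> and \<open>g\<close> dominate all \<open>\<lambda>\<^sub>i B\<^sub>i\<close> at once, so that a Riesz product of these forms is a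
  bounded form depending on signs \<open>\<epsilon>\<close> whose \<open>\<epsilon>\<^sub>i\<close>-coefficient is \<open>\<mu>\<^sub>i \<lambda>\<^sub>i B\<^sub>i\<close>. Testing \<open>\<Sum> \<epsilon>\<^sub>i z\<^sub>i\<close>
  against it with \<open>\<lambda>\<^sub>i\<close> and \<open>\<mu>\<^sub>i\<close> proportional to the second and third power of the norm of \<open>z\<^sub>i\<close> gives cotype 6.

  The projective cube has no finite cotype. A matching vector code with three queries encodes
  \<open>x \<in> {-1, 1}\<^sup>n\<close> as a function \<open>C x\<close> on \<open>D\<close> points, with \<open>log D\<close> below any prescribed power of \<open>n\<close>, such that
  each \<open>x\<^sub>i\<close> is read off from \<open>C x \<otimes> C x \<otimes> C x\<close> by a trilinear form bounded on \<open>\<ell>\<^sub>3\<close>. The Rademacher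
  coefficients of \<open>x \<mapsto> C x \<otimes> C x \<otimes> C x\<close> are therefore large. The Rademacher projection loses only a factor
  of order \<open>log D\<close> on spaces of dimension polynomial in \<open>D\<close>, so the signed sums of these \<open>n\<close> coefficients
  are too small for any finite cotype.
\<close>

section \<open>The three-norm over a finite index set\<close>

text \<open>The exponent 3 serves both halves. Since 1/3 + 2/3 = 1, a weight in l_3 integrates the
  square of a vector in l_3, so bilinear forms on l_3 can be compared with Hilbert space forms.
  Since 1/3 + 1/3 + 1/3 = 1, a trilinear form that reads three entries along injective maps has norm
  at most 1, while the tensor cube of a vector with D entries of modulus at most 1 has norm at most
  D. Decoding by three queries therefore loses constants only. With two queries the same count
  fails: the pairing of D coordinates has norm D^(1/3) as a bilinear form on l_3.

  The obstacle is the length of the code. The Rademacher projection costs a power of log D, so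
  cotype q is refuted only if that power is smaller than n^(1/q), and this for every q. Binomial
  coefficients modulo the two primes 5 and 7 provide such codes, with an exponent e that grows with
  q. The field has 71 elements because 5 * 7 divides 71 - 1, so that it contains roots of unity of
  both orders, and because a polynomial with only three terms separates the relevant pairs of roots
  there.\<close>

definition norm3 :: "'i set \<Rightarrow> ('i \<Rightarrow> real) \<Rightarrow> real" where
  "norm3 A x = root 3 (\<Sum>i\<in>A. \<bar>x i\<bar> ^ 3)"

lemma norm3_nonneg [simp]: "0 \<le> norm3 A x"
  by (simp add: norm3_def sum_nonneg)

lemma norm3_cube: "norm3 A x ^ 3 = (\<Sum>i\<in>A. \<bar>x i\<bar> ^ 3)"
  by (simp add: norm3_def sum_nonneg)

lemma norm3_cong: "(\<And>i. i \<in> A \<Longrightarrow> \<bar>x i\<bar> = \<bar>y i\<bar>) \<Longrightarrow> norm3 A x = norm3 A y"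
  by (simp add: norm3_def)

lemma norm3_mono:
  assumes "\<And>i. i \<in> A \<Longrightarrow> \<bar>x i\<bar> \<le> \<bar>y i\<bar>"
  shows "norm3 A x \<le> norm3 A y"
  unfolding norm3_def by (intro real_root_le_mono sum_mono power_mono assms) auto

lemma norm3_subset: "finite B \<Longrightarrow> A \<subseteq> B \<Longrightarrow> norm3 A x \<le> norm3 B x"
  unfolding norm3_def by (intro real_root_le_mono sum_mono2) auto

lemma norm3_scale: "norm3 A (\<lambda>i. c * x i) = \<bar>c\<bar> * norm3 A x"
proof -
  have "(\<Sum>i\<in>A. \<bar>c * x i\<bar> ^ 3) = \<bar>c\<bar> ^ 3 * (\<Sum>i\<in>A. \<bar>x i\<bar> ^ 3)"
    by (simp add: abs_mult power_mult_distrib sum_distrib_left)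
  thus ?thesis by (simp add: norm3_def real_root_mult real_root_power_cancel)
qed

lemma norm3_eq_0: "finite A \<Longrightarrow> norm3 A x = 0 \<longleftrightarrow> (\<forall>i\<in>A. x i = 0)"
  by (simp add: norm3_def sum_nonneg_eq_0_iff)

lemma cube_leD: "a ^ 3 \<le> b ^ 3 \<Longrightarrow> 0 \<le> b \<Longrightarrow> a \<le> (b::real)"
  by (rule power_le_imp_le_base[where n = 2]) (auto simp: numeral_eq_Suc)

lemma am_gm_3:
  fixes a b c :: real
  assumes "a \<ge> 0" "b \<ge> 0" "c \<ge> 0"
  shows "a * b * c \<le> (a ^ 3 + b ^ 3 + c ^ 3) / 3"
proof -
  have "a ^ 3 + b ^ 3 + c ^ 3 - 3 * (a * b * c)
      = (a + b + c) * ((a - b)\<^sup>2 + (b - c)\<^sup>2 + (c - a)\<^sup>2) / 2"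
    by (simp add: power2_eq_square power3_eq_cube field_simps)
  also have "\<dots> \<ge> 0" using assms by simp
  finally show ?thesis by simp
qed

text \<open>After each factor is divided by its norm, AM-GM applies termwise and the three sums of
  cubes are 1. The exponents 1/3 + 1/3 + 1/3 = 1 leave no dimension factor, which is what bounds the
  decoding forms later.\<close>

lemma holder3:
  assumes "finite A"
  shows "(\<Sum>i\<in>A. \<bar>x i * y i * z i\<bar>) \<le> norm3 A x * norm3 A y * norm3 A z"
proof (cases "norm3 A x = 0 \<or> norm3 A y = 0 \<or> norm3 A z = 0")
  case True
  hence "\<forall>i\<in>A. x i * y i * z i = 0" using assms by (auto simp: norm3_eq_0)
  hence "(\<Sum>i\<in>A. \<bar>x i * y i * z i\<bar>) = 0" by (intro sum.neutral) auto
  thus ?thesis by (simp only:) simp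
next
  case False
  hence p: "norm3 A x > 0" "norm3 A y > 0" "norm3 A z > 0"
    using norm3_nonneg by (smt (verit))+
  let ?X = "norm3 A x" and ?Y = "norm3 A y" and ?Z = "norm3 A z"
  have "(\<Sum>i\<in>A. \<bar>x i * y i * z i\<bar>) / (?X * ?Y * ?Z)
     = (\<Sum>i\<in>A. (\<bar>x i\<bar> / ?X) * (\<bar>y i\<bar> / ?Y) * (\<bar>z i\<bar> / ?Z))"
    by (simp add: sum_divide_distrib abs_mult)
  also have "\<dots> \<le> (\<Sum>i\<in>A. ((\<bar>x i\<bar> / ?X)^3 + (\<bar>y i\<bar> / ?Y)^3 + (\<bar>z i\<bar> / ?Z)^3) / 3)"
    by (intro sum_mono am_gm_3) (use p in auto)
  also have "\<dots> = ((\<Sum>i\<in>A. \<bar>x i\<bar>^3) / ?X^3 + (\<Sum>i\<in>A. \<bar>y i\<bar>^3) / ?Y^3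
       + (\<Sum>i\<in>A. \<bar>z i\<bar>^3) / ?Z^3) / 3"
    by (simp add: sum.distrib power_divide flip: sum_divide_distrib)
  also have "\<dots> = 1" using p False by (simp flip: norm3_cube)
  finally show ?thesis using p by (simp add: divide_le_eq)
qed

text \<open>Minkowski from \<open>holder3\<close>: one factor of
  \<open>\<bar>x i + y i\<bar> ^ 3\<close> is split by the triangle inequality and the other two
  stay, which gives \<open>?S ^ 3\<close> \<le> (\<open>norm3 A x + norm3 A y\<close>) times the
  square of \<open>?S\<close>.\<close>

lemma norm3_triangle:
  assumes "finite A"
  shows "norm3 A (\<lambda>i. x i + y i) \<le> norm3 A x + norm3 A y"
proof -
  let ?S = "norm3 A (\<lambda>i. x i + y i)"
  have "?S ^ 3 = (\<Sum>i\<in>A. \<bar>x i + y i\<bar> ^ 3)" by (simp add: norm3_cube)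
  also have "\<dots> \<le> (\<Sum>i\<in>A. \<bar>x i * (x i + y i) * (x i + y i)\<bar> + \<bar>y i * (x i + y i) * (x i + y i)\<bar>)"
  proof (rule sum_mono)
    fix i
    have "\<bar>x i + y i\<bar> ^ 3 = \<bar>x i + y i\<bar> * (\<bar>x i + y i\<bar> * \<bar>x i + y i\<bar>)"
      by (simp add: power3_eq_cube)
    also have "\<dots> \<le> (\<bar>x i\<bar> + \<bar>y i\<bar>) * (\<bar>x i + y i\<bar> * \<bar>x i + y i\<bar>)"
      by (intro mult_right_mono) auto
    finally show "\<bar>x i + y i\<bar> ^ 3
        \<le> \<bar>x i * (x i + y i) * (x i + y i)\<bar> + \<bar>y i * (x i + y i) * (x i + y i)\<bar>"
      by (simp only: abs_mult distrib_right[of "\<bar>x i\<bar>" "\<bar>y i\<bar>"] mult.assoc)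
  qed
  also have "\<dots> \<le> norm3 A x * ?S * ?S + norm3 A y * ?S * ?S"
    using holder3[OF assms, of x "\<lambda>i. x i + y i" "\<lambda>i. x i + y i"]
      holder3[OF assms, of y "\<lambda>i. x i + y i" "\<lambda>i. x i + y i"]
    by (simp add: sum.distrib)
  finally have le: "?S * (?S * ?S) \<le> (norm3 A x + norm3 A y) * (?S * ?S)"
    by (simp add: power3_eq_cube algebra_simps)
  show ?thesis
  proof (cases "?S = 0")
    case True
    thus ?thesis by (metis add_nonneg_nonneg norm3_nonneg)
  next
    case False
    hence "?S * ?S > 0" using norm3_nonneg[of A] by (simp add: zero_less_mult_iff less_le)
    thus ?thesis using le by (simp only: mult_le_cancel_right_pos)
  qed
qed

section \<open>Averages over signs\<close>

text \<open>The extensional function space of \<open>has_cotype\<close>. Coordinates from n on are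
  \<open>undefined\<close>, which keeps the set finite; for n = 0 its one element is
  \<open>\<lambda>_. undefined\<close>.\<close>

definition signs :: "nat \<Rightarrow> (nat \<Rightarrow> real) set" where
  "signs n = {..<n} \<rightarrow>\<^sub>E {-1, 1}"

definition sign_avg :: "nat \<Rightarrow> ((nat \<Rightarrow> real) \<Rightarrow> real) \<Rightarrow> real" where
  "sign_avg n f = (\<Sum>\<epsilon>\<in>signs n. f \<epsilon>) / 2 ^ n"

lemma finite_signs [simp]: "finite (signs n)"
  by (auto simp: signs_def intro: finite_PiE)

lemma card_signs: "card (signs n) = 2 ^ n"
  by (simp add: signs_def card_PiE card_insert_if numeral_2_eq_2)

lemma signs_sq: "\<epsilon> \<in> signs n \<Longrightarrow> i < n \<Longrightarrow> \<epsilon> i * \<epsilon> i = 1"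
  by (force simp: signs_def PiE_iff)

lemma signs_cases: "\<epsilon> \<in> signs n \<Longrightarrow> i < n \<Longrightarrow> \<epsilon> i = 1 \<or> \<epsilon> i = -1"
  by (force simp: signs_def PiE_iff)

lemma sign_avg_0: "sign_avg 0 f = f (\<lambda>_. undefined)"
  by (simp add: sign_avg_def signs_def)

text \<open>Independence of the last sign. The moment computations over signs below are inductions
  through this equation.\<close>

lemma sign_avg_Suc:
  "sign_avg (Suc n) f = sign_avg n (\<lambda>\<epsilon>. (f (\<epsilon>(n := 1)) + f (\<epsilon>(n := -1))) / 2)"
proof -
  have eq: "signs (Suc n) = (\<lambda>(y, g). g(n := y)) ` ({-1, 1} \<times> signs n)"
    unfolding signs_def lessThan_Suc by (rule PiE_insert_eq)
  have inj: "inj_on (\<lambda>(y, g). g(n := y)) ({-1, 1::real} \<times> signs n)"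
    unfolding signs_def by (rule inj_combinator) simp
  have "(\<Sum>\<epsilon>\<in>signs (Suc n). f \<epsilon>) = (\<Sum>y\<in>{-1, 1}. \<Sum>g\<in>signs n. f (g(n := y)))"
    unfolding eq sum.reindex[OF inj] by (simp add: sum.cartesian_product case_prod_unfold)
  also have "\<dots> = (\<Sum>\<epsilon>\<in>signs n. f (\<epsilon>(n := 1)) + f (\<epsilon>(n := -1)))"
    by (simp add: sum.distrib)
  finally show ?thesis by (simp add: sign_avg_def sum_divide_distrib divide_simps)
qed

lemma sign_avg_const [simp]: "sign_avg n (\<lambda>_. c) = c"
  by (simp add: sign_avg_def card_signs)

lemma sign_avg_add: "sign_avg n (\<lambda>\<epsilon>. f \<epsilon> + g \<epsilon>) = sign_avg n f + sign_avg n g"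
  by (simp add: sign_avg_def sum.distrib add_divide_distrib)

lemma sign_avg_diff: "sign_avg n (\<lambda>\<epsilon>. f \<epsilon> - g \<epsilon>) = sign_avg n f - sign_avg n g"
  by (simp add: sign_avg_def sum_subtractf diff_divide_distrib)

lemma sign_avg_cmult: "sign_avg n (\<lambda>\<epsilon>. c * f \<epsilon>) = c * sign_avg n f"
  by (simp add: sign_avg_def sum_distrib_left)

lemma sign_avg_cmult_right: "sign_avg n (\<lambda>\<epsilon>. f \<epsilon> * c) = sign_avg n f * c"
  by (simp add: sign_avg_def sum_distrib_right)

lemma sign_avg_sum: "sign_avg n (\<lambda>\<epsilon>. \<Sum>i\<in>I. f i \<epsilon>) = (\<Sum>i\<in>I. sign_avg n (f i))"
  unfolding sign_avg_def by (subst sum.swap) (simp add: sum_divide_distrib)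

lemma sign_avg_mono: "(\<And>\<epsilon>. \<epsilon> \<in> signs n \<Longrightarrow> f \<epsilon> \<le> g \<epsilon>) \<Longrightarrow> sign_avg n f \<le> sign_avg n g"
  by (simp add: sign_avg_def sum_mono divide_right_mono)

lemma sign_avg_cong: "(\<And>\<epsilon>. \<epsilon> \<in> signs n \<Longrightarrow> f \<epsilon> = g \<epsilon>) \<Longrightarrow> sign_avg n f = sign_avg n g"
  by (simp add: sign_avg_def)

lemma sign_avg_nonneg: "(\<And>\<epsilon>. \<epsilon> \<in> signs n \<Longrightarrow> 0 \<le> f \<epsilon>) \<Longrightarrow> 0 \<le> sign_avg n f"
  by (simp add: sign_avg_def sum_nonneg)

lemma sign_avg_square_le: "(sign_avg n f)\<^sup>2 \<le> sign_avg n (\<lambda>\<epsilon>. (f \<epsilon>)\<^sup>2)"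
proof -
  define m where "m = sign_avg n f"
  have "0 \<le> sign_avg n (\<lambda>\<epsilon>. (f \<epsilon> - m)\<^sup>2)" by (rule sign_avg_nonneg) simp
  also have "(\<lambda>\<epsilon>. (f \<epsilon> - m)\<^sup>2) = (\<lambda>\<epsilon>. (f \<epsilon>)\<^sup>2 - (2 * m) * f \<epsilon> + m\<^sup>2)"
    by (auto simp: power2_eq_square algebra_simps)
  also have "sign_avg n \<dots> = sign_avg n (\<lambda>\<epsilon>. (f \<epsilon>)\<^sup>2) - 2 * m * m + m\<^sup>2"
    by (simp only: sign_avg_add sign_avg_diff sign_avg_cmult sign_avg_const m_def)
  finally show ?thesis by (simp add: m_def power2_eq_square)
qed

lemma sum_upd_last:
  "(\<Sum>k<(n::nat). (if k = n then s else \<epsilon> k) * x k) = (\<Sum>k<n. \<epsilon> k * (x k::real))"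
  by (rule sum.cong) auto

lemma sign_avg_product:
  "sign_avg n (\<lambda>\<epsilon>. (\<Sum>k<n. \<epsilon> k * x k) * (\<Sum>k<n. \<epsilon> k * y k)) = (\<Sum>k<n. x k * y k)"
proof (induction n)
  case (Suc n)
  have "((\<Sum>k<n. \<epsilon> k * x k) + x n) * ((\<Sum>k<n. \<epsilon> k * y k) + y n)
      + ((\<Sum>k<n. \<epsilon> k * x k) + - x n) * ((\<Sum>k<n. \<epsilon> k * y k) + - y n)
      = 2 * ((\<Sum>k<n. \<epsilon> k * x k) * (\<Sum>k<n. \<epsilon> k * y k)) + 2 * (x n * y n)" for \<epsilon>
    by (simp add: algebra_simps)
  thus ?case using Suc by (simp add: sign_avg_Suc sum_upd_last add_divide_distrib sign_avg_add)
qed (simp add: sign_avg_0)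

text \<open>Khintchine's inequality for the fourth moment with the Gaussian constant 3. The
  induction step has slack 2 * (x n)^4.\<close>

lemma sign_avg_fourth:
  "sign_avg n (\<lambda>\<epsilon>. (\<Sum>k<n. \<epsilon> k * x k) ^ 4) \<le> 3 * (\<Sum>k<n. (x k)\<^sup>2)\<^sup>2"
proof (induction n)
  case (Suc n)
  let ?S = "\<lambda>\<epsilon>. \<Sum>k<n. \<epsilon> k * x k" and ?Q = "\<Sum>k<n. (x k)\<^sup>2"
  have eq: "((?S \<epsilon> + x n) ^ 4 + (?S \<epsilon> - x n) ^ 4) / 2
      = (?S \<epsilon>) ^ 4 + 6 * (x n)\<^sup>2 * (?S \<epsilon> * ?S \<epsilon>) + (x n) ^ 4" for \<epsilon>
    by (simp add: power4_eq_xxxx power2_eq_square field_simps)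
  have "sign_avg (Suc n) (\<lambda>\<epsilon>. (\<Sum>k<Suc n. \<epsilon> k * x k) ^ 4)
      = sign_avg n (\<lambda>\<epsilon>. ((?S \<epsilon> + x n) ^ 4 + (?S \<epsilon> - x n) ^ 4) / 2)"
    by (simp add: sign_avg_Suc sum_upd_last)
  also have "\<dots> = sign_avg n (\<lambda>\<epsilon>. (?S \<epsilon>) ^ 4) + 6 * (x n)\<^sup>2 * ?Q + (x n) ^ 4"
    unfolding eq sign_avg_add sign_avg_cmult sign_avg_product sign_avg_const
    by (simp add: power2_eq_square)
  also have "\<dots> \<le> 3 * ?Q\<^sup>2 + 6 * (x n)\<^sup>2 * ?Q + 3 * (x n) ^ 4"
  proof -
    have "0 \<le> (x n) ^ 4" by simp
    with Suc show ?thesis by linarith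
  qed
  also have "\<dots> = 3 * (\<Sum>k<Suc n. (x k)\<^sup>2)\<^sup>2"
    by (simp add: power4_eq_xxxx power2_eq_square algebra_simps)
  finally show ?case .
qed (simp add: sign_avg_0)

section \<open>Grothendieck's inequality\<close>

text \<open>A bound on the projective norm as a relation: some representation of cost at most r
  exists. No infimum has to be formed or attained, and only the entries of z over A matter.\<close>

definition proj_le :: "'i set \<Rightarrow> ('i \<Rightarrow> 'i \<Rightarrow> real) \<Rightarrow> real \<Rightarrow> bool" where
  "proj_le A z r \<longleftrightarrow> (\<exists>(K::nat) x y. (\<forall>a\<in>A. \<forall>b\<in>A. z a b = (\<Sum>k<K. x k a * y k b)) \<and>
     (\<Sum>k<K. norm3 A (x k) * norm3 A (y k)) \<le> r)"

text \<open>The norm of factorization through a Hilbert space: each index a carries the vectors (x k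
  a) and (y k a), k < K, of R^K. The mean of the two squares replaces the product of norms; after
  rescaling the infimum is the same, and the mean fits the additive functional
  \<open>dom_inf\<close> below.\<close>

definition hilb_le :: "'i set \<Rightarrow> ('i \<Rightarrow> 'i \<Rightarrow> real) \<Rightarrow> real \<Rightarrow> bool" where
  "hilb_le A z r \<longleftrightarrow> (\<exists>(K::nat) x y. (\<forall>a\<in>A. \<forall>b\<in>A. z a b = (\<Sum>k<K. x k a * y k b)) \<and>
     (norm3 A (\<lambda>a. sqrt (\<Sum>k<K. (x k a)\<^sup>2)))\<^sup>2 + (norm3 A (\<lambda>a. sqrt (\<Sum>k<K. (y k a)\<^sup>2)))\<^sup>2 \<le> 2 * r)"

lemma proj_leI:
  assumes "finite S" "\<And>a b. a \<in> A \<Longrightarrow> b \<in> A \<Longrightarrow> z a b = (\<Sum>k\<in>S. x k a * y k b)"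
    "(\<Sum>k\<in>S. norm3 A (x k) * norm3 A (y k)) \<le> r"
  shows "proj_le A z r"
proof -
  obtain h where h: "bij_betw h {..<card S} S"
    using ex_bij_betw_nat_finite[OF assms(1)] by (auto simp: atLeast0LessThan)
  show ?thesis unfolding proj_le_def
    by (rule exI[of _ "card S"], rule exI[of _ "\<lambda>k. x (h k)"], rule exI[of _ "\<lambda>k. y (h k)"])
      (use assms sum.reindex_bij_betw[OF h, of "\<lambda>k. norm3 A (x k) * norm3 A (y k)"]
        sum.reindex_bij_betw[OF h, of "\<lambda>k. x k _ * y k _"] in simp)
qed

lemma hilb_leI:
  assumes "finite S" "\<And>a b. a \<in> A \<Longrightarrow> b \<in> A \<Longrightarrow> z a b = (\<Sum>k\<in>S. x k a * y k b)"
    "(norm3 A (\<lambda>a. sqrt (\<Sum>k\<in>S. (x k a)\<^sup>2)))\<^sup>2 + (norm3 A (\<lambda>a. sqrt (\<Sum>k\<in>S. (y k a)\<^sup>2)))\<^sup>2 \<le> 2 * r"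
  shows "hilb_le A z r"
proof -
  obtain h where h: "bij_betw h {..<card S} S"
    using ex_bij_betw_nat_finite[OF assms(1)] by (auto simp: atLeast0LessThan)
  show ?thesis unfolding hilb_le_def
    by (rule exI[of _ "card S"], rule exI[of _ "\<lambda>k. x (h k)"], rule exI[of _ "\<lambda>k. y (h k)"])
      (use assms sum.reindex_bij_betw[OF h, of "\<lambda>k. (x k _)\<^sup>2"]
        sum.reindex_bij_betw[OF h, of "\<lambda>k. (y k _)\<^sup>2"]
        sum.reindex_bij_betw[OF h, of "\<lambda>k. x k _ * y k _"] in simp)
qed

lemma proj_le_mono: "proj_le A z r \<Longrightarrow> r \<le> s \<Longrightarrow> proj_le A z s"
  unfolding proj_le_def by (elim exE conjE) (intro exI conjI, assumption, linarith)

lemma proj_le_cong: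
  "proj_le A z r \<Longrightarrow> (\<And>a b. a \<in> A \<Longrightarrow> b \<in> A \<Longrightarrow> w a b = z a b) \<Longrightarrow> proj_le A w r"
  by (simp add: proj_le_def cong: ball_cong)

lemma hilb_le_nonneg: "hilb_le A z r \<Longrightarrow> 0 \<le> r"
  unfolding hilb_le_def by (smt (verit) zero_le_power2)

lemma proj_le_add:
  assumes "proj_le A z r" "proj_le A w s"
  shows "proj_le A (\<lambda>a b. z a b + w a b) (r + s)"
proof -
  from assms(1) obtain K x y where 1: "\<And>a b. a \<in> A \<Longrightarrow> b \<in> A \<Longrightarrow> z a b = (\<Sum>k<(K::nat). x k a * y k b)"
     "(\<Sum>k<K. norm3 A (x k) * norm3 A (y k)) \<le> r"
    unfolding proj_le_def by blast
  from assms(2) obtain L u v where 2: "\<And>a b. a \<in> A \<Longrightarrow> b \<in> A \<Longrightarrow> w a b = (\<Sum>k<(L::nat). u k a * v k b)"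
     "(\<Sum>k<L. norm3 A (u k) * norm3 A (v k)) \<le> s"
    unfolding proj_le_def by blast
  show ?thesis
  proof (rule proj_leI[of "Sum_Type.Plus {..<K} {..<L}" _ _ "case_sum x u" "case_sum y v"])
    show "z a b + w a b = (\<Sum>k\<in>Sum_Type.Plus {..<K} {..<L}. case_sum x u k a * case_sum y v k b)"
      if "a \<in> A" "b \<in> A" for a b
      unfolding 1(1)[OF that] 2(1)[OF that] by (simp add: sum.Plus)
    show "(\<Sum>k\<in>Sum_Type.Plus {..<K} {..<L}. norm3 A (case_sum x u k) * norm3 A (case_sum y v k)) \<le> r + s"
      using 1(2) 2(2) by (simp add: sum.Plus)
  qed simp
qed

text \<open>An average over 2^K sign vectors is an inner product in a Euclidean space with one
  coordinate for each of them, once each factor takes the weight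
  \<open>1 / sqrt (2 ^ K)\<close>.\<close>

lemma hilb_le_sign_avg:
  assumes "\<And>a. a \<in> A \<Longrightarrow> sign_avg K (\<lambda>\<epsilon>. (U \<epsilon> a)\<^sup>2) \<le> (X a)\<^sup>2"
    and "\<And>a. a \<in> A \<Longrightarrow> sign_avg K (\<lambda>\<epsilon>. (V \<epsilon> a)\<^sup>2) \<le> (Y a)\<^sup>2"
    and "(norm3 A X)\<^sup>2 + (norm3 A Y)\<^sup>2 \<le> 2 * r"
  shows "hilb_le A (\<lambda>a b. sign_avg K (\<lambda>\<epsilon>. U \<epsilon> a * V \<epsilon> b)) r"
proof (rule hilb_leI[of "signs K" _ _ "\<lambda>\<epsilon> a. U \<epsilon> a / sqrt (2 ^ K)" "\<lambda>\<epsilon> a. V \<epsilon> a / sqrt (2 ^ K)"])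
  have le: "norm3 A (\<lambda>a. sqrt (\<Sum>\<epsilon>\<in>signs K. (W \<epsilon> a / sqrt (2 ^ K))\<^sup>2)) \<le> norm3 A Z"
    if "\<And>a. a \<in> A \<Longrightarrow> sign_avg K (\<lambda>\<epsilon>. (W \<epsilon> a)\<^sup>2) \<le> (Z a)\<^sup>2" for W :: "(nat \<Rightarrow> real) \<Rightarrow> 'a \<Rightarrow> real" and Z
  proof (rule norm3_mono)
    fix a assume "a \<in> A"
    have "(\<Sum>\<epsilon>\<in>signs K. (W \<epsilon> a / sqrt (2 ^ K))\<^sup>2) = sign_avg K (\<lambda>\<epsilon>. (W \<epsilon> a)\<^sup>2)"
      by (simp add: sign_avg_def power_divide sum_divide_distrib)
    with that[OF \<open>a \<in> A\<close>] have "sqrt (\<Sum>\<epsilon>\<in>signs K. (W \<epsilon> a / sqrt (2 ^ K))\<^sup>2) \<le> sqrt ((Z a)\<^sup>2)"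
      by (simp only: real_sqrt_le_iff)
    thus "\<bar>sqrt (\<Sum>\<epsilon>\<in>signs K. (W \<epsilon> a / sqrt (2 ^ K))\<^sup>2)\<bar> \<le> \<bar>Z a\<bar>"
      by (simp add: sum_nonneg)
  qed
  show "(norm3 A (\<lambda>a. sqrt (\<Sum>\<epsilon>\<in>signs K. (U \<epsilon> a / sqrt (2 ^ K))\<^sup>2)))\<^sup>2
     + (norm3 A (\<lambda>a. sqrt (\<Sum>\<epsilon>\<in>signs K. (V \<epsilon> a / sqrt (2 ^ K))\<^sup>2)))\<^sup>2 \<le> 2 * r"
    by (rule order_trans[OF add_mono assms(3)]; rule power_mono[OF le norm3_nonneg]) (fact assms)+
qed (simp_all add: sign_avg_def sum_divide_distrib)

text \<open>A crude start for the iteration in \<open>grothendieck\<close>: Cauchy-Schwarz bounds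
  every entry by r, and the matrix is a combination of (card A)^2 matrix units, each of norm
  1.\<close>

lemma hilb_le_imp_proj_le_card:
  assumes "finite A" "hilb_le A z r"
  shows "proj_le A z (real (card A) ^ 2 * r)"
proof -
  from assms(2) obtain K x y where rep: "\<And>a b. a \<in> A \<Longrightarrow> b \<in> A \<Longrightarrow> z a b = (\<Sum>k<(K::nat). x k a * y k b)"
    and r: "(norm3 A (\<lambda>a. sqrt (\<Sum>k<K. (x k a)\<^sup>2)))\<^sup>2 + (norm3 A (\<lambda>a. sqrt (\<Sum>k<K. (y k a)\<^sup>2)))\<^sup>2 \<le> 2 * r"
    unfolding hilb_le_def by blast
  define X where "X = (\<lambda>a. sqrt (\<Sum>k<K. (x k a)\<^sup>2))"
  define Y where "Y = (\<lambda>a. sqrt (\<Sum>k<K. (y k a)\<^sup>2))"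
  have unit: "norm3 A (\<lambda>i. if i = a then c else 0) = \<bar>c\<bar>" if "a \<in> A" for a c
  proof -
    have "(\<Sum>i\<in>A. \<bar>if i = a then c else 0\<bar> ^ 3) = (\<Sum>i\<in>A. if i = a then \<bar>c\<bar> ^ 3 else 0)"
      by (intro sum.cong) auto
    thus ?thesis using that assms(1) by (simp add: norm3_def real_root_power_cancel)
  qed
  have coord: "\<bar>f a\<bar> \<le> norm3 A f" if "a \<in> A" for a f
    using norm3_mono[of A "\<lambda>i. if i = a then f a else 0" f] unit[OF that] by simp
  have zle: "\<bar>z a b\<bar> \<le> r" if "a \<in> A" "b \<in> A" for a b
  proof -
    have "\<bar>z a b\<bar> \<le> (\<Sum>k<K. \<bar>x k a\<bar> * \<bar>y k b\<bar>)"
      unfolding rep[OF that] by (metis (mono_tags, lifting) abs_mult sum.cong sum_abs)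
    also have "\<dots> \<le> X a * Y b"
      using L2_set_mult_ineq[of "\<lambda>k. \<bar>x k a\<bar>" "\<lambda>k. \<bar>y k b\<bar>" "{..<K}"] by (simp add: L2_set_def X_def Y_def)
    also have "\<dots> \<le> norm3 A X * norm3 A Y"
      using coord[OF that(1), of X] coord[OF that(2), of Y]
      by (intro mult_mono) (auto simp: X_def Y_def sum_nonneg)
    also have "\<dots> \<le> r" using r sum_squares_bound[of "norm3 A X" "norm3 A Y"]
      unfolding X_def Y_def by linarith
    finally show ?thesis .
  qed
  show ?thesis
  proof (rule proj_leI[of "A \<times> A" _ _ "\<lambda>p i. if i = fst p then z (fst p) (snd p) else 0"
        "\<lambda>p i. if i = snd p then 1 else 0"])
    show "z a b = (\<Sum>p\<in>A \<times> A. (if a = fst p then z (fst p) (snd p) else 0) * (if b = snd p then 1 else 0))"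
      if "a \<in> A" "b \<in> A" for a b
    proof -
      have "(\<Sum>p\<in>A \<times> A. (if a = fst p then z (fst p) (snd p) else 0) * (if b = snd p then 1 else 0))
          = (\<Sum>p\<in>A \<times> A. if p = (a, b) then z a b else 0)"
        by (intro sum.cong) auto
      thus ?thesis using assms(1) that by simp
    qed
    have "(\<Sum>p\<in>A \<times> A. norm3 A (\<lambda>i. if i = fst p then z (fst p) (snd p) else 0)
        * norm3 A (\<lambda>i. if i = snd p then 1 else 0)) \<le> (\<Sum>p\<in>A \<times> A. r)"
      by (intro sum_mono) (auto simp: unit zle)
    thus "(\<Sum>p\<in>A \<times> A. norm3 A (\<lambda>i. if i = fst p then z (fst p) (snd p) else 0)
        * norm3 A (\<lambda>i. if i = snd p then 1 else 0)) \<le> real (card A) ^ 2 * r"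
      by (simp add: card_cartesian_product power2_eq_square)
  qed (simp add: assms(1))
qed

text \<open>The Rademacher sums G have the inner products of the given vectors, so z is the mean of
  G G'. Cutting G at M standard deviations gives a bounded part T, whose mean is a mixture of
  rank-one tensors, and a remainder R of small second moment. Then G G' = T T' + T R' + R G', and
  the last two terms factor through Hilbert space with constant r / 4 each, so together they cost (c
  / 2) * r.\<close>

lemma grothendieck_step:
  assumes step: "\<And>z r. hilb_le A z r \<Longrightarrow> proj_le A z (c * r)" and z: "hilb_le A z r"
  shows "proj_le A z ((48 + c / 2) * r)"
proof -
  from z obtain K x y where rep: "\<And>a b. a \<in> A \<Longrightarrow> b \<in> A \<Longrightarrow> z a b = (\<Sum>k<(K::nat). x k a * y k b)"
    and r: "(norm3 A (\<lambda>a. sqrt (\<Sum>k<K. (x k a)\<^sup>2)))\<^sup>2 + (norm3 A (\<lambda>a. sqrt (\<Sum>k<K. (y k a)\<^sup>2)))\<^sup>2 \<le> 2 * r"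
    unfolding hilb_le_def by blast
  define N where "N = (\<lambda>(x :: nat \<Rightarrow> 'a \<Rightarrow> real) a. sqrt (\<Sum>k<K. (x k a)\<^sup>2))"
  define G where "G = (\<lambda>(x :: nat \<Rightarrow> 'a \<Rightarrow> real) (\<epsilon> :: nat \<Rightarrow> real) a. \<Sum>k<K. \<epsilon> k * x k a)"
  \<comment> \<open>48 = 3 * 16: as R vanishes where \<bar>G\<bar> \<le> M N, one has R^2 \<le> G^4
    / (48 N^2), and the fourth moment bound 3 N^4 leaves (N / 4)^2.\<close>
  define M :: real where "M = sqrt 48"
  have M: "M > 0" "M\<^sup>2 = 48" by (auto simp: M_def)
  define T where "T = (\<lambda>x \<epsilon> a. max (- (M * N x a)) (min (M * N x a) (G x \<epsilon> a)))"
  define R where "R = (\<lambda>x \<epsilon> a. G x \<epsilon> a - T x \<epsilon> a)"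
  have N0: "N x a \<ge> 0" for x a by (simp add: N_def sum_nonneg)
  have N2: "(N x a)\<^sup>2 = (\<Sum>k<K. (x k a)\<^sup>2)" for x a by (simp add: N_def sum_nonneg)
  have G2: "sign_avg K (\<lambda>\<epsilon>. (G x \<epsilon> a)\<^sup>2) = (N x a)\<^sup>2" for x a
    using sign_avg_product[of K "\<lambda>k. x k a" "\<lambda>k. x k a"] by (simp add: G_def N2 flip: power2_eq_square)
  have MN: "0 \<le> M * N x a" for x a using N0[of x a] M(1) by simp
  have TG: "\<bar>T x \<epsilon> a\<bar> \<le> \<bar>G x \<epsilon> a\<bar>" for x \<epsilon> a
    using MN[of x a] unfolding T_def by linarith
  have TN: "\<bar>T x \<epsilon> a\<bar> \<le> M * N x a" for x \<epsilon> a
    using MN[of x a] unfolding T_def by linarith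
  have T2: "sign_avg K (\<lambda>\<epsilon>. (T x \<epsilon> a)\<^sup>2) \<le> (N x a)\<^sup>2" for x a
    unfolding G2[symmetric] by (rule sign_avg_mono) (use TG in \<open>simp add: abs_le_square_iff\<close>)
  have R2: "sign_avg K (\<lambda>\<epsilon>. (R x \<epsilon> a)\<^sup>2) \<le> (N x a / 4)\<^sup>2" for x a
  proof (cases "N x a = 0")
    case True
    hence "\<And>k. k < K \<Longrightarrow> x k a = 0"
      using N2[of x a] by (simp add: sum_nonneg_eq_0_iff)
    hence "G x \<epsilon> a = 0" for \<epsilon> by (simp add: G_def)
    thus ?thesis using True by (simp add: R_def T_def)
  next
    case False
    hence p: "N x a > 0" using N0 by (simp add: less_le)
    have "(R x \<epsilon> a)\<^sup>2 \<le> (G x \<epsilon> a) ^ 4 * (1 / (48 * (N x a)\<^sup>2))" for \<epsilon>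
    proof -
      define m where "m = M * N x a"
      have m: "m > 0" using p M by (simp add: m_def)
      have "\<bar>R x \<epsilon> a\<bar> * m \<le> (G x \<epsilon> a)\<^sup>2"
      proof (cases "\<bar>G x \<epsilon> a\<bar> \<le> m")
        case True
        hence "R x \<epsilon> a = 0" by (auto simp: R_def T_def m_def[symmetric])
        thus ?thesis by simp
      next
        case False
        hence "\<bar>R x \<epsilon> a\<bar> \<le> \<bar>G x \<epsilon> a\<bar>" using m by (auto simp: R_def T_def m_def[symmetric])
        hence "\<bar>R x \<epsilon> a\<bar> * m \<le> \<bar>G x \<epsilon> a\<bar> * \<bar>G x \<epsilon> a\<bar>" using False m by (intro mult_mono) auto
        thus ?thesis by (simp add: power2_eq_square)
      qed
      hence "(\<bar>R x \<epsilon> a\<bar> * m)\<^sup>2 \<le> ((G x \<epsilon> a)\<^sup>2)\<^sup>2" using m by (intro power_mono) auto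
      hence "(R x \<epsilon> a)\<^sup>2 * m\<^sup>2 \<le> (G x \<epsilon> a) ^ 4" by (simp add: power_mult_distrib flip: power_mult)
      hence "(R x \<epsilon> a)\<^sup>2 * (48 * (N x a)\<^sup>2) \<le> (G x \<epsilon> a) ^ 4" using M by (simp add: m_def power_mult_distrib)
      thus ?thesis using p by (simp add: field_simps)
    qed
    hence "sign_avg K (\<lambda>\<epsilon>. (R x \<epsilon> a)\<^sup>2) \<le> sign_avg K (\<lambda>\<epsilon>. (G x \<epsilon> a) ^ 4) * (1 / (48 * (N x a)\<^sup>2))"
      unfolding sign_avg_cmult_right[symmetric] by (intro sign_avg_mono)
    also have "\<dots> \<le> (3 * ((N x a)\<^sup>2)\<^sup>2) * (1 / (48 * (N x a)\<^sup>2))"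
      using sign_avg_fourth[of K "\<lambda>k. x k a"] by (intro mult_right_mono) (auto simp: G_def N2 sum_nonneg)
    also have "\<dots> = (N x a / 4)\<^sup>2" using p by (simp add: power2_eq_square field_simps)
    finally show ?thesis .
  qed
  have r': "(norm3 A (N x))\<^sup>2 + (norm3 A (N y))\<^sup>2 \<le> 2 * r" using r by (simp add: N_def)
  have hf: "norm3 A (\<lambda>a. N x a / 2) = norm3 A (N x) / 2" for x
    using norm3_scale[of A "1/2" "N x"] by simp
  have half: "(norm3 A (\<lambda>a. N x a / 2))\<^sup>2 + (norm3 A (\<lambda>a. N y a / 2))\<^sup>2 \<le> 2 * (r / 4)"
    unfolding hf power_divide using r' by simp
  have main: "proj_le A (\<lambda>a b. sign_avg K (\<lambda>\<epsilon>. T x \<epsilon> a * T y \<epsilon> b)) (48 * r)"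
  proof (rule proj_leI[of "signs K" _ _ "\<lambda>\<epsilon> a. (1 / 2 ^ K) * T x \<epsilon> a" "\<lambda>\<epsilon>. T y \<epsilon>"])
    have "norm3 A (\<lambda>a. 1 / 2 ^ K * T x \<epsilon> a) * norm3 A (T y \<epsilon>) \<le> 48 * r * (1 / 2 ^ K)" for \<epsilon>
    proof -
      have *: "norm3 A (T x \<epsilon>) \<le> M * norm3 A (N x)" for x
      proof -
        have "norm3 A (T x \<epsilon>) \<le> norm3 A (\<lambda>a. M * N x a)"
          by (rule norm3_mono) (use TN[of x \<epsilon>] MN[of x] in simp)
        thus ?thesis using M(1) unfolding norm3_scale by simp
      qed
      have "norm3 A (T x \<epsilon>) * norm3 A (T y \<epsilon>) \<le> (M * norm3 A (N x)) * (M * norm3 A (N y))"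
        using M by (intro mult_mono *) auto
      also have "\<dots> = 48 * (norm3 A (N x) * norm3 A (N y))" using M by (simp add: power2_eq_square)
      also have "\<dots> \<le> 48 * r" using r' sum_squares_bound[of "norm3 A (N x)" "norm3 A (N y)"] by simp
      finally show ?thesis unfolding norm3_scale by (simp add: divide_right_mono)
    qed
    hence "(\<Sum>\<epsilon>\<in>signs K. norm3 A (\<lambda>a. 1 / 2 ^ K * T x \<epsilon> a) * norm3 A (T y \<epsilon>)) \<le> (\<Sum>\<epsilon>\<in>signs K. 48 * r * (1 / 2 ^ K))"
      by (intro sum_mono)
    thus "(\<Sum>\<epsilon>\<in>signs K. norm3 A (\<lambda>a. 1 / 2 ^ K * T x \<epsilon> a) * norm3 A (T y \<epsilon>)) \<le> 48 * r"
      by (simp add: card_signs)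
  qed (simp_all add: sign_avg_def sum_divide_distrib)
  \<comment> \<open>The factor 2 balances the moments: T / 2 and 2 R both have second moment at most
    (N / 2)^2, the bound in \<open>half\<close>.\<close>
  have "hilb_le A (\<lambda>a b. sign_avg K (\<lambda>\<epsilon>. (T x \<epsilon> a / 2) * (2 * R y \<epsilon> b))) (r / 4)"
  proof (rule hilb_le_sign_avg[OF _ _ half])
    show "sign_avg K (\<lambda>\<epsilon>. (T x \<epsilon> a / 2)\<^sup>2) \<le> (N x a / 2)\<^sup>2" for a
      using T2[of x a] sign_avg_cmult[of K "1/4" "\<lambda>\<epsilon>. (T x \<epsilon> a)\<^sup>2"] by (simp add: power_divide)
    show "sign_avg K (\<lambda>\<epsilon>. (2 * R y \<epsilon> a)\<^sup>2) \<le> (N y a / 2)\<^sup>2" for a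
      using R2[of y a] sign_avg_cmult[of K "4" "\<lambda>\<epsilon>. (R y \<epsilon> a)\<^sup>2"] by (simp add: power_divide power_mult_distrib)
  qed
  from step[OF this] have TR: "proj_le A (\<lambda>a b. sign_avg K (\<lambda>\<epsilon>. T x \<epsilon> a * R y \<epsilon> b)) (c * (r / 4))" by simp
  have "hilb_le A (\<lambda>a b. sign_avg K (\<lambda>\<epsilon>. (2 * R x \<epsilon> a) * (G y \<epsilon> b / 2))) (r / 4)"
  proof (rule hilb_le_sign_avg[OF _ _ half])
    show "sign_avg K (\<lambda>\<epsilon>. (G y \<epsilon> a / 2)\<^sup>2) \<le> (N y a / 2)\<^sup>2" for a
      using G2[of y a] sign_avg_cmult[of K "1/4" "\<lambda>\<epsilon>. (G y \<epsilon> a)\<^sup>2"] by (simp add: power_divide)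
    show "sign_avg K (\<lambda>\<epsilon>. (2 * R x \<epsilon> a)\<^sup>2) \<le> (N x a / 2)\<^sup>2" for a
      using R2[of x a] sign_avg_cmult[of K "4" "\<lambda>\<epsilon>. (R x \<epsilon> a)\<^sup>2"] by (simp add: power_divide power_mult_distrib)
  qed
  from step[OF this] have RG: "proj_le A (\<lambda>a b. sign_avg K (\<lambda>\<epsilon>. R x \<epsilon> a * G y \<epsilon> b)) (c * (r / 4))" by simp
  have "proj_le A z (48 * r + c * (r / 4) + c * (r / 4))"
  proof (rule proj_le_cong[OF proj_le_add[OF proj_le_add[OF main TR] RG]])
    fix a b assume ab: "a \<in> A" "b \<in> A"
    have "z a b = sign_avg K (\<lambda>\<epsilon>. G x \<epsilon> a * G y \<epsilon> b)"
      by (simp add: rep[OF ab] G_def sign_avg_product)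
    also have "(\<lambda>\<epsilon>. G x \<epsilon> a * G y \<epsilon> b)
        = (\<lambda>\<epsilon>. T x \<epsilon> a * T y \<epsilon> b + T x \<epsilon> a * R y \<epsilon> b + R x \<epsilon> a * G y \<epsilon> b)"
      by (simp add: R_def algebra_simps)
    finally show "z a b = sign_avg K (\<lambda>\<epsilon>. T x \<epsilon> a * T y \<epsilon> b) + sign_avg K (\<lambda>\<epsilon>. T x \<epsilon> a * R y \<epsilon> b)
        + sign_avg K (\<lambda>\<epsilon>. R x \<epsilon> a * G y \<epsilon> b)"
      by (simp only: sign_avg_add)
  qed
  thus ?thesis by (simp add: algebra_simps)
qed

text \<open>The map c \<mapsto> 48 + c / 2 on constants has the fixed point 96. Starting from (card
  A)^2 it is iterated until the excess over 96 is at most 1, so 97 works for every finite A.\<close>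

theorem grothendieck:
  assumes "finite A" "hilb_le A z r"
  shows "proj_le A z (97 * r)"
proof -
  define c where "c = real (card A) ^ 2"
  have iter: "hilb_le A z r \<Longrightarrow> proj_le A z ((96 + c / 2 ^ k) * r)" for k z r
  proof (induction k arbitrary: z r)
    case 0
    have "c * r \<le> (96 + c / 2 ^ 0) * r"
      using hilb_le_nonneg[OF 0] by (intro mult_right_mono) auto
    thus ?case
      by (rule proj_le_mono[OF hilb_le_imp_proj_le_card[OF assms(1) 0, folded c_def]])
  next
    case (Suc k)
    have "48 + (96 + c / 2 ^ k) / 2 = 96 + c / 2 ^ Suc k" by (simp add: field_simps)
    thus ?case using grothendieck_step[OF Suc.IH Suc.prems] by (simp only:)
  qed
  obtain k where "c < 2 ^ k" using real_arch_pow[of 2 c] by auto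
  hence "c / 2 ^ k \<le> 1" by simp
  hence "(96 + c / 2 ^ k) * r \<le> 97 * r"
    using hilb_le_nonneg[OF assms(2)] by (intro mult_right_mono) auto
  thus ?thesis by (rule proj_le_mono[OF iter[OF assms(2)]])
qed

section \<open>The Hahn-Banach theorem in finitely many coordinates\<close>

definition sublinear :: "(('i \<Rightarrow> real) \<Rightarrow> real) \<Rightarrow> bool" where
  "sublinear p \<longleftrightarrow> (\<forall>u v. p (\<lambda>i. u i + v i) \<le> p u + p v) \<and>
     (\<forall>c u. 0 \<le> c \<longrightarrow> p (\<lambda>i. c * u i) = c * p u)"

text \<open>Linearity of p in the single direction v. A sublinear functional is made linear one
  direction at a time, and directions in which it is already linear stay so.\<close>

definition additive_along :: "(('i \<Rightarrow> real) \<Rightarrow> real) \<Rightarrow> ('i \<Rightarrow> real) \<Rightarrow> bool" where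
  "additive_along p v \<longleftrightarrow> (\<forall>u s. p (\<lambda>i. u i + s * v i) = p u + s * p v)"

lemma sublinearD:
  assumes "sublinear p"
  shows "p (\<lambda>i. u i + v i) \<le> p u + p v" "0 \<le> c \<Longrightarrow> p (\<lambda>i. c * u i) = c * p u" "p (\<lambda>_. 0) = 0"
proof -
  show 2: "0 \<le> c \<Longrightarrow> p (\<lambda>i. c * u i) = c * p u" for c u
    using assms unfolding sublinear_def by blast
  show "p (\<lambda>i. u i + v i) \<le> p u + p v" using assms unfolding sublinear_def by blast
  show "p (\<lambda>_. 0) = 0" using 2[of 0 "\<lambda>_. 0"] by simp
qed

lemma sublinear_scale_ge:
  assumes "sublinear p"
  shows "t * p y \<le> p (\<lambda>i. t * y i)"
proof (cases "t \<ge> 0")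
  case True
  thus ?thesis using sublinearD(2)[OF assms] by simp
next
  case False
  hence "p (\<lambda>i. - t * y i) = - t * p y" by (intro sublinearD(2)[OF assms]) simp
  moreover have "p (\<lambda>i. t * y i + - t * y i) \<le> p (\<lambda>i. t * y i) + p (\<lambda>i. - t * y i)"
    by (rule sublinearD(1)[OF assms])
  ultimately show ?thesis using sublinearD(3)[OF assms] by simp
qed

text \<open>The new functional is the infimum over t of \<open>F u t\<close>, the largest sublinear
  minorant of p that is additive along y with the same value there. The infimum is finite because
  \<open>F u t\<close> is at least \<open>- p (\<lambda>i. - u i)\<close>.\<close>

lemma sublinear_additive_along_step:
  fixes p :: "('i \<Rightarrow> real) \<Rightarrow> real"
  assumes p: "sublinear p"
  obtains p' where "sublinear p'" "\<And>u. p' u \<le> p u" "additive_along p' y" "p' y = p y"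
    "\<And>v. additive_along p v \<Longrightarrow> additive_along p' v \<and> p' v = p v"
proof
  define F where "F = (\<lambda>u t. p (\<lambda>i. u i + t * y i) - t * p y)"
  define p' where "p' = (\<lambda>u. INF t. F u t)"
  have lb: "- p (\<lambda>i. - u i) \<le> F u t" for u t
  proof -
    have "p (\<lambda>i. (u i + t * y i) + - u i) \<le> p (\<lambda>i. u i + t * y i) + p (\<lambda>i. - u i)"
      by (rule sublinearD(1)[OF p])
    thus ?thesis using sublinear_scale_ge[OF p, of t y] by (simp add: F_def)
  qed
  have bdd: "bdd_below (range (F u))" for u
    by (rule bdd_belowI[of _ "- p (\<lambda>i. - u i)"]) (use lb in auto)
  have low: "p' u \<le> F u t" for u t unfolding p'_def by (rule cINF_lower[OF bdd]) simp
  have great: "m \<le> p' u" if "\<And>t. m \<le> F u t" for m u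
    unfolding p'_def by (rule cINF_greatest) (use that in auto)
  show le: "p' u \<le> p u" for u using low[of u 0] by (simp add: F_def)
  have zero: "p' (\<lambda>_. 0) = 0"
  proof (rule antisym)
    show "p' (\<lambda>_. 0) \<le> 0" using le[of "\<lambda>_. 0"] sublinearD(3)[OF p] by simp
    show "0 \<le> p' (\<lambda>_. 0)" by (rule great) (simp add: F_def sublinear_scale_ge[OF p])
  qed
  have add: "p' (\<lambda>i. u i + v i) \<le> p' u + p' v" for u v
  proof -
    have st: "p' (\<lambda>i. u i + v i) \<le> F u s + F v t" for s t
    proof -
      have "(\<lambda>i. u i + v i + (s + t) * y i) = (\<lambda>i. (u i + s * y i) + (v i + t * y i))"
        by (auto simp: algebra_simps)
      hence "F (\<lambda>i. u i + v i) (s + t) \<le> F u s + F v t"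
        using sublinearD(1)[OF p, of "\<lambda>i. u i + s * y i" "\<lambda>i. v i + t * y i"]
        by (simp add: F_def algebra_simps)
      thus ?thesis using low[of "\<lambda>i. u i + v i" "s + t"] by simp
    qed
    have "p' (\<lambda>i. u i + v i) - F u s \<le> p' v" for s
      by (rule great) (use st[of s] in \<open>simp add: algebra_simps\<close>)
    hence "p' (\<lambda>i. u i + v i) - p' v \<le> p' u"
      by (intro great) (simp add: algebra_simps)
    thus ?thesis by simp
  qed
  have scale_le: "p' (\<lambda>i. c * u i) \<le> c * p' u" if "c > 0" for c u
  proof -
    have "p' (\<lambda>i. c * u i) / c \<le> p' u"
    proof (rule great)
      fix t
      have "(\<lambda>i. c * u i + (c * t) * y i) = (\<lambda>i. c * (u i + t * y i))"
        by (auto simp: algebra_simps)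
      hence "F (\<lambda>i. c * u i) (c * t) = c * F u t"
        using that sublinearD(2)[OF p, of c "\<lambda>i. u i + t * y i"]
        by (simp add: F_def algebra_simps)
      thus "p' (\<lambda>i. c * u i) / c \<le> F u t"
        using low[of "\<lambda>i. c * u i" "c * t"] that by (simp add: divide_le_eq mult.commute)
    qed
    thus ?thesis using that by (simp add: divide_le_eq mult.commute)
  qed
  show "sublinear p'"
    unfolding sublinear_def
  proof (intro conjI allI impI add)
    fix c :: real and u :: "'i \<Rightarrow> real" assume "0 \<le> c"
    show "p' (\<lambda>i. c * u i) = c * p' u"
    proof (cases "c = 0")
      case True
      thus ?thesis using zero by simp
    next
      case False
      hence c: "c > 0" using \<open>0 \<le> c\<close> by simp
      have "p' u \<le> (1 / c) * p' (\<lambda>i. c * u i)"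
        using scale_le[of "1 / c" "\<lambda>i. c * u i"] c by simp
      thus ?thesis using scale_le[OF c, of u] c by (simp add: field_simps)
    qed
  qed
  show py: "p' y = p y"
  proof (rule antisym[OF le great])
    fix t
    have "(\<lambda>i. y i + t * y i) = (\<lambda>i. (1 + t) * y i)" by (auto simp: algebra_simps)
    thus "p y \<le> F y t" using sublinear_scale_ge[OF p, of "1 + t" y] by (simp add: F_def algebra_simps)
  qed
  have along_le: "p' (\<lambda>i. u i + s * y i) \<le> p' u + s * p y" for u s
  proof -
    have "p' (\<lambda>i. u i + s * y i) - s * p y \<le> p' u"
    proof (rule great)
      fix t
      have "(\<lambda>i. u i + s * y i + (t - s) * y i) = (\<lambda>i. u i + t * y i)" by (auto simp: algebra_simps)
      thus "p' (\<lambda>i. u i + s * y i) - s * p y \<le> F u t"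
        using low[of "\<lambda>i. u i + s * y i" "t - s"] by (simp add: F_def algebra_simps)
    qed
    thus ?thesis by simp
  qed
  show "additive_along p' y"
    unfolding additive_along_def py
  proof (intro allI antisym along_le)
    fix u s
    show "p' u + s * p y \<le> p' (\<lambda>i. u i + s * y i)"
      using along_le[of "\<lambda>i. u i + s * y i" "- s"] by simp
  qed
  show "additive_along p' v \<and> p' v = p v" if v: "additive_along p v" for v
  proof -
    have le': "p' (\<lambda>i. u i + s * v i) \<le> p' u + s * p v" for u s
    proof -
      have "p' (\<lambda>i. u i + s * v i) - s * p v \<le> p' u"
      proof (rule great)
        fix t
        have "(\<lambda>i. u i + s * v i + t * y i) = (\<lambda>i. (u i + t * y i) + s * v i)" by (auto simp: algebra_simps)
        hence "F (\<lambda>i. u i + s * v i) t = F u t + s * p v"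
          using v by (simp add: F_def additive_along_def)
        thus "p' (\<lambda>i. u i + s * v i) - s * p v \<le> F u t" using low[of "\<lambda>i. u i + s * v i" t] by simp
      qed
      thus ?thesis by simp
    qed
    have eq: "p' (\<lambda>i. u i + s * v i) = p' u + s * p v" for u s
      using le'[of u s] le'[of "\<lambda>i. u i + s * v i" "- s"] by simp
    have "p' v = p v" using eq[of "\<lambda>_. 0" 1] zero by simp
    thus ?thesis using eq by (simp add: additive_along_def)
  qed
qed

lemma sublinear_additive_along_finite:
  assumes "finite Y" "sublinear p"
  shows "\<exists>p'. sublinear p' \<and> (\<forall>u. p' u \<le> p u) \<and> (\<forall>v\<in>Y. additive_along p' v) \<and>
     (\<forall>v. additive_along p v \<longrightarrow> additive_along p' v \<and> p' v = p v)"
  using assms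
proof (induction Y)
  case empty
  thus ?case by blast
next
  case (insert y Y)
  from insert.IH[OF insert.prems] obtain p1 where p1: "sublinear p1" "\<And>u. p1 u \<le> p u"
    "\<And>v. v \<in> Y \<Longrightarrow> additive_along p1 v"
    "\<And>v. additive_along p v \<Longrightarrow> additive_along p1 v \<and> p1 v = p v" by blast
  obtain p2 where p2: "sublinear p2" "\<And>u. p2 u \<le> p1 u" "additive_along p2 y"
    "\<And>v. additive_along p1 v \<Longrightarrow> additive_along p2 v \<and> p2 v = p1 v"
    using sublinear_additive_along_step[OF p1(1), of y] by metis
  have "p2 u \<le> p u" for u using p1(2)[of u] p2(2)[of u] by simp
  moreover have "additive_along p2 v \<and> p2 v = p v" if "additive_along p v" for v
    using p1(4)[OF that] p2(4)[of v] by simp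
  moreover have "additive_along p2 v" if "v \<in> insert y Y" for v
    using that p1(3) p2(3,4) by blast
  ultimately show ?case using p2(1) by blast
qed

text \<open>Finitely many directions take the place of a maximality argument. The direction z comes
  first, since there the value of p must survive; the unit vectors then make the functional a finite
  sum. Functions may be nonzero off I, hence \<open>dep\<close>.\<close>

lemma hahn_banach_coordinates:
  fixes p :: "('i \<Rightarrow> real) \<Rightarrow> real"
  assumes fin: "finite I" and p: "sublinear p"
    and dep: "\<And>u v. (\<And>i. i \<in> I \<Longrightarrow> u i = v i) \<Longrightarrow> p u = p v"
  obtains c where "\<And>u. (\<Sum>i\<in>I. c i * u i) \<le> p u" "(\<Sum>i\<in>I. c i * z i) = p z"
proof -
  define e where "e = (\<lambda>(j :: 'i) i. if i = j then 1 else 0 :: real)"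
  define res where "res = (\<lambda>J (u :: 'i \<Rightarrow> real) i. if i \<in> J then u i else 0)"
  obtain p1 where p1: "sublinear p1" "\<And>u. p1 u \<le> p u" "additive_along p1 (res I z)" "p1 (res I z) = p (res I z)"
    using sublinear_additive_along_step[OF p, of "res I z"] by metis
  from sublinear_additive_along_finite[of "e ` I", OF _ p1(1)] fin
  obtain q where q: "sublinear q" "\<And>u. q u \<le> p1 u" "\<And>j. j \<in> I \<Longrightarrow> additive_along q (e j)"
      "\<And>v. additive_along p1 v \<Longrightarrow> q v = p1 v" by blast
  have lin: "J \<subseteq> I \<Longrightarrow> q (res J u) = (\<Sum>j\<in>J. q (e j) * u j)" if "finite J" for J u
    using that
  proof (induction J)
    case empty
    have "res {} u = (\<lambda>_. 0)" by (auto simp: res_def)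
    thus ?case using sublinearD(3)[OF q(1)] by simp
  next
    case (insert j J)
    have "res (insert j J) u = (\<lambda>i. res J u i + u j * e j i)"
      using insert.hyps by (auto simp: res_def e_def)
    thus ?case using insert q(3)[of j] by (simp add: additive_along_def mult.commute)
  qed
  have res: "p (res I u) = p u" for u by (rule dep) (simp add: res_def)
  show ?thesis
  proof
    show "(\<Sum>i\<in>I. q (e i) * u i) \<le> p u" for u
      using lin[OF fin, of u] q(2)[of "res I u"] p1(2)[of "res I u"] res[of u] by simp
    show "(\<Sum>i\<in>I. q (e i) * z i) = p z"
      using lin[OF fin, of z] q(4)[OF p1(3)] p1(4) res[of z] by simp
  qed
qed

section \<open>Factorization of bilinear forms\<close>

definition ball3 :: "'i set \<Rightarrow> ('i \<Rightarrow> real) set" where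
  "ball3 A = {f. (\<forall>i. 0 \<le> f i) \<and> norm3 A f \<le> 1}"

text \<open>For finite A, the norm of the positive part of a in l_{3/2}, written as the support
  function of the positive part of the ball of l_3. At a = x^2 it equals
  \<open>(norm3 A x)\<^sup>2\<close>, which links norms to linear functionals of squares.\<close>

definition support3 :: "'i set \<Rightarrow> ('i \<Rightarrow> real) \<Rightarrow> real" where
  "support3 A a = (SUP f\<in>ball3 A. \<Sum>i\<in>A. f i * a i)"

context
  fixes A :: "'i set"
  assumes fin: "finite A"
begin

lemma ball3_le_1:
  assumes "f \<in> ball3 A" "i \<in> A"
  shows "f i \<le> 1"
proof -
  have "f i ^ 3 \<le> (\<Sum>i\<in>A. \<bar>f i\<bar> ^ 3)"
    using assms fin member_le_sum[of i A "\<lambda>i. \<bar>f i\<bar> ^ 3"] by (simp add: ball3_def)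
  also have "\<dots> = norm3 A f ^ 3" by (simp add: norm3_cube)
  also have "\<dots> \<le> 1" using assms by (simp add: ball3_def power_le_one)
  finally show ?thesis using cube_leD[of "f i" 1] by simp
qed

lemma zero_in_ball3: "(\<lambda>_. 0) \<in> ball3 A"
  by (simp add: ball3_def norm3_def)

lemma bdd_above_ball3: "bdd_above ((\<lambda>f. \<Sum>i\<in>A. f i * a i) ` ball3 A)"
proof (rule bdd_aboveI2[of _ _ "\<Sum>i\<in>A. \<bar>a i\<bar>"], rule sum_mono)
  fix f i assume "f \<in> ball3 A" "i \<in> A"
  hence f: "0 \<le> f i" "f i \<le> 1" using ball3_le_1 by (auto simp: ball3_def)
  have "f i * a i \<le> f i * \<bar>a i\<bar>" using f by (intro mult_left_mono) auto
  also have "\<dots> \<le> 1 * \<bar>a i\<bar>" using f by (intro mult_right_mono) auto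
  finally show "f i * a i \<le> \<bar>a i\<bar>" by simp
qed

lemma support3_ge: "f \<in> ball3 A \<Longrightarrow> (\<Sum>i\<in>A. f i * a i) \<le> support3 A a"
  unfolding support3_def by (rule cSUP_upper[OF _ bdd_above_ball3])

lemma support3_le: "(\<And>f. f \<in> ball3 A \<Longrightarrow> (\<Sum>i\<in>A. f i * a i) \<le> m) \<Longrightarrow> support3 A a \<le> m"
  unfolding support3_def by (rule cSUP_least) (use zero_in_ball3 in auto)

lemma support3_nonneg: "0 \<le> support3 A a"
  using support3_ge[OF zero_in_ball3, of a] by simp

lemma support3_add: "support3 A (\<lambda>i. a i + b i) \<le> support3 A a + support3 A b"
  by (rule support3_le) (simp add: distrib_left sum.distrib add_mono support3_ge)

lemma support3_scale_le:
  assumes "0 \<le> c"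
  shows "support3 A (\<lambda>i. c * a i) \<le> c * support3 A a"
proof (rule support3_le)
  fix f assume "f \<in> ball3 A"
  hence "c * (\<Sum>i\<in>A. f i * a i) \<le> c * support3 A a" using assms by (intro mult_left_mono support3_ge)
  thus "(\<Sum>i\<in>A. f i * (c * a i)) \<le> c * support3 A a"
    by (simp add: sum_distrib_left mult.left_commute)
qed

lemma support3_cong: "(\<And>i. i \<in> A \<Longrightarrow> a i = b i) \<Longrightarrow> support3 A a = support3 A b"
  unfolding support3_def by (intro SUP_cong sum.cong) auto

lemma support3_nonpos: "(\<And>i. i \<in> A \<Longrightarrow> a i \<le> 0) \<Longrightarrow> support3 A a \<le> 0"
  by (rule support3_le) (auto simp: ball3_def intro!: sum_nonpos mult_nonneg_nonpos)

text \<open>The extremal weight is \<bar>x\<bar> divided by its norm.\<close>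

lemma norm3_square_le_support3: "(norm3 A x)\<^sup>2 \<le> support3 A (\<lambda>i. (x i)\<^sup>2)"
proof (cases "norm3 A x = 0")
  case True
  thus ?thesis using support3_nonneg by simp
next
  case False
  hence p: "norm3 A x > 0" using norm3_nonneg[of A x] by (simp add: less_le)
  define f where "f = (\<lambda>i. 1 / norm3 A x * \<bar>x i\<bar>)"
  have "norm3 A f = 1"
    unfolding f_def norm3_scale using p norm3_cong[of A "\<lambda>i. \<bar>x i\<bar>" x] by simp
  hence "f \<in> ball3 A" using p by (simp add: ball3_def f_def)
  moreover have "(\<Sum>i\<in>A. f i * (x i)\<^sup>2) = (norm3 A x)\<^sup>2"
  proof -
    have "(\<Sum>i\<in>A. f i * (x i)\<^sup>2) = 1 / norm3 A x * (\<Sum>i\<in>A. \<bar>x i\<bar> ^ 3)"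
      unfolding sum_distrib_left by (intro sum.cong) (auto simp: f_def power3_eq_cube power2_eq_square)
    also have "\<dots> = (norm3 A x)\<^sup>2" using p unfolding norm3_cube[symmetric] by (simp add: power3_eq_cube power2_eq_square)
    finally show ?thesis .
  qed
  ultimately show ?thesis using support3_ge[of f "\<lambda>i. (x i)\<^sup>2"] by simp
qed

lemma weighted_square_le: "(\<Sum>i\<in>A. f i * (x i)\<^sup>2) \<le> norm3 A f * (norm3 A x)\<^sup>2"
proof -
  have "(\<Sum>i\<in>A. f i * (x i)\<^sup>2) \<le> (\<Sum>i\<in>A. \<bar>f i * x i * x i\<bar>)"
    by (intro sum_mono) (simp add: power2_eq_square mult.assoc abs_mult mult_right_mono)
  thus ?thesis using holder3[OF fin, of f x x] by (simp add: power2_eq_square mult.assoc)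
qed

text \<open>A bipolar argument for the positive ball. The test vector f^2 gives that the cube of the
  norm of f is at most its square.\<close>

lemma norm3_le_1_of_support3:
  assumes "\<And>i. 0 \<le> f i" "\<And>a. (\<Sum>i\<in>A. f i * a i) \<le> support3 A a"
  shows "norm3 A f \<le> 1"
proof -
  have "norm3 A f ^ 3 = (\<Sum>i\<in>A. f i * (f i)\<^sup>2)"
    using assms(1) unfolding norm3_cube by (simp add: power3_eq_cube power2_eq_square mult.assoc)
  also have "\<dots> \<le> support3 A (\<lambda>i. (f i)\<^sup>2)" by (rule assms(2))
  also have "\<dots> \<le> 1 * (norm3 A f)\<^sup>2"
  proof (rule support3_le)
    fix h assume h: "h \<in> ball3 A"
    have "(\<Sum>i\<in>A. h i * (f i)\<^sup>2) \<le> norm3 A h * (norm3 A f)\<^sup>2" by (rule weighted_square_le)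
    also have "\<dots> \<le> 1 * (norm3 A f)\<^sup>2" using h by (intro mult_right_mono) (auto simp: ball3_def)
    finally show "(\<Sum>i\<in>A. h i * (f i)\<^sup>2) \<le> 1 * (norm3 A f)\<^sup>2" .
  qed
  finally have le: "(norm3 A f)\<^sup>2 * norm3 A f \<le> (norm3 A f)\<^sup>2 * 1"
    by (simp add: power3_eq_cube power2_eq_square)
  show ?thesis
  proof (cases "norm3 A f = 0")
    case False
    hence "(norm3 A f)\<^sup>2 > 0" by simp
    thus ?thesis using le by (simp only: mult_le_cancel_left_pos)
  qed simp
qed

text \<open>
  A vector \<open>u\<close> stands for a triple \<open>(a, b, w)\<close> of two vectors and a matrix. The functional
  bounds \<open>w\<close> as a Hilbertian tensor \<open>\<Sum>\<^sub>k x\<^sub>k \<otimes> y\<^sub>k\<close> after \<open>a\<close> and \<open>b\<close> are added to the square functions, so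
  that one linear functional below it yields a bilinear form together with its dominating weights.
\<close>

definition dom_val :: "('i + 'i + 'i \<times> 'i \<Rightarrow> real) \<Rightarrow> real \<Rightarrow> bool" where
  "dom_val u t \<longleftrightarrow> (\<exists>(K::nat) x y.
     (\<forall>a\<in>A. \<forall>b\<in>A. u (Inr (Inr (a, b))) = (\<Sum>k<K. x k a * y k b)) \<and>
     (support3 A (\<lambda>a. u (Inl a) + (\<Sum>k<K. (x k a)\<^sup>2))
       + support3 A (\<lambda>a. u (Inr (Inl a)) + (\<Sum>k<K. (y k a)\<^sup>2))) / 2 \<le> t)"

definition dom_inf :: "('i + 'i + 'i \<times> 'i \<Rightarrow> real) \<Rightarrow> real" where
  "dom_inf u = Inf {t. dom_val u t}"

lemma dom_valI:
  assumes "finite S"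
    "\<And>a b. a \<in> A \<Longrightarrow> b \<in> A \<Longrightarrow> u (Inr (Inr (a, b))) = (\<Sum>k\<in>S. x k a * y k b)"
    "(support3 A (\<lambda>a. u (Inl a) + (\<Sum>k\<in>S. (x k a)\<^sup>2))
       + support3 A (\<lambda>a. u (Inr (Inl a)) + (\<Sum>k\<in>S. (y k a)\<^sup>2))) / 2 \<le> t"
  shows "dom_val u t"
proof -
  obtain h where h: "bij_betw h {..<card S} S"
    using ex_bij_betw_nat_finite[OF assms(1)] by (auto simp: atLeast0LessThan)
  note r = sum.reindex_bij_betw[OF h, of "\<lambda>k. (x k _)\<^sup>2"] sum.reindex_bij_betw[OF h, of "\<lambda>k. (y k _)\<^sup>2"]
    sum.reindex_bij_betw[OF h, of "\<lambda>k. x k _ * y k _"]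
  have "\<forall>a\<in>A. \<forall>b\<in>A. u (Inr (Inr (a, b))) = (\<Sum>k<card S. x (h k) a * y (h k) b)"
    using assms(2) by (simp add: r)
  moreover have "(support3 A (\<lambda>a. u (Inl a) + (\<Sum>k<card S. (x (h k) a)\<^sup>2))
       + support3 A (\<lambda>a. u (Inr (Inl a)) + (\<Sum>k<card S. (y (h k) a)\<^sup>2))) / 2 \<le> t"
    using assms(3) by (simp only: r)
  ultimately show ?thesis unfolding dom_val_def by (intro exI conjI)
qed

lemma dom_val_nonneg:
  assumes "dom_val u t"
  shows "0 \<le> t"
proof -
  obtain a b where "(support3 A a + support3 A b) / 2 \<le> t"
    using assms unfolding dom_val_def by blast
  moreover have "0 \<le> (support3 A a + support3 A b) / 2" by (simp add: support3_nonneg)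
  ultimately show ?thesis by (rule order_trans[rotated])
qed

lemma dom_val_ex: "\<exists>t. dom_val u t"
proof -
  have "u (Inr (Inr (a, b))) = (\<Sum>p\<in>A \<times> A. (if a = fst p then u (Inr (Inr p)) else 0) * (if b = snd p then 1 else 0))"
    if "a \<in> A" "b \<in> A" for a b
  proof -
    have "(\<Sum>p\<in>A \<times> A. (if a = fst p then u (Inr (Inr p)) else 0) * (if b = snd p then 1 else 0))
        = (\<Sum>p\<in>A \<times> A. if p = (a, b) then u (Inr (Inr (a, b))) else 0)"
      by (intro sum.cong) auto
    thus ?thesis using fin that by simp
  qed
  note eq = this
  show ?thesis
    by (rule exI, rule dom_valI[of "A \<times> A" u "\<lambda>p i. if i = fst p then u (Inr (Inr p)) else 0"
      "\<lambda>p i. if i = snd p then 1 else 0", OF _ eq order_refl]) (use fin in simp)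
qed

lemma dom_inf_le:
  assumes "dom_val u t"
  shows "dom_inf u \<le> t"
  unfolding dom_inf_def
proof (rule cInf_lower)
  show "t \<in> {t. dom_val u t}" using assms by simp
  show "bdd_below {t. dom_val u t}"
    by (rule bdd_belowI[of _ 0], drule CollectD, rule dom_val_nonneg)
qed

lemma dom_inf_ge:
  assumes "\<And>t. dom_val u t \<Longrightarrow> m \<le> t"
  shows "m \<le> dom_inf u"
  unfolding dom_inf_def
proof (rule cInf_greatest)
  show "{t. dom_val u t} \<noteq> {}" using dom_val_ex[of u] by simp
qed (use assms in simp)

lemma dom_inf_approx:
  assumes "dom_inf u < s"
  obtains t where "dom_val u t" "t < s"
proof (rule ccontr)
  assume "\<not> thesis"
  hence "s \<le> t" if "dom_val u t" for t using \<open>\<And>t. dom_val u t \<Longrightarrow> t < s \<Longrightarrow> thesis\<close>[OF that] by linarith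
  hence "s \<le> dom_inf u" by (rule dom_inf_ge)
  thus False using assms by simp
qed

text \<open>Concatenating two representations adds the matrices and the square functions alike, and
  \<open>support3\<close> is subadditive.\<close>

lemma dom_val_add:
  assumes "dom_val u s" "dom_val v t"
  shows "dom_val (\<lambda>i. u i + v i) (s + t)"
proof -
  from assms(1) obtain K x y where
    1: "\<And>a b. a \<in> A \<Longrightarrow> b \<in> A \<Longrightarrow> u (Inr (Inr (a, b))) = (\<Sum>k<(K::nat). x k a * y k b)"
      "(support3 A (\<lambda>a. u (Inl a) + (\<Sum>k<K. (x k a)\<^sup>2))
       + support3 A (\<lambda>a. u (Inr (Inl a)) + (\<Sum>k<K. (y k a)\<^sup>2))) / 2 \<le> s"
    unfolding dom_val_def by blast
  from assms(2) obtain L x' y' where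
    2: "\<And>a b. a \<in> A \<Longrightarrow> b \<in> A \<Longrightarrow> v (Inr (Inr (a, b))) = (\<Sum>k<(L::nat). x' k a * y' k b)"
      "(support3 A (\<lambda>a. v (Inl a) + (\<Sum>k<L. (x' k a)\<^sup>2))
       + support3 A (\<lambda>a. v (Inr (Inl a)) + (\<Sum>k<L. (y' k a)\<^sup>2))) / 2 \<le> t"
    unfolding dom_val_def by blast
  show ?thesis
  proof (rule dom_valI[of "Sum_Type.Plus {..<K} {..<L}" _ "case_sum x x'" "case_sum y y'"])
    show "u (Inr (Inr (a, b))) + v (Inr (Inr (a, b)))
        = (\<Sum>k\<in>Sum_Type.Plus {..<K} {..<L}. case_sum x x' k a * case_sum y y' k b)"
      if "a \<in> A" "b \<in> A" for a b
      unfolding 1(1)[OF that] 2(1)[OF that] by (simp add: sum.Plus)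
    have sup: "support3 A (\<lambda>a. u (f a) + v (f a) + (\<Sum>k\<in>Sum_Type.Plus {..<K} {..<L}. (case_sum w w' k a)\<^sup>2))
        \<le> support3 A (\<lambda>a. u (f a) + (\<Sum>k<K. (w k a)\<^sup>2)) + support3 A (\<lambda>a. v (f a) + (\<Sum>k<L. (w' k a)\<^sup>2))" for f w w'
      using support3_add[of "\<lambda>a. u (f a) + (\<Sum>k<K. (w k a)\<^sup>2)" "\<lambda>a. v (f a) + (\<Sum>k<L. (w' k a)\<^sup>2)"]
      by (simp add: sum.Plus algebra_simps)
    show "(support3 A (\<lambda>a. u (Inl a) + v (Inl a) + (\<Sum>k\<in>Sum_Type.Plus {..<K} {..<L}. (case_sum x x' k a)\<^sup>2))
       + support3 A (\<lambda>a. u (Inr (Inl a)) + v (Inr (Inl a)) + (\<Sum>k\<in>Sum_Type.Plus {..<K} {..<L}. (case_sum y y' k a)\<^sup>2))) / 2 \<le> s + t"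
      using 1(2) 2(2) sup[of Inl x x'] sup[of "\<lambda>a. Inr (Inl a)" y y'] by argo
  qed simp
qed

text \<open>The factor sqrt c on both sides of a representation multiplies the matrix and both
  square functions by c.\<close>

lemma dom_val_scale:
  assumes "dom_val u t" "0 \<le> c"
  shows "dom_val (\<lambda>i. c * u i) (c * t)"
proof -
  from assms(1) obtain K x y where
    1: "\<And>a b. a \<in> A \<Longrightarrow> b \<in> A \<Longrightarrow> u (Inr (Inr (a, b))) = (\<Sum>k<(K::nat). x k a * y k b)"
      "(support3 A (\<lambda>a. u (Inl a) + (\<Sum>k<K. (x k a)\<^sup>2))
       + support3 A (\<lambda>a. u (Inr (Inl a)) + (\<Sum>k<K. (y k a)\<^sup>2))) / 2 \<le> t"
    unfolding dom_val_def by blast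
  show ?thesis
  proof (rule dom_valI[of "{..<K}" _ "\<lambda>k a. sqrt c * x k a" "\<lambda>k a. sqrt c * y k a"])
    show "c * u (Inr (Inr (a, b))) = (\<Sum>k<K. sqrt c * x k a * (sqrt c * y k b))"
      if "a \<in> A" "b \<in> A" for a b
    proof -
      have "sqrt c * x k a * (sqrt c * y k b) = (sqrt c * sqrt c) * (x k a * y k b)" for k
        by (simp only: mult_ac)
      hence eq: "sqrt c * x k a * (sqrt c * y k b) = c * (x k a * y k b)" for k
        using assms(2) by simp
      show ?thesis unfolding 1(1)[OF that] eq sum_distrib_left ..
    qed
    have sup: "support3 A (\<lambda>a. c * u (f a) + (\<Sum>k<K. (sqrt c * w k a)\<^sup>2))
        \<le> c * support3 A (\<lambda>a. u (f a) + (\<Sum>k<K. (w k a)\<^sup>2))" for f w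
      using support3_scale_le[OF assms(2), of "\<lambda>a. u (f a) + (\<Sum>k<K. (w k a)\<^sup>2)"] assms(2)
      by (simp add: distrib_left sum_distrib_left power_mult_distrib)
    have "c * ((support3 A (\<lambda>a. u (Inl a) + (\<Sum>k<K. (x k a)\<^sup>2))
       + support3 A (\<lambda>a. u (Inr (Inl a)) + (\<Sum>k<K. (y k a)\<^sup>2))) / 2) \<le> c * t"
      using 1(2) assms(2) by (rule mult_left_mono)
    thus "(support3 A (\<lambda>a. c * u (Inl a) + (\<Sum>k<K. (sqrt c * x k a)\<^sup>2))
       + support3 A (\<lambda>a. c * u (Inr (Inl a)) + (\<Sum>k<K. (sqrt c * y k a)\<^sup>2))) / 2 \<le> c * t"
      using sup[of Inl x] sup[of "\<lambda>a. Inr (Inl a)" y] by argo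
  qed simp
qed

lemma sublinear_dom_inf: "sublinear dom_inf"
  unfolding sublinear_def
proof (intro conjI allI impI)
  fix u v
  show "dom_inf (\<lambda>i. u i + v i) \<le> dom_inf u + dom_inf v"
  proof -
    have *: "dom_inf (\<lambda>i. u i + v i) \<le> s + t" if "dom_val u s" "dom_val v t" for s t
      by (rule dom_inf_le[OF dom_val_add[OF that]])
    have "dom_inf (\<lambda>i. u i + v i) - s \<le> dom_inf v" if "dom_val u s" for s
      using dom_inf_ge[of v "dom_inf (\<lambda>i. u i + v i) - s"] *[OF that] by (simp add: algebra_simps)
    hence "dom_inf (\<lambda>i. u i + v i) - dom_inf v \<le> dom_inf u"
      using dom_inf_ge[of u "dom_inf (\<lambda>i. u i + v i) - dom_inf v"] by (simp add: algebra_simps)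
    thus ?thesis by simp
  qed
next
  fix c :: real and u
  assume c: "0 \<le> c"
  have pos: "dom_inf (\<lambda>i. c * u i) \<le> c * dom_inf u" if "c > 0" for c u
  proof -
    have "dom_inf (\<lambda>i. c * u i) / c \<le> dom_inf u"
      proof (rule dom_inf_ge)
      fix t assume "dom_val u t"
      from dom_inf_le[OF dom_val_scale[OF this, of c]] that
      show "dom_inf (\<lambda>i. c * u i) / c \<le> t" by (simp add: divide_le_eq mult.commute)
    qed
    thus ?thesis using that by (simp add: divide_le_eq mult.commute)
  qed
  show "dom_inf (\<lambda>i. c * u i) = c * dom_inf u"
  proof (cases "c = 0")
    case True
    have "dom_inf (\<lambda>i. 0) \<le> 0"
      by (rule dom_inf_le, rule dom_valI[of "{}"]) (auto intro: support3_nonpos)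
    moreover have "0 \<le> dom_inf (\<lambda>i. 0)" by (rule dom_inf_ge) (rule dom_val_nonneg)
    ultimately show ?thesis using True by simp
  next
    case False
    hence c: "c > 0" using c by simp
    have "dom_inf u \<le> (1 / c) * dom_inf (\<lambda>i. c * u i)"
      using pos[of "1 / c" "\<lambda>i. c * u i"] c by simp
    thus ?thesis using pos[OF c, of u] c by (simp add: field_simps)
  qed
qed

text \<open>With zero in the first two components, \<open>dom_val\<close> is a Hilbertian
  factorization with constant t, to which Grothendieck's inequality applies.\<close>

lemma dom_val_imp_proj_le:
  assumes "dom_val u t" "\<And>a. u (Inl a) = 0" "\<And>a. u (Inr (Inl a)) = 0"
  shows "proj_le A (\<lambda>a b. u (Inr (Inr (a, b)))) (97 * t)"
proof -
  from assms(1) obtain K x y where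
    1: "\<And>a b. a \<in> A \<Longrightarrow> b \<in> A \<Longrightarrow> u (Inr (Inr (a, b))) = (\<Sum>k<(K::nat). x k a * y k b)"
      "(support3 A (\<lambda>a. u (Inl a) + (\<Sum>k<K. (x k a)\<^sup>2))
       + support3 A (\<lambda>a. u (Inr (Inl a)) + (\<Sum>k<K. (y k a)\<^sup>2))) / 2 \<le> t"
    unfolding dom_val_def by blast
  have sq: "(norm3 A (\<lambda>a. sqrt (\<Sum>k<K. (w k a)\<^sup>2)))\<^sup>2 \<le> support3 A (\<lambda>a. \<Sum>k<K. (w k a)\<^sup>2)" for w :: "nat \<Rightarrow> 'i \<Rightarrow> real"
    using norm3_square_le_support3[of "\<lambda>a. sqrt (\<Sum>k<K. (w k a)\<^sup>2)"] by (simp add: sum_nonneg)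
  have "hilb_le A (\<lambda>a b. u (Inr (Inr (a, b)))) t"
  proof (rule hilb_leI[of "{..<K}" _ _ x y])
    show "(norm3 A (\<lambda>a. sqrt (\<Sum>k<K. (x k a)\<^sup>2)))\<^sup>2 + (norm3 A (\<lambda>a. sqrt (\<Sum>k<K. (y k a)\<^sup>2)))\<^sup>2 \<le> 2 * t"
      using 1(2) sq[of x] sq[of y] assms(2,3) by simp
  qed (use 1(1) in auto)
  thus ?thesis by (rule grothendieck[OF fin])
qed

lemma dom_inf_cong:
  assumes "\<And>i. i \<in> Sum_Type.Plus A (Sum_Type.Plus A (A \<times> A)) \<Longrightarrow> u i = v i"
  shows "dom_inf u = dom_inf v"
proof -
  have "u (Inl a) = v (Inl a)" "u (Inr (Inl a)) = v (Inr (Inl a))" if "a \<in> A" for a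
    using that assms by auto
  hence "support3 A (\<lambda>a. u (Inl a) + s a) = support3 A (\<lambda>a. v (Inl a) + s a)"
    "support3 A (\<lambda>a. u (Inr (Inl a)) + s a) = support3 A (\<lambda>a. v (Inr (Inl a)) + s a)" for s
    by (intro support3_cong; simp)+
  moreover have "u (Inr (Inr (a, b))) = v (Inr (Inr (a, b)))" if "a \<in> A" "b \<in> A" for a b
    using that assms by auto
  ultimately have "dom_val u t = dom_val v t" for t
    unfolding dom_val_def by (simp cong: ball_cong)
  thus ?thesis by (simp add: dom_inf_def)
qed

text \<open>One functional c below \<open>dom_inf\<close>, exact at (0, 0, z), is tested three
  times. Triples (a, b, 0) put the weights below the support functions, hence into the positive
  balls. The triple (- x^2, - y^2, x \<otimes> y) has \<open>dom_inf\<close> at most 0, which is the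
  domination of B. The triple (0, 0, z) ties the value of B at z to the projective norm; the strict
  inequality there allows for an infimum that is not attained.\<close>

lemma dominated_bilinear_form:
  obtains B f g where "\<And>i. 0 \<le> f i" "\<And>i. 0 \<le> g i" "norm3 A f \<le> 1" "norm3 A g \<le> 1"
    "\<And>x y. (\<Sum>a\<in>A. \<Sum>b\<in>A. B a b * x a * y b) \<le> ((\<Sum>a\<in>A. f a * (x a)\<^sup>2) + (\<Sum>b\<in>A. g b * (y b)\<^sup>2)) / 2"
    "\<And>s. (\<Sum>a\<in>A. \<Sum>b\<in>A. B a b * z a b) < s \<Longrightarrow> proj_le A z (97 * s)"
proof -
  let ?I = "Sum_Type.Plus A (Sum_Type.Plus A (A \<times> A))"
  define mk :: "('i \<Rightarrow> real) \<Rightarrow> ('i \<Rightarrow> real) \<Rightarrow> ('i \<Rightarrow> 'i \<Rightarrow> real) \<Rightarrow> 'i + 'i + 'i \<times> 'i \<Rightarrow> real"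
    where "mk = (\<lambda>a b w. case_sum a (case_sum b (\<lambda>(i, j). w i j)))"
  have finI: "finite ?I" using fin by (intro finite_Plus finite_cartesian_product)
  obtain c where c: "\<And>u. (\<Sum>i\<in>?I. c i * u i) \<le> dom_inf u"
     "(\<Sum>i\<in>?I. c i * mk (\<lambda>_. 0) (\<lambda>_. 0) z i) = dom_inf (mk (\<lambda>_. 0) (\<lambda>_. 0) z)"
    using hahn_banach_coordinates[OF finI sublinear_dom_inf dom_inf_cong] by blast
  have split: "(\<Sum>i\<in>?I. c i * mk a b w i) = (\<Sum>i\<in>A. c (Inl i) * a i) + (\<Sum>i\<in>A. c (Inr (Inl i)) * b i)
      + (\<Sum>i\<in>A. \<Sum>j\<in>A. c (Inr (Inr (i, j))) * w i j)" for a b w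
    using fin by (simp add: sum.Plus finite_Plus finite_cartesian_product mk_def sum.cartesian_product case_prod_unfold)
  define B where "B = (\<lambda>a b. c (Inr (Inr (a, b))))"
  \<comment> \<open>The factor 2 undoes the halving in \<open>dom_val\<close>; the value 0 off A
    lets the weights be nonnegative everywhere.\<close>
  define f where "f = (\<lambda>a. if a \<in> A then 2 * c (Inl a) else 0)"
  define g where "g = (\<lambda>a. if a \<in> A then 2 * c (Inr (Inl a)) else 0)"
  have lin: "(\<Sum>i\<in>A. f i * a i) + (\<Sum>i\<in>A. g i * b i) \<le> support3 A a + support3 A b" for a b
  proof -
    have "dom_inf (mk a b (\<lambda>_ _. 0)) \<le> (support3 A a + support3 A b) / 2"
      by (rule dom_inf_le, rule dom_valI[of "{}"]) (simp_all add: mk_def)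
    with c(1)[of "mk a b (\<lambda>_ _. 0)"]
    have "2 * ((\<Sum>i\<in>A. c (Inl i) * a i) + (\<Sum>i\<in>A. c (Inr (Inl i)) * b i)) \<le> support3 A a + support3 A b"
      unfolding split by simp
    thus ?thesis by (simp add: f_def g_def sum_distrib_left mult.assoc distrib_left)
  qed
  have s0: "support3 A (\<lambda>_. 0) = 0"
    by (rule antisym[OF support3_nonpos support3_nonneg]) simp
  have unit: "(\<Sum>i\<in>A. h i * (if i = j then -1 else 0)) = - h j" if "j \<in> A" for j and h :: "'i \<Rightarrow> real"
  proof -
    have "(\<Sum>i\<in>A. h i * (if i = j then -1 else 0)) = (\<Sum>i\<in>A. if i = j then - h j else 0)"
      by (intro sum.cong) auto
    thus ?thesis using fin that by simp
  qed
  \<comment> \<open>Negative unit vectors have support value at most 0, so the functional is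
    nonnegative on positive ones; this gives the signs of f and g.\<close>
  have neg: "support3 A (\<lambda>j. if j = i then -1 else 0) \<le> 0" for i
    by (rule support3_nonpos) simp
  have f0: "0 \<le> f i" for i
  proof (cases "i \<in> A")
    case True
    thus ?thesis using lin[of "\<lambda>j. if j = i then -1 else 0" "\<lambda>_. 0"] s0 neg[of i] by (simp add: unit)
  qed (simp add: f_def)
  have g0: "0 \<le> g i" for i
  proof (cases "i \<in> A")
    case True
    thus ?thesis using lin[of "\<lambda>_. 0" "\<lambda>j. if j = i then -1 else 0"] s0 neg[of i] by (simp add: unit)
  qed (simp add: g_def)
  have f1: "norm3 A f \<le> 1"
    by (rule norm3_le_1_of_support3[OF f0]) (use lin[where b = "\<lambda>_. 0"] s0 in simp)
  have g1: "norm3 A g \<le> 1"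
    by (rule norm3_le_1_of_support3[OF g0]) (use lin[of "\<lambda>_. 0"] s0 in simp)
  have dom: "(\<Sum>a\<in>A. \<Sum>b\<in>A. B a b * x a * y b) \<le> ((\<Sum>a\<in>A. f a * (x a)\<^sup>2) + (\<Sum>b\<in>A. g b * (y b)\<^sup>2)) / 2" for x y
  proof -
    let ?u = "mk (\<lambda>a. - (x a)\<^sup>2) (\<lambda>b. - (y b)\<^sup>2) (\<lambda>a b. x a * y b)"
    \<comment> \<open>The rank-one representation by x and y cancels the two negative
      squares.\<close>
    have "dom_inf ?u \<le> 0"
      by (rule dom_inf_le, rule dom_valI[of "{()}" _ "\<lambda>_. x" "\<lambda>_. y"]) (simp_all add: mk_def s0)
    with c(1)[of ?u] have "(\<Sum>i\<in>A. \<Sum>j\<in>A. c (Inr (Inr (i, j))) * (x i * y j))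
        \<le> (\<Sum>i\<in>A. c (Inl i) * (x i)\<^sup>2) + (\<Sum>i\<in>A. c (Inr (Inl i)) * (y i)\<^sup>2)"
      unfolding split by (simp add: sum_negf)
    thus ?thesis by (simp add: B_def f_def g_def mult.assoc sum_distrib_left[symmetric] add_divide_distrib)
  qed
  have "proj_le A z (97 * s)" if "(\<Sum>a\<in>A. \<Sum>b\<in>A. B a b * z a b) < s" for s
  proof -
    have "dom_inf (mk (\<lambda>_. 0) (\<lambda>_. 0) z) < s" using that c(2) unfolding split by (simp add: B_def)
    then obtain t where t: "dom_val (mk (\<lambda>_. 0) (\<lambda>_. 0) z) t" "t < s" by (rule dom_inf_approx)
    have "proj_le A z (97 * t)" using dom_val_imp_proj_le[OF t(1)] by (simp add: mk_def)
    thus ?thesis by (rule proj_le_mono) (use t(2) in simp)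
  qed
  thus ?thesis using that f0 g0 f1 g1 dom by blast
qed

end

section \<open>Riesz products of bilinear forms\<close>

context
  fixes A :: "'i set" and f g :: "'i \<Rightarrow> real" and b :: "nat \<Rightarrow> 'i \<Rightarrow> 'i \<Rightarrow> real" and \<mu> :: "nat \<Rightarrow> real"
  assumes fin: "finite A"
    and f0: "\<And>a. 0 \<le> f a" and g0: "\<And>a. 0 \<le> g a"
    and bound: "\<And>j x y. \<bar>\<Sum>a\<in>A. \<Sum>c\<in>A. b j a c * x a * y c\<bar>
      \<le> sqrt (\<Sum>a\<in>A. f a * (x a)\<^sup>2) * sqrt (\<Sum>c\<in>A. g c * (y c)\<^sup>2)"
begin

definition form :: "nat \<Rightarrow> ('i \<Rightarrow> real) \<Rightarrow> ('i \<Rightarrow> real) \<Rightarrow> real" where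
  "form j x y = (\<Sum>a\<in>A. \<Sum>c\<in>A. b j a c * x a * y c)"

text \<open>The operator from L2(f) to L2(g) that represents the form; \<open>op_gf\<close> is its
  adjoint. The default 0 where a weight vanishes is harmless, because b vanishes there too
  (\<open>form_zero_g\<close>, \<open>form_zero_f\<close>).\<close>

definition op_fg :: "nat \<Rightarrow> ('i \<Rightarrow> real) \<Rightarrow> 'i \<Rightarrow> real" where
  "op_fg j x c = (if g c = 0 then 0 else (\<Sum>a\<in>A. b j a c * x a) / g c)"

definition op_gf :: "nat \<Rightarrow> ('i \<Rightarrow> real) \<Rightarrow> 'i \<Rightarrow> real" where
  "op_gf j y a = (if f a = 0 then 0 else (\<Sum>c\<in>A. b j a c * y c) / f a)"

text \<open>A product of operators 1 + \<mu> \<epsilon> J, with J skew on the direct sum of L2(f)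
  and L2(g), applied to (x, 0). A skew perturbation raises the squared norm by a factor of at most 1
  + \<mu>^2 instead of (1 + \<bar>\<mu>\<bar>)^2, so that square summability of \<mu> is
  enough.\<close>

primrec riesz :: "(nat \<Rightarrow> real) \<Rightarrow> ('i \<Rightarrow> real) \<Rightarrow> nat \<Rightarrow> ('i \<Rightarrow> real) \<times> ('i \<Rightarrow> real)" where
  "riesz \<epsilon> x 0 = (x, \<lambda>_. 0)"
| "riesz \<epsilon> x (Suc n) =
    (\<lambda>a. fst (riesz \<epsilon> x n) a - \<mu> n * \<epsilon> n * op_gf n (snd (riesz \<epsilon> x n)) a,
     \<lambda>c. snd (riesz \<epsilon> x n) c + \<mu> n * \<epsilon> n * op_fg n (fst (riesz \<epsilon> x n)) c)"

lemma form_unit: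
  assumes "a \<in> A" "c \<in> A"
  shows "\<bar>b j a c\<bar> \<le> sqrt (f a) * sqrt (g c)"
proof -
  have s: "(\<Sum>i\<in>A. h i * (if i = k then 1 else 0)) = h k" if "k \<in> A" for k and h :: "'i \<Rightarrow> real"
  proof -
    have "(\<Sum>i\<in>A. h i * (if i = k then 1 else 0)) = (\<Sum>i\<in>A. if i = k then h k else 0)"
      by (intro sum.cong) auto
    thus ?thesis using fin that by simp
  qed
  have i2: "(if i = k then 1 else 0 :: real)\<^sup>2 = (if i = k then 1 else 0)" for i k :: 'i by simp
  show ?thesis
    using bound[of j "\<lambda>i. if i = a then 1 else 0" "\<lambda>i. if i = c then 1 else 0"] assms
    unfolding i2 by (simp only: s)
qed

lemma form_zero_g: "a \<in> A \<Longrightarrow> c \<in> A \<Longrightarrow> g c = 0 \<Longrightarrow> b j a c = 0"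
  using form_unit[of a c j] by simp

lemma form_zero_f: "a \<in> A \<Longrightarrow> c \<in> A \<Longrightarrow> f a = 0 \<Longrightarrow> b j a c = 0"
  using form_unit[of a c j] by simp

lemma op_fg_form: "(\<Sum>c\<in>A. g c * op_fg j x c * y c) = form j x y"
proof -
  have "g c * op_fg j x c * y c = (\<Sum>a\<in>A. b j a c * x a * y c)" if "c \<in> A" for c
    using that form_zero_g[of _ c j] by (auto simp: op_fg_def sum_distrib_right)
  hence "(\<Sum>c\<in>A. g c * op_fg j x c * y c) = (\<Sum>c\<in>A. \<Sum>a\<in>A. b j a c * x a * y c)" by simp
  thus ?thesis unfolding form_def by (subst sum.swap)
qed

lemma op_gf_form: "(\<Sum>a\<in>A. f a * op_gf j y a * x a) = form j x y"
proof -
  have "f a * op_gf j y a = (\<Sum>c\<in>A. b j a c * y c)" if "a \<in> A" for a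
    using that form_zero_f[of a _ j] by (auto simp: op_gf_def)
  hence "f a * op_gf j y a * x a = (\<Sum>c\<in>A. b j a c * x a * y c)" if "a \<in> A" for a
    using that by (simp add: sum_distrib_left sum_distrib_right mult_ac)
  thus ?thesis by (simp add: form_def)
qed

lemma le_of_le_sqrt_mult:
  fixes s p :: real
  assumes "s \<le> sqrt p * sqrt s" "0 \<le> p" "0 \<le> s"
  shows "s \<le> p"
proof (cases "s = 0")
  case False
  hence s: "s > 0" using assms by simp
  have "sqrt s * sqrt s \<le> sqrt p * sqrt s" using assms by simp
  hence "sqrt s \<le> sqrt p" using s by (simp only: mult_le_cancel_right_pos real_sqrt_gt_zero)
  thus ?thesis by simp
qed (use assms in simp)

text \<open>The form is tested against \<open>op_fg j x\<close> itself.\<close>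

lemma op_fg_contraction: "(\<Sum>c\<in>A. g c * (op_fg j x c)\<^sup>2) \<le> (\<Sum>a\<in>A. f a * (x a)\<^sup>2)"
proof (rule le_of_le_sqrt_mult)
  have "(\<Sum>c\<in>A. g c * (op_fg j x c)\<^sup>2) = form j x (op_fg j x)"
    unfolding op_fg_form[symmetric] by (simp add: power2_eq_square mult.assoc)
  also have "\<dots> \<le> \<bar>form j x (op_fg j x)\<bar>" by simp
  also have "\<dots> \<le> sqrt (\<Sum>a\<in>A. f a * (x a)\<^sup>2) * sqrt (\<Sum>c\<in>A. g c * (op_fg j x c)\<^sup>2)"
    unfolding form_def by (rule bound)
  finally show "(\<Sum>c\<in>A. g c * (op_fg j x c)\<^sup>2)
      \<le> sqrt (\<Sum>a\<in>A. f a * (x a)\<^sup>2) * sqrt (\<Sum>c\<in>A. g c * (op_fg j x c)\<^sup>2)" .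
qed (auto intro!: sum_nonneg simp: f0 g0)

lemma op_gf_contraction: "(\<Sum>a\<in>A. f a * (op_gf j y a)\<^sup>2) \<le> (\<Sum>c\<in>A. g c * (y c)\<^sup>2)"
proof (rule le_of_le_sqrt_mult)
  have "(\<Sum>a\<in>A. f a * (op_gf j y a)\<^sup>2) = form j (op_gf j y) y"
    unfolding op_gf_form[symmetric] by (simp add: power2_eq_square mult.assoc)
  also have "\<dots> \<le> \<bar>form j (op_gf j y) y\<bar>" by simp
  also have "\<dots> \<le> sqrt (\<Sum>a\<in>A. f a * (op_gf j y a)\<^sup>2) * sqrt (\<Sum>c\<in>A. g c * (y c)\<^sup>2)"
    unfolding form_def by (rule bound)
  finally show "(\<Sum>a\<in>A. f a * (op_gf j y a)\<^sup>2)
      \<le> sqrt (\<Sum>c\<in>A. g c * (y c)\<^sup>2) * sqrt (\<Sum>a\<in>A. f a * (op_gf j y a)\<^sup>2)"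
    by (simp only: mult.commute)
qed (auto intro!: sum_nonneg simp: f0 g0)

text \<open>The two cross terms cancel because the operators are adjoint and enter with opposite signs.\<close>

lemma riesz_energy_step:
  assumes "\<epsilon> n * \<epsilon> n = (1::real)"
  shows "(\<Sum>a\<in>A. f a * (fst (riesz \<epsilon> x (Suc n)) a)\<^sup>2) + (\<Sum>c\<in>A. g c * (snd (riesz \<epsilon> x (Suc n)) c)\<^sup>2)
     \<le> (1 + (\<mu> n)\<^sup>2) * ((\<Sum>a\<in>A. f a * (fst (riesz \<epsilon> x n) a)\<^sup>2) + (\<Sum>c\<in>A. g c * (snd (riesz \<epsilon> x n) c)\<^sup>2))"
proof -
  let ?p = "fst (riesz \<epsilon> x n)" and ?s = "snd (riesz \<epsilon> x n)" and ?t = "\<mu> n * \<epsilon> n"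
  have t2: "?t * ?t = (\<mu> n)\<^sup>2"
    using assms by (simp add: power2_eq_square mult_ac)
  have exp: "h * (u + t * v)\<^sup>2 = h * u\<^sup>2 + (2 * t) * (h * v * u) + (t * t) * (h * v\<^sup>2)" for h u t v :: real
    by (simp add: power2_eq_square algebra_simps)
  have "(\<Sum>a\<in>A. f a * (fst (riesz \<epsilon> x (Suc n)) a)\<^sup>2)
      = (\<Sum>a\<in>A. f a * (?p a + (- ?t) * op_gf n ?s a)\<^sup>2)" by simp
  also have "\<dots> = (\<Sum>a\<in>A. f a * (?p a)\<^sup>2) - 2 * ?t * form n ?p ?s + (\<mu> n)\<^sup>2 * (\<Sum>a\<in>A. f a * (op_gf n ?s a)\<^sup>2)"
    unfolding exp sum.distrib sum_distrib_left[symmetric] op_gf_form minus_mult_minus t2 by simp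
  finally have 1: "(\<Sum>a\<in>A. f a * (fst (riesz \<epsilon> x (Suc n)) a)\<^sup>2) = \<dots>" .
  have "(\<Sum>c\<in>A. g c * (snd (riesz \<epsilon> x (Suc n)) c)\<^sup>2)
      = (\<Sum>c\<in>A. g c * (?s c + ?t * op_fg n ?p c)\<^sup>2)" by simp
  also have "\<dots> = (\<Sum>c\<in>A. g c * (?s c)\<^sup>2) + 2 * ?t * form n ?p ?s + (\<mu> n)\<^sup>2 * (\<Sum>c\<in>A. g c * (op_fg n ?p c)\<^sup>2)"
    unfolding exp sum.distrib sum_distrib_left[symmetric] op_fg_form t2 by simp
  finally have 2: "(\<Sum>c\<in>A. g c * (snd (riesz \<epsilon> x (Suc n)) c)\<^sup>2) = \<dots>" .
  have "(\<mu> n)\<^sup>2 * (\<Sum>a\<in>A. f a * (op_gf n ?s a)\<^sup>2) \<le> (\<mu> n)\<^sup>2 * (\<Sum>c\<in>A. g c * (?s c)\<^sup>2)"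
    "(\<mu> n)\<^sup>2 * (\<Sum>c\<in>A. g c * (op_fg n ?p c)\<^sup>2) \<le> (\<mu> n)\<^sup>2 * (\<Sum>a\<in>A. f a * (?p a)\<^sup>2)"
    by (intro mult_left_mono op_gf_contraction op_fg_contraction; simp)+
  thus ?thesis unfolding 1 2 by (simp only: distrib_right distrib_left mult_1)
qed

lemma riesz_energy:
  assumes "\<And>j. j < n \<Longrightarrow> \<epsilon> j * \<epsilon> j = (1::real)"
  shows "(\<Sum>a\<in>A. f a * (fst (riesz \<epsilon> x n) a)\<^sup>2) + (\<Sum>c\<in>A. g c * (snd (riesz \<epsilon> x n) c)\<^sup>2)
     \<le> exp (\<Sum>j<n. (\<mu> j)\<^sup>2) * (\<Sum>a\<in>A. f a * (x a)\<^sup>2)"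
  using assms
proof (induction n)
  case (Suc n)
  let ?E = "\<lambda>n. (\<Sum>a\<in>A. f a * (fst (riesz \<epsilon> x n) a)\<^sup>2) + (\<Sum>c\<in>A. g c * (snd (riesz \<epsilon> x n) c)\<^sup>2)"
  have "?E (Suc n) \<le> (1 + (\<mu> n)\<^sup>2) * ?E n" by (rule riesz_energy_step) (simp add: Suc.prems)
  also have "\<dots> \<le> exp ((\<mu> n)\<^sup>2) * (exp (\<Sum>j<n. (\<mu> j)\<^sup>2) * (\<Sum>a\<in>A. f a * (x a)\<^sup>2))"
    using Suc by (intro mult_mono exp_ge_add_one_self Suc.IH) (auto intro!: sum_nonneg add_nonneg_nonneg simp: f0 g0)
  also have "\<dots> = exp (\<Sum>j<Suc n. (\<mu> j)\<^sup>2) * (\<Sum>a\<in>A. f a * (x a)\<^sup>2)"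
    by (simp add: exp_add mult_ac)
  finally show ?case .
qed simp

lemma op_fg_sum: "op_fg j (\<lambda>a. \<Sum>k\<in>S. t k * X k a) c = (\<Sum>k\<in>S. t k * op_fg j (X k) c)"
proof -
  have "(\<Sum>a\<in>A. b j a c * (\<Sum>k\<in>S. t k * X k a)) = (\<Sum>k\<in>S. t k * (\<Sum>a\<in>A. b j a c * X k a))"
    unfolding sum_distrib_left by (subst sum.swap) (simp add: mult_ac)
  thus ?thesis by (simp add: op_fg_def sum_divide_distrib[where A = S])
qed

lemma op_gf_sum: "op_gf j (\<lambda>a. \<Sum>k\<in>S. t k * X k a) c = (\<Sum>k\<in>S. t k * op_gf j (X k) c)"
proof -
  have "(\<Sum>a\<in>A. b j c a * (\<Sum>k\<in>S. t k * X k a)) = (\<Sum>k\<in>S. t k * (\<Sum>a\<in>A. b j c a * X k a))"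
    unfolding sum_distrib_left by (subst sum.swap) (simp add: mult_ac)
  thus ?thesis by (simp add: op_gf_def sum_divide_distrib[where A = S])
qed

lemma riesz_sum:
  "riesz \<epsilon> (\<lambda>a. \<Sum>k\<in>S. t k * X k a) n =
    (\<lambda>a. \<Sum>k\<in>S. t k * fst (riesz \<epsilon> (X k) n) a, \<lambda>c. \<Sum>k\<in>S. t k * snd (riesz \<epsilon> (X k) n) c)"
proof (induction n)
  case (Suc n)
  show ?case
    by (simp add: Suc op_fg_sum op_gf_sum sum_distrib_left algebra_simps sum.distrib sum_subtractf)
qed simp

lemma riesz_cong: "(\<And>j. j < n \<Longrightarrow> \<epsilon> j = \<delta> j) \<Longrightarrow> riesz \<epsilon> x n = riesz \<delta> x n"
  by (induction n) auto

lemma riesz_upd: "riesz (\<epsilon>(n := s)) x n = riesz \<epsilon> x n"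
  by (rule riesz_cong) simp

lemma sign_avg_op_fg: "sign_avg n (\<lambda>\<epsilon>. op_fg j (p \<epsilon>) c) = op_fg j (\<lambda>a. sign_avg n (\<lambda>\<epsilon>. p \<epsilon> a)) c"
proof (cases "g c = 0")
  case False
  hence "op_fg j h c = (\<Sum>a\<in>A. (b j a c / g c) * h a)" for h
    by (simp add: op_fg_def sum_divide_distrib)
  thus ?thesis by (simp only: sign_avg_sum sign_avg_cmult)
qed (simp add: op_fg_def)

lemma riesz_mean: "sign_avg n (\<lambda>\<epsilon>. fst (riesz \<epsilon> x n) a) = x a"
  by (induction n) (simp_all add: sign_avg_0 sign_avg_Suc riesz_upd)

text \<open>Updates after step j vanish in the mean, as each carries its own sign. At step j the
  sign cancels against \<open>\<epsilon> j\<close>, and what remains is \<open>op_fg\<close> of the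
  first component, whose mean is x by \<open>riesz_mean\<close>.\<close>

lemma riesz_coefficient:
  "j < n \<Longrightarrow> sign_avg n (\<lambda>\<epsilon>. \<epsilon> j * snd (riesz \<epsilon> x n) c) = \<mu> j * op_fg j x c"
proof (induction n)
  case (Suc n)
  show ?case
  proof (cases "j = n")
    case True
    have "sign_avg (Suc n) (\<lambda>\<epsilon>. \<epsilon> j * snd (riesz \<epsilon> x (Suc n)) c)
        = sign_avg n (\<lambda>\<epsilon>. \<mu> n * op_fg n (fst (riesz \<epsilon> x n)) c)"
      by (simp add: True sign_avg_Suc riesz_upd)
    also have "\<dots> = \<mu> n * op_fg n x c"
      by (simp add: sign_avg_cmult sign_avg_op_fg riesz_mean)
    finally show ?thesis by (simp add: True)
  next
    case False
    hence "j < n" using Suc.prems by simp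
    have "sign_avg (Suc n) (\<lambda>\<epsilon>. \<epsilon> j * snd (riesz \<epsilon> x (Suc n)) c)
        = sign_avg n (\<lambda>\<epsilon>. \<epsilon> j * snd (riesz \<epsilon> x n) c)"
      using False by (simp add: sign_avg_Suc riesz_upd algebra_simps)
    thus ?thesis using Suc.IH[OF \<open>j < n\<close>] by simp
  qed
qed simp

text \<open>The matrix of the map from x to the second component, paired with y in L2(g). The
  product is linear in its start (\<open>riesz_sum\<close>), so unit vectors determine the
  form.\<close>

definition riesz_form :: "nat \<Rightarrow> (nat \<Rightarrow> real) \<Rightarrow> 'i \<Rightarrow> 'i \<Rightarrow> real" where
  "riesz_form n \<epsilon> a c = g c * snd (riesz \<epsilon> (\<lambda>i. if i = a then 1 else 0) n) c"

lemma riesz_form_apply: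
  "(\<Sum>a\<in>A. \<Sum>c\<in>A. riesz_form n \<epsilon> a c * (x a * y c)) = (\<Sum>c\<in>A. g c * snd (riesz \<epsilon> (\<lambda>i. if i \<in> A then x i else 0) n) c * y c)"
proof -
  have "(\<lambda>i. if i \<in> A then x i else 0) = (\<lambda>i. \<Sum>a\<in>A. x a * (if i = a then 1 else 0))"
    using fin by (simp add: if_distrib[of "(*) _"] cong: if_cong)
  hence "snd (riesz \<epsilon> (\<lambda>i. if i \<in> A then x i else 0) n) c
      = (\<Sum>a\<in>A. x a * snd (riesz \<epsilon> (\<lambda>i. if i = a then 1 else 0) n) c)" for c
    by (simp add: riesz_sum)
  thus ?thesis by (subst sum.swap) (simp add: riesz_form_def sum_distrib_left sum_distrib_right mult_ac)
qed

text \<open>The squared norm grows at most by the factor exp 1 along the product; Cauchy-Schwarz in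
  L2(g) leaves its root exp (1/2).\<close>

lemma riesz_form_bound:
  assumes "\<And>j. j < n \<Longrightarrow> \<epsilon> j * \<epsilon> j = 1" "(\<Sum>j<n. (\<mu> j)\<^sup>2) \<le> 1"
  shows "(\<Sum>a\<in>A. \<Sum>c\<in>A. riesz_form n \<epsilon> a c * (x a * y c))
    \<le> exp (1/2) * (sqrt (\<Sum>a\<in>A. f a * (x a)\<^sup>2) * sqrt (\<Sum>c\<in>A. g c * (y c)\<^sup>2))"
proof -
  let ?x = "\<lambda>i. if i \<in> A then x i else 0"
  let ?s = "snd (riesz \<epsilon> ?x n)"
  have "(\<Sum>c\<in>A. g c * (?s c)\<^sup>2) \<le> (\<Sum>a\<in>A. f a * (fst (riesz \<epsilon> ?x n) a)\<^sup>2) + (\<Sum>c\<in>A. g c * (?s c)\<^sup>2)"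
    by (simp add: sum_nonneg f0)
  also have "\<dots> \<le> exp (\<Sum>j<n. (\<mu> j)\<^sup>2) * (\<Sum>a\<in>A. f a * (?x a)\<^sup>2)"
    by (rule riesz_energy[OF assms(1)])
  also have "\<dots> \<le> exp 1 * (\<Sum>a\<in>A. f a * (x a)\<^sup>2)"
    using assms(2) by (intro mult_mono) (auto intro!: sum_nonneg simp: f0)
  finally have "sqrt (\<Sum>c\<in>A. g c * (?s c)\<^sup>2) \<le> sqrt (exp 1) * sqrt (\<Sum>a\<in>A. f a * (x a)\<^sup>2)"
    by (simp flip: real_sqrt_mult)
  moreover have "sqrt (exp 1) = exp (1/2 :: real)"
    by (rule real_sqrt_unique) (simp_all add: power2_eq_square flip: exp_add)
  ultimately have le: "sqrt (\<Sum>c\<in>A. g c * (?s c)\<^sup>2) \<le> exp (1/2) * sqrt (\<Sum>a\<in>A. f a * (x a)\<^sup>2)" by simp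
  have "(\<Sum>a\<in>A. \<Sum>c\<in>A. riesz_form n \<epsilon> a c * (x a * y c)) = (\<Sum>c\<in>A. g c * ?s c * y c)"
    by (rule riesz_form_apply)
  also have "\<dots> \<le> (\<Sum>c\<in>A. \<bar>sqrt (g c) * ?s c\<bar> * \<bar>sqrt (g c) * y c\<bar>)"
  proof (rule sum_mono)
    fix c
    have "g c * ?s c * y c = (sqrt (g c) * sqrt (g c)) * ?s c * y c" using g0[of c] by simp
    also have "\<dots> = (sqrt (g c) * ?s c) * (sqrt (g c) * y c)" by (simp only: mult_ac)
    also have "\<dots> \<le> \<bar>sqrt (g c) * ?s c\<bar> * \<bar>sqrt (g c) * y c\<bar>" unfolding abs_mult[symmetric] by simp
    finally show "g c * ?s c * y c \<le> \<bar>sqrt (g c) * ?s c\<bar> * \<bar>sqrt (g c) * y c\<bar>" .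
  qed
  also have "\<dots> \<le> sqrt (\<Sum>c\<in>A. g c * (?s c)\<^sup>2) * sqrt (\<Sum>c\<in>A. g c * (y c)\<^sup>2)"
    using L2_set_mult_ineq[of "\<lambda>c. sqrt (g c) * ?s c" "\<lambda>c. sqrt (g c) * y c" A]
    by (simp add: L2_set_def power_mult_distrib g0)
  also have "\<dots> \<le> (exp (1/2) * sqrt (\<Sum>a\<in>A. f a * (x a)\<^sup>2)) * sqrt (\<Sum>c\<in>A. g c * (y c)\<^sup>2)"
    by (intro mult_right_mono le) (simp add: sum_nonneg g0)
  finally show ?thesis by (simp add: mult.assoc)
qed

lemma riesz_form_coefficient:
  assumes "j < n" "a \<in> A" "c \<in> A"
  shows "sign_avg n (\<lambda>\<epsilon>. \<epsilon> j * riesz_form n \<epsilon> a c) = \<mu> j * b j a c"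
proof -
  have "sign_avg n (\<lambda>\<epsilon>. \<epsilon> j * riesz_form n \<epsilon> a c) = g c * (\<mu> j * op_fg j (\<lambda>i. if i = a then 1 else 0) c)"
    unfolding riesz_coefficient[OF assms(1), symmetric] sign_avg_cmult[symmetric]
    by (simp add: riesz_form_def mult_ac)
  also have "\<dots> = \<mu> j * b j a c"
    using assms fin form_zero_g[of a c j]
    by (simp add: op_fg_def if_distrib[of "(*) _"] cong: if_cong)
  finally show ?thesis .
qed

end

section \<open>Cotype of the projective tensor square\<close>

text \<open>The choice t = (q / p)^(1/4) turns the arithmetic mean into the geometric one. The shift
  by e avoids p = 0 and q = 0 and is sent to 0 at the end.\<close>

lemma le_sqrt_mult_of_scaling:
  fixes B p q :: real
  assumes "0 \<le> p" "0 \<le> q" "\<And>t. t > 0 \<Longrightarrow> B \<le> (t\<^sup>2 * p + q / t\<^sup>2) / 2"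
  shows "B \<le> sqrt p * sqrt q"
proof -
  have "B \<le> sqrt (p + e) * sqrt (q + e)" if "e > 0" for e
  proof -
    define t where "t = sqrt (sqrt (q + e) / sqrt (p + e))"
    have pos: "p + e > 0" "q + e > 0" using assms that by auto
    hence t: "t > 0" "t\<^sup>2 = sqrt (q + e) / sqrt (p + e)" by (auto simp: t_def)
    have "B \<le> (t\<^sup>2 * p + q / t\<^sup>2) / 2" by (rule assms(3)[OF t(1)])
    also have "\<dots> \<le> (t\<^sup>2 * (p + e) + (q + e) / t\<^sup>2) / 2"
      using that t(1) by (intro divide_right_mono add_mono mult_left_mono) auto
    also have "t\<^sup>2 * (p + e) = sqrt (q + e) * ((p + e) / sqrt (p + e))"
      unfolding t(2) by simp
    also have "(p + e) / sqrt (p + e) = sqrt (p + e)" using pos by (simp add: real_div_sqrt)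
    also have "(q + e) / t\<^sup>2 = ((q + e) / sqrt (q + e)) * sqrt (p + e)"
      unfolding t(2) by simp
    also have "(q + e) / sqrt (q + e) = sqrt (q + e)" using pos by (simp add: real_div_sqrt)
    finally show ?thesis by (simp add: mult.commute)
  qed
  hence ev: "\<forall>\<^sub>F e in at_right 0. B \<le> sqrt (p + e) * sqrt (q + e)"
    by (simp add: eventually_at_right_less eventually_at_filter)
  have "((\<lambda>e. sqrt (p + e) * sqrt (q + e)) \<longlongrightarrow> sqrt (p + 0) * sqrt (q + 0)) (at_right 0)"
    by (intro tendsto_intros)
  from tendsto_lowerbound[OF this ev] show ?thesis by simp
qed

text \<open>The exponent comes from two constraints on the weights: the mixed weight functions stay
  in the ball of l_3 if \<Sum> \<lambda>^3 \<le> 1, and the Riesz product stays bounded if \<Sum>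
  \<mu>^2 \<le> 1. Since 1/3 + 1/2 + 1/6 = 1, the largest value of \<Sum> \<lambda> \<mu> r is the
  l_6 norm of r, attained at \<lambda> = \<rho>^2 and \<mu> = \<rho>^3. The numbers r and R stand
  for lower and upper estimates of norms, so infima need not be attained.\<close>

theorem proj_le_cotype_6:
  assumes fin: "finite A"
    and lower: "\<And>i s. i < n \<Longrightarrow> proj_le A (z i) s \<Longrightarrow> r i \<le> s"
    and r0: "\<And>i. i < n \<Longrightarrow> 0 \<le> r i"
    and upper: "\<And>\<epsilon>. \<epsilon> \<in> signs n \<Longrightarrow> proj_le A (\<lambda>a c. \<Sum>i<n. \<epsilon> i * z i a c) (R \<epsilon>)"
  shows "root 6 (\<Sum>i<n. r i ^ 6) \<le> 97 * exp (1/2) * sign_avg n R"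
proof (cases "(\<Sum>i<n. r i ^ 6) = 0")
  case True
  have "0 \<le> R \<epsilon>" if \<epsilon>: "\<epsilon> \<in> signs n" for \<epsilon>
  proof -
    obtain K :: nat and x y :: "nat \<Rightarrow> 'a \<Rightarrow> real" where "(\<Sum>k<K. norm3 A (x k) * norm3 A (y k)) \<le> R \<epsilon>"
      using upper[OF \<epsilon>] unfolding proj_le_def by blast
    moreover have "0 \<le> (\<Sum>k<K. norm3 A (x k) * norm3 A (y k))" by (simp add: sum_nonneg)
    ultimately show ?thesis by linarith
  qed
  hence "0 \<le> sign_avg n R" by (rule sign_avg_nonneg)
  thus ?thesis using True by simp
next
  case False
  define T where "T = root 6 (\<Sum>i<n. r i ^ 6)"
  have "0 \<le> (\<Sum>i<n. r i ^ 6)" by (intro sum_nonneg) simp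
  hence T: "T > 0" "T ^ 6 = (\<Sum>i<n. r i ^ 6)" using False by (auto simp: T_def)
  define \<rho> where "\<rho> = (\<lambda>i. if i < n then r i / T else 0)"
  have \<rho>0: "0 \<le> \<rho> i" for i using r0 T by (simp add: \<rho>_def)
  have "(\<Sum>i<n. \<rho> i ^ 6) = (\<Sum>i<n. r i ^ 6) / T ^ 6"
    by (simp add: \<rho>_def power_divide sum_divide_distrib)
  also have "\<dots> = 1" unfolding T(2) using False by simp
  finally have \<rho>6: "(\<Sum>i<n. \<rho> i ^ 6) = 1" .
  define dom :: "nat \<Rightarrow> ('a \<Rightarrow> 'a \<Rightarrow> real) \<times> ('a \<Rightarrow> real) \<times> ('a \<Rightarrow> real) \<Rightarrow> bool" where
    "dom = (\<lambda>i w. (\<forall>a. 0 \<le> fst (snd w) a) \<and> (\<forall>a. 0 \<le> snd (snd w) a) \<and>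
      norm3 A (fst (snd w)) \<le> 1 \<and> norm3 A (snd (snd w)) \<le> 1 \<and>
      (\<forall>x y. (\<Sum>a\<in>A. \<Sum>b\<in>A. fst w a b * x a * y b)
        \<le> ((\<Sum>a\<in>A. fst (snd w) a * (x a)\<^sup>2) + (\<Sum>b\<in>A. snd (snd w) b * (y b)\<^sup>2)) / 2) \<and>
      (\<forall>s. (\<Sum>a\<in>A. \<Sum>b\<in>A. fst w a b * z i a b) < s \<longrightarrow> proj_le A (z i) (97 * s)))"
  have "\<exists>w. dom i w" for i
  proof (rule dominated_bilinear_form[OF fin, of "z i"])
    fix B f g
    assume "\<And>a. 0 \<le> f a" "\<And>a. 0 \<le> g a" "norm3 A f \<le> 1" "norm3 A g \<le> 1"
      "\<And>x y. (\<Sum>a\<in>A. \<Sum>b\<in>A. B a b * x a * y b) \<le> ((\<Sum>a\<in>A. f a * (x a)\<^sup>2) + (\<Sum>b\<in>A. g b * (y b)\<^sup>2)) / 2"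
      "\<And>s. (\<Sum>a\<in>A. \<Sum>b\<in>A. B a b * z i a b) < s \<Longrightarrow> proj_le A (z i) (97 * s)"
    hence "dom i (B, f, g)" unfolding dom_def fst_conv snd_conv by (intro conjI allI impI)
    thus ?thesis ..
  qed
  then obtain W where W: "\<And>i. dom i (W i)" by metis
  define B where "B = (\<lambda>i. fst (W i))"
  define F where "F = (\<lambda>i. fst (snd (W i)))"
  define G where "G = (\<lambda>i. snd (snd (W i)))"
  have BFG: "\<And>i a. 0 \<le> F i a" "\<And>i a. 0 \<le> G i a"
    "\<And>i. norm3 A (F i) \<le> 1" "\<And>i. norm3 A (G i) \<le> 1"
    "\<And>i x y. (\<Sum>a\<in>A. \<Sum>b\<in>A. B i a b * x a * y b) \<le> ((\<Sum>a\<in>A. F i a * (x a)\<^sup>2) + (\<Sum>b\<in>A. G i b * (y b)\<^sup>2)) / 2"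
    "\<And>i s. (\<Sum>a\<in>A. \<Sum>b\<in>A. B i a b * z i a b) < s \<Longrightarrow> proj_le A (z i) (97 * s)"
    using W unfolding dom_def B_def F_def G_def by blast+
  \<comment> \<open>The cubic sum dominates each single term, and by \<open>\<rho>6\<close> it stays
    in the unit ball: its cubes add up to \<Sum> \<rho>^6 times the cubed norms of the F i.\<close>
  define mix where "mix = (\<lambda>(F :: nat \<Rightarrow> 'a \<Rightarrow> real) a. root 3 (\<Sum>i<n. ((\<rho> i)\<^sup>2 * F i a) ^ 3))"
  have mix0: "0 \<le> mix F a" if "\<And>i a. 0 \<le> F i a" for F a
    unfolding mix_def by (intro real_root_ge_zero sum_nonneg) (simp add: that)
  have mix_ge: "(\<rho> i)\<^sup>2 * F i a \<le> mix F a" if "\<And>i a. 0 \<le> F i a" for F i a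
  proof (cases "i < n")
    case True
    have "((\<rho> i)\<^sup>2 * F i a) ^ 3 \<le> (\<Sum>i<n. ((\<rho> i)\<^sup>2 * F i a) ^ 3)"
      by (rule member_le_sum[of i "{..<n}" "\<lambda>i. ((\<rho> i)\<^sup>2 * F i a) ^ 3"]) (simp_all add: that True)
    also have "\<dots> = mix F a ^ 3" unfolding mix_def by (simp add: sum_nonneg that)
    finally show ?thesis by (rule cube_leD) (rule mix0[OF that])
  next
    case False
    thus ?thesis using mix0[OF that] by (simp add: \<rho>_def)
  qed
  have mix_norm: "norm3 A (mix F) \<le> 1" if F: "\<And>i a. 0 \<le> F i a" "\<And>i. norm3 A (F i) \<le> 1" for F
  proof -
    have "norm3 A (mix F) ^ 3 = (\<Sum>a\<in>A. mix F a ^ 3)" by (simp add: norm3_cube mix0[OF F(1)])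
    also have "\<dots> = (\<Sum>a\<in>A. \<Sum>i<n. ((\<rho> i)\<^sup>2 * F i a) ^ 3)"
      unfolding mix_def by (simp add: sum_nonneg F)
    also have "\<dots> = (\<Sum>i<n. \<rho> i ^ 6 * norm3 A (F i) ^ 3)"
      by (subst sum.swap) (simp add: norm3_cube F power_mult_distrib sum_distrib_left flip: power_mult)
    also have "\<dots> \<le> (\<Sum>i<n. \<rho> i ^ 6 * 1)"
      by (intro sum_mono mult_left_mono power_le_one F) simp_all
    also have "\<dots> = 1" using \<rho>6 by simp
    finally show ?thesis using cube_leD[of "norm3 A (mix F)" 1] by simp
  qed
  define f where "f = mix F"
  define g where "g = mix G"
  have bound: "\<bar>\<Sum>a\<in>A. \<Sum>c\<in>A. (\<rho> j)\<^sup>2 * B j a c * x a * y c\<bar>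
      \<le> sqrt (\<Sum>a\<in>A. f a * (x a)\<^sup>2) * sqrt (\<Sum>c\<in>A. g c * (y c)\<^sup>2)" for j x y
  proof -
    let ?p = "\<lambda>x. \<Sum>a\<in>A. F j a * (x a)\<^sup>2" and ?q = "\<Sum>c\<in>A. G j c * (y c)\<^sup>2"
    let ?B = "\<lambda>x. \<Sum>a\<in>A. \<Sum>c\<in>A. B j a c * x a * y c"
    have p0: "0 \<le> ?p x" for x by (intro sum_nonneg) (simp add: BFG)
    have q0: "0 \<le> ?q" by (intro sum_nonneg) (simp add: BFG)
    have B1: "?B x \<le> sqrt (?p x) * sqrt ?q" for x
    proof (rule le_sqrt_mult_of_scaling[OF p0 q0])
      fix t :: real assume t: "t > 0"
      have "?B x = (\<Sum>a\<in>A. \<Sum>c\<in>A. B j a c * (t * x a) * (y c / t))"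
        using t by (simp add: mult.assoc)
      also have "\<dots> \<le> ((\<Sum>a\<in>A. F j a * (t * x a)\<^sup>2) + (\<Sum>c\<in>A. G j c * (y c / t)\<^sup>2)) / 2"
        by (rule BFG(5))
      also have "(\<Sum>a\<in>A. F j a * (t * x a)\<^sup>2) = t\<^sup>2 * ?p x"
        by (simp add: power_mult_distrib sum_distrib_left mult_ac)
      also have "(\<Sum>c\<in>A. G j c * (y c / t)\<^sup>2) = ?q / t\<^sup>2"
        by (simp add: power_divide sum_divide_distrib)
      finally show "?B x \<le> (t\<^sup>2 * ?p x + ?q / t\<^sup>2) / 2" .
    qed
    have "\<bar>?B x\<bar> \<le> sqrt (?p x) * sqrt ?q"
      using B1[of x] B1[of "\<lambda>a. - x a"] by (simp add: sum_negf abs_le_iff)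
    hence "(\<rho> j)\<^sup>2 * \<bar>?B x\<bar> \<le> (\<rho> j)\<^sup>2 * (sqrt (?p x) * sqrt ?q)" by (rule mult_left_mono) simp
    also have "\<dots> = sqrt ((\<rho> j)\<^sup>2 * ?p x) * sqrt ((\<rho> j)\<^sup>2 * ?q)"
      using \<rho>0[of j] by (simp add: real_sqrt_mult power2_eq_square)
    also have "\<dots> \<le> sqrt (\<Sum>a\<in>A. f a * (x a)\<^sup>2) * sqrt (\<Sum>c\<in>A. g c * (y c)\<^sup>2)"
    proof (intro mult_mono real_sqrt_le_mono)
      show "(\<rho> j)\<^sup>2 * ?p x \<le> (\<Sum>a\<in>A. f a * (x a)\<^sup>2)"
        unfolding sum_distrib_left f_def mult.assoc[symmetric]
        by (intro sum_mono mult_right_mono mix_ge BFG) simp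
      show "(\<rho> j)\<^sup>2 * ?q \<le> (\<Sum>c\<in>A. g c * (y c)\<^sup>2)"
        unfolding sum_distrib_left g_def mult.assoc[symmetric]
        by (intro sum_mono mult_right_mono mix_ge BFG) simp
    qed (auto intro!: sum_nonneg simp: g_def f_def mix0 BFG q0)
    finally show ?thesis
      by (simp add: abs_mult mult.assoc flip: sum_distrib_left)
  qed
  define b where "b = (\<lambda>j a c. (\<rho> j)\<^sup>2 * B j a c)"
  define \<mu> where "\<mu> = (\<lambda>j. \<rho> j ^ 3)"
  have f0: "0 \<le> f a" and g0: "0 \<le> g a" for a by (simp_all add: f_def g_def mix0 BFG)
  have "\<bar>\<Sum>a\<in>A. \<Sum>c\<in>A. b j a c * x a * y c\<bar>
      \<le> sqrt (\<Sum>a\<in>A. f a * (x a)\<^sup>2) * sqrt (\<Sum>c\<in>A. g c * (y c)\<^sup>2)" for j x y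
    unfolding b_def by (rule bound)
  note ctx = fin f0 g0 this
  define \<Phi> where "\<Phi> = riesz_form A f g b \<mu> n"
  have \<mu>: "(\<Sum>j<n. (\<mu> j)\<^sup>2) \<le> 1" using \<rho>6 by (simp add: \<mu>_def flip: power_mult)
  have \<Phi>_le: "(\<Sum>a\<in>A. \<Sum>c\<in>A. \<Phi> \<epsilon> a c * w a c) \<le> exp (1/2) * s"
    if \<epsilon>: "\<epsilon> \<in> signs n" and w: "proj_le A w s" for \<epsilon> w s
  proof -
    obtain K x y where w: "\<And>a c. a \<in> A \<Longrightarrow> c \<in> A \<Longrightarrow> w a c = (\<Sum>k<(K::nat). x k a * y k c)"
      and s: "(\<Sum>k<K. norm3 A (x k) * norm3 A (y k)) \<le> s"
      using w unfolding proj_le_def by blast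
    have sq: "sqrt (\<Sum>a\<in>A. h a * (u a)\<^sup>2) \<le> norm3 A u" if "norm3 A h \<le> 1" for h u
    proof -
      have "(\<Sum>a\<in>A. h a * (u a)\<^sup>2) \<le> norm3 A h * (norm3 A u)\<^sup>2" by (rule weighted_square_le[OF fin])
      also have "\<dots> \<le> 1 * (norm3 A u)\<^sup>2" using that by (intro mult_right_mono) auto
      finally show ?thesis by (simp add: real_le_lsqrt)
    qed
    have "(\<Sum>a\<in>A. \<Sum>c\<in>A. \<Phi> \<epsilon> a c * w a c) = (\<Sum>a\<in>A. \<Sum>c\<in>A. \<Sum>k<K. \<Phi> \<epsilon> a c * (x k a * y k c))"
      by (simp add: w sum_distrib_left)
    also have "\<dots> = (\<Sum>k<K. \<Sum>a\<in>A. \<Sum>c\<in>A. \<Phi> \<epsilon> a c * (x k a * y k c))"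
      by (simp only: sum.swap[of _ "{..<K}"])
    also have "\<dots> \<le> (\<Sum>k<K. exp (1/2) * (norm3 A (x k) * norm3 A (y k)))"
    proof (rule sum_mono)
      fix k
      have "(\<Sum>a\<in>A. \<Sum>c\<in>A. \<Phi> \<epsilon> a c * (x k a * y k c))
          \<le> exp (1/2) * (sqrt (\<Sum>a\<in>A. f a * (x k a)\<^sup>2) * sqrt (\<Sum>c\<in>A. g c * (y k c)\<^sup>2))"
        unfolding \<Phi>_def by (rule riesz_form_bound[OF ctx _ \<mu>]) (use signs_sq[OF \<epsilon>] in simp)
      also have "\<dots> \<le> exp (1/2) * (norm3 A (x k) * norm3 A (y k))"
        by (intro mult_left_mono mult_mono sq) (auto intro!: sum_nonneg simp: f_def g_def mix_norm BFG mix0)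
      finally show "(\<Sum>a\<in>A. \<Sum>c\<in>A. \<Phi> \<epsilon> a c * (x k a * y k c)) \<le> exp (1/2) * (norm3 A (x k) * norm3 A (y k))" .
    qed
    also have "\<dots> \<le> exp (1/2) * s" using s by (simp flip: sum_distrib_left)
    finally show ?thesis .
  qed
  \<comment> \<open>Here \<rho>^6 T = \<rho>^5 r, and \<rho>^5 = \<mu> * \<rho>^2 is the coefficient
    with which the Riesz form carries B.\<close>
  have "T / 97 = (\<Sum>i<n. \<rho> i ^ 6) * T / 97" by (simp add: \<rho>6)
  also have "\<dots> = (\<Sum>i<n. \<rho> i ^ 5 * (r i / 97))"
  proof -
    have "\<rho> i ^ 6 * T / 97 = \<rho> i ^ 5 * (r i / 97)" if "i < n" for i
      using that T(1) by (simp add: \<rho>_def power_divide eval_nat_numeral)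
    thus ?thesis by (simp add: sum_distrib_right sum_divide_distrib)
  qed
  also have "\<dots> \<le> (\<Sum>i<n. \<rho> i ^ 5 * (\<Sum>a\<in>A. \<Sum>c\<in>A. B i a c * z i a c))"
  proof (intro sum_mono mult_left_mono)
    fix i assume "i \<in> {..<n}"
    show "r i / 97 \<le> (\<Sum>a\<in>A. \<Sum>c\<in>A. B i a c * z i a c)"
    proof (rule field_le_epsilon)
      fix e :: real assume "e > 0"
      hence "proj_le A (z i) (97 * ((\<Sum>a\<in>A. \<Sum>c\<in>A. B i a c * z i a c) + e))" by (intro BFG) simp
      from lower[OF _ this] \<open>i \<in> {..<n}\<close>
      show "r i / 97 \<le> (\<Sum>a\<in>A. \<Sum>c\<in>A. B i a c * z i a c) + e" by simp
    qed
  qed (simp add: \<rho>0)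
  also have "\<dots> = (\<Sum>i<n. \<Sum>a\<in>A. \<Sum>c\<in>A. sign_avg n (\<lambda>\<epsilon>. \<epsilon> i * \<Phi> \<epsilon> a c) * z i a c)"
  proof (rule sum.cong[OF refl])
    fix i assume "i \<in> {..<n}"
    hence i: "i < n" by simp
    have "\<rho> i ^ 5 * B i a c = sign_avg n (\<lambda>\<epsilon>. \<epsilon> i * \<Phi> \<epsilon> a c)" if "a \<in> A" "c \<in> A" for a c
      unfolding \<Phi>_def riesz_form_coefficient[OF ctx i that]
      by (simp add: \<mu>_def b_def flip: power_add mult.assoc)
    thus "\<rho> i ^ 5 * (\<Sum>a\<in>A. \<Sum>c\<in>A. B i a c * z i a c)
        = (\<Sum>a\<in>A. \<Sum>c\<in>A. sign_avg n (\<lambda>\<epsilon>. \<epsilon> i * \<Phi> \<epsilon> a c) * z i a c)"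
      by (simp add: sum_distrib_left mult.assoc[symmetric])
  qed
  also have "\<dots> = sign_avg n (\<lambda>\<epsilon>. \<Sum>i<n. \<Sum>a\<in>A. \<Sum>c\<in>A. \<epsilon> i * \<Phi> \<epsilon> a c * z i a c)"
    by (simp only: sign_avg_sum sign_avg_cmult_right)
  also have "\<dots> = sign_avg n (\<lambda>\<epsilon>. \<Sum>a\<in>A. \<Sum>c\<in>A. \<Phi> \<epsilon> a c * (\<Sum>i<n. \<epsilon> i * z i a c))"
  proof (rule sign_avg_cong)
    fix \<epsilon>
    have "(\<Sum>i<n. \<Sum>a\<in>A. \<Sum>c\<in>A. \<epsilon> i * \<Phi> \<epsilon> a c * z i a c) = (\<Sum>a\<in>A. \<Sum>c\<in>A. \<Sum>i<n. \<epsilon> i * \<Phi> \<epsilon> a c * z i a c)"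
      by (simp only: sum.swap[of _ _ "{..<n}"])
    thus "(\<Sum>i<n. \<Sum>a\<in>A. \<Sum>c\<in>A. \<epsilon> i * \<Phi> \<epsilon> a c * z i a c)
        = (\<Sum>a\<in>A. \<Sum>c\<in>A. \<Phi> \<epsilon> a c * (\<Sum>i<n. \<epsilon> i * z i a c))"
      by (simp add: sum_distrib_left mult_ac)
  qed
  also have "\<dots> \<le> sign_avg n (\<lambda>\<epsilon>. exp (1/2) * R \<epsilon>)"
    by (rule sign_avg_mono) (intro \<Phi>_le upper)
  also have "\<dots> = exp (1/2) * sign_avg n R" by (rule sign_avg_cmult)
  finally show ?thesis unfolding T_def[symmetric] by (simp add: divide_le_eq mult_ac)
qed

section \<open>Rademacher projections in large dimension\<close>

text \<open>The n-th finite difference kills polynomials of degree below n. One factor y + i is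
  split: the part y leaves the smaller power, and i is absorbed by the binomial coefficient, which
  lowers n and k together.\<close>

lemma alternating_binomial_power_sum:
  fixes y :: real
  assumes "k < n"
  shows "(\<Sum>i\<le>n. (-1) ^ i * real (n choose i) * (y + real i) ^ k) = 0"
  using assms
proof (induction k arbitrary: n y)
  case 0
  thus ?case using choose_alternating_sum[of n, where ?'a = real] by simp
next
  case (Suc k)
  then obtain m where n: "n = Suc m" and m: "k < m" by (cases n) auto
  have "(\<Sum>i\<le>n. (-1) ^ i * real (n choose i) * (y + real i) ^ Suc k)
      = (\<Sum>i\<le>n. y * ((-1) ^ i * real (n choose i) * (y + real i) ^ k))
        + (\<Sum>i\<le>n. (-1) ^ i * (real i * real (n choose i)) * (y + real i) ^ k)"
    by (simp add: sum.distrib[symmetric] algebra_simps)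
  also have "(\<Sum>i\<le>n. y * ((-1) ^ i * real (n choose i) * (y + real i) ^ k)) = 0"
    unfolding sum_distrib_left[symmetric] using Suc.IH[of n y] Suc.prems by simp
  also have "(\<Sum>i\<le>n. (-1) ^ i * (real i * real (n choose i)) * (y + real i) ^ k)
      = (\<Sum>i\<le>m. (-1) ^ Suc i * (real (Suc i) * real (n choose Suc i)) * (y + real (Suc i)) ^ k)"
    unfolding n sum.atMost_Suc_shift by simp
  also have "\<dots> = (\<Sum>i\<le>m. (- real n) * ((-1) ^ i * real (m choose i) * ((y + 1) + real i) ^ k))"
  proof (rule sum.cong[OF refl])
    fix i
    have "real (Suc i) * real (n choose Suc i) = real n * real (m choose i)"
      unfolding n of_nat_mult[symmetric] by (simp only: Suc_times_binomial_eq mult.commute)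
    thus "(-1) ^ Suc i * (real (Suc i) * real (n choose Suc i)) * (y + real (Suc i)) ^ k
        = (- real n) * ((-1) ^ i * real (m choose i) * ((y + 1) + real i) ^ k)"
      by (simp add: algebra_simps)
  qed
  also have "\<dots> = 0" unfolding sum_distrib_left[symmetric] using Suc.IH[OF m, of "y + 1"] by simp
  finally show ?case by simp
qed

text \<open>For 1 \<le> j \<le> d, the weights (-1)^(j+1) (d!)^2 / (j (d - j)! (d + j)!) of the
  classical central difference formula for a first derivative, in binomial form.\<close>

definition diff_coeff :: "nat \<Rightarrow> nat \<Rightarrow> real" where
  "diff_coeff d j = - ((-1) ^ j * real ((2 * d) choose (d + j)) / (real ((2 * d) choose d) * real j))"

text \<open>
  The multiplier belonging to central numerical differentiation of \<open>r \<mapsto> r\<^sup>k\<close> at \<open>0\<close> from the nodes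
  \<open>\<plusminus> j / (2d)\<close>, which is exact for polynomials of degree at most \<open>2d\<close>.
\<close>

definition diff_multiplier :: "nat \<Rightarrow> nat \<Rightarrow> real" where
  "diff_multiplier d k = 2 * real d *
     (\<Sum>j = 1..d. diff_coeff d j * ((real j / (2 * real d)) ^ k - (- (real j / (2 * real d))) ^ k))"

lemma abs_diff_coeff_le:
  assumes "1 \<le> j"
  shows "\<bar>diff_coeff d j\<bar> \<le> 1"
proof -
  have "(2 * d) choose (d + j) \<le> (2 * d) choose d"
    using binomial_maximum'[of d "d + j"] by simp
  moreover have "0 < (2 * d) choose d" by simp
  ultimately have "real ((2 * d) choose (d + j)) \<le> real ((2 * d) choose d) * 1" "0 < real ((2 * d) choose d)"
    by simp_all
  moreover have "real ((2 * d) choose d) * 1 \<le> real ((2 * d) choose d) * real j"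
    using assms by (intro mult_left_mono) auto
  ultimately have "real ((2 * d) choose (d + j)) \<le> real ((2 * d) choose d) * real j"
    "0 < real ((2 * d) choose d)" by linarith+
  thus ?thesis using assms
    by (simp add: diff_coeff_def abs_mult divide_le_eq power_abs)
qed

text \<open>The 2d-th difference of r^(k - 1), centred at 0, vanishes. As k - 1 is even, the terms
  at d + j and d - j agree, and the middle term 0^(k - 1) survives only for k = 1.\<close>

lemma diff_coeff_moment:
  assumes "odd k" "k \<le> 2 * d"
  shows "2 * (\<Sum>j = 1..d. diff_coeff d j * real j ^ k) = (if k = 1 then 1 else 0)"
proof -
  obtain l where k: "k = Suc l" and l: "even l" using assms(1) by (cases k) auto
  let ?c = "\<lambda>i. real ((2 * d) choose i)"
  have "0 = (\<Sum>i\<le>2 * d. (-1) ^ i * ?c i * (- real d + real i) ^ l)"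
    using alternating_binomial_power_sum[of l "2 * d" "- real d"] assms k by simp
  also have "{..2 * d} = {..<d} \<union> {d} \<union> {d + 1..2 * d}" by auto
  also have "(\<Sum>i\<in>{..<d} \<union> {d} \<union> {d + 1..2 * d}. (-1) ^ i * ?c i * (- real d + real i) ^ l)
     = (\<Sum>i<d. (-1) ^ i * ?c i * (- real d + real i) ^ l) + (-1) ^ d * ?c d * 0 ^ l
      + (\<Sum>i = d + 1..2 * d. (-1) ^ i * ?c i * (- real d + real i) ^ l)"
    by (subst sum.union_disjoint; (subst sum.union_disjoint)?) auto
  also have "(\<Sum>i = d + 1..2 * d. (-1) ^ i * ?c i * (- real d + real i) ^ l)
      = (\<Sum>j = 1..d. (-1) ^ (d + j) * ?c (d + j) * real j ^ l)"
    by (rule sum.reindex_bij_witness[of _ "\<lambda>j. d + j" "\<lambda>i. i - d"]) (auto simp: of_nat_diff)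
  also have "(\<Sum>i<d. (-1) ^ i * ?c i * (- real d + real i) ^ l)
      = (\<Sum>j = 1..d. (-1) ^ (d + j) * ?c (d + j) * real j ^ l)"
  proof (rule sum.reindex_bij_witness[of _ "\<lambda>j. d - j" "\<lambda>i. d - i"])
    fix i assume "i \<in> {..<d}"
    hence i: "i < d" by simp
    have "d + (d - i) = 2 * d - i" using i by simp
    hence "?c (d + (d - i)) = ?c i" using binomial_symmetric[of i "2 * d"] i by simp
    moreover have "real (d - i) ^ l = (- real d + real i) ^ l"
    proof -
      have "real (d - i) = - (- real d + real i)" using i by (simp add: of_nat_diff)
      thus ?thesis using l by (simp only: uminus_power_if if_True)
    qed
    moreover have "(-1 :: real) ^ (d + (d - i)) = (-1) ^ i"
    proof -
      have "even (d + (d - i)) \<longleftrightarrow> even i" using i by auto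
      thus ?thesis by (simp add: minus_one_power_iff)
    qed
    ultimately show "(-1) ^ (d + (d - i)) * ?c (d + (d - i)) * real (d - i) ^ l = (-1) ^ i * ?c i * (- real d + real i) ^ l"
      by simp
  qed auto
  finally have "0 = (-1) ^ d * (2 * (\<Sum>j = 1..d. (-1) ^ j * ?c (d + j) * real j ^ l) + ?c d * 0 ^ l)"
    by (simp add: power_add sum_distrib_left algebra_simps)
  hence *: "2 * (\<Sum>j = 1..d. (-1) ^ j * ?c (d + j) * real j ^ l) = - ?c d * 0 ^ l"
    by simp
  have pos: "?c d > 0" by simp
  have "(\<Sum>j = 1..d. diff_coeff d j * real j ^ k) = (\<Sum>j = 1..d. - (1 / ?c d) * ((-1) ^ j * ?c (d + j) * real j ^ l))"
    by (intro sum.cong) (auto simp: diff_coeff_def k)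
  also have "\<dots> = - (1 / ?c d) * (\<Sum>j = 1..d. (-1) ^ j * ?c (d + j) * real j ^ l)"
    by (simp only: sum_distrib_left)
  finally have "2 * (\<Sum>j = 1..d. diff_coeff d j * real j ^ k)
      = - (1 / ?c d) * (2 * (\<Sum>j = 1..d. (-1) ^ j * ?c (d + j) * real j ^ l))" by simp
  also have "\<dots> = 0 ^ l" unfolding * using pos by simp
  finally show ?thesis using k by (simp add: power_0_left)
qed

lemma diff_multiplier_low:
  assumes "1 \<le> d" "k \<le> 2 * d"
  shows "diff_multiplier d k = (if k = 1 then 1 else 0)"
proof (cases "even k")
  case True
  thus ?thesis by (auto simp: diff_multiplier_def)
next
  case False
  have "(\<Sum>j = 1..d. diff_coeff d j * ((real j / (2 * real d)) ^ k - (- (real j / (2 * real d))) ^ k))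
      = (1 / (2 * real d) ^ k) * (2 * (\<Sum>j = 1..d. diff_coeff d j * real j ^ k))"
    using False by (simp add: sum_distrib_left power_divide mult_ac)
  also have "\<dots> = (1 / (2 * real d) ^ k) * (if k = 1 then 1 else 0)"
    by (simp only: diff_coeff_moment[OF False assms(2)])
  finally show ?thesis using assms by (simp add: diff_multiplier_def)
qed

text \<open>All nodes lie in [-1/2, 1/2], so a power k \<ge> 2d is at most 4^(-d). This exponential
  gain pays for the dimension in \<open>rademacher_projection_bound\<close>.\<close>

lemma diff_multiplier_high:
  assumes "1 \<le> d" "2 * d \<le> k"
  shows "\<bar>diff_multiplier d k\<bar> \<le> 4 * real d ^ 2 / 4 ^ d"
proof -
  have "\<bar>diff_coeff d j * ((real j / (2 * real d)) ^ k - (- (real j / (2 * real d))) ^ k)\<bar> \<le> 2 / 4 ^ d"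
    if j: "j \<in> {1..d}" for j
  proof -
    have "(real j / (2 * real d)) ^ k \<le> (1 / 2) ^ k"
      using j assms by (intro power_mono) (auto simp: field_simps)
    also have "\<dots> \<le> (1 / 2) ^ (2 * d)" using assms by (intro power_decreasing) auto
    also have "\<dots> = 1 / 4 ^ d" by (simp add: power_mult power_one_over)
    finally have p: "(real j / (2 * real d)) ^ k \<le> 1 / 4 ^ d" .
    have "\<bar>(real j / (2 * real d)) ^ k - (- (real j / (2 * real d))) ^ k\<bar>
        \<le> \<bar>(real j / (2 * real d)) ^ k\<bar> + \<bar>(- (real j / (2 * real d))) ^ k\<bar>" by (rule abs_triangle_ineq4)
    also have "\<dots> = 2 * (real j / (2 * real d)) ^ k" by (simp add: power_abs)
    also have "\<dots> \<le> 2 / 4 ^ d" using p by simp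
    finally have "\<bar>diff_coeff d j\<bar> * \<bar>(real j / (2 * real d)) ^ k - (- (real j / (2 * real d))) ^ k\<bar> \<le> 1 * (2 / 4 ^ d)"
      using abs_diff_coeff_le[of j d] j by (intro mult_mono) auto
    thus ?thesis by (simp add: abs_mult)
  qed
  hence "(\<Sum>j = 1..d. \<bar>diff_coeff d j * ((real j / (2 * real d)) ^ k - (- (real j / (2 * real d))) ^ k)\<bar>)
      \<le> (\<Sum>j = 1..d. 2 / 4 ^ d)" by (intro sum_mono)
  also have "\<dots> = 2 * real d / 4 ^ d" by simp
  finally have "\<bar>\<Sum>j = 1..d. diff_coeff d j * ((real j / (2 * real d)) ^ k - (- (real j / (2 * real d))) ^ k)\<bar> \<le> 2 * real d / 4 ^ d"
    by (rule order_trans[OF sum_abs])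
  hence "2 * real d * \<bar>\<Sum>j = 1..d. diff_coeff d j * ((real j / (2 * real d)) ^ k - (- (real j / (2 * real d))) ^ k)\<bar>
      \<le> 2 * real d * (2 * real d / 4 ^ d)" by (intro mult_left_mono) auto
  thus ?thesis by (simp add: diff_multiplier_def abs_mult power2_eq_square)
qed

section \<open>Walsh functions on the sign cube\<close>

definition walsh :: "nat set \<Rightarrow> (nat \<Rightarrow> real) \<Rightarrow> real" where
  "walsh S \<epsilon> = (\<Prod>i\<in>S. \<epsilon> i)"

lemma sign_avg_prod:
  "sign_avg n (\<lambda>\<epsilon>. \<Prod>i<n. \<phi> i (\<epsilon> i)) = (\<Prod>i<n. (\<phi> i 1 + \<phi> i (-1)) / 2)"
proof (induction n)
  case (Suc n)
  have "(\<Prod>i<n. \<phi> i ((\<epsilon>(n := s)) i)) = (\<Prod>i<n. \<phi> i (\<epsilon> i))" for \<epsilon> s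
    by (rule prod.cong) auto
  hence "sign_avg (Suc n) (\<lambda>\<epsilon>. \<Prod>i<Suc n. \<phi> i (\<epsilon> i))
      = sign_avg n (\<lambda>\<epsilon>. (\<Prod>i<n. \<phi> i (\<epsilon> i)) * ((\<phi> n 1 + \<phi> n (-1)) / 2))"
    unfolding sign_avg_Suc prod.lessThan_Suc by (simp add: distrib_left add_divide_distrib)
  thus ?case unfolding sign_avg_cmult_right Suc by simp
qed (simp add: sign_avg_0)

lemma walsh_orthonormal:
  assumes "S \<subseteq> {..<n}" "T \<subseteq> {..<n}"
  shows "sign_avg n (\<lambda>\<epsilon>. walsh S \<epsilon> * walsh T \<epsilon>) = (if S = T then 1 else 0)"
proof -
  define \<phi> where "\<phi> = (\<lambda>i (s :: real). (if i \<in> S then s else 1) * (if i \<in> T then s else 1))"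
  have w: "walsh S \<epsilon> = (\<Prod>i<n. if i \<in> S then \<epsilon> i else 1)" if "S \<subseteq> {..<n}" for S \<epsilon>
    unfolding walsh_def using that by (subst prod.inter_restrict[symmetric]) (auto simp: Int_absorb1)
  have "walsh S \<epsilon> * walsh T \<epsilon> = (\<Prod>i<n. \<phi> i (\<epsilon> i))" for \<epsilon>
    unfolding w[OF assms(1)] w[OF assms(2)] \<phi>_def by (simp only: prod.distrib)
  hence "sign_avg n (\<lambda>\<epsilon>. walsh S \<epsilon> * walsh T \<epsilon>) = (\<Prod>i<n. (\<phi> i 1 + \<phi> i (-1)) / 2)"
    by (simp only: sign_avg_prod)
  also have "\<dots> = (if S = T then 1 else 0)"
  proof (cases "S = T")
    case True
    thus ?thesis by (auto simp: \<phi>_def intro!: prod.neutral)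
  next
    case False
    then obtain i where "i < n" "i \<in> S \<longleftrightarrow> i \<notin> T" using assms by blast
    hence "(\<phi> i 1 + \<phi> i (-1)) / 2 = 0" by (auto simp: \<phi>_def)
    thus ?thesis using \<open>i < n\<close> False by (auto intro!: prod_zero)
  qed
  finally show ?thesis .
qed

lemma walsh_parseval:
  "sign_avg n (\<lambda>\<epsilon>. (\<Sum>S\<in>Pow {..<n}. a S * walsh S \<epsilon>)\<^sup>2) = (\<Sum>S\<in>Pow {..<n}. (a S)\<^sup>2)"
proof -
  have "sign_avg n (\<lambda>\<epsilon>. (\<Sum>S\<in>Pow {..<n}. a S * walsh S \<epsilon>)\<^sup>2)
      = (\<Sum>S\<in>Pow {..<n}. \<Sum>T\<in>Pow {..<n}. (a S * a T) * sign_avg n (\<lambda>\<epsilon>. walsh S \<epsilon> * walsh T \<epsilon>))"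
    unfolding sign_avg_sum[symmetric] sign_avg_cmult[symmetric]
    by (simp add: power2_eq_square sum_product mult_ac)
  also have "\<dots> = (\<Sum>S\<in>Pow {..<n}. \<Sum>T\<in>Pow {..<n}. if S = T then (a S)\<^sup>2 else 0)"
    by (intro sum.cong refl) (auto simp: walsh_orthonormal power2_eq_square)
  also have "\<dots> = (\<Sum>S\<in>Pow {..<n}. (a S)\<^sup>2)" by (intro sum.cong refl) (simp add: sum.delta')
  finally show ?thesis .
qed

lemma walsh_bessel:
  "(\<Sum>S\<in>Pow {..<n}. (sign_avg n (\<lambda>x. f x * walsh S x))\<^sup>2) \<le> sign_avg n (\<lambda>x. (f x)\<^sup>2)"
proof -
  define a where "a = (\<lambda>S. sign_avg n (\<lambda>x. f x * walsh S x))"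
  let ?g = "\<lambda>x. \<Sum>S\<in>Pow {..<n}. a S * walsh S x"
  have "0 \<le> sign_avg n (\<lambda>x. (f x - ?g x)\<^sup>2)" by (rule sign_avg_nonneg) simp
  also have "(\<lambda>x. (f x - ?g x)\<^sup>2) = (\<lambda>x. (f x)\<^sup>2 - 2 * (f x * ?g x) + (?g x)\<^sup>2)"
    by (auto simp: power2_eq_square algebra_simps)
  also have "sign_avg n \<dots> = sign_avg n (\<lambda>x. (f x)\<^sup>2) - 2 * sign_avg n (\<lambda>x. f x * ?g x) + (\<Sum>S\<in>Pow {..<n}. (a S)\<^sup>2)"
    by (simp only: sign_avg_add sign_avg_diff sign_avg_cmult walsh_parseval)
  also have "sign_avg n (\<lambda>x. f x * ?g x) = (\<Sum>S\<in>Pow {..<n}. a S * sign_avg n (\<lambda>x. f x * walsh S x))"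
    unfolding sign_avg_cmult[symmetric] sign_avg_sum[symmetric] by (simp add: sum_distrib_left mult_ac)
  finally show ?thesis by (simp add: a_def power2_eq_square)
qed

section \<open>An approximate kernel of the Rademacher projection\<close>

lemma prod_one_plus_walsh:
  "(\<Prod>i<n. 1 + r * (\<epsilon> i * x i)) = (\<Sum>S\<in>Pow {..<n}. r ^ card S * (walsh S \<epsilon> * walsh S x))"
proof -
  have "(\<Prod>i<n. r * (\<epsilon> i * x i) + 1) = (\<Sum>S\<in>Pow {..<n}. (\<Prod>i\<in>S. r * (\<epsilon> i * x i)) * (\<Prod>i\<in>{..<n} - S. 1))"
    by (rule prod_add) simp
  also have "\<dots> = (\<Sum>S\<in>Pow {..<n}. r ^ card S * (walsh S \<epsilon> * walsh S x))"
    by (simp add: prod.distrib walsh_def)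
  finally show ?thesis by (simp add: add.commute)
qed

text \<open>The product with parameter r is the kernel of the noise operator, and its derivative at
  r = 0 is the kernel \<Sum> \<epsilon> i * x i of the Rademacher projection. A central difference
  formula in place of the derivative leaves a combination of 2d nonnegative kernels of mean
  1.\<close>

definition rad_kernel :: "nat \<Rightarrow> nat \<Rightarrow> (nat \<Rightarrow> real) \<Rightarrow> (nat \<Rightarrow> real) \<Rightarrow> real" where
  "rad_kernel d n \<epsilon> x = 2 * real d * (\<Sum>j = 1..d. diff_coeff d j *
     ((\<Prod>i<n. 1 + (real j / (2 * real d)) * (\<epsilon> i * x i)) - (\<Prod>i<n. 1 + (- (real j / (2 * real d))) * (\<epsilon> i * x i))))"

lemma rad_kernel_walsh:
  "rad_kernel d n \<epsilon> x = (\<Sum>S\<in>Pow {..<n}. diff_multiplier d (card S) * (walsh S \<epsilon> * walsh S x))"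
proof -
  let ?h = "\<lambda>j. real j / (2 * real d)"
  have "rad_kernel d n \<epsilon> x = 2 * real d * (\<Sum>j = 1..d. \<Sum>S\<in>Pow {..<n}.
      diff_coeff d j * (?h j ^ card S - (- ?h j) ^ card S) * (walsh S \<epsilon> * walsh S x))"
    unfolding rad_kernel_def prod_one_plus_walsh
    by (simp add: sum_subtractf[symmetric] sum_distrib_left left_diff_distrib right_diff_distrib mult.assoc)
  also have "\<dots> = 2 * real d * (\<Sum>S\<in>Pow {..<n}. (\<Sum>j = 1..d.
      diff_coeff d j * (?h j ^ card S - (- ?h j) ^ card S)) * (walsh S \<epsilon> * walsh S x))"
    by (subst sum.swap) (simp only: sum_distrib_right)
  also have "\<dots> = (\<Sum>S\<in>Pow {..<n}. diff_multiplier d (card S) * (walsh S \<epsilon> * walsh S x))"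
    unfolding diff_multiplier_def by (simp only: sum_distrib_left[where A = "Pow {..<n}"] mult.assoc)
  finally show ?thesis .
qed

text \<open>For \<bar>r\<bar> \<le> 1 each product is nonnegative with mean 1. There are 2d of them,
  each with a coefficient of modulus at most 2d.\<close>

lemma rad_kernel_mass:
  assumes "\<epsilon> \<in> signs n" "1 \<le> d"
  shows "sign_avg n (\<lambda>x. \<bar>rad_kernel d n \<epsilon> x\<bar>) \<le> 4 * real d ^ 2"
proof -
  let ?P = "\<lambda>r x. \<Prod>i<n. 1 + r * (\<epsilon> i * x i)"
  have P0: "0 \<le> ?P r x" if "\<bar>r\<bar> \<le> 1" "x \<in> signs n" for r x
  proof (rule prod_nonneg)
    fix i assume "i \<in> {..<n}"
    hence "i < n" by simp
    hence "\<epsilon> i * x i = 1 \<or> \<epsilon> i * x i = -1"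
      using signs_cases[OF assms(1)] signs_cases[OF that(2)] by fastforce
    thus "0 \<le> 1 + r * (\<epsilon> i * x i)" using that(1) by auto
  qed
  have P1: "sign_avg n (?P r) = 1" for r
    using sign_avg_prod[of n "\<lambda>i s. 1 + r * (\<epsilon> i * s)"] by simp
  have h: "\<bar>real j / (2 * real d)\<bar> \<le> 1" "\<bar>- (real j / (2 * real d))\<bar> \<le> 1" if "j \<in> {1..d}" for j
    using that assms(2) by (auto simp: field_simps)
  have "sign_avg n (\<lambda>x. \<bar>rad_kernel d n \<epsilon> x\<bar>)
      \<le> sign_avg n (\<lambda>x. 2 * real d * (\<Sum>j = 1..d. ?P (real j / (2 * real d)) x + ?P (- (real j / (2 * real d))) x))"
  proof (rule sign_avg_mono)
    fix x assume x: "x \<in> signs n"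
    have "\<bar>\<Sum>j = 1..d. diff_coeff d j * (?P (real j / (2 * real d)) x - ?P (- (real j / (2 * real d))) x)\<bar>
        \<le> (\<Sum>j = 1..d. \<bar>diff_coeff d j * (?P (real j / (2 * real d)) x - ?P (- (real j / (2 * real d))) x)\<bar>)"
      by (rule sum_abs)
    also have "\<dots> \<le> (\<Sum>j = 1..d. 1 * (?P (real j / (2 * real d)) x + ?P (- (real j / (2 * real d))) x))"
      unfolding abs_mult
    proof (intro sum_mono mult_mono abs_diff_coeff_le)
      fix j assume j: "j \<in> {1..d}"
      show "\<bar>?P (real j / (2 * real d)) x - ?P (- (real j / (2 * real d))) x\<bar>
        \<le> ?P (real j / (2 * real d)) x + ?P (- (real j / (2 * real d))) x"
        using P0[OF h(1)[OF j] x] P0[OF h(2)[OF j] x] by linarith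
    qed auto
    finally have "2 * real d * \<bar>\<Sum>j = 1..d. diff_coeff d j * (?P (real j / (2 * real d)) x - ?P (- (real j / (2 * real d))) x)\<bar>
      \<le> 2 * real d * (\<Sum>j = 1..d. ?P (real j / (2 * real d)) x + ?P (- (real j / (2 * real d))) x)"
      by (intro mult_left_mono) simp_all
    thus "\<bar>rad_kernel d n \<epsilon> x\<bar> \<le> 2 * real d * (\<Sum>j = 1..d. ?P (real j / (2 * real d)) x + ?P (- (real j / (2 * real d))) x)"
      by (simp add: rad_kernel_def abs_mult)
  qed
  also have "\<dots> = 2 * real d * (\<Sum>j = 1..d. 1 + 1)"
    by (simp only: sign_avg_cmult sign_avg_sum sign_avg_add P1)
  also have "\<dots> = 4 * real d ^ 2" by (simp add: power2_eq_square)
  finally show ?thesis .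
qed

definition rad_tail :: "nat \<Rightarrow> nat \<Rightarrow> (nat \<Rightarrow> real) \<Rightarrow> (nat \<Rightarrow> real) \<Rightarrow> real" where
  "rad_tail d n \<epsilon> x = (\<Sum>S\<in>Pow {..<n}. (if 2 * d < card S then diff_multiplier d (card S) else 0) * (walsh S \<epsilon> * walsh S x))"

text \<open>Exactness of the difference formula up to degree 2d removes all Walsh functions of these
  degrees except the Rademacher functions.\<close>

lemma rad_kernel_eq:
  assumes "1 \<le> d"
  shows "rad_kernel d n \<epsilon> x = (\<Sum>i<n. \<epsilon> i * x i) + rad_tail d n \<epsilon> x"
proof -
  have "rad_kernel d n \<epsilon> x - rad_tail d n \<epsilon> x
      = (\<Sum>S\<in>Pow {..<n}. (if card S = 1 then 1 else 0) * (walsh S \<epsilon> * walsh S x))"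
    unfolding rad_kernel_walsh rad_tail_def sum_subtractf[symmetric]
    by (intro sum.cong refl) (use assms in \<open>auto simp: diff_multiplier_low\<close>)
  also have "\<dots> = (\<Sum>S\<in>(\<lambda>i. {i}) ` {..<n}. walsh S \<epsilon> * walsh S x)"
    by (rule sum.mono_neutral_cong_right) (auto simp: card_1_singleton_iff)
  also have "\<dots> = (\<Sum>i<n. \<epsilon> i * x i)"
    by (subst sum.reindex) (auto simp: walsh_def)
  finally show ?thesis by simp
qed

text \<open>Only degrees above 2d occur, so Parseval and Bessel bound the second moment by the
  square of the largest multiplier, whatever n is.\<close>

lemma rad_tail_bound:
  assumes "1 \<le> d" "\<And>x. x \<in> signs n \<Longrightarrow> \<bar>f x\<bar> \<le> 1"
  shows "sign_avg n (\<lambda>\<epsilon>. (sign_avg n (\<lambda>x. f x * rad_tail d n \<epsilon> x))\<^sup>2) \<le> (4 * real d ^ 2 / 4 ^ d)\<^sup>2"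
proof -
  define \<eta> where "\<eta> = 4 * real d ^ 2 / 4 ^ d"
  define a where "a = (\<lambda>S. sign_avg n (\<lambda>x. f x * walsh S x))"
  define m where "m = (\<lambda>S :: nat set. if 2 * d < card S then diff_multiplier d (card S) else 0)"
  have m: "(m S)\<^sup>2 \<le> \<eta>\<^sup>2" for S
    using diff_multiplier_high[OF assms(1), of "card S"]
    by (auto simp: m_def \<eta>_def intro!: power2_le_iff_abs_le[THEN iffD2])
  have "sign_avg n (\<lambda>x. f x * rad_tail d n \<epsilon> x) = (\<Sum>S\<in>Pow {..<n}. (m S * a S) * walsh S \<epsilon>)" for \<epsilon>
  proof -
    have "(\<lambda>x. f x * rad_tail d n \<epsilon> x) = (\<lambda>x. \<Sum>S\<in>Pow {..<n}. (m S * walsh S \<epsilon>) * (f x * walsh S x))"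
      by (simp add: rad_tail_def m_def sum_distrib_left mult_ac)
    thus ?thesis by (simp only: sign_avg_sum sign_avg_cmult a_def[symmetric]) (simp add: mult_ac a_def)
  qed
  hence "sign_avg n (\<lambda>\<epsilon>. (sign_avg n (\<lambda>x. f x * rad_tail d n \<epsilon> x))\<^sup>2) = (\<Sum>S\<in>Pow {..<n}. (m S * a S)\<^sup>2)"
    by (simp only: walsh_parseval)
  also have "\<dots> \<le> (\<Sum>S\<in>Pow {..<n}. \<eta>\<^sup>2 * (a S)\<^sup>2)"
    unfolding power_mult_distrib by (intro sum_mono mult_right_mono m) simp
  also have "\<dots> = \<eta>\<^sup>2 * (\<Sum>S\<in>Pow {..<n}. (a S)\<^sup>2)" by (simp only: sum_distrib_left)
  also have "\<dots> \<le> \<eta>\<^sup>2 * sign_avg n (\<lambda>x. (f x)\<^sup>2)"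
    unfolding a_def by (intro mult_left_mono walsh_bessel) simp
  also have "\<dots> \<le> \<eta>\<^sup>2 * sign_avg n (\<lambda>_. 1)"
    by (intro mult_left_mono sign_avg_mono) (use assms(2) in \<open>auto simp: abs_square_le_1\<close>)
  finally show ?thesis by (simp add: \<eta>_def)
qed

section \<open>A matching vector code over the field with 71 elements\<close>

lemma prime_dvd_choose_prime_power:
  fixes p :: nat
  assumes "prime p" "0 < i" "i < p ^ e"
  shows "p dvd (p ^ e choose i)"
proof (rule ccontr)
  assume "\<not> p dvd (p ^ e choose i)"
  hence cop: "coprime (p ^ e) (p ^ e choose i)"
    using assms(1) by (simp add: prime_imp_coprime)
  have "i * (p ^ e choose i) = p ^ e * (p ^ e - 1 choose (i - 1))"
    using times_binomial_minus1_eq[OF assms(2), of "p ^ e"] by simp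
  hence "p ^ e dvd i * (p ^ e choose i)" by simp
  hence "p ^ e dvd i" using cop by (simp add: coprime_dvd_mult_left_iff)
  thus False using assms by (simp add: nat_dvd_not_less)
qed

text \<open>In Vandermonde's sum only the term that takes nothing from the block of size p^e
  survives modulo p.\<close>

lemma choose_add_prime_power_cong:
  fixes p :: nat
  assumes "prime p" "j < p ^ e"
  shows "[(s + p ^ e) choose j = s choose j] (mod p)"
proof -
  have "(s + p ^ e) choose j = (\<Sum>k\<le>j. (s choose k) * (p ^ e choose (j - k)))"
    by (rule vandermonde[symmetric])
  also have "[\<dots> = (\<Sum>k\<le>j. if k = j then s choose j else 0)] (mod p)"
  proof (rule cong_sum)
    fix k assume "k \<in> {..j}"
    show "[(s choose k) * (p ^ e choose (j - k)) = (if k = j then s choose j else 0)] (mod p)"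
    proof (cases "k = j")
      case False
      hence "p dvd (p ^ e choose (j - k))"
        using \<open>k \<in> {..j}\<close> assms by (intro prime_dvd_choose_prime_power) auto
      thus ?thesis using False by (simp add: cong_0_iff)
    qed simp
  qed
  finally show ?thesis by simp
qed

text \<open>By periodicity it is enough to look at t < p^e, where the coefficient is nonzero only
  for t = p^e - 1. A polynomial of degree p^e - 1 thus detects divisibility by a prime power while
  its values are taken modulo the prime; this low degree is what keeps the code short.\<close>

lemma choose_prime_power_minus_1_cong:
  fixes p :: nat
  assumes "prime p"
  shows "[t choose (p ^ e - 1) = (if p ^ e dvd t + 1 then 1 else 0)] (mod p)"
proof (induction t rule: less_induct)
  case (less t)
  have pe: "0 < p ^ e" using assms by (simp add: prime_gt_0_nat)
  show ?case
  proof (cases "t < p ^ e")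
    case True
    show ?thesis
    proof (cases "t + 1 = p ^ e")
      case True
      hence "t = p ^ e - 1" by simp
      thus ?thesis using True by simp
    next
      case False
      hence "t + 1 < p ^ e" using True by simp
      hence "\<not> p ^ e dvd t + 1" by (simp add: nat_dvd_not_less)
      thus ?thesis using \<open>t + 1 < p ^ e\<close> by (simp add: binomial_eq_0)
    qed
  next
    case False
    define s where "s = t - p ^ e"
    have t: "t = s + p ^ e" using False by (simp add: s_def)
    hence "s < t" using pe by linarith
    have "[t choose (p ^ e - 1) = s choose (p ^ e - 1)] (mod p)"
      unfolding t by (rule choose_add_prime_power_cong[OF assms]) (use pe in simp)
    also have "[s choose (p ^ e - 1) = (if p ^ e dvd s + 1 then 1 else 0)] (mod p)"
      by (rule less[OF \<open>s < t\<close>])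
    also have "p ^ e dvd s + 1 \<longleftrightarrow> p ^ e dvd t + 1"
      using dvd_add_left_iff[of "p ^ e" "p ^ e" "s + 1"] t by (simp add: algebra_simps)
    finally show ?thesis .
  qed
qed

section \<open>Subset codes and their shifts\<close>

lemma power_cong_of_exponent_cong:
  fixes x q :: int and m a b :: nat
  assumes "[x ^ m = 1] (mod q)" "[a = b] (mod m)"
  shows "[x ^ a = x ^ b] (mod q)"
proof -
  have red: "[x ^ c = x ^ (c mod m)] (mod q)" for c
  proof -
    have "x ^ c = (x ^ m) ^ (c div m) * x ^ (c mod m)"
      by (simp flip: power_mult power_add)
    also have "[\<dots> = 1 ^ (c div m) * x ^ (c mod m)] (mod q)"
      by (intro cong_mult cong_pow assms(1)) simp
    finally show ?thesis by simp
  qed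
  show ?thesis using red[of a] red[of b] assms(2) by (metis Cong.cong_def cong_sym cong_trans)
qed

text \<open>The exponent is the inner product of z with the indicator vector of the members of \<J>
  contained in A. If \<J> consists of all subsets of one size in a set containing A and B, the
  vectors of A and B have as inner product \<open>card (A \<inter> B)\<close> choose that
  size.\<close>

definition subset_weight :: "int \<Rightarrow> 'a set set \<Rightarrow> 'a set \<Rightarrow> ('a set \<Rightarrow> nat) \<Rightarrow> int" where
  "subset_weight x \<J> A z = x ^ (\<Sum>J\<in>{J\<in>\<J>. J \<subseteq> A}. z J)"

text \<open>Translation by k times the indicator vector belonging to B, modulo m. The restriction to
  \<J> stays within the extensional functions, on which the translation is injective.\<close>

definition subset_shift :: "nat \<Rightarrow> 'a set set \<Rightarrow> nat \<Rightarrow> 'a set \<Rightarrow> ('a set \<Rightarrow> nat) \<Rightarrow> 'a set \<Rightarrow> nat" where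
  "subset_shift m \<J> k B z = (\<lambda>J\<in>\<J>. (z J + (if J \<subseteq> B then k else 0)) mod m)"

text \<open>Translation multiplies the weight by x to the power k times an inner product, and that
  inner product is 0 or 1 modulo p by \<open>choose_prime_power_minus_1_cong\<close>.\<close>

lemma subset_weight_shift:
  fixes p :: nat
  assumes p: "prime p" and x: "[x ^ p = 1] (mod q)" and fin: "finite A"
    and J: "\<J> = {J. J \<subseteq> U \<and> card J = p ^ e - 1}" and A: "A \<subseteq> U" "finite U"
  shows "[subset_weight x \<J> A (subset_shift p \<J> k B z)
    = subset_weight x \<J> A z * x ^ (k * (if p ^ e dvd card (A \<inter> B) + 1 then 1 else 0))] (mod q)"
proof -
  let ?S = "{J\<in>\<J>. J \<subseteq> A}"
  have finS: "finite ?S" using fin by (auto intro: finite_subset[of _ "Pow A"])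
  have "(\<Sum>J\<in>?S. subset_shift p \<J> k B z J) = (\<Sum>J\<in>?S. (z J + (if J \<subseteq> B then k else 0)) mod p)"
    by (intro sum.cong) (auto simp: subset_shift_def)
  also have "[\<dots> = (\<Sum>J\<in>?S. z J + (if J \<subseteq> B then k else 0))] (mod p)"
    by (intro cong_sum) (simp add: Cong.cong_def)
  also have "(\<Sum>J\<in>?S. z J + (if J \<subseteq> B then k else 0)) = (\<Sum>J\<in>?S. z J) + k * (card (A \<inter> B) choose (p ^ e - 1))"
  proof -
    have "{J\<in>?S. J \<subseteq> B} = {J. J \<subseteq> A \<inter> B \<and> card J = p ^ e - 1}" using A by (auto simp: J)
    hence "card {J\<in>?S. J \<subseteq> B} = card (A \<inter> B) choose (p ^ e - 1)"
      using n_subsets[of "A \<inter> B" "p ^ e - 1"] fin by simp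
    thus ?thesis using finS by (simp add: sum.distrib sum.If_cases Int_def)
  qed
  also have "[\<dots> = (\<Sum>J\<in>?S. z J) + k * (if p ^ e dvd card (A \<inter> B) + 1 then 1 else 0)] (mod p)"
    by (intro cong_add cong_mult choose_prime_power_minus_1_cong[OF p]) simp_all
  finally show ?thesis
    unfolding subset_weight_def power_add[symmetric] by (rule power_cong_of_exponent_cong[OF x])
qed

lemma subset_shift_PiE: "0 < m \<Longrightarrow> subset_shift m \<J> k B z \<in> \<J> \<rightarrow>\<^sub>E {..<m}"
  by (auto simp: subset_shift_def)

lemma subset_shift_inj: "inj_on (subset_shift m \<J> k B) (\<J> \<rightarrow>\<^sub>E {..<m})"
proof (rule inj_onI, rule PiE_ext)
  fix z z' J assume z: "z \<in> \<J> \<rightarrow>\<^sub>E {..<m}" "z' \<in> \<J> \<rightarrow>\<^sub>E {..<m}"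
    "subset_shift m \<J> k B z = subset_shift m \<J> k B z'" and J: "J \<in> \<J>"
  have "(z J + (if J \<subseteq> B then k else 0)) mod m = (z' J + (if J \<subseteq> B then k else 0)) mod m"
    using fun_cong[OF z(3), of J] J by (simp add: subset_shift_def)
  hence "[z J + (if J \<subseteq> B then k else 0) = z' J + (if J \<subseteq> B then k else 0)] (mod m)"
    by (simp only: Cong.cong_def)
  hence "[z J = z' J] (mod m)" by (simp only: cong_add_rcancel_nat)
  thus "z J = z' J" using z(1,2) J by (auto simp: Cong.cong_def PiE_iff)
qed assumption+

text \<open>
  The numbers 5 and 32 have orders 5 and 7 modulo 71, and the polynomial \<open>5 - 6 a b + a\<^sup>2 b\<^sup>5\<close> vanishes
  modulo 71 at \<open>(a, b) = (1, 1), (5, 1), (1, 32)\<close> but equals 28 at \<open>(5, 32)\<close>. Three terms suffice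
  because \<open>(25 - 1) / (5 - 1) = 6 = (32\<^sup>5 - 1) / (32 - 1)\<close> modulo 71.
\<close>

lemma matching_vector_code:
  fixes e l :: nat
  defines "n \<equiv> l choose (35 ^ e - 1)" and "W \<equiv> 5 ^ (l choose (5 ^ e - 1)) * 7 ^ (l choose (7 ^ e - 1))"
  obtains g :: "nat \<Rightarrow> nat \<Rightarrow> int" and \<tau> \<tau>' :: "nat \<Rightarrow> nat \<Rightarrow> nat" where
    "\<And>i. i < n \<Longrightarrow> inj_on (\<tau> i) {..<W} \<and> \<tau> i ` {..<W} \<subseteq> {..<W}"
    "\<And>i. i < n \<Longrightarrow> inj_on (\<tau>' i) {..<W} \<and> \<tau>' i ` {..<W} \<subseteq> {..<W}"
    "\<And>i z. coprime (g i z) 71"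
    "\<And>i j z. i < n \<Longrightarrow> j < n \<Longrightarrow> z < W \<Longrightarrow>
      [5 * g j z - 6 * g j (\<tau> i z) + g j (\<tau>' i z) = (if j = i then 28 * g i z else 0)] (mod 71)"
proof -
  \<comment> \<open>This size is -1 modulo both 5^e and 7^e, so that
    \<open>card (A \<inter> B) + 1\<close> is divisible by both only if A = B.\<close>
  define w :: nat where "w = 35 ^ e - 1"
  define \<A> where "\<A> = {A. A \<subseteq> {..<l} \<and> card A = w}"
  define \<J>1 where "\<J>1 = {J. J \<subseteq> {..<l} \<and> card J = 5 ^ e - 1}"
  define \<J>2 where "\<J>2 = {J. J \<subseteq> {..<l} \<and> card J = 7 ^ e - 1}"
  define P where "P = (\<J>1 \<rightarrow>\<^sub>E {..<5::nat}) \<times> (\<J>2 \<rightarrow>\<^sub>E {..<7::nat})"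
  have fin: "finite \<A>" "finite \<J>1" "finite \<J>2"
    by (auto simp: \<A>_def \<J>1_def \<J>2_def intro: finite_subset[of _ "Pow {..<l}"])
  have card: "card \<A> = n" "card \<J>1 = l choose (5 ^ e - 1)" "card \<J>2 = l choose (7 ^ e - 1)"
    using n_subsets[of "{..<l}"] by (simp_all add: \<A>_def \<J>1_def \<J>2_def n_def w_def)
  have "finite P" unfolding P_def using fin by (intro finite_cartesian_product finite_PiE) auto
  moreover have "card P = W"
    unfolding P_def card_cartesian_product using fin by (simp add: card_PiE card W_def)
  ultimately obtain h where h: "bij_betw h {..<W} P"
    using ex_bij_betw_nat_finite[of P] by (auto simp: atLeast0LessThan)
  obtain en where en: "bij_betw en {..<n} \<A>"
    using ex_bij_betw_nat_finite[OF fin(1)] by (auto simp: atLeast0LessThan card)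
  define wt where "wt = (\<lambda>A (z :: (nat set \<Rightarrow> nat) \<times> (nat set \<Rightarrow> nat)). subset_weight 5 \<J>1 A (fst z) * subset_weight 32 \<J>2 A (snd z))"
  define sh where "sh = (\<lambda>k1 k2 B z. (subset_shift 5 \<J>1 k1 B (fst z), subset_shift 7 \<J>2 k2 B (snd z)))"
  define dec where "dec = the_inv_into {..<W} h"
  have dec: "h (dec p) = p" "dec p < W" if "p \<in> P" for p
    using that h f_the_inv_into_f_bij_betw[OF h] the_inv_into_into[of h "{..<W}" p "{..<W}"]
    by (auto simp: dec_def bij_betw_def)
  have dec_inj: "inj_on dec P" by (rule inj_on_inverseI[of _ h]) (rule dec)
  have hP: "h z \<in> P" if "z < W" for z using that h by (auto simp: bij_betw_def)
  have h_inj: "inj_on h {..<W}" using h by (simp add: bij_betw_def)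
  have shP: "sh k1 k2 B z \<in> P" for k1 k2 B z by (simp add: sh_def P_def subset_shift_PiE)
  have sh_inj: "inj_on (sh k1 k2 B) P" for k1 k2 B
  proof (rule inj_onI)
    fix y z assume "y \<in> P" "z \<in> P" "sh k1 k2 B y = sh k1 k2 B z"
    thus "y = z"
      using inj_onD[OF subset_shift_inj, of 5 \<J>1 k1 B "fst y" "fst z"]
        inj_onD[OF subset_shift_inj, of 7 \<J>2 k2 B "snd y" "snd z"]
      by (auto simp: sh_def P_def mem_Times_iff intro: prod_eqI)
  qed
  \<comment> \<open>The shifts by (1, 1) and (2, 5) realise the monomials a b and a^2 b^5 of the
    decoding polynomial.\<close>
  define \<tau> where "\<tau> = (\<lambda>i z. dec (sh 1 1 (en i) (h z)))"
  define \<tau>' where "\<tau>' = (\<lambda>i z. dec (sh 2 5 (en i) (h z)))"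
  define g where "g = (\<lambda>i z. wt (en i) (h z))"
  have good: "inj_on (\<lambda>z. dec (sh k1 k2 B (h z))) {..<W} \<and> (\<lambda>z. dec (sh k1 k2 B (h z))) ` {..<W} \<subseteq> {..<W}"
    for k1 k2 B
  proof
    show "inj_on (\<lambda>z. dec (sh k1 k2 B (h z))) {..<W}"
    proof (rule inj_onI)
      fix y z assume yz: "y \<in> {..<W}" "z \<in> {..<W}" "dec (sh k1 k2 B (h y)) = dec (sh k1 k2 B (h z))"
      hence "sh k1 k2 B (h y) = sh k1 k2 B (h z)" using inj_onD[OF dec_inj] shP by blast
      hence "h y = h z" using inj_onD[OF sh_inj] hP yz by blast
      thus "y = z" using inj_onD[OF h_inj] yz by blast
    qed
    show "(\<lambda>z. dec (sh k1 k2 B (h z))) ` {..<W} \<subseteq> {..<W}" by (rule image_subsetI) (simp add: dec(2)[OF shP])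
  qed
  have cong: "[5 * g j z - 6 * g j (\<tau> i z) + g j (\<tau>' i z) = (if j = i then 28 * g i z else 0)] (mod 71)"
    if ij: "i < n" "j < n" "z < W" for i j z
  proof -
    define A where "A = en j"
    define B where "B = en i"
    have AB: "A \<in> \<A>" "B \<in> \<A>" using ij en by (auto simp: A_def B_def bij_betw_def)
    have AB_iff: "A = B \<longleftrightarrow> j = i"
      using ij en by (auto simp: A_def B_def bij_betw_def dest: inj_onD)
    have A: "A \<subseteq> {..<l}" "finite A" "card A = w" and B: "B \<subseteq> {..<l}" "finite B" "card B = w"
      using AB by (auto simp: \<A>_def intro: finite_subset)
    define t where "t = card (A \<inter> B)"
    define a :: nat where "a = (if 5 ^ e dvd t + 1 then 1 else 0)"
    define b :: nat where "b = (if 7 ^ e dvd t + 1 then 1 else 0)"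
    have shift: "[wt A (sh k1 k2 B (h z)) = wt A (h z) * (5 ^ (k1 * a) * 32 ^ (k2 * b))] (mod 71)" for k1 k2
    proof -
      have "[subset_weight 5 \<J>1 A (subset_shift 5 \<J>1 k1 B (fst (h z)))
          = subset_weight 5 \<J>1 A (fst (h z)) * 5 ^ (k1 * a)] (mod 71)"
        unfolding a_def t_def
        by (rule subset_weight_shift[where U = "{..<l}"]) (use A in \<open>simp_all add: \<J>1_def Cong.cong_def\<close>)
      moreover have "[subset_weight 32 \<J>2 A (subset_shift 7 \<J>2 k2 B (snd (h z)))
          = subset_weight 32 \<J>2 A (snd (h z)) * 32 ^ (k2 * b)] (mod 71)"
        unfolding b_def t_def
        by (rule subset_weight_shift[where U = "{..<l}"]) (use A in \<open>simp_all add: \<J>2_def Cong.cong_def\<close>)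
      ultimately have "[wt A (sh k1 k2 B (h z)) = (subset_weight 5 \<J>1 A (fst (h z)) * 5 ^ (k1 * a))
          * (subset_weight 32 \<J>2 A (snd (h z)) * 32 ^ (k2 * b))] (mod 71)"
        unfolding wt_def sh_def fst_conv snd_conv by (rule cong_mult)
      thus ?thesis by (simp add: wt_def mult_ac)
    qed
    have gz: "g j z = wt A (h z)" "g j (\<tau> i z) = wt A (sh 1 1 B (h z))" "g j (\<tau>' i z) = wt A (sh 2 5 B (h z))"
      using dec(1)[OF shP] by (simp_all add: g_def \<tau>_def \<tau>'_def A_def B_def)
    have "[5 * g j z - 6 * g j (\<tau> i z) + g j (\<tau>' i z)
        = 5 * wt A (h z) - 6 * (wt A (h z) * (5 ^ (1 * a) * 32 ^ (1 * b))) + wt A (h z) * (5 ^ (2 * a) * 32 ^ (5 * b))] (mod 71)"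
      unfolding gz by (intro cong_add cong_diff cong_mult shift cong_refl)
    also have "5 * wt A (h z) - 6 * (wt A (h z) * (5 ^ (1 * a) * 32 ^ (1 * b))) + wt A (h z) * (5 ^ (2 * a) * 32 ^ (5 * b))
        = wt A (h z) * (5 - 6 * (5 ^ a * 32 ^ b) + 5 ^ (2 * a) * 32 ^ (5 * b))"
      by (simp add: algebra_simps)
    also have "[\<dots> = wt A (h z) * (if j = i then 28 else 0)] (mod 71)"
    proof (intro cong_mult cong_refl)
      show "[5 - 6 * (5 ^ a * 32 ^ b) + 5 ^ (2 * a) * 32 ^ (5 * b) = (if j = i then 28 else 0 :: int)] (mod 71)"
      proof (cases "j = i")
        case True
        hence "t = w" using AB_iff A by (simp add: t_def)
        hence t1: "t + 1 = 5 ^ e * 7 ^ e" by (simp add: w_def flip: power_mult_distrib)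
        have "5 ^ e dvd t + 1" "7 ^ e dvd t + 1" unfolding t1 by simp_all
        hence "a = 1" "b = 1" by (simp_all add: a_def b_def)
        thus ?thesis using True by (simp add: Cong.cong_def)
      next
        case False
        \<comment> \<open>Both together would make 35^e divide t + 1 by coprimality, and two sets of
          size 35^e - 1 with that large an intersection are equal.\<close>
        have "\<not> (a = 1 \<and> b = 1)"
        proof
          assume "a = 1 \<and> b = 1"
          hence "5 ^ e dvd t + 1" "7 ^ e dvd t + 1" by (auto simp: a_def b_def split: if_splits)
          moreover have "coprime (5 ^ e) (7 ^ e :: nat)"
            by (simp add: coprime_iff_gcd_eq_1 gcd_non_0_nat)
          ultimately have "5 ^ e * 7 ^ e dvd t + 1" by (intro divides_mult)
          hence "35 ^ e \<le> t + 1" by (simp add: dvd_imp_le flip: power_mult_distrib)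
          hence "w \<le> card (A \<inter> B)" by (simp add: w_def t_def)
          hence "A \<inter> B = A" "A \<inter> B = B"
            using A B card_seteq[of A "A \<inter> B"] card_seteq[of B "A \<inter> B"] by auto
          thus False using AB_iff False by auto
        qed
        hence "(a = 0 \<and> b = 0) \<or> (a = 1 \<and> b = 0) \<or> (a = 0 \<and> b = 1)"
          by (auto simp: a_def b_def)
        thus ?thesis using False by (auto simp: Cong.cong_def)
      qed
    qed
    also have "wt A (h z) * (if j = i then 28 else 0) = (if j = i then 28 * g i z else 0)"
      using AB_iff by (auto simp: g_def A_def)
    finally show ?thesis .
  qed
  have "coprime (g i z) 71" for i z
  proof -
    have "coprime (5::int) 71" "coprime (32::int) 71" by (simp_all add: coprime_iff_gcd_eq_1 gcd_non_0_int)
    thus ?thesis by (simp add: g_def wt_def subset_weight_def)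
  qed
  thus ?thesis using that[of \<tau> \<tau>' g] good cong by (simp add: \<tau>_def \<tau>'_def)
qed

section \<open>Failure of cotype for seminorms on threefold tensors\<close>

abbreviation cube :: "nat \<Rightarrow> (nat \<times> nat \<times> nat) set" where
  "cube D \<equiv> {..<D} \<times> {..<D} \<times> {..<D}"

definition tensor3 :: "(nat \<Rightarrow> real) \<Rightarrow> (nat \<Rightarrow> real) \<Rightarrow> (nat \<Rightarrow> real) \<Rightarrow> nat \<times> nat \<times> nat \<Rightarrow> real" where
  "tensor3 u v w = (\<lambda>(a, b, c). u a * v b * w c)"

text \<open>What the argument uses of a projective norm: on rank-one tensors it is at most the
  product of the norms, and it is at least what bounded trilinear forms detect. This separates the
  combinatorial part from completions of tensor products.\<close>

definition tensor3_seminorm :: "nat \<Rightarrow> ((nat \<times> nat \<times> nat \<Rightarrow> real) \<Rightarrow> real) \<Rightarrow> bool" where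
  "tensor3_seminorm D N \<longleftrightarrow>
     (\<forall>s t. N (\<lambda>p. s p + t p) \<le> N s + N t) \<and>
     (\<forall>c t. N (\<lambda>p. c * t p) = \<bar>c\<bar> * N t) \<and>
     (\<forall>u v w. N (tensor3 u v w) \<le> norm3 {..<D} u * norm3 {..<D} v * norm3 {..<D} w) \<and>
     (\<forall>T \<kappa>. (\<forall>u v w. \<bar>\<Sum>p\<in>cube D. T p * tensor3 u v w p\<bar>
         \<le> \<kappa> * (norm3 {..<D} u * norm3 {..<D} v * norm3 {..<D} w)) \<longrightarrow>
       (\<forall>t. \<bar>\<Sum>p\<in>cube D. T p * t p\<bar> \<le> \<kappa> * N t))"

lemma norm3_unit: "finite A \<Longrightarrow> a \<in> A \<Longrightarrow> norm3 A (\<lambda>i. if i = a then 1 else 0) = 1"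
proof -
  assume "finite A" "a \<in> A"
  moreover have "(\<Sum>i\<in>A. \<bar>if i = a then 1 else 0 :: real\<bar> ^ 3) = (\<Sum>i\<in>A. if i = a then 1 else 0)"
    by (intro sum.cong) auto
  ultimately show ?thesis by (simp add: norm3_def)
qed

lemma norm3_le_card: "(\<And>i. i \<in> A \<Longrightarrow> \<bar>x i\<bar> \<le> 1) \<Longrightarrow> norm3 A x \<le> root 3 (card A)"
  unfolding norm3_def using sum_bounded_above[of A "\<lambda>i. \<bar>x i\<bar> ^ 3" 1]
  by (intro real_root_le_mono) (auto simp: power_le_one)

lemma norm3_reindex_le:
  assumes "inj_on \<phi> A" "\<phi> ` A \<subseteq> B" "finite B"
  shows "norm3 A (\<lambda>z. u (\<phi> z)) \<le> norm3 B u"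
proof -
  have "(\<Sum>z\<in>A. \<bar>u (\<phi> z)\<bar> ^ 3) = (\<Sum>b\<in>\<phi> ` A. \<bar>u b\<bar> ^ 3)"
    by (simp add: sum.reindex[OF assms(1)])
  also have "\<dots> \<le> (\<Sum>b\<in>B. \<bar>u b\<bar> ^ 3)" by (intro sum_mono2 assms) auto
  finally show ?thesis unfolding norm3_def by (intro real_root_le_mono) auto
qed

context
  fixes D :: nat and N :: "(nat \<times> nat \<times> nat \<Rightarrow> real) \<Rightarrow> real"
  assumes N: "tensor3_seminorm D N"
begin

lemma N_add: "N (\<lambda>p. s p + t p) \<le> N s + N t"
  and N_scale: "N (\<lambda>p. c * t p) = \<bar>c\<bar> * N t"
  and N_tensor3: "N (tensor3 u v w) \<le> norm3 {..<D} u * norm3 {..<D} v * norm3 {..<D} w"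
  using N unfolding tensor3_seminorm_def by blast+

lemma N_functional:
  assumes "\<And>u v w. \<bar>\<Sum>p\<in>cube D. T p * tensor3 u v w p\<bar> \<le> \<kappa> * (norm3 {..<D} u * norm3 {..<D} v * norm3 {..<D} w)"
  shows "\<bar>\<Sum>p\<in>cube D. T p * t p\<bar> \<le> \<kappa> * N t"
  using N assms unfolding tensor3_seminorm_def by blast

lemma N_zero: "N (\<lambda>_. 0) = 0" using N_scale[of 0 "\<lambda>_. 0"] by simp

lemma N_nonneg: "0 \<le> N t"
  using N_add[of t "\<lambda>p. - 1 * t p"] N_scale[of "-1" t] N_zero by simp

lemma N_sum: "finite I \<Longrightarrow> N (\<lambda>p. \<Sum>i\<in>I. h i p) \<le> (\<Sum>i\<in>I. N (h i))"
proof (induction I rule: finite_induct)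
  case (insert i I)
  thus ?case using N_add[of "h i" "\<lambda>p. \<Sum>i\<in>I. h i p"] by simp
qed (simp add: N_zero)

text \<open>Unit tensors have norm at most 1. The resulting l_1 bound is crude, but it is applied
  only to a tail that is exponentially small in d.\<close>

lemma N_le_sum:
  assumes "\<And>p. p \<notin> cube D \<Longrightarrow> t p = 0"
  shows "N t \<le> (\<Sum>p\<in>cube D. \<bar>t p\<bar>)"
proof -
  define \<delta> where "\<delta> = (\<lambda>p p' :: nat \<times> nat \<times> nat. if p' = p then 1 else 0 :: real)"
  have \<delta>: "N (\<delta> p) \<le> 1" if p: "p \<in> cube D" for p
  proof -
    obtain a b c where abc: "p = (a, b, c)" by (metis prod_cases3)
    define e where "e = (\<lambda>a i :: nat. if i = a then 1 else 0 :: real)"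
    have "\<delta> p = tensor3 (e a) (e b) (e c)"
      by (rule ext) (auto simp: \<delta>_def e_def tensor3_def abc split: if_splits)
    moreover have "norm3 {..<D} (e a) = 1" "norm3 {..<D} (e b) = 1" "norm3 {..<D} (e c) = 1"
      using p abc unfolding e_def by (auto intro!: norm3_unit)
    ultimately show ?thesis using N_tensor3[of "e a" "e b" "e c"] by simp
  qed
  have "t = (\<lambda>p'. \<Sum>p\<in>cube D. t p * \<delta> p p')"
  proof
    fix p'
    have "(\<Sum>p\<in>cube D. t p * \<delta> p p') = (\<Sum>p\<in>cube D. if p = p' then t p' else 0)"
      by (intro sum.cong) (auto simp: \<delta>_def)
    also have "\<dots> = t p'" using assms[of p'] by (subst sum.delta) auto
    finally show "t p' = (\<Sum>p\<in>cube D. t p * \<delta> p p')" by simp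
  qed
  hence "N t = N (\<lambda>p'. \<Sum>p\<in>cube D. t p * \<delta> p p')" by simp
  also have "\<dots> \<le> (\<Sum>p\<in>cube D. N (\<lambda>p'. t p * \<delta> p p'))" by (rule N_sum) simp
  also have "\<dots> = (\<Sum>p\<in>cube D. \<bar>t p\<bar> * N (\<delta> p))" by (simp only: N_scale)
  also have "\<dots> \<le> (\<Sum>p\<in>cube D. \<bar>t p\<bar> * 1)" by (intro sum_mono mult_left_mono \<delta>) auto
  finally show ?thesis by simp
qed

lemma N_sign_avg: "N (\<lambda>p. sign_avg n (\<lambda>x. k x * f x p)) \<le> sign_avg n (\<lambda>x. \<bar>k x\<bar> * N (f x))"
proof -
  have "N (\<lambda>p. sign_avg n (\<lambda>x. k x * f x p)) = N (\<lambda>p. \<Sum>x\<in>signs n. (k x / 2 ^ n) * f x p)"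
    by (simp add: sign_avg_def sum_divide_distrib)
  also have "\<dots> \<le> (\<Sum>x\<in>signs n. N (\<lambda>p. (k x / 2 ^ n) * f x p))" by (rule N_sum) simp
  also have "\<dots> = (\<Sum>x\<in>signs n. \<bar>k x / 2 ^ n\<bar> * N (f x))" by (simp only: N_scale)
  also have "\<dots> = sign_avg n (\<lambda>x. \<bar>k x\<bar> * N (f x))" by (simp add: sign_avg_def sum_divide_distrib)
  finally show ?thesis .
qed

text \<open>The signed sum is the average of f against \<open>rad_kernel\<close>, minus a tail. The
  kernel has L1 mass at most 4 d^2. The tail is bounded coordinate by coordinate: there are D^3 of
  them, each with second moment at most \<eta>^2, and D^3 \<le> 4^d gives D^3 * \<eta> \<le> 4 d^2.
  So d of order log D is enough, and the loss d^2 is affordable by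
  \<open>choose_growth\<close>.\<close>

lemma rademacher_projection_bound:
  assumes d: "1 \<le> d" and M: "1 \<le> M" and D: "real D ^ 3 \<le> 4 ^ d"
    and f1: "\<And>x p. x \<in> signs n \<Longrightarrow> \<bar>f x p\<bar> \<le> 1"
    and f0: "\<And>x p. p \<notin> cube D \<Longrightarrow> f x p = 0"
    and fM: "\<And>x. x \<in> signs n \<Longrightarrow> N (f x) \<le> M"
  shows "sqrt (sign_avg n (\<lambda>\<epsilon>. (N (\<lambda>p. \<Sum>i<n. \<epsilon> i * sign_avg n (\<lambda>x. x i * f x p)))\<^sup>2)) \<le> 8 * real d ^ 2 * M"
proof -
  define \<eta> where "\<eta> = 4 * real d ^ 2 / 4 ^ d"
  define tl where "tl = (\<lambda>\<epsilon> p. sign_avg n (\<lambda>x. f x p * rad_tail d n \<epsilon> x))"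
  define L where "L = (\<lambda>\<epsilon> p. \<Sum>i<n. \<epsilon> i * sign_avg n (\<lambda>x. x i * f x p))"
  have tail: "N (tl \<epsilon>) \<le> (\<Sum>p\<in>cube D. \<bar>tl \<epsilon> p\<bar>)" for \<epsilon>
    by (rule N_le_sum) (simp add: tl_def f0)
  have decomp: "L \<epsilon> p = sign_avg n (\<lambda>x. rad_kernel d n \<epsilon> x * f x p) + - 1 * tl \<epsilon> p" for \<epsilon> p
  proof -
    have "L \<epsilon> p = sign_avg n (\<lambda>x. (\<Sum>i<n. \<epsilon> i * x i) * f x p)"
      unfolding L_def sign_avg_cmult[symmetric] sign_avg_sum[symmetric] by (simp add: sum_distrib_right mult.assoc)
    also have "(\<lambda>x. (\<Sum>i<n. \<epsilon> i * x i) * f x p) = (\<lambda>x. rad_kernel d n \<epsilon> x * f x p - f x p * rad_tail d n \<epsilon> x)"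
      by (simp add: rad_kernel_eq[OF d] algebra_simps)
    finally show ?thesis by (simp add: sign_avg_diff tl_def)
  qed
  have main: "N (\<lambda>p. sign_avg n (\<lambda>x. rad_kernel d n \<epsilon> x * f x p)) \<le> 4 * real d ^ 2 * M" if "\<epsilon> \<in> signs n" for \<epsilon>
  proof -
    have "N (\<lambda>p. sign_avg n (\<lambda>x. rad_kernel d n \<epsilon> x * f x p)) \<le> sign_avg n (\<lambda>x. \<bar>rad_kernel d n \<epsilon> x\<bar> * N (f x))"
      by (rule N_sign_avg)
    also have "\<dots> \<le> sign_avg n (\<lambda>x. \<bar>rad_kernel d n \<epsilon> x\<bar> * M)"
      by (intro sign_avg_mono mult_left_mono fM) auto
    also have "\<dots> \<le> 4 * real d ^ 2 * M"
      unfolding sign_avg_cmult_right using M by (intro mult_right_mono rad_kernel_mass[OF that d]) auto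
    finally show ?thesis .
  qed
  have bnd: "(N (L \<epsilon>))\<^sup>2 \<le> 2 * (4 * real d ^ 2 * M)\<^sup>2 + 2 * (real (card (cube D)) * (\<Sum>p\<in>cube D. (tl \<epsilon> p)\<^sup>2))"
    if \<epsilon>: "\<epsilon> \<in> signs n" for \<epsilon>
  proof -
    have "N (L \<epsilon>) = N (\<lambda>p. sign_avg n (\<lambda>x. rad_kernel d n \<epsilon> x * f x p) + - 1 * tl \<epsilon> p)"
      by (rule arg_cong[where f = N], rule ext, rule decomp)
    also have "\<dots> \<le> N (\<lambda>p. sign_avg n (\<lambda>x. rad_kernel d n \<epsilon> x * f x p)) + N (tl \<epsilon>)"
      using N_add[of "\<lambda>p. sign_avg n (\<lambda>x. rad_kernel d n \<epsilon> x * f x p)" "\<lambda>p. - 1 * tl \<epsilon> p"] N_scale[of "-1" "tl \<epsilon>"]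
      by simp
    also have "\<dots> \<le> 4 * real d ^ 2 * M + (\<Sum>p\<in>cube D. \<bar>tl \<epsilon> p\<bar>)"
      by (intro add_mono main[OF \<epsilon>] tail)
    finally have "(N (L \<epsilon>))\<^sup>2 \<le> (4 * real d ^ 2 * M + (\<Sum>p\<in>cube D. \<bar>tl \<epsilon> p\<bar>))\<^sup>2"
      by (rule power_mono) (rule N_nonneg)
    also have "\<dots> \<le> 2 * (4 * real d ^ 2 * M)\<^sup>2 + 2 * (\<Sum>p\<in>cube D. \<bar>tl \<epsilon> p\<bar>)\<^sup>2"
      using sum_squares_bound[of "4 * real d ^ 2 * M" "\<Sum>p\<in>cube D. \<bar>tl \<epsilon> p\<bar>"] by (simp add: power2_sum)
    also have "(\<Sum>p\<in>cube D. \<bar>tl \<epsilon> p\<bar>)\<^sup>2 \<le> real (card (cube D)) * (\<Sum>p\<in>cube D. (tl \<epsilon> p)\<^sup>2)"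
      using Cauchy_Schwarz_ineq_sum[of "\<lambda>_. 1" "\<lambda>p. \<bar>tl \<epsilon> p\<bar>" "cube D"] by simp
    finally show ?thesis by simp
  qed
  have cardD: "real (card (cube D)) = real D ^ 3"
    by (simp add: card_cartesian_product power3_eq_cube)
  have "sign_avg n (\<lambda>\<epsilon>. (N (L \<epsilon>))\<^sup>2)
      \<le> sign_avg n (\<lambda>\<epsilon>. 2 * (4 * real d ^ 2 * M)\<^sup>2 + 2 * (real (card (cube D)) * (\<Sum>p\<in>cube D. (tl \<epsilon> p)\<^sup>2)))"
    by (rule sign_avg_mono) (rule bnd)
  also have "\<dots> = 2 * (4 * real d ^ 2 * M)\<^sup>2
      + 2 * (real (card (cube D)) * (\<Sum>p\<in>cube D. sign_avg n (\<lambda>\<epsilon>. (tl \<epsilon> p)\<^sup>2)))"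
    by (simp only: sign_avg_add sign_avg_const sign_avg_cmult sign_avg_sum)
  also have "\<dots> \<le> 2 * (4 * real d ^ 2 * M)\<^sup>2 + 2 * (real (card (cube D)) * (\<Sum>p\<in>cube D. \<eta>\<^sup>2))"
    unfolding tl_def \<eta>_def
    by (intro add_mono mult_left_mono sum_mono rad_tail_bound[OF d] f1) auto
  also have "\<dots> = 2 * (4 * real d ^ 2 * M)\<^sup>2 + 2 * (real D ^ 3 * \<eta>)\<^sup>2"
    by (simp add: cardD[symmetric] power2_eq_square)
  also have "\<dots> \<le> 2 * (4 * real d ^ 2 * M)\<^sup>2 + 2 * (4 * real d ^ 2 * M)\<^sup>2"
  proof -
    have "real D ^ 3 * \<eta> \<le> 4 ^ d * \<eta>" by (intro mult_right_mono D) (simp add: \<eta>_def)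
    also have "\<dots> = 4 * real d ^ 2 * 1" by (simp add: \<eta>_def)
    also have "\<dots> \<le> 4 * real d ^ 2 * M" using M by (intro mult_left_mono) auto
    finally have "(real D ^ 3 * \<eta>)\<^sup>2 \<le> (4 * real d ^ 2 * M)\<^sup>2" by (rule power_mono) (simp add: \<eta>_def)
    thus ?thesis by simp
  qed
  also have "\<dots> = (8 * real d ^ 2 * M)\<^sup>2" by (simp add: power_mult_distrib)
  finally show ?thesis unfolding L_def using M by (intro real_le_lsqrt) auto
qed

end

section \<open>Reading a sign by three trigonometric queries\<close>

lemma sin_add3:
  "sin (a + b + c) = sin a * cos b * cos c + cos a * sin b * cos c + cos a * cos b * sin c - sin a * sin b * (sin c :: real)"
  by (simp add: sin_add cos_add algebra_simps)

text \<open>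
  The matching vector code, composed with the real and imaginary parts of all additive characters.
  A coordinate \<open>142 z + 2 \<lambda> + \<sigma>\<close> carries the sine (\<open>\<sigma> = 0\<close>) or the cosine (\<open>\<sigma> = 1\<close>) of \<open>2\<pi>\<lambda>F(z)/71\<close>.
\<close>

lemma trigonometric_decoding:
  fixes e l :: nat
  defines "n \<equiv> l choose (35 ^ e - 1)" and "W \<equiv> 5 ^ (l choose (5 ^ e - 1)) * 7 ^ (l choose (7 ^ e - 1))"
  defines "D \<equiv> 142 * W"
  obtains C :: "(nat \<Rightarrow> real) \<Rightarrow> nat \<Rightarrow> real" and T :: "nat \<Rightarrow> nat \<times> nat \<times> nat \<Rightarrow> real" where
    "\<And>x a. \<bar>C x a\<bar> \<le> 1" "\<And>x a. D \<le> a \<Longrightarrow> C x a = 0"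
    "\<And>i u v w. i < n \<Longrightarrow> \<bar>\<Sum>p\<in>cube D. T i p * tensor3 u v w p\<bar>
       \<le> 4 * (norm3 {..<D} u * norm3 {..<D} v * norm3 {..<D} w)"
    "\<And>i x. i < n \<Longrightarrow> x \<in> signs n \<Longrightarrow>
       (\<Sum>p\<in>cube D. T i p * tensor3 (C x) (C x) (C x) p) = real W * sin (2 * pi / 71) * x i"
proof -
  obtain g :: "nat \<Rightarrow> nat \<Rightarrow> int" and \<tau> \<tau>' where
    \<tau>: "\<And>i. i < n \<Longrightarrow> inj_on (\<tau> i) {..<W} \<and> \<tau> i ` {..<W} \<subseteq> {..<W}" and
    \<tau>': "\<And>i. i < n \<Longrightarrow> inj_on (\<tau>' i) {..<W} \<and> \<tau>' i ` {..<W} \<subseteq> {..<W}" and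
    cop: "\<And>i z. coprime (g i z) 71" and
    code: "\<And>i j z. i < n \<Longrightarrow> j < n \<Longrightarrow> z < W \<Longrightarrow>
      [5 * g j z - 6 * g j (\<tau> i z) + g j (\<tau>' i z) = (if j = i then 28 * g i z else 0)] (mod 71)"
    unfolding n_def W_def by (rule matching_vector_code[of l e]) blast
  have inverse: "\<exists>m. m < 71 \<and> [int m * (28 * g i z) = 1] (mod 71)" for i z
  proof -
    have "coprime (28 :: int) 71" by (simp add: coprime_iff_gcd_eq_1 gcd_non_0_int)
    hence "coprime (28 * g i z) 71" using cop by simp
    then obtain y where y: "[28 * g i z * y = 1] (mod 71)" using cong_solve_coprime_int by blast
    have "[int (nat (y mod 71)) * (28 * g i z) = y * (28 * g i z)] (mod 71)"
      by (intro cong_mult) (simp_all add: Cong.cong_def)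
    also have "y * (28 * g i z) = 28 * g i z * y" by (rule mult.commute)
    also note y
    finally have "[int (nat (y mod 71)) * (28 * g i z) = 1] (mod 71)" .
    moreover have "nat (y mod 71) < 71" by (simp add: nat_less_iff)
    ultimately show ?thesis by blast
  qed
  \<comment> \<open>Multiplication by the inverse of 28 * g i z turns the right-hand side of the
    code relation into 1 for j = i, so the three queries see the phase \<theta> * x i up to
    multiples of 2 \<pi>. The inverse depends on z, which is why all 71 characters are
    stored.\<close>
  define lam where "lam = (\<lambda>i z. SOME m. m < 71 \<and> [int m * (28 * g i z) = 1] (mod 71))"
  have lam: "lam i z < 71" "[int (lam i z) * (28 * g i z) = 1] (mod 71)" for i z
    using someI_ex[OF inverse[of i z]] by (simp_all only: lam_def)
  define \<theta> :: real where "\<theta> = 2 * pi / 71"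
  define F where "F = (\<lambda>(x :: nat \<Rightarrow> real) z. \<Sum>j<n. x j * of_int (g j z))"
  define ix where "ix = (\<lambda>z (m :: nat) \<sigma> :: nat. 142 * z + (2 * m + \<sigma>))"
  define C where "C = (\<lambda>x a. if a < D then (if even a then sin else cos) (\<theta> * (real (a mod 142 div 2) * F x (a div 142))) else 0)"
  \<comment> \<open>The coefficients 5 and -6 of the code relation times \<open>lam\<close>; 65 is
    -6 modulo 71.\<close>
  define m1 where "m1 = (\<lambda>i z. 5 * lam i z mod 71)"
  define m2 where "m2 = (\<lambda>i z. 65 * lam i z mod 71)"
  have m: "m1 i z < 71" "m2 i z < 71" for i z by (simp_all add: m1_def m2_def)
  have ixD: "ix z m \<sigma> < D" if "z < W" "m < 71" "\<sigma> < 2" for z m \<sigma>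
    using that by (simp add: ix_def D_def)
  have ix_div: "ix z m \<sigma> div 142 = z" "ix z m \<sigma> mod 142 div 2 = m" "even (ix z m \<sigma>) \<longleftrightarrow> even \<sigma>"
    if "m < 71" "\<sigma> < 2" for z m \<sigma>
  proof -
    have s: "2 * m + \<sigma> < 142" using that by simp
    show "ix z m \<sigma> div 142 = z" using s by (simp add: ix_def)
    have "ix z m \<sigma> mod 142 = 2 * m + \<sigma>" using s by (simp add: ix_def)
    thus "ix z m \<sigma> mod 142 div 2 = m" using that by simp
    show "even (ix z m \<sigma>) \<longleftrightarrow> even \<sigma>" by (simp add: ix_def)
  qed
  have C_sin: "C x (ix z m 0) = sin (\<theta> * (real m * F x z))" if "z < W" "m < 71" for x z m
    using that ix_div[of m 0 z] ixD[of z m 0] by (simp add: C_def)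
  have C_cos: "C x (ix z m 1) = cos (\<theta> * (real m * F x z))" if "z < W" "m < 71" for x z m
    using that ix_div[of m 1 z] ixD[of z m 1] by (simp add: C_def)
  have ix_inj: "inj_on (\<lambda>z. ix (\<phi> z) (\<mu> z) \<sigma>) {..<W}" if "inj_on \<phi> {..<W}" "\<And>z. \<mu> z < 71" "\<sigma> < 2" for \<phi> \<mu> \<sigma>
  proof (rule inj_onI)
    fix y z assume yz: "y \<in> {..<W}" "z \<in> {..<W}" "ix (\<phi> y) (\<mu> y) \<sigma> = ix (\<phi> z) (\<mu> z) \<sigma>"
    have "\<phi> y = ix (\<phi> y) (\<mu> y) \<sigma> div 142" by (simp only: ix_div(1)[OF that(2,3)])
    also have "\<dots> = \<phi> z" by (simp only: yz(3) ix_div(1)[OF that(2,3)])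
    finally show "y = z" by (rule inj_onD[OF that(1) _ yz(1,2)])
  qed
  define P where "P = (\<lambda>i \<alpha> \<beta> \<gamma> z. (ix z (m1 i z) \<alpha>, ix (\<tau> i z) (m2 i z) \<beta>, ix (\<tau>' i z) (lam i z) \<gamma>))"
  \<comment> \<open>The sign pattern of \<open>sin_add3\<close>: three terms with one sine and two
    cosines, minus the product of three sines.\<close>
  define T where "T = (\<lambda>i p. \<Sum>z<W. of_bool (p = P i 0 1 1 z) + of_bool (p = P i 1 0 1 z)
      + of_bool (p = P i 1 1 0 z) - of_bool (p = P i 0 0 0 z) :: real)"
  have P: "P i \<alpha> \<beta> \<gamma> z \<in> cube D" if "i < n" "z < W" "\<alpha> < 2" "\<beta> < 2" "\<gamma> < 2" for i \<alpha> \<beta> \<gamma> z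
  proof -
    have "\<tau> i z < W" "\<tau>' i z < W"
      using \<tau>[OF that(1)] \<tau>'[OF that(1)] that(2) by (auto simp: image_subset_iff)
    thus ?thesis using that by (simp add: P_def ixD m lam)
  qed
  have apply_T: "(\<Sum>p\<in>cube D. T i p * t p) = (\<Sum>z<W. t (P i 0 1 1 z) + t (P i 1 0 1 z) + t (P i 1 1 0 z) - t (P i 0 0 0 z))"
    if "i < n" for i and t :: "nat \<times> nat \<times> nat \<Rightarrow> real"
  proof -
    have one: "(\<Sum>p\<in>cube D. of_bool (p = P i \<alpha> \<beta> \<gamma> z) * t p) = t (P i \<alpha> \<beta> \<gamma> z)"
      if "z < W" "\<alpha> < 2" "\<beta> < 2" "\<gamma> < 2" for \<alpha> \<beta> \<gamma> z
    proof -
      have "(\<Sum>p\<in>cube D. of_bool (p = P i \<alpha> \<beta> \<gamma> z) * t p)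
          = (\<Sum>p\<in>cube D. if p = P i \<alpha> \<beta> \<gamma> z then t (P i \<alpha> \<beta> \<gamma> z) else 0)"
        by (intro sum.cong) auto
      also have "\<dots> = t (P i \<alpha> \<beta> \<gamma> z)" using P[OF \<open>i < n\<close> that] by (subst sum.delta) auto
      finally show ?thesis .
    qed
    have "(\<Sum>p\<in>cube D. T i p * t p) = (\<Sum>z<W. \<Sum>p\<in>cube D. (of_bool (p = P i 0 1 1 z) + of_bool (p = P i 1 0 1 z)
      + of_bool (p = P i 1 1 0 z) - of_bool (p = P i 0 0 0 z)) * t p)"
      unfolding T_def sum_distrib_right by (rule sum.swap)
    also have "\<dots> = (\<Sum>z<W. t (P i 0 1 1 z) + t (P i 1 0 1 z) + t (P i 1 1 0 z) - t (P i 0 0 0 z))"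
    proof (rule sum.cong[OF refl])
      fix z assume "z \<in> {..<W}"
      hence z: "z < W" by simp
      have c: "(0::nat) < 2" "(1::nat) < 2" by simp_all
      show "(\<Sum>p\<in>cube D. (of_bool (p = P i 0 1 1 z) + of_bool (p = P i 1 0 1 z)
          + of_bool (p = P i 1 1 0 z) - of_bool (p = P i 0 0 0 z)) * t p)
          = t (P i 0 1 1 z) + t (P i 1 0 1 z) + t (P i 1 1 0 z) - t (P i 0 0 0 z)"
        by (simp only: distrib_right left_diff_distrib sum.distrib sum_subtractf one[OF z c(1) c(2) c(2)]
            one[OF z c(2) c(1) c(2)] one[OF z c(2) c(2) c(1)] one[OF z c(1) c(1) c(1)])
    qed
    finally show ?thesis .
  qed
  have bound: "\<bar>\<Sum>p\<in>cube D. T i p * tensor3 u v w p\<bar> \<le> 4 * (norm3 {..<D} u * norm3 {..<D} v * norm3 {..<D} w)"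
    if i: "i < n" for i u v w
  proof -
    let ?B = "norm3 {..<D} u * norm3 {..<D} v * norm3 {..<D} w"
    \<comment> \<open>Each of the four terms reads entries along three injective maps, so
      \<open>holder3\<close> bounds it without a dimension factor.\<close>
    have one: "\<bar>\<Sum>z<W. tensor3 u v w (P i \<alpha> \<beta> \<gamma> z)\<bar> \<le> ?B" if s: "\<alpha> < 2" "\<beta> < 2" "\<gamma> < 2" for \<alpha> \<beta> \<gamma>
    proof -
      have "\<bar>\<Sum>z<W. tensor3 u v w (P i \<alpha> \<beta> \<gamma> z)\<bar>
          \<le> (\<Sum>z<W. \<bar>u (ix z (m1 i z) \<alpha>) * v (ix (\<tau> i z) (m2 i z) \<beta>) * w (ix (\<tau>' i z) (lam i z) \<gamma>)\<bar>)"
        unfolding tensor3_def P_def case_prod_conv by (rule sum_abs)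
      also have "\<dots> \<le> norm3 {..<W} (\<lambda>z. u (ix z (m1 i z) \<alpha>)) * norm3 {..<W} (\<lambda>z. v (ix (\<tau> i z) (m2 i z) \<beta>))
          * norm3 {..<W} (\<lambda>z. w (ix (\<tau>' i z) (lam i z) \<gamma>))"
        by (rule holder3) simp
      also have "\<dots> \<le> ?B"
      proof (intro mult_mono norm3_reindex_le mult_nonneg_nonneg norm3_nonneg)
        show "inj_on (\<lambda>z. ix z (m1 i z) \<alpha>) {..<W}"
          by (rule ix_inj[of "\<lambda>z. z"]) (simp_all add: s m(1))
        show "inj_on (\<lambda>z. ix (\<tau> i z) (m2 i z) \<beta>) {..<W}"
          by (rule ix_inj) (simp_all add: s m(2) \<tau>[OF i])
        show "inj_on (\<lambda>z. ix (\<tau>' i z) (lam i z) \<gamma>) {..<W}"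
          by (rule ix_inj) (simp_all add: s lam(1) \<tau>'[OF i])
        have "P i \<alpha> \<beta> \<gamma> z \<in> cube D" if "z < W" for z by (rule P[OF i that s])
        thus "(\<lambda>z. ix z (m1 i z) \<alpha>) ` {..<W} \<subseteq> {..<D}" "(\<lambda>z. ix (\<tau> i z) (m2 i z) \<beta>) ` {..<W} \<subseteq> {..<D}"
          "(\<lambda>z. ix (\<tau>' i z) (lam i z) \<gamma>) ` {..<W} \<subseteq> {..<D}"
          by (simp_all add: P_def image_subset_iff)
      qed simp_all
      finally show ?thesis .
    qed
    have tri: "\<bar>a + b + c - d\<bar> \<le> 4 * B" if "\<bar>a\<bar> \<le> B" "\<bar>b\<bar> \<le> B" "\<bar>c\<bar> \<le> B" "\<bar>d\<bar> \<le> B" for a b c d B :: real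
      using that by linarith
    show ?thesis
      unfolding apply_T[OF i] sum.distrib sum_subtractf
      by (intro tri one) simp_all
  qed
  have decode: "(\<Sum>p\<in>cube D. T i p * tensor3 (C x) (C x) (C x) p) = real W * sin (2 * pi / 71) * x i"
    if i: "i < n" and x: "x \<in> signs n" for i x
  proof -
    have dec: "tensor3 (C x) (C x) (C x) (P i 0 1 1 z) + tensor3 (C x) (C x) (C x) (P i 1 0 1 z)
      + tensor3 (C x) (C x) (C x) (P i 1 1 0 z) - tensor3 (C x) (C x) (C x) (P i 0 0 0 z) = sin (2 * pi / 71) * x i"
      if z: "z < W" for z
    proof -
      have tz: "\<tau> i z < W" "\<tau>' i z < W" using \<tau>[OF i] \<tau>'[OF i] z by auto
      let ?ph = "real (m1 i z) * F x z + real (m2 i z) * F x (\<tau> i z) + real (lam i z) * F x (\<tau>' i z)"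
      have "tensor3 (C x) (C x) (C x) (P i 0 1 1 z) + tensor3 (C x) (C x) (C x) (P i 1 0 1 z)
        + tensor3 (C x) (C x) (C x) (P i 1 1 0 z) - tensor3 (C x) (C x) (C x) (P i 0 0 0 z)
        = sin (\<theta> * (real (m1 i z) * F x z) + \<theta> * (real (m2 i z) * F x (\<tau> i z)) + \<theta> * (real (lam i z) * F x (\<tau>' i z)))"
        unfolding sin_add3 tensor3_def P_def
        by (simp add: C_sin C_cos[unfolded One_nat_def] z tz m lam(1))
      also have "\<dots> = sin (\<theta> * ?ph)" by (simp add: distrib_left)
      finally have eq: "tensor3 (C x) (C x) (C x) (P i 0 1 1 z) + tensor3 (C x) (C x) (C x) (P i 1 0 1 z)
        + tensor3 (C x) (C x) (C x) (P i 1 1 0 z) - tensor3 (C x) (C x) (C x) (P i 0 0 0 z) = sin (\<theta> * ?ph)" .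
      have "\<exists>k\<in>\<int>. ?ph = 71 * k + x i"
      proof -
        define r where "r = (\<lambda>j. int (m1 i z) * g j z + int (m2 i z) * g j (\<tau> i z) + int (lam i z) * g j (\<tau>' i z))"
        have "\<exists>k. r j = 71 * k + (if j = i then 1 else 0)" if j: "j < n" for j
        proof -
          have "[int (m1 i z) = int (lam i z) * 5] (mod 71)" "[int (m2 i z) = int (lam i z) * (-6)] (mod 71)"
          proof -
            show "[int (m1 i z) = int (lam i z) * 5] (mod 71)"
              by (simp add: m1_def Cong.cong_def zmod_int mult.commute)
            have "[int (m2 i z) = int (lam i z) * 65] (mod 71)"
              by (simp add: m2_def Cong.cong_def zmod_int mult.commute)
            also have "[int (lam i z) * 65 = int (lam i z) * (-6)] (mod 71)"
              by (intro cong_mult) (simp_all add: Cong.cong_def)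
            finally show "[int (m2 i z) = int (lam i z) * (-6)] (mod 71)" .
          qed
          hence "[r j = int (lam i z) * 5 * g j z + int (lam i z) * (-6) * g j (\<tau> i z) + int (lam i z) * g j (\<tau>' i z)] (mod 71)"
            unfolding r_def by (intro cong_add cong_mult cong_refl)
          also have "int (lam i z) * 5 * g j z + int (lam i z) * (-6) * g j (\<tau> i z) + int (lam i z) * g j (\<tau>' i z)
              = int (lam i z) * (5 * g j z - 6 * g j (\<tau> i z) + g j (\<tau>' i z))" by (simp add: algebra_simps)
          also have "[\<dots> = int (lam i z) * (if j = i then 28 * g i z else 0)] (mod 71)"
            by (intro cong_mult cong_refl code[OF i j z])
          also have "[int (lam i z) * (if j = i then 28 * g i z else 0) = (if j = i then 1 else 0)] (mod 71)"
            using lam(2)[of i z] by simp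
          finally have "71 dvd r j - (if j = i then 1 else 0)" by (simp add: cong_iff_dvd_diff)
          then obtain k where "r j - (if j = i then 1 else 0) = 71 * k" by (rule dvdE)
          thus ?thesis by (intro exI[of _ k]) simp
        qed
        hence "\<forall>j\<in>{..<n}. \<exists>k. r j = 71 * k + (if j = i then 1 else 0)" by simp
        from bchoice[OF this] obtain k where "\<forall>j\<in>{..<n}. r j = 71 * k j + (if j = i then 1 else 0)" by blast
        hence k: "\<And>j. j < n \<Longrightarrow> r j = 71 * k j + (if j = i then 1 else 0)" by simp
        have "?ph = (\<Sum>j<n. x j * (real (m1 i z) * of_int (g j z)) + x j * (real (m2 i z) * of_int (g j (\<tau> i z)))
            + x j * (real (lam i z) * of_int (g j (\<tau>' i z))))"
          unfolding F_def sum.distrib by (simp add: sum_distrib_left mult.left_commute)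
        also have "\<dots> = (\<Sum>j<n. x j * of_int (r j))"
          by (simp add: r_def distrib_left)
        also have "\<dots> = (\<Sum>j<n. 71 * (x j * of_int (k j)) + (if j = i then x i else 0))"
          by (intro sum.cong refl) (auto simp: k algebra_simps)
        also have "\<dots> = 71 * (\<Sum>j<n. x j * of_int (k j)) + x i"
          using i by (simp add: sum.distrib sum_distrib_left)
        finally have "?ph = 71 * (\<Sum>j<n. x j * of_int (k j)) + x i" .
        moreover have "(\<Sum>j<n. x j * of_int (k j)) \<in> \<int>"
          using signs_cases[OF x] by (intro Ints_sum Ints_mult) force+
        ultimately show ?thesis by blast
      qed
      then obtain k where k: "k \<in> \<int>" "?ph = 71 * k + x i" by blast
      have ph: "\<theta> * ?ph = 2 * pi * k + \<theta> * x i" unfolding k(2) by (simp add: \<theta>_def field_simps)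
      have "sin (2 * pi * k + \<theta> * x i) = sin (\<theta> * x i)"
        using k(1) by (simp add: sin_add sin_integer_2pi cos_integer_2pi)
      \<comment> \<open>The sine is odd and x i is a sign, which makes the decoded value
        proportional to x i.\<close>
      also have "\<dots> = sin (2 * pi / 71) * x i" using signs_cases[OF x i] by (auto simp: \<theta>_def)
      finally show ?thesis unfolding eq ph .
    qed
    have "(\<Sum>p\<in>cube D. T i p * tensor3 (C x) (C x) (C x) p) = (\<Sum>z<W. sin (2 * pi / 71) * x i)"
      unfolding apply_T[OF i] by (rule sum.cong) (simp_all only: dec lessThan_iff)
    thus ?thesis by simp
  qed
  show ?thesis
  proof (rule that[of C T])
    show "\<bar>C x a\<bar> \<le> 1" for x a by (simp add: C_def)
    show "C x a = 0" if "D \<le> a" for x a using that by (simp add: C_def)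
  qed (erule bound, erule (1) decode)
qed

text \<open>With l = w * m and e fixed, the number n of encoded signs is at least m^w for w = 35^e -
  1, while the squared logarithm of the code length is at most of order m^(2 * (7^e - 1)). The
  exponents have a ratio of about 5^e / 2, so a large e beats q and a large m beats the
  constants.\<close>

lemma choose_growth:
  fixes c q :: real
  assumes "1 \<le> q" "0 < c"
  obtains e l :: nat where
    "c * (real (12 + 5 * ((l choose (5 ^ e - 1)) + (l choose (7 ^ e - 1)))))\<^sup>2 < real (l choose (35 ^ e - 1)) powr (1 / q)"
proof -
  \<comment> \<open>This choice gives w / q \<ge> 2 * 7^e - 1, one more than the exponent k = 2 *
    (7^e - 1); the additional power of m absorbs c'.\<close>
  obtain e :: nat where e: "2 * q < 5 ^ e" using real_arch_pow[of 5 "2 * q"] by auto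
  define w :: nat where "w = 35 ^ e - 1"
  define s :: nat where "s = 7 ^ e"
  have s1: "1 \<le> s" by (simp add: s_def)
  have e0: "e \<noteq> 0" using e assms(1) by (intro notI) simp
  hence w0: "0 < w" using one_less_power[of "35::nat" e] by (simp add: w_def)
  have "real w = 5 ^ e * 7 ^ e - 1" by (simp add: w_def of_nat_diff flip: power_mult_distrib)
  moreover have "2 * q * 7 ^ e \<le> 5 ^ e * 7 ^ e" using e by (intro mult_right_mono) auto
  moreover have "q * (2 * real s - 1) = 2 * q * 7 ^ e - q" by (simp add: s_def algebra_simps)
  ultimately have wq: "q * (2 * real s - 1) \<le> real w" using assms(1) by linarith
  define k where "k = 2 * (s - 1)"
  define c' where "c' = c * 22\<^sup>2 * real w ^ k"
  obtain m :: nat where m: "c' + 1 < real m" using reals_Archimedean2 by blast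
  have c': "0 \<le> c'" using assms by (simp add: c'_def)
  have m1: "1 < real m" using m c' by simp
  define l where "l = w * m"
  have l1: "1 \<le> l" using w0 m1 by (simp add: l_def)
  have ch: "l choose (p - 1) \<le> l ^ (s - 1)" if "p \<le> s" for p
  proof (cases "p - 1 \<le> l")
    case True
    have "l choose (p - 1) \<le> l ^ (p - 1)" using True by (rule binomial_le_pow)
    also have "\<dots> \<le> l ^ (s - 1)" using l1 that by (intro power_increasing) auto
    finally show ?thesis .
  qed (simp add: binomial_eq_0)
  have "(l choose (5 ^ e - 1)) + (l choose (7 ^ e - 1)) \<le> l ^ (s - 1) + l ^ (s - 1)"
    by (intro add_mono ch) (simp_all add: s_def power_mono)
  moreover have "1 \<le> l ^ (s - 1)" using l1 by simp
  moreover have "12 + 5 * x \<le> 22 * y" if "x \<le> y + y" "1 \<le> y" for x y :: nat using that by linarith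
  ultimately have "12 + 5 * ((l choose (5 ^ e - 1)) + (l choose (7 ^ e - 1))) \<le> 22 * l ^ (s - 1)" by blast
  hence "real (12 + 5 * ((l choose (5 ^ e - 1)) + (l choose (7 ^ e - 1)))) \<le> 22 * real l ^ (s - 1)"
    by (metis of_nat_le_iff of_nat_mult of_nat_numeral of_nat_power)
  hence "(real (12 + 5 * ((l choose (5 ^ e - 1)) + (l choose (7 ^ e - 1)))))\<^sup>2 \<le> (22 * real l ^ (s - 1))\<^sup>2"
    by (intro power_mono) auto
  also have "\<dots> = 22\<^sup>2 * real l ^ k" by (simp add: power_mult_distrib k_def mult.commute flip: power_mult)
  finally have "c * (real (12 + 5 * ((l choose (5 ^ e - 1)) + (l choose (7 ^ e - 1)))))\<^sup>2 \<le> c * (22\<^sup>2 * real l ^ k)"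
    using assms(2) by (intro mult_left_mono) auto
  also have "\<dots> = c' * real m ^ k" by (simp add: c'_def l_def power_mult_distrib)
  also have "\<dots> < real m * real m ^ k" using m m1 by (intro mult_strict_right_mono) auto
  also have "\<dots> = real m powr real (Suc k)" using m1 by (subst powr_realpow) auto
  also have "\<dots> \<le> real m powr (real w / q)"
  proof (rule powr_mono)
    have "real (Suc k) = 2 * real s - 1" using s1 by (simp add: k_def of_nat_diff)
    hence "real (Suc k) * q \<le> real w" using wq by (simp only: mult.commute)
    thus "real (Suc k) \<le> real w / q" using assms(1) by (simp add: pos_le_divide_eq)
  qed (use m1 in simp)
  also have "\<dots> = (real m ^ w) powr (1 / q)" using m1 by (simp add: powr_powr flip: powr_realpow)
  also have "\<dots> \<le> real (l choose w) powr (1 / q)"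
  proof (rule powr_mono2)
    have "w \<le> l" using m1 by (simp add: l_def)
    from binomial_ge_n_over_k_pow_k[OF this, where ?'a = real] w0
    show "real m ^ w \<le> real (l choose w)" by (simp add: l_def)
  qed (use assms(1) in auto)
  finally show ?thesis using that[of l e] by (simp add: w_def)
qed

text \<open>The vectors are the Rademacher coefficients of the tensor cubes f x. Their signed sums
  have quadratic mean at most 8 d^2 D, and decoding bounds each coefficient from below by W s / 4.
  As D / W = 142 is constant, cotype q would give n^(1/q) \<le> c * d^2, against
  \<open>choose_growth\<close>. The data n, D and t are fixed before N, so they serve every such
  seminorm.\<close>

theorem tensor3_seminorm_no_cotype:
  fixes q C :: real
  assumes q: "1 \<le> q" and C: "0 < C"
  obtains n D :: nat and t :: "nat \<Rightarrow> nat \<times> nat \<times> nat \<Rightarrow> real" where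
    "\<And>N. tensor3_seminorm D N \<Longrightarrow>
       C * sqrt (sign_avg n (\<lambda>\<epsilon>. (N (\<lambda>p. \<Sum>i<n. \<epsilon> i * t i p))\<^sup>2)) < (\<Sum>i<n. N (t i) powr q) powr (1 / q)"
proof -
  define s :: real where "s = sin (2 * pi / 71)"
  have s: "0 < s" unfolding s_def by (rule sin_gt_zero) (use pi_gt_zero in auto)
  \<comment> \<open>8 comes from \<open>rademacher_projection_bound\<close>, 142 is D / W, and 4 / s
    comes from the decoding forms.\<close>
  define c where "c = C * 8 * 142 * 4 / s"
  have "0 < c" using C s by (simp add: c_def)
  obtain e l :: nat where el:
    "c * (real (12 + 5 * ((l choose (5 ^ e - 1)) + (l choose (7 ^ e - 1)))))\<^sup>2 < real (l choose (35 ^ e - 1)) powr (1 / q)"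
    by (rule choose_growth[OF q \<open>0 < c\<close>])
  define h where "h = (l choose (5 ^ e - 1)) + (l choose (7 ^ e - 1))"
  \<comment> \<open>D \<le> 2^8 * 8^h, hence D^3 \<le> 2^(24 + 9 h) \<le> 4^d.\<close>
  define d where "d = 12 + 5 * h"
  define n where "n = l choose (35 ^ e - 1)"
  define W :: nat where "W = 5 ^ (l choose (5 ^ e - 1)) * 7 ^ (l choose (7 ^ e - 1))"
  define D where "D = 142 * W"
  obtain Co :: "(nat \<Rightarrow> real) \<Rightarrow> nat \<Rightarrow> real" and T where
    Co: "\<And>x a. \<bar>Co x a\<bar> \<le> 1" "\<And>x a. D \<le> a \<Longrightarrow> Co x a = 0"
    and T: "\<And>i u v w. i < n \<Longrightarrow> \<bar>\<Sum>p\<in>cube D. T i p * tensor3 u v w p\<bar>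
       \<le> 4 * (norm3 {..<D} u * norm3 {..<D} v * norm3 {..<D} w)"
    and dec: "\<And>i x. i < n \<Longrightarrow> x \<in> signs n \<Longrightarrow>
       (\<Sum>p\<in>cube D. T i p * tensor3 (Co x) (Co x) (Co x) p) = real W * sin (2 * pi / 71) * x i"
  proof (rule trigonometric_decoding[of l e, folded W_def n_def, folded D_def], goal_cases)
    case (1 Co T)
    from 1(2-5) show thesis by (rule 1(1))
  qed
  define f where "f = (\<lambda>x. tensor3 (Co x) (Co x) (Co x))"
  define t where "t = (\<lambda>i p. sign_avg n (\<lambda>x. x i * f x p))"
  have W1: "1 \<le> W" by (simp add: W_def)
  have D: "real D ^ 3 \<le> 4 ^ d"
  proof -
    have "W \<le> 8 ^ (l choose (5 ^ e - 1)) * 8 ^ (l choose (7 ^ e - 1))"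
      unfolding W_def by (intro mult_le_mono power_mono) auto
    also have "\<dots> = 8 ^ h" by (simp add: h_def power_add)
    finally have "D \<le> 256 * 8 ^ h" by (simp add: D_def)
    hence "D ^ 3 \<le> (256 * 8 ^ h) ^ 3" by (rule power_mono) simp
    also have "\<dots> = 2 ^ (24 + 9 * h)"
    proof -
      have "((8::nat) ^ h) ^ 3 = (8 ^ 3) ^ h" by (simp only: power_mult[symmetric] mult.commute)
      thus ?thesis by (simp add: power_mult_distrib power_add power_mult)
    qed
    also have "\<dots> \<le> 2 ^ (2 * d)" by (intro power_increasing) (auto simp: d_def)
    also have "\<dots> = 4 ^ d" by (simp add: power_mult)
    finally have "real (D ^ 3) \<le> real (4 ^ d)" by (simp only: of_nat_le_iff)
    thus ?thesis by simp
  qed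
  show ?thesis
  proof (rule that[of D n t])
    fix N assume N: "tensor3_seminorm D N"
    have f1: "\<bar>f x p\<bar> \<le> 1" for x p
    proof -
      obtain a b c where "p = (a, b, c)" by (rule prod_cases3)
      moreover have "\<bar>Co x a\<bar> * \<bar>Co x b\<bar> * \<bar>Co x c\<bar> \<le> 1 * 1 * 1"
        by (intro mult_mono Co) auto
      ultimately show ?thesis by (simp add: f_def tensor3_def abs_mult)
    qed
    have f0: "f x p = 0" if "p \<notin> cube D" for x p
    proof -
      obtain a b c where p: "p = (a, b, c)" by (rule prod_cases3)
      hence "D \<le> a \<or> D \<le> b \<or> D \<le> c" using that by auto
      thus ?thesis using Co(2)[of a x] Co(2)[of b x] Co(2)[of c x] by (auto simp: f_def tensor3_def p)
    qed
    have fM: "N (f x) \<le> real D" for x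
    proof -
      have r: "norm3 {..<D} (Co x) \<le> root 3 (real D)"
        using norm3_le_card[of "{..<D}" "Co x"] Co(1) by simp
      have "N (f x) \<le> norm3 {..<D} (Co x) * norm3 {..<D} (Co x) * norm3 {..<D} (Co x)"
        unfolding f_def by (rule N_tensor3[OF N])
      also have "\<dots> \<le> root 3 (real D) * root 3 (real D) * root 3 (real D)"
        by (intro mult_mono r) auto
      also have "\<dots> = root 3 (real D) ^ 3" by (simp add: power3_eq_cube)
      also have "\<dots> = real D" by simp
      finally show ?thesis .
    qed
    have "sqrt (sign_avg n (\<lambda>\<epsilon>. (N (\<lambda>p. \<Sum>i<n. \<epsilon> i * t i p))\<^sup>2)) \<le> 8 * real d ^ 2 * real D"
      unfolding t_def
      by (rule rademacher_projection_bound[OF N _ _ D]) (use f1 f0 fM W1 in \<open>auto simp: d_def D_def\<close>)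
    hence "C * sqrt (sign_avg n (\<lambda>\<epsilon>. (N (\<lambda>p. \<Sum>i<n. \<epsilon> i * t i p))\<^sup>2)) \<le> C * (8 * real d ^ 2 * real D)"
      using C by (intro mult_left_mono) auto
    also have "\<dots> = (c * real d ^ 2) * (real W * s / 4)" using s by (simp add: c_def D_def)
    also have "\<dots> < real n powr (1 / q) * (real W * s / 4)"
      using el W1 s unfolding d_def h_def n_def by (intro mult_strict_right_mono) auto
    also have "\<dots> = (real n * (real W * s / 4) powr q) powr (1 / q)"
      using s q by (simp add: powr_mult powr_powr)
    also have "\<dots> \<le> (\<Sum>i<n. N (t i) powr q) powr (1 / q)"
    proof (rule powr_mono2)
      have lower: "real W * s / 4 \<le> N (t i)" if i: "i < n" for i
      proof -
        have "(\<Sum>p\<in>cube D. T i p * t i p) = sign_avg n (\<lambda>x. x i * (\<Sum>p\<in>cube D. T i p * f x p))"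
          unfolding t_def sign_avg_cmult[symmetric] sign_avg_sum[symmetric]
          by (simp only: sum_distrib_left mult.left_commute)
        also have "\<dots> = sign_avg n (\<lambda>x. real W * s)"
        proof (rule sign_avg_cong)
          fix x assume x: "x \<in> signs n"
          have "x i * (\<Sum>p\<in>cube D. T i p * f x p) = real W * s * (x i * x i)"
            unfolding f_def dec[OF i x] s_def by (simp only: mult_ac)
          thus "x i * (\<Sum>p\<in>cube D. T i p * f x p) = real W * s" using signs_sq[OF x i] by simp
        qed
        finally have "(\<Sum>p\<in>cube D. T i p * t i p) = real W * s" by simp
        with N_functional[OF N T[OF i], of "t i"] have "\<bar>real W * s\<bar> \<le> 4 * N (t i)" by (simp only:)
        thus ?thesis by linarith
      qed
      have "real n * (real W * s / 4) powr q = (\<Sum>i<n. (real W * s / 4) powr q)" by simp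
      also have "\<dots> \<le> (\<Sum>i<n. N (t i) powr q)"
        using q s by (intro sum_mono powr_mono2 lower) auto
      finally show "real n * (real W * s / 4) powr q \<le> (\<Sum>i<n. N (t i) powr q)" .
    qed (use q in auto)
    finally show "C * sqrt (sign_avg n (\<lambda>\<epsilon>. (N (\<lambda>p. \<Sum>i<n. \<epsilon> i * t i p))\<^sup>2)) < (\<Sum>i<n. N (t i) powr q) powr (1 / q)" .
  qed
qed

section \<open>Quotients and completions of seminormed spaces\<close>

lemma real_scalars_simps [simp]:
  "carrier real_scalars = UNIV" "x \<oplus>\<^bsub>real_scalars\<^esub> y = x + y" "x \<otimes>\<^bsub>real_scalars\<^esub> y = x * y"
  "\<one>\<^bsub>real_scalars\<^esub> = 1" "\<zero>\<^bsub>real_scalars\<^esub> = 0"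
  by (simp_all add: real_scalars_def)

lemma cring_real_scalars: "cring real_scalars"
proof (rule cringI)
  show "abelian_group real_scalars"
    by (rule abelian_groupI) (auto simp: add.commute add.left_commute intro: exI[of _ "- _"])
  show "Group.comm_monoid real_scalars"
    by (rule comm_monoidI) (auto simp: mult.commute mult.left_commute)
qed (auto simp: distrib_right)

lemma real_scalars_minus [simp]: "\<ominus>\<^bsub>real_scalars\<^esub> x = - x"
proof -
  interpret cring real_scalars by (rule cring_real_scalars)
  show ?thesis by (rule minus_equality[of "- x" x]) simp_all
qed

lemma real_moduleI:
  assumes "abelian_group M"
    and "\<And>a x. x \<in> carrier M \<Longrightarrow> a \<odot>\<^bsub>M\<^esub> x \<in> carrier M"
    and "\<And>a b x. x \<in> carrier M \<Longrightarrow> (a + b) \<odot>\<^bsub>M\<^esub> x = a \<odot>\<^bsub>M\<^esub> x \<oplus>\<^bsub>M\<^esub> b \<odot>\<^bsub>M\<^esub> x"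
    and "\<And>a x y. x \<in> carrier M \<Longrightarrow> y \<in> carrier M \<Longrightarrow> a \<odot>\<^bsub>M\<^esub> (x \<oplus>\<^bsub>M\<^esub> y) = a \<odot>\<^bsub>M\<^esub> x \<oplus>\<^bsub>M\<^esub> a \<odot>\<^bsub>M\<^esub> y"
    and "\<And>a b x. x \<in> carrier M \<Longrightarrow> (a * b) \<odot>\<^bsub>M\<^esub> x = a \<odot>\<^bsub>M\<^esub> (b \<odot>\<^bsub>M\<^esub> x)"
    and "\<And>x. x \<in> carrier M \<Longrightarrow> 1 \<odot>\<^bsub>M\<^esub> x = x"
  shows "Module.module real_scalars M"
  by (rule Module.moduleI[OF cring_real_scalars]) (simp_all add: assms)

locale real_module = Module.module real_scalars M
  for M :: "(real, 'v, 'm) module_scheme" (structure)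
begin

lemma scale_closed [simp]: "x \<in> carrier M \<Longrightarrow> c \<odot> x \<in> carrier M"
  using smult_closed by simp

lemma scale_add_left: "x \<in> carrier M \<Longrightarrow> (a + b) \<odot> x = a \<odot> x \<oplus> b \<odot> x"
  using smult_l_distr[of a b x] by simp

lemma scale_add_right: "x \<in> carrier M \<Longrightarrow> y \<in> carrier M \<Longrightarrow> a \<odot> (x \<oplus> y) = a \<odot> x \<oplus> a \<odot> y"
  using smult_r_distr[of a x y] by simp

lemma scale_scale: "x \<in> carrier M \<Longrightarrow> a \<odot> (b \<odot> x) = (a * b) \<odot> x"
  using smult_assoc1[of a b x] by simp

lemma scale_one [simp]: "x \<in> carrier M \<Longrightarrow> 1 \<odot> x = x"
  using smult_one[of x] by simp

lemma scale_zero_left [simp]: "x \<in> carrier M \<Longrightarrow> 0 \<odot> x = \<zero>"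
  using smult_l_null[of x] by simp

lemma scale_zero_right [simp]: "a \<odot> \<zero> = \<zero>"
  using smult_r_null[of a] by simp

lemma scale_minus_one: "x \<in> carrier M \<Longrightarrow> (-1) \<odot> x = \<ominus> x"
  using smult_l_minus[of 1 x] by simp

lemma scale_minus_right: "x \<in> carrier M \<Longrightarrow> a \<odot> (\<ominus> x) = \<ominus> (a \<odot> x)"
  using smult_r_minus[of a x] by simp

lemma scale_diff_right: "x \<in> carrier M \<Longrightarrow> y \<in> carrier M \<Longrightarrow> a \<odot> (x \<ominus> y) = a \<odot> x \<ominus> a \<odot> y"
  by (simp add: a_minus_def scale_add_right scale_minus_right)

lemma scale_finsum:
  assumes "finite I" "f \<in> I \<rightarrow> carrier M"
  shows "c \<odot> finsum M f I = finsum M (\<lambda>i. c \<odot> f i) I"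
  using finsum_smult_ldistr[of I c f] assms by simp

lemma add_diff_add:
  "x \<in> carrier M \<Longrightarrow> y \<in> carrier M \<Longrightarrow> u \<in> carrier M \<Longrightarrow> v \<in> carrier M \<Longrightarrow>
   (x \<oplus> y) \<ominus> (u \<oplus> v) = (x \<ominus> u) \<oplus> (y \<ominus> v)"
  by (simp add: a_minus_def M.minus_add M.a_ac)

lemma diff_add_diff:
  "x \<in> carrier M \<Longrightarrow> y \<in> carrier M \<Longrightarrow> z \<in> carrier M \<Longrightarrow> (x \<ominus> y) \<oplus> (y \<ominus> z) = x \<ominus> z"
proof -
  assume a: "x \<in> carrier M" "y \<in> carrier M" "z \<in> carrier M"
  have "(x \<ominus> y) \<oplus> (y \<ominus> z) = x \<oplus> ((\<ominus> y \<oplus> y) \<oplus> \<ominus> z)"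
    using a by (simp add: a_minus_def M.a_assoc)
  thus ?thesis using a by (simp add: M.l_neg a_minus_def)
qed

lemma real_submoduleI:
  assumes "H \<subseteq> carrier M" "\<zero> \<in> H" "\<And>a b. a \<in> H \<Longrightarrow> b \<in> H \<Longrightarrow> a \<oplus> b \<in> H"
    "\<And>c a. a \<in> H \<Longrightarrow> c \<odot> a \<in> H"
  shows "submodule H real_scalars M"
proof (rule submoduleI)
  fix a assume "a \<in> H"
  thus "\<ominus> a \<in> H" using assms(1) assms(4)[of a "-1"] scale_minus_one[of a] by auto
qed (use assms in auto)

end

lemma real_moduleD: "Module.module real_scalars M \<Longrightarrow> real_module M"
  by (simp add: real_module_def)

section \<open>Quotients of real modules\<close>

locale real_quotient = real_module M for M :: "(real, 'v, 'm) module_scheme" (structure) +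
  fixes N assumes N: "submodule N real_scalars M"
begin

abbreviation coset :: "'v \<Rightarrow> 'v set" where "coset m \<equiv> N +> m"

lemma N_subset: "N \<subseteq> carrier M" and N_zero: "\<zero> \<in> N"
  and N_add: "a \<in> N \<Longrightarrow> b \<in> N \<Longrightarrow> a \<oplus> b \<in> N" and N_scale: "a \<in> N \<Longrightarrow> c \<odot> a \<in> N"
  using submoduleE[OF N] subgroup.one_closed[OF submodule.axioms(1)[OF N]] by auto

sublocale abelian_subgroup N M
proof (rule abelian_subgroupI3)
  show "additive_subgroup N M" using submodule.axioms(1)[OF N] by (rule additive_subgroupI)
qed (rule M.abelian_group_axioms)

lemma coset_eq_iff:
  assumes "m \<in> carrier M" "m' \<in> carrier M"
  shows "coset m = coset m' \<longleftrightarrow> m \<ominus> m' \<in> N"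
proof
  assume "coset m = coset m'"
  hence "m \<in> coset m'" using a_rcos_self[OF assms(1)] by simp
  thus "m \<ominus> m' \<in> N" using a_rcos_module[OF assms(2,1)] by (simp add: a_minus_def)
next
  assume "m \<ominus> m' \<in> N"
  hence "m \<in> coset m'" using a_rcos_module[OF assms(2,1)] by (simp add: a_minus_def)
  thus "coset m = coset m'" using a_repr_independence'[OF _ assms(2)] by simp
qed

lemma mem_coset_iff: "m \<in> carrier M \<Longrightarrow> x \<in> coset m \<longleftrightarrow> x \<in> carrier M \<and> coset x = coset m"
  using a_repr_independence'[of x m] a_rcos_self[of x] a_r_coset_subset_G[OF N_subset, of m] by auto

lemma carrier_quot: "carrier (quot_module M N) = coset ` carrier M"
  by (auto simp: quot_module_def A_RCOSETS_def RCOSETS_def a_r_coset_def)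

lemma coset_in_quot [simp]: "m \<in> carrier M \<Longrightarrow> coset m \<in> carrier (quot_module M N)"
  by (simp add: carrier_quot)

lemma quot_add:
  "m \<in> carrier M \<Longrightarrow> m' \<in> carrier M \<Longrightarrow> coset m \<oplus>\<^bsub>quot_module M N\<^esub> coset m' = coset (m \<oplus> m')"
  by (simp add: quot_module_def a_rcos_sum)

lemma quot_zero: "\<zero>\<^bsub>quot_module M N\<^esub> = coset \<zero>"
  using a_rcos_const[OF N_zero] by (simp add: quot_module_def)

lemma quot_scale:
  assumes m: "m \<in> carrier M"
  shows "c \<odot>\<^bsub>quot_module M N\<^esub> coset m = coset (c \<odot> m)"
proof -
  \<comment> \<open>All members of the coset contribute the same set, so the union in
    \<open>quot_module\<close> collapses.\<close>
  have "coset (c \<odot> a) = coset (c \<odot> m)" if "a \<in> coset m" for a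
  proof -
    have a: "a \<in> carrier M" "coset a = coset m" using that mem_coset_iff[OF m] by auto
    hence "c \<odot> (a \<ominus> m) \<in> N" using N_scale coset_eq_iff[OF a(1) m] by simp
    thus ?thesis using a m by (simp add: coset_eq_iff scale_diff_right)
  qed
  moreover have "m \<in> coset m" by (rule a_rcos_self[OF m])
  ultimately have "(\<Union>a\<in>coset m. coset (c \<odot> a)) = coset (c \<odot> m)" by blast
  thus ?thesis by (simp add: quot_module_def)
qed

lemma real_module_quot: "real_module (quot_module M N)"
proof (rule real_moduleD, rule real_moduleI)
  show "abelian_group (quot_module M N)"
  proof (rule abelian_groupI)
    fix x assume "x \<in> carrier (quot_module M N)"
    then obtain m where "m \<in> carrier M" "x = coset m" by (auto simp: carrier_quot)
    thus "\<exists>y\<in>carrier (quot_module M N). y \<oplus>\<^bsub>quot_module M N\<^esub> x = \<zero>\<^bsub>quot_module M N\<^esub>"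
      by (intro bexI[of _ "coset (\<ominus> m)"]) (simp_all add: quot_add quot_zero M.l_neg)
  qed (auto simp: carrier_quot quot_add quot_zero M.a_ac)
qed (auto simp: carrier_quot quot_add quot_scale scale_add_left scale_add_right scale_scale)

end

lemma real_module_finsum_map:
  assumes "real_module A" "real_module B"
    and h: "\<And>x. x \<in> carrier A \<Longrightarrow> h x \<in> carrier B"
      "\<And>x y. x \<in> carrier A \<Longrightarrow> y \<in> carrier A \<Longrightarrow> h (x \<oplus>\<^bsub>A\<^esub> y) = h x \<oplus>\<^bsub>B\<^esub> h y"
      "h \<zero>\<^bsub>A\<^esub> = \<zero>\<^bsub>B\<^esub>"
    and I: "finite I" "f \<in> I \<rightarrow> carrier A"
  shows "h (finsum A f I) = finsum B (\<lambda>i. h (f i)) I"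
proof -
  interpret A: real_module A by fact
  interpret B: real_module B by fact
  show ?thesis using I
  proof (induction I rule: finite_induct)
    case (insert i I)
    hence "f \<in> I \<rightarrow> carrier A" "f i \<in> carrier A" by auto
    moreover from this have "(\<lambda>i. h (f i)) \<in> I \<rightarrow> carrier B" "h (f i) \<in> carrier B" using h(1) by auto
    ultimately show ?case using insert h by simp
  qed (simp add: h)
qed

section \<open>Linear functionals and seminorms\<close>

definition lin_functional :: "(real, 'v, 'm) module_scheme \<Rightarrow> ('v \<Rightarrow> real) \<Rightarrow> bool" where
  "lin_functional M l \<longleftrightarrow>
     (\<forall>x\<in>carrier M. \<forall>y\<in>carrier M. l (x \<oplus>\<^bsub>M\<^esub> y) = l x + l y) \<and>
     (\<forall>c. \<forall>x\<in>carrier M. l (c \<odot>\<^bsub>M\<^esub> x) = c * l x)"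

context real_module
begin

lemma lin_functionalD:
  assumes "lin_functional M l"
  shows "x \<in> carrier M \<Longrightarrow> y \<in> carrier M \<Longrightarrow> l (x \<oplus> y) = l x + l y"
    "x \<in> carrier M \<Longrightarrow> l (c \<odot> x) = c * l x"
    "l \<zero> = 0"
    "x \<in> carrier M \<Longrightarrow> y \<in> carrier M \<Longrightarrow> l (x \<ominus> y) = l x - l y"
proof -
  show add: "l (x \<oplus> y) = l x + l y" if "x \<in> carrier M" "y \<in> carrier M" for x y
    using assms that by (simp add: lin_functional_def)
  show scale: "l (c \<odot> x) = c * l x" if "x \<in> carrier M" for c x
    using assms that by (simp add: lin_functional_def)
  show "l \<zero> = 0" using scale[of \<zero> 0] by simp
  show "l (x \<ominus> y) = l x - l y" if "x \<in> carrier M" "y \<in> carrier M"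
    using that scale[of y "-1"] by (simp add: a_minus_def add scale_minus_one)
qed

lemma lin_functional_finsum:
  assumes l: "lin_functional M l" and "finite I" "f \<in> I \<rightarrow> carrier M"
  shows "l (finsum M f I) = (\<Sum>i\<in>I. l (f i))"
  using assms(2,3)
proof (induction I rule: finite_induct)
  case (insert i I)
  hence "f \<in> I \<rightarrow> carrier M" "f i \<in> carrier M" by auto
  thus ?case using insert by (simp add: lin_functionalD[OF l])
qed (simp add: lin_functionalD[OF l])

end

text \<open>Without definiteness, because the projective norm and the norm of a completion are first
  known to be seminorms only. For tensor products of spaces with enough functionals,
  \<open>real_normed_space_alg_normed\<close> adds it.\<close>

locale seminormed = real_module V for V :: "'v normed_rec" (structure) +
  assumes vnorm_add_le: "\<lbrakk>x \<in> carrier V; y \<in> carrier V\<rbrakk> \<Longrightarrow> vnorm V (x \<oplus> y) \<le> vnorm V x + vnorm V y"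
    and vnorm_scale: "x \<in> carrier V \<Longrightarrow> vnorm V (c \<odot> x) = \<bar>c\<bar> * vnorm V x"
begin

lemma vnorm_zero [simp]: "vnorm V \<zero> = 0"
  using vnorm_scale[of \<zero> 0] by simp

lemma vnorm_minus [simp]: "x \<in> carrier V \<Longrightarrow> vnorm V (\<ominus> x) = vnorm V x"
  using vnorm_scale[of x "-1"] by (simp add: scale_minus_one)

lemma vnorm_nonneg: "x \<in> carrier V \<Longrightarrow> 0 \<le> vnorm V x"
  using vnorm_add_le[of x "\<ominus> x"] by (simp add: M.r_neg)

lemma vnorm_diff_commute:
  assumes "x \<in> carrier V" "y \<in> carrier V"
  shows "vnorm V (x \<ominus> y) = vnorm V (y \<ominus> x)"
proof -
  have "y \<ominus> x = \<ominus> (x \<ominus> y)" using assms by (simp add: a_minus_def M.minus_add M.a_comm)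
  thus ?thesis using assms by simp
qed

lemma vnorm_triangle_diff:
  assumes "x \<in> carrier V" "y \<in> carrier V"
  shows "\<bar>vnorm V x - vnorm V y\<bar> \<le> vnorm V (x \<ominus> y)"
proof -
  have "vnorm V u \<le> vnorm V (u \<ominus> v) + vnorm V v" if "u \<in> carrier V" "v \<in> carrier V" for u v
  proof -
    have "u = (u \<ominus> v) \<oplus> v" using that by (simp add: a_minus_def M.a_assoc M.l_neg)
    thus ?thesis using vnorm_add_le[of "u \<ominus> v" v] that by simp
  qed
  from this[of x y] this[of y x] show ?thesis
    using vnorm_diff_commute[of x y] assms by simp
qed

lemma vnorm_finsum_le:
  assumes "finite I" "f \<in> I \<rightarrow> carrier V"
  shows "vnorm V (finsum V f I) \<le> (\<Sum>i\<in>I. vnorm V (f i))"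
  using assms
proof (induction I rule: finite_induct)
  case (insert i I)
  hence f: "f \<in> I \<rightarrow> carrier V" "f i \<in> carrier V" by auto
  have "vnorm V (finsum V f (insert i I)) \<le> vnorm V (f i) + vnorm V (finsum V f I)"
    using insert f vnorm_add_le[of "f i" "finsum V f I"] by simp
  thus ?case using insert f by simp
qed simp

end

section \<open>Cauchy sequences modulo null sequences\<close>

context real_normed_space
begin

sublocale seminormed V
proof
  fix x y assume "x \<in> carrier V" "y \<in> carrier V"
  thus "vnorm V (x \<oplus> y) \<le> vnorm V x + vnorm V y" by (rule vnorm_triangle)
qed (rule vnorm_smult)

lemma Metric_space_vdist: "Metric_space (carrier V) (vdist V)"
proof
  show "vdist V x y = vdist V y x" for x y
    using vnorm_diff_commute[of x y] by (simp add: vdist_def)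
  show "0 \<le> vdist V x y" for x y by (simp add: vdist_def vnorm_nonneg)
  show "vdist V x y = 0 \<longleftrightarrow> x = y" if "x \<in> carrier V" "y \<in> carrier V" for x y
  proof -
    have "x = (x \<ominus> y) \<oplus> y" using that by (simp add: a_minus_def M.a_assoc M.l_neg)
    hence "x \<ominus> y = \<zero> \<longleftrightarrow> x = y" using that by (auto simp: a_minus_def M.r_neg)
    thus ?thesis using that vnorm_eq_0[of "x \<ominus> y"] by (simp add: vdist_def)
  qed
  show "vdist V x z \<le> vdist V x y + vdist V y z" if "x \<in> carrier V" "y \<in> carrier V" "z \<in> carrier V" for x y z
    using that vnorm_add_le[of "x \<ominus> y" "y \<ominus> z"] diff_add_diff[of x y z] by (simp add: vdist_def)
qed

definition cauchy :: "(nat \<Rightarrow> 'v) \<Rightarrow> bool" where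
  "cauchy \<sigma> \<longleftrightarrow> (\<forall>n. \<sigma> n \<in> carrier V) \<and>
     (\<forall>e>0. \<exists>K. \<forall>n\<ge>K. \<forall>m\<ge>K. vnorm V (\<sigma> n \<ominus> \<sigma> m) < e)"

lemma MCauchy_iff: "Metric_space.MCauchy (carrier V) (vdist V) \<sigma> \<longleftrightarrow> cauchy \<sigma>"
  unfolding Metric_space.MCauchy_def[OF Metric_space_vdist] cauchy_def vdist_def image_subset_iff
  by auto

lemma carrier_cauchy_module [simp]: "carrier (cauchy_module V) = {\<sigma>. cauchy \<sigma>}"
  by (simp add: cauchy_module_def MCauchy_iff)

lemma cauchy_module_simps [simp]:
  "\<sigma> \<oplus>\<^bsub>cauchy_module V\<^esub> \<tau> = (\<lambda>n. \<sigma> n \<oplus> \<tau> n)"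
  "c \<odot>\<^bsub>cauchy_module V\<^esub> \<sigma> = (\<lambda>n. c \<odot> \<sigma> n)"
  "\<zero>\<^bsub>cauchy_module V\<^esub> = (\<lambda>_. \<zero>)"
  by (simp_all add: cauchy_module_def)

lemma cauchy_carrier: "cauchy \<sigma> \<Longrightarrow> \<sigma> n \<in> carrier V"
  by (simp add: cauchy_def)

lemma cauchyD:
  assumes "cauchy \<sigma>" "0 < e"
  obtains K where "\<And>n m. K \<le> n \<Longrightarrow> K \<le> m \<Longrightarrow> vnorm V (\<sigma> n \<ominus> \<sigma> m) < e"
  using assms unfolding cauchy_def by blast

lemma cauchy_const: "v \<in> carrier V \<Longrightarrow> cauchy (\<lambda>_. v)"
  by (simp add: cauchy_def a_minus_def M.r_neg)

lemma cauchy_add: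
  assumes s: "cauchy \<sigma>" and t: "cauchy \<tau>"
  shows "cauchy (\<lambda>n. \<sigma> n \<oplus> \<tau> n)"
  unfolding cauchy_def
proof (intro conjI allI impI)
  fix e :: real assume e: "0 < e"
  obtain K where K: "\<And>n m. K \<le> n \<Longrightarrow> K \<le> m \<Longrightarrow> vnorm V (\<sigma> n \<ominus> \<sigma> m) < e / 2"
    using cauchyD[OF s, of "e / 2"] e by auto
  obtain L where L: "\<And>n m. L \<le> n \<Longrightarrow> L \<le> m \<Longrightarrow> vnorm V (\<tau> n \<ominus> \<tau> m) < e / 2"
    using cauchyD[OF t, of "e / 2"] e by auto
  have "vnorm V ((\<sigma> n \<oplus> \<tau> n) \<ominus> (\<sigma> m \<oplus> \<tau> m)) < e" if "max K L \<le> n" "max K L \<le> m" for n m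
    using vnorm_add_le[of "\<sigma> n \<ominus> \<sigma> m" "\<tau> n \<ominus> \<tau> m"] K[of n m] L[of n m] that
      cauchy_carrier[OF s] cauchy_carrier[OF t] by (simp add: add_diff_add)
  thus "\<exists>K. \<forall>n\<ge>K. \<forall>m\<ge>K. vnorm V ((\<sigma> n \<oplus> \<tau> n) \<ominus> (\<sigma> m \<oplus> \<tau> m)) < e" by blast
qed (simp add: cauchy_carrier s t)

lemma cauchy_scale:
  assumes s: "cauchy \<sigma>"
  shows "cauchy (\<lambda>n. c \<odot> \<sigma> n)"
  unfolding cauchy_def
proof (intro conjI allI impI)
  fix e :: real assume e: "0 < e"
  have "0 < e / (\<bar>c\<bar> + 1)" using e by simp
  then obtain K where K: "\<And>n m. K \<le> n \<Longrightarrow> K \<le> m \<Longrightarrow> vnorm V (\<sigma> n \<ominus> \<sigma> m) < e / (\<bar>c\<bar> + 1)"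
    using cauchyD[OF s] by blast
  have "vnorm V (c \<odot> \<sigma> n \<ominus> c \<odot> \<sigma> m) < e" if "K \<le> n" "K \<le> m" for n m
  proof -
    have "vnorm V (c \<odot> \<sigma> n \<ominus> c \<odot> \<sigma> m) = \<bar>c\<bar> * vnorm V (\<sigma> n \<ominus> \<sigma> m)"
      using cauchy_carrier[OF s] by (simp add: vnorm_scale flip: scale_diff_right)
    also have "\<dots> \<le> (\<bar>c\<bar> + 1) * vnorm V (\<sigma> n \<ominus> \<sigma> m)"
      using cauchy_carrier[OF s] by (intro mult_right_mono vnorm_nonneg) auto
    also have "\<dots> < e" using K[OF that] by (simp add: pos_less_divide_eq mult.commute)
    finally show ?thesis .
  qed
  thus "\<exists>K. \<forall>n\<ge>K. \<forall>m\<ge>K. vnorm V (c \<odot> \<sigma> n \<ominus> c \<odot> \<sigma> m) < e" by blast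
qed (simp add: cauchy_carrier s)

lemma cauchy_minus:
  assumes "cauchy \<sigma>"
  shows "cauchy (\<lambda>n. \<ominus> \<sigma> n)"
  using cauchy_scale[OF assms, of "-1"] by (simp add: scale_minus_one cauchy_carrier[OF assms])

lemma real_module_cauchy: "real_module (cauchy_module V)"
proof (rule real_moduleD, rule real_moduleI)
  show "abelian_group (cauchy_module V)"
  proof (rule abelian_groupI)
    fix \<sigma> assume "\<sigma> \<in> carrier (cauchy_module V)"
    hence s: "cauchy \<sigma>" by simp
    show "\<exists>\<tau>\<in>carrier (cauchy_module V). \<tau> \<oplus>\<^bsub>cauchy_module V\<^esub> \<sigma> = \<zero>\<^bsub>cauchy_module V\<^esub>"
      by (rule bexI[of _ "\<lambda>n. \<ominus> \<sigma> n"])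
        (simp_all add: cauchy_minus s cauchy_carrier M.l_neg)
  qed (auto simp: cauchy_add cauchy_const cauchy_carrier M.a_ac)
qed (auto simp: cauchy_scale cauchy_carrier scale_add_left scale_add_right scale_scale)

lemma null_seqs_iff: "\<sigma> \<in> null_seqs V \<longleftrightarrow> cauchy \<sigma> \<and> (\<lambda>n. vnorm V (\<sigma> n)) \<longlonglongrightarrow> 0"
  by (simp add: null_seqs_def)

lemma submodule_null_seqs: "submodule (null_seqs V) real_scalars (cauchy_module V)"
proof (rule real_module.real_submoduleI[OF real_module_cauchy])
  fix \<sigma> \<tau> assume st: "\<sigma> \<in> null_seqs V" "\<tau> \<in> null_seqs V"
  have "(\<lambda>n. vnorm V (\<sigma> n) + vnorm V (\<tau> n)) \<longlonglongrightarrow> 0 + 0"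
    using st by (intro tendsto_add) (auto simp: null_seqs_iff)
  hence lim: "(\<lambda>n. vnorm V (\<sigma> n) + vnorm V (\<tau> n)) \<longlonglongrightarrow> 0" by simp
  have "(\<lambda>n. vnorm V (\<sigma> n \<oplus> \<tau> n)) \<longlonglongrightarrow> 0"
    by (rule Lim_null_comparison[OF _ lim])
      (use st in \<open>simp add: null_seqs_iff cauchy_carrier vnorm_nonneg vnorm_add_le\<close>)
  thus "\<sigma> \<oplus>\<^bsub>cauchy_module V\<^esub> \<tau> \<in> null_seqs V"
    using st by (simp add: null_seqs_iff cauchy_add)
next
  fix c \<sigma> assume "\<sigma> \<in> null_seqs V"
  moreover from this have "(\<lambda>n. \<bar>c\<bar> * vnorm V (\<sigma> n)) \<longlonglongrightarrow> \<bar>c\<bar> * 0"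
    by (intro tendsto_mult tendsto_const) (simp add: null_seqs_iff)
  ultimately show "c \<odot>\<^bsub>cauchy_module V\<^esub> \<sigma> \<in> null_seqs V"
    by (simp add: null_seqs_iff cauchy_scale cauchy_carrier vnorm_scale)
qed (auto simp: null_seqs_iff cauchy_const)

sublocale seqs: real_quotient "cauchy_module V" "null_seqs V"
  by (rule real_quotient.intro[OF real_module_cauchy]) (rule real_quotient_axioms.intro[OF submodule_null_seqs])

abbreviation cls :: "(nat \<Rightarrow> 'v) \<Rightarrow> (nat \<Rightarrow> 'v) set" where
  "cls \<sigma> \<equiv> null_seqs V +>\<^bsub>cauchy_module V\<^esub> \<sigma>"

lemma cls_eq_iff:
  assumes "cauchy \<sigma>" "cauchy \<tau>"
  shows "cls \<sigma> = cls \<tau> \<longleftrightarrow> (\<lambda>n. vnorm V (\<sigma> n \<ominus> \<tau> n)) \<longlonglongrightarrow> 0"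
proof -
  have "\<ominus>\<^bsub>cauchy_module V\<^esub> \<tau> = (\<lambda>n. \<ominus> \<tau> n)"
    using seqs.scale_minus_one[of \<tau>] assms by (simp add: scale_minus_one cauchy_carrier)
  hence "\<sigma> \<ominus>\<^bsub>cauchy_module V\<^esub> \<tau> = (\<lambda>n. \<sigma> n \<ominus> \<tau> n)"
    by (simp add: a_minus_def)
  moreover have "cauchy (\<lambda>n. \<sigma> n \<ominus> \<tau> n)"
    using cauchy_add[OF assms(1) cauchy_minus[OF assms(2)]] by (simp add: a_minus_def)
  ultimately show ?thesis
    using seqs.coset_eq_iff[of \<sigma> \<tau>] assms by (simp add: null_seqs_iff)
qed

lemma cauchy_vnorm_convergent:
  assumes "cauchy \<sigma>"
  shows "convergent (\<lambda>n. vnorm V (\<sigma> n))"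
proof -
  have "Cauchy (\<lambda>n. vnorm V (\<sigma> n))"
  proof (rule CauchyI)
    fix e :: real assume "0 < e"
    then obtain K where K: "\<And>n m. K \<le> n \<Longrightarrow> K \<le> m \<Longrightarrow> vnorm V (\<sigma> n \<ominus> \<sigma> m) < e"
      using cauchyD[OF assms] by blast
    have "norm (vnorm V (\<sigma> m) - vnorm V (\<sigma> n)) < e" if "K \<le> m" "K \<le> n" for m n
      using vnorm_triangle_diff[of "\<sigma> m" "\<sigma> n"] K[of m n] that cauchy_carrier[OF assms] by simp
    thus "\<exists>K. \<forall>m\<ge>K. \<forall>n\<ge>K. norm (vnorm V (\<sigma> m) - vnorm V (\<sigma> n)) < e" by blast
  qed
  thus ?thesis by (simp add: Cauchy_convergent_iff)
qed

lemma completion_simps: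
  "carrier (completion V) = carrier (quot_module (cauchy_module V) (null_seqs V))"
  "add (completion V) = add (quot_module (cauchy_module V) (null_seqs V))"
  "zero (completion V) = zero (quot_module (cauchy_module V) (null_seqs V))"
  "module.smult (completion V) = module.smult (quot_module (cauchy_module V) (null_seqs V))"
  "vnorm (completion V) A = (THE r. \<forall>\<sigma>\<in>A. (\<lambda>n. vnorm V (\<sigma> n)) \<longlonglongrightarrow> r)"
  by (simp_all add: completion_def module.extend_def normed_rec.fields_def)

lemma carrier_completion: "carrier (completion V) = cls ` {\<sigma>. cauchy \<sigma>}"
  by (simp add: completion_simps seqs.carrier_quot)

lemma cls_in_completion [simp]: "cauchy \<sigma> \<Longrightarrow> cls \<sigma> \<in> carrier (completion V)"
  by (simp add: carrier_completion)

lemma completion_add: "cauchy \<sigma> \<Longrightarrow> cauchy \<tau> \<Longrightarrow> cls \<sigma> \<oplus>\<^bsub>completion V\<^esub> cls \<tau> = cls (\<lambda>n. \<sigma> n \<oplus> \<tau> n)"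
  using seqs.quot_add[of \<sigma> \<tau>] by (simp add: completion_simps)

lemma completion_scale: "cauchy \<sigma> \<Longrightarrow> c \<odot>\<^bsub>completion V\<^esub> cls \<sigma> = cls (\<lambda>n. c \<odot> \<sigma> n)"
  using seqs.quot_scale[of \<sigma> c] by (simp add: completion_simps)

lemma completion_zero: "\<zero>\<^bsub>completion V\<^esub> = cls (\<lambda>_. \<zero>)"
  using seqs.quot_zero by (simp add: completion_simps)

text \<open>Members of one coset differ by null sequences, so their norms have a common limit and
  the description in \<open>completion\<close> denotes it.\<close>

lemma completion_norm:
  assumes "cauchy \<sigma>"
  shows "(\<lambda>n. vnorm V (\<sigma> n)) \<longlonglongrightarrow> vnorm (completion V) (cls \<sigma>)"
proof -
  obtain r where r: "(\<lambda>n. vnorm V (\<sigma> n)) \<longlonglongrightarrow> r"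
    using cauchy_vnorm_convergent[OF assms] by (auto simp: convergent_def)
  have all: "(\<lambda>n. vnorm V (\<tau> n)) \<longlonglongrightarrow> r" if "\<tau> \<in> cls \<sigma>" for \<tau>
  proof -
    have t: "cauchy \<tau>" "cls \<tau> = cls \<sigma>" using that seqs.mem_coset_iff[of \<sigma> \<tau>] assms by auto
    hence "(\<lambda>n. vnorm V (\<tau> n \<ominus> \<sigma> n)) \<longlonglongrightarrow> 0" using cls_eq_iff assms by simp
    hence "(\<lambda>n. vnorm V (\<tau> n) - vnorm V (\<sigma> n)) \<longlonglongrightarrow> 0"
      by (rule Lim_null_comparison[rotated])
        (use vnorm_triangle_diff cauchy_carrier[OF t(1)] cauchy_carrier[OF assms] in simp)
    from tendsto_add[OF this r] show ?thesis by simp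
  qed
  have self: "\<sigma> \<in> cls \<sigma>" using assms seqs.mem_coset_iff[of \<sigma> \<sigma>] by simp
  have "(THE r. \<forall>\<sigma>\<in>cls \<sigma>. (\<lambda>n. vnorm V (\<sigma> n)) \<longlonglongrightarrow> r) = r"
  proof (rule the_equality)
    fix r' assume "\<forall>\<sigma>\<in>cls \<sigma>. (\<lambda>n. vnorm V (\<sigma> n)) \<longlonglongrightarrow> r'"
    from bspec[OF this self] r show "r' = r" by (rule LIMSEQ_unique)
  qed (intro ballI all)
  thus ?thesis using r by (simp add: completion_simps)
qed

lemma completion_norm_const: "v \<in> carrier V \<Longrightarrow> vnorm (completion V) (cls (\<lambda>_. v)) = vnorm V v"
  by (rule LIMSEQ_unique[OF completion_norm[OF cauchy_const]]) simp_all

lemma seminormed_completion: "seminormed (completion V)"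
proof -
  have "real_module (completion V)"
  proof -
    interpret Q: real_module "quot_module (cauchy_module V) (null_seqs V)" by (rule seqs.real_module_quot)
    have "abelian_group (completion V)"
    proof (rule abelian_groupI)
      fix x assume "x \<in> carrier (completion V)"
      thus "\<exists>y\<in>carrier (completion V). y \<oplus>\<^bsub>completion V\<^esub> x = \<zero>\<^bsub>completion V\<^esub>"
        unfolding completion_simps
        by (intro bexI[of _ "\<ominus>\<^bsub>quot_module (cauchy_module V) (null_seqs V)\<^esub> x"]) (simp_all add: Q.M.l_neg)
    qed (auto simp: completion_simps Q.M.a_ac)
    thus ?thesis
      by (intro real_moduleD real_moduleI)
        (auto simp: completion_simps Q.scale_add_left Q.scale_add_right Q.scale_scale)
  qed
  moreover have "seminormed_axioms (completion V)"
  proof (rule seminormed_axioms.intro)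
    fix x y assume "x \<in> carrier (completion V)" "y \<in> carrier (completion V)"
    then obtain \<sigma> \<tau> where st: "cauchy \<sigma>" "x = cls \<sigma>" "cauchy \<tau>" "y = cls \<tau>"
      by (auto simp: carrier_completion)
    have lim: "(\<lambda>n. vnorm V (\<sigma> n \<oplus> \<tau> n)) \<longlonglongrightarrow> vnorm (completion V) (x \<oplus>\<^bsub>completion V\<^esub> y)"
      using completion_norm[OF cauchy_add[OF st(1,3)]] completion_add[OF st(1,3)] st by simp
    show "vnorm (completion V) (x \<oplus>\<^bsub>completion V\<^esub> y) \<le> vnorm (completion V) x + vnorm (completion V) y"
      by (rule LIMSEQ_le[OF lim tendsto_add[OF completion_norm[OF st(1)] completion_norm[OF st(3)], folded st(2,4)]])
        (use vnorm_add_le cauchy_carrier st in blast)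
  next
    fix x c assume "x \<in> carrier (completion V)"
    then obtain \<sigma> where st: "cauchy \<sigma>" "x = cls \<sigma>" by (auto simp: carrier_completion)
    have "(\<lambda>n. vnorm V (c \<odot> \<sigma> n)) \<longlonglongrightarrow> vnorm (completion V) (c \<odot>\<^bsub>completion V\<^esub> x)"
      using completion_norm[OF cauchy_scale[OF st(1)]] completion_scale[OF st(1)] st by simp
    moreover have "(\<lambda>n. vnorm V (c \<odot> \<sigma> n)) \<longlonglongrightarrow> \<bar>c\<bar> * vnorm (completion V) x"
      using tendsto_mult[OF tendsto_const completion_norm[OF st(1)]] st by (simp add: vnorm_scale cauchy_carrier)
    ultimately show "vnorm (completion V) (c \<odot>\<^bsub>completion V\<^esub> x) = \<bar>c\<bar> * vnorm (completion V) x"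
      by (rule LIMSEQ_unique)
  qed
  ultimately show ?thesis by (rule seminormed.intro)
qed

text \<open>Bounded functionals map Cauchy sequences to Cauchy sequences. The extension is the limit
  along a chosen representative, and its third property shows independence of the choice.\<close>

lemma lin_functional_completion:
  assumes l: "lin_functional V l" and bound: "\<And>x. x \<in> carrier V \<Longrightarrow> \<bar>l x\<bar> \<le> \<kappa> * vnorm V x"
  obtains L where "lin_functional (completion V) L"
    "\<And>z. z \<in> carrier (completion V) \<Longrightarrow> \<bar>L z\<bar> \<le> \<kappa> * vnorm (completion V) z"
    "\<And>\<sigma>. cauchy \<sigma> \<Longrightarrow> (\<lambda>n. l (\<sigma> n)) \<longlonglongrightarrow> L (cls \<sigma>)"
proof -
  have conv: "convergent (\<lambda>n. l (\<sigma> n))" if s: "cauchy \<sigma>" for \<sigma>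
  proof -
    have "Cauchy (\<lambda>n. l (\<sigma> n))"
    proof (rule CauchyI)
      fix e :: real assume e: "0 < e"
      obtain K where K: "\<And>n m. K \<le> n \<Longrightarrow> K \<le> m \<Longrightarrow> vnorm V (\<sigma> n \<ominus> \<sigma> m) < e / (\<bar>\<kappa>\<bar> + 1)"
        using cauchyD[OF s, of "e / (\<bar>\<kappa>\<bar> + 1)"] e by auto
      have "norm (l (\<sigma> m) - l (\<sigma> n)) < e" if "K \<le> m" "K \<le> n" for m n
      proof -
        have c: "\<sigma> m \<in> carrier V" "\<sigma> n \<in> carrier V" by (simp_all add: cauchy_carrier s)
        have "norm (l (\<sigma> m) - l (\<sigma> n)) \<le> \<kappa> * vnorm V (\<sigma> m \<ominus> \<sigma> n)"
          using bound[of "\<sigma> m \<ominus> \<sigma> n"] c lin_functionalD(4)[OF l] by simp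
        also have "\<dots> \<le> (\<bar>\<kappa>\<bar> + 1) * vnorm V (\<sigma> m \<ominus> \<sigma> n)"
          using c by (intro mult_right_mono vnorm_nonneg) auto
        also have "\<dots> < e" using K[OF that] by (simp add: pos_less_divide_eq mult.commute)
        finally show ?thesis .
      qed
      thus "\<exists>K. \<forall>m\<ge>K. \<forall>n\<ge>K. norm (l (\<sigma> m) - l (\<sigma> n)) < e" by blast
    qed
    thus ?thesis by (simp add: Cauchy_convergent_iff)
  qed
  define L where "L = (\<lambda>z. lim (\<lambda>n. l ((SOME \<sigma>. cauchy \<sigma> \<and> z = cls \<sigma>) n)))"
  have lim: "(\<lambda>n. l (\<sigma> n)) \<longlonglongrightarrow> L (cls \<sigma>)" if s: "cauchy \<sigma>" for \<sigma>
  proof -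
    define \<tau> where "\<tau> = (SOME \<tau>. cauchy \<tau> \<and> cls \<sigma> = cls \<tau>)"
    have t: "cauchy \<tau>" "cls \<sigma> = cls \<tau>" using someI[of "\<lambda>\<tau>. cauchy \<tau> \<and> cls \<sigma> = cls \<tau>" \<sigma>] s by (simp_all add: \<tau>_def)
    have 1: "(\<lambda>n. l (\<tau> n)) \<longlonglongrightarrow> L (cls \<sigma>)"
      using conv[OF t(1)] by (simp add: L_def \<tau>_def convergent_LIMSEQ_iff)
    have "(\<lambda>n. \<kappa> * vnorm V (\<sigma> n \<ominus> \<tau> n)) \<longlonglongrightarrow> \<kappa> * 0"
      using t(2) cls_eq_iff[OF s t(1)] by (intro tendsto_mult tendsto_const) simp
    hence "(\<lambda>n. \<kappa> * vnorm V (\<sigma> n \<ominus> \<tau> n)) \<longlonglongrightarrow> 0" by simp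
    hence "(\<lambda>n. l (\<sigma> n) - l (\<tau> n)) \<longlonglongrightarrow> 0"
    proof (rule Lim_null_comparison[rotated], intro always_eventually allI)
      fix n
      show "norm (l (\<sigma> n) - l (\<tau> n)) \<le> \<kappa> * vnorm V (\<sigma> n \<ominus> \<tau> n)"
        using bound[of "\<sigma> n \<ominus> \<tau> n"] lin_functionalD(4)[OF l] cauchy_carrier s t by simp
    qed
    from tendsto_add[OF this 1] show ?thesis by simp
  qed
  have lin: "lin_functional (completion V) L"
    unfolding lin_functional_def
  proof (intro conjI ballI allI)
    fix x y assume "x \<in> carrier (completion V)" "y \<in> carrier (completion V)"
    then obtain \<sigma> \<tau> where st: "cauchy \<sigma>" "x = cls \<sigma>" "cauchy \<tau>" "y = cls \<tau>"
      by (auto simp: carrier_completion)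
    have "(\<lambda>n. l (\<sigma> n) + l (\<tau> n)) \<longlonglongrightarrow> L x + L y" unfolding st by (intro tendsto_add lim st)
    moreover have "(\<lambda>n. l (\<sigma> n) + l (\<tau> n)) \<longlonglongrightarrow> L (x \<oplus>\<^bsub>completion V\<^esub> y)"
      using lim[OF cauchy_add[OF st(1,3)]] st by (simp add: completion_add lin_functionalD[OF l] cauchy_carrier)
    ultimately show "L (x \<oplus>\<^bsub>completion V\<^esub> y) = L x + L y" using LIMSEQ_unique by blast
  next
    fix c x assume "x \<in> carrier (completion V)"
    then obtain \<sigma> where st: "cauchy \<sigma>" "x = cls \<sigma>" by (auto simp: carrier_completion)
    have "(\<lambda>n. c * l (\<sigma> n)) \<longlonglongrightarrow> c * L x" unfolding st by (intro tendsto_mult tendsto_const lim st)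
    moreover have "(\<lambda>n. c * l (\<sigma> n)) \<longlonglongrightarrow> L (c \<odot>\<^bsub>completion V\<^esub> x)"
      using lim[OF cauchy_scale[OF st(1)], of c] st by (simp add: completion_scale lin_functionalD[OF l] cauchy_carrier)
    ultimately show "L (c \<odot>\<^bsub>completion V\<^esub> x) = c * L x" using LIMSEQ_unique by blast
  qed
  have bnd: "\<bar>L z\<bar> \<le> \<kappa> * vnorm (completion V) z" if z: "z \<in> carrier (completion V)" for z
  proof -
    obtain \<sigma> where st: "cauchy \<sigma>" "z = cls \<sigma>" using z by (auto simp: carrier_completion)
    show ?thesis unfolding st
      by (rule LIMSEQ_le[OF tendsto_rabs[OF lim[OF st(1)]] tendsto_mult[OF tendsto_const completion_norm[OF st(1)]]])
        (use bound cauchy_carrier st in blast)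
  qed
  show ?thesis by (rule that[OF lin bnd lim])
qed

end

section \<open>Algebraic tensor products\<close>

lemma lookup_map_mult [simp]: "Poly_Mapping.lookup (Poly_Mapping.map ((*) c) f) k = (c::real) * Poly_Mapping.lookup f k"
  by (simp add: Poly_Mapping.map.rep_eq when_def)

lemma map_mult_single [simp]: "Poly_Mapping.map ((*) c) (Poly_Mapping.single k d) = Poly_Mapping.single k (c * d :: real)"
  by (rule poly_mapping_eqI) (simp add: lookup_single when_def)

lemma free_module_simps [simp]:
  "carrier (free_module I) = {f. Poly_Mapping.keys f \<subseteq> I}"
  "f \<oplus>\<^bsub>free_module I\<^esub> g = f + g" "\<zero>\<^bsub>free_module I\<^esub> = 0"
  "c \<odot>\<^bsub>free_module I\<^esub> f = Poly_Mapping.map ((*) c) f"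
  by (simp_all add: free_module_def)

lemma keys_add_subset: "Poly_Mapping.keys f \<subseteq> I \<Longrightarrow> Poly_Mapping.keys g \<subseteq> I \<Longrightarrow> Poly_Mapping.keys (f + g) \<subseteq> I"
  using Poly_Mapping.keys_add[of f g] by blast

lemma keys_map_mult_subset: "Poly_Mapping.keys f \<subseteq> I \<Longrightarrow> Poly_Mapping.keys (Poly_Mapping.map ((*) (c::real)) f) \<subseteq> I"
  by (auto simp: in_keys_iff)

lemma real_module_free: "real_module (free_module I)"
proof (rule real_moduleD, rule real_moduleI)
  show "abelian_group (free_module I)"
    by (rule abelian_groupI) (auto simp: keys_add_subset add_ac intro!: exI[of _ "- _"])
qed (auto simp: keys_map_mult_subset intro!: poly_mapping_eqI simp: lookup_add algebra_simps)

lemma free_module_minus: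
  assumes "Poly_Mapping.keys f \<subseteq> I"
  shows "\<ominus>\<^bsub>free_module I\<^esub> f = - f"
proof -
  interpret F: real_module "free_module I" by (rule real_module_free)
  have "\<ominus>\<^bsub>free_module I\<^esub> f = (-1) \<odot>\<^bsub>free_module I\<^esub> f"
    using F.scale_minus_one[of f] assms by simp
  also have "\<dots> = - f" by (rule poly_mapping_eqI) simp
  finally show ?thesis .
qed

lemma free_module_diff:
  "Poly_Mapping.keys g \<subseteq> I \<Longrightarrow> f \<ominus>\<^bsub>free_module I\<^esub> g = f - g"
  by (simp add: a_minus_def free_module_minus)

lemma finsum_free_module:
  "finite S \<Longrightarrow> (\<And>k. k \<in> S \<Longrightarrow> Poly_Mapping.keys (g k) \<subseteq> I) \<Longrightarrow> finsum (free_module I) g S = sum g S"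
proof (induction S rule: finite_induct)
  case empty
  interpret F: real_module "free_module I" by (rule real_module_free)
  show ?case by simp
next
  case (insert k S)
  interpret F: real_module "free_module I" by (rule real_module_free)
  have "g \<in> S \<rightarrow> carrier (free_module I)" "g k \<in> carrier (free_module I)" using insert.prems by auto
  thus ?case using insert by simp
qed

lemma submodule_submodule_hull:
  assumes "real_module M" "S \<subseteq> carrier M"
  shows "submodule (submodule_hull M S) real_scalars M" "S \<subseteq> submodule_hull M S"
    "submodule H real_scalars M \<Longrightarrow> S \<subseteq> H \<Longrightarrow> submodule_hull M S \<subseteq> H"
proof -
  interpret M: real_module M by fact
  have c: "submodule (carrier M) real_scalars M" by (rule M.carrier_is_submodule)
  show "submodule (submodule_hull M S) real_scalars M"
  proof (rule M.real_submoduleI)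
    show "submodule_hull M S \<subseteq> carrier M" using c assms(2) by (auto simp: submodule_hull_def)
    have *: "\<zero>\<^bsub>M\<^esub> \<in> H" "a \<in> H \<Longrightarrow> b \<in> H \<Longrightarrow> a \<oplus>\<^bsub>M\<^esub> b \<in> H" "a \<in> H \<Longrightarrow> r \<odot>\<^bsub>M\<^esub> a \<in> H"
      if H: "submodule H real_scalars M" for H a b r
    proof -
      interpret Q: real_quotient M H
        by (rule real_quotient.intro[OF assms(1)], rule real_quotient_axioms.intro[OF H])
      show "\<zero>\<^bsub>M\<^esub> \<in> H" "a \<in> H \<Longrightarrow> b \<in> H \<Longrightarrow> a \<oplus>\<^bsub>M\<^esub> b \<in> H" "a \<in> H \<Longrightarrow> r \<odot>\<^bsub>M\<^esub> a \<in> H"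
        using Q.N_zero Q.N_add Q.N_scale by auto
    qed
    show "\<zero>\<^bsub>M\<^esub> \<in> submodule_hull M S"
      "a \<in> submodule_hull M S \<Longrightarrow> b \<in> submodule_hull M S \<Longrightarrow> a \<oplus>\<^bsub>M\<^esub> b \<in> submodule_hull M S"
      "a \<in> submodule_hull M S \<Longrightarrow> r \<odot>\<^bsub>M\<^esub> a \<in> submodule_hull M S" for a b r
      using * by (auto simp: submodule_hull_def)
  qed
  show "S \<subseteq> submodule_hull M S" by (auto simp: submodule_hull_def)
  show "submodule H real_scalars M \<Longrightarrow> S \<subseteq> H \<Longrightarrow> submodule_hull M S \<subseteq> H" by (auto simp: submodule_hull_def)
qed

definition bounded_functional :: "'v normed_rec \<Rightarrow> ('v \<Rightarrow> real) \<Rightarrow> bool" where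
  "bounded_functional V l \<longleftrightarrow> lin_functional V l \<and> (\<exists>\<kappa>\<ge>0. \<forall>x\<in>carrier V. \<bar>l x\<bar> \<le> \<kappa> * vnorm V x)"

text \<open>Stands in for the Hahn-Banach theorem in infinite dimensions: for the two spaces that
  occur as factors, coordinate functionals separate points.\<close>

definition separated :: "'v normed_rec \<Rightarrow> bool" where
  "separated V \<longleftrightarrow> (\<forall>x\<in>carrier V. (\<forall>l. bounded_functional V l \<longrightarrow> l x = 0) \<longrightarrow> x = \<zero>\<^bsub>V\<^esub>)"

definition bilinear_on :: "'a normed_rec \<Rightarrow> 'b normed_rec \<Rightarrow> ('a \<Rightarrow> 'b \<Rightarrow> real) \<Rightarrow> bool" where
  "bilinear_on X Y \<beta> \<longleftrightarrow> (\<forall>x\<in>carrier X. lin_functional Y (\<beta> x)) \<and> (\<forall>y\<in>carrier Y. lin_functional X (\<lambda>x. \<beta> x y))"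

definition alg_normed :: "'a normed_rec \<Rightarrow> 'b normed_rec \<Rightarrow> ('a \<times> 'b \<Rightarrow>\<^sub>0 real) set normed_rec" where
  "alg_normed X Y = module.extend (alg_tensor X Y) (normed_rec.fields (proj_norm X Y))"

lemma proj_tensor_eq: "proj_tensor X Y = completion (alg_normed X Y)"
  by (simp add: proj_tensor_def alg_normed_def)

lemma alg_normed_simps [simp]:
  "carrier (alg_normed X Y) = carrier (alg_tensor X Y)"
  "add (alg_normed X Y) = add (alg_tensor X Y)"
  "zero (alg_normed X Y) = zero (alg_tensor X Y)"
  "module.smult (alg_normed X Y) = module.smult (alg_tensor X Y)"
  "vnorm (alg_normed X Y) = proj_norm X Y"
  by (simp_all add: alg_normed_def module.extend_def normed_rec.fields_def)

lemma alg_normed_finsum: "finsum (alg_normed X Y) = finsum (alg_tensor X Y)"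
  by (intro ext) (simp add: finsum_def finprod_def)

lemma real_module_finsum_Plus:
  assumes "real_module M" "finite S" "finite T" "f \<in> S \<rightarrow> carrier M" "g \<in> T \<rightarrow> carrier M"
  shows "finsum M (case_sum f g) (Sum_Type.Plus S T) = finsum M f S \<oplus>\<^bsub>M\<^esub> finsum M g T"
proof -
  interpret real_module M by fact
  have "finsum M (case_sum f g) (Inl ` S \<union> Inr ` T) = finsum M (case_sum f g) (Inl ` S) \<oplus>\<^bsub>M\<^esub> finsum M (case_sum f g) (Inr ` T)"
    using assms by (intro M.finsum_Un_disjoint) auto
  moreover have "finsum M (case_sum f g) (Inl ` S) = finsum M f S" "finsum M (case_sum f g) (Inr ` T) = finsum M g T"
    using assms by (subst M.finsum_reindex; auto)+
  ultimately show ?thesis by (simp add: Plus_def)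
qed

lemma real_module_finsum_reindex_bij:
  assumes "real_module M" "bij_betw h S T" "f \<in> T \<rightarrow> carrier M"
  shows "finsum M (\<lambda>k. f (h k)) S = finsum M f T"
proof -
  interpret real_module M by fact
  show ?thesis using M.finsum_reindex[of f h S] assms by (simp add: bij_betw_def)
qed

locale tensor_pair = X: seminormed X + Y: seminormed Y
  for X :: "'a normed_rec" and Y :: "'b normed_rec"
begin

abbreviation F where "F \<equiv> free_module (carrier X \<times> carrier Y)"
abbreviation A where "A \<equiv> alg_tensor X Y"
abbreviation pure where "pure \<equiv> pure_tensor X Y"

lemma bilinear_relations_subset: "bilinear_relations X Y \<subseteq> carrier F"
proof -
  have k: "Poly_Mapping.keys (Poly_Mapping.single (x, y) c) \<subseteq> carrier X \<times> carrier Y"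
    if "x \<in> carrier X" "y \<in> carrier Y" for x y and c :: real
    using that by auto
  have d: "Poly_Mapping.keys (f - g) \<subseteq> I" if "Poly_Mapping.keys f \<subseteq> I" "Poly_Mapping.keys g \<subseteq> I" for f g :: "'a \<times> 'b \<Rightarrow>\<^sub>0 real" and I
    using keys_diff[of f g] that by blast
  show ?thesis
    unfolding bilinear_relations_def Let_def free_module_simps
    by (intro Un_least subsetI; elim CollectE exE conjE; simp only: mem_Collect_eq; intro d k; simp)
qed

sublocale rel: real_quotient F "tensor_relations X Y"
proof (rule real_quotient.intro[OF real_module_free], rule real_quotient_axioms.intro)
  show "submodule (tensor_relations X Y) real_scalars F"
    unfolding tensor_relations_def
    by (rule submodule_submodule_hull(1)[OF real_module_free bilinear_relations_subset])
qed

lemma relationI: "f \<in> bilinear_relations X Y \<Longrightarrow> f \<in> tensor_relations X Y"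
  unfolding tensor_relations_def
  using submodule_submodule_hull(2)[OF real_module_free bilinear_relations_subset] by blast

lemma alg_tensor_quot: "A = quot_module F (tensor_relations X Y)"
  by (simp add: alg_tensor_def)

sublocale A: real_module A
  unfolding alg_tensor_quot by (rule rel.real_module_quot)

lemma alg_tensor_cosetE:
  assumes "z \<in> carrier A"
  obtains f where "f \<in> carrier F" "z = rel.coset f"
proof -
  have "z \<in> rel.coset ` carrier F" using assms by (simp only: alg_tensor_quot rel.carrier_quot)
  thus ?thesis by (elim imageE) (rule that)
qed

lemma pure_closed [simp]: "x \<in> carrier X \<Longrightarrow> y \<in> carrier Y \<Longrightarrow> pure x y \<in> carrier A"
  unfolding pure_tensor_def alg_tensor_quot by (rule rel.coset_in_quot) simp

lemma single_coset:
  "x \<in> carrier X \<Longrightarrow> y \<in> carrier Y \<Longrightarrow> rel.coset (Poly_Mapping.single (x, y) c) = c \<odot>\<^bsub>A\<^esub> pure x y"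
  unfolding pure_tensor_def alg_tensor_quot by (subst rel.quot_scale) auto

lemma coset_eqI:
  assumes "f \<in> carrier F" "g \<in> carrier F" "f - g \<in> bilinear_relations X Y"
  shows "rel.coset f = rel.coset g"
proof -
  have "f \<ominus>\<^bsub>F\<^esub> g = f - g" using assms(2) by (simp add: free_module_diff)
  thus ?thesis using rel.coset_eq_iff[OF assms(1,2)] relationI[OF assms(3)] by (simp only:)
qed

lemma single_in_free: "x \<in> carrier X \<Longrightarrow> y \<in> carrier Y \<Longrightarrow> Poly_Mapping.single (x, y) c \<in> carrier F"
  by simp

lemma sum_single_in_free:
  "x \<in> carrier X \<Longrightarrow> y \<in> carrier Y \<Longrightarrow> x' \<in> carrier X \<Longrightarrow> y' \<in> carrier Y \<Longrightarrow>
    Poly_Mapping.single (x, y) c + Poly_Mapping.single (x', y') c' \<in> carrier F"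
  unfolding free_module_simps mem_Collect_eq by (rule keys_add_subset) auto

lemma pure_plus:
  assumes "x \<in> carrier X" "y \<in> carrier Y" "x' \<in> carrier X" "y' \<in> carrier Y"
  shows "rel.coset (Poly_Mapping.single (x, y) 1 + Poly_Mapping.single (x', y') 1) = pure x y \<oplus>\<^bsub>A\<^esub> pure x' y'"
  using rel.quot_add[OF single_in_free[OF assms(1,2), of 1] single_in_free[OF assms(3,4), of 1]]
  by (simp only: pure_tensor_def alg_tensor_quot free_module_simps)

lemma pure_add_left:
  assumes "x \<in> carrier X" "x' \<in> carrier X" "y \<in> carrier Y"
  shows "pure (x \<oplus>\<^bsub>X\<^esub> x') y = pure x y \<oplus>\<^bsub>A\<^esub> pure x' y"
proof -
  let ?e = "\<lambda>x. Poly_Mapping.single (x, y) (1::real)"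
  have "?e (x \<oplus>\<^bsub>X\<^esub> x') - ?e x - ?e x' \<in> bilinear_relations X Y"
    unfolding bilinear_relations_def Let_def
    by (intro UnI1 CollectI exI conjI, rule refl) (rule assms)+
  hence "rel.coset (?e (x \<oplus>\<^bsub>X\<^esub> x')) = rel.coset (?e x + ?e x')"
    by (intro coset_eqI single_in_free sum_single_in_free X.a_closed assms) (simp only: diff_diff_eq)
  thus ?thesis unfolding pure_plus[OF assms(1,3,2,3), symmetric] by (simp only: pure_tensor_def)
qed

lemma pure_add_right:
  assumes "x \<in> carrier X" "y \<in> carrier Y" "y' \<in> carrier Y"
  shows "pure x (y \<oplus>\<^bsub>Y\<^esub> y') = pure x y \<oplus>\<^bsub>A\<^esub> pure x y'"
proof -
  let ?e = "\<lambda>y. Poly_Mapping.single (x, y) (1::real)"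
  have "?e (y \<oplus>\<^bsub>Y\<^esub> y') - ?e y - ?e y' \<in> bilinear_relations X Y"
    unfolding bilinear_relations_def Let_def
    by (intro UnI1[OF UnI1] UnI2 CollectI exI conjI, rule refl) (rule assms)+
  hence "rel.coset (?e (y \<oplus>\<^bsub>Y\<^esub> y')) = rel.coset (?e y + ?e y')"
    by (intro coset_eqI single_in_free sum_single_in_free Y.a_closed assms) (simp only: diff_diff_eq)
  thus ?thesis unfolding pure_plus[OF assms(1,2,1,3), symmetric] by (simp only: pure_tensor_def)
qed

lemma pure_scale_left:
  assumes "x \<in> carrier X" "y \<in> carrier Y"
  shows "pure (c \<odot>\<^bsub>X\<^esub> x) y = c \<odot>\<^bsub>A\<^esub> pure x y"
proof -
  have "Poly_Mapping.single (c \<odot>\<^bsub>X\<^esub> x, y) 1 - Poly_Mapping.single (x, y) c \<in> bilinear_relations X Y"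
    unfolding bilinear_relations_def Let_def
    by (intro UnI1[OF UnI2] CollectI exI conjI, rule refl) (rule assms)+
  hence "rel.coset (Poly_Mapping.single (c \<odot>\<^bsub>X\<^esub> x, y) 1) = rel.coset (Poly_Mapping.single (x, y) c)"
    by (intro coset_eqI single_in_free X.scale_closed assms)
  thus ?thesis unfolding single_coset[OF assms, symmetric] by (simp only: pure_tensor_def)
qed

lemma pure_scale_right:
  assumes "x \<in> carrier X" "y \<in> carrier Y"
  shows "pure x (c \<odot>\<^bsub>Y\<^esub> y) = c \<odot>\<^bsub>A\<^esub> pure x y"
proof -
  have "Poly_Mapping.single (x, c \<odot>\<^bsub>Y\<^esub> y) 1 - Poly_Mapping.single (x, y) c \<in> bilinear_relations X Y"
    unfolding bilinear_relations_def Let_def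
    by (intro UnI2 CollectI exI conjI, rule refl) (rule assms)+
  hence "rel.coset (Poly_Mapping.single (x, c \<odot>\<^bsub>Y\<^esub> y) 1) = rel.coset (Poly_Mapping.single (x, y) c)"
    by (intro coset_eqI single_in_free Y.scale_closed assms)
  thus ?thesis unfolding single_coset[OF assms, symmetric] by (simp only: pure_tensor_def)
qed

lemma pure_zero_left: "y \<in> carrier Y \<Longrightarrow> pure \<zero>\<^bsub>X\<^esub> y = \<zero>\<^bsub>A\<^esub>"
  using pure_scale_left[of "\<zero>\<^bsub>X\<^esub>" y 0] by simp

lemma pure_zero_right: "x \<in> carrier X \<Longrightarrow> pure x \<zero>\<^bsub>Y\<^esub> = \<zero>\<^bsub>A\<^esub>"
  using pure_scale_right[of x "\<zero>\<^bsub>Y\<^esub>" 0] by simp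

lemma pure_finsum_right:
  "x \<in> carrier X \<Longrightarrow> finite S \<Longrightarrow> y \<in> S \<rightarrow> carrier Y \<Longrightarrow>
    pure x (finsum Y y S) = finsum A (\<lambda>k. pure x (y k)) S"
  by (rule real_module_finsum_map[OF Y.real_module_axioms A.real_module_axioms])
    (auto simp: pure_add_right pure_zero_right)

lemma pure_finsum_left:
  "y \<in> carrier Y \<Longrightarrow> finite S \<Longrightarrow> x \<in> S \<rightarrow> carrier X \<Longrightarrow>
    pure (finsum X x S) y = finsum A (\<lambda>k. pure (x k) y) S"
  by (rule real_module_finsum_map[OF X.real_module_axioms A.real_module_axioms])
    (auto simp: pure_add_left pure_zero_left)

text \<open>The coefficients of a representative are moved into the first factors of its
  pairs.\<close>

lemma alg_tensor_elem:
  assumes "z \<in> carrier A"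
  obtains N :: nat and x y where "\<And>i. i < N \<Longrightarrow> x i \<in> carrier X" "\<And>i. i < N \<Longrightarrow> y i \<in> carrier Y"
    "z = finsum A (\<lambda>i. pure (x i) (y i)) {..<N}"
proof -
  obtain f where f: "Poly_Mapping.keys f \<subseteq> carrier X \<times> carrier Y" "z = rel.coset f"
    using assms unfolding alg_tensor_quot rel.carrier_quot by auto
  let ?K = "Poly_Mapping.keys f"
  obtain h where h: "bij_betw h {..<card ?K} ?K"
    using ex_bij_betw_nat_finite[of ?K] by (auto simp: atLeast0LessThan)
  define g where "g = (\<lambda>k. Poly_Mapping.single k (Poly_Mapping.lookup f k))"
  have g: "Poly_Mapping.keys (g k) \<subseteq> carrier X \<times> carrier Y" if "k \<in> ?K" for k
    using f(1) that by (auto simp: g_def)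
  have "f = sum g ?K"
    by (rule poly_mapping_eqI) (simp add: g_def lookup_sum lookup_single when_def sum.delta in_keys_iff)
  also have "\<dots> = finsum F g ?K" using g by (subst finsum_free_module) auto
  finally have "f = finsum F g ?K" .
  hence "z = rel.coset (finsum F g ?K)" using f(2) by simp
  also have "\<dots> = finsum A (\<lambda>k. rel.coset (g k)) ?K"
    unfolding alg_tensor_quot
  proof (rule real_module_finsum_map[OF real_module_free rel.real_module_quot])
    show "g \<in> ?K \<rightarrow> carrier F" using g by simp
  qed (rule rel.coset_in_quot rel.quot_add[symmetric] rel.quot_zero[symmetric] finite_keys; assumption?)+
  also have "\<dots> = finsum A (\<lambda>k. pure (Poly_Mapping.lookup f k \<odot>\<^bsub>X\<^esub> fst k) (snd k)) ?K"
  proof (rule A.finsum_cong')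
    fix k assume "k \<in> ?K"
    hence k: "fst k \<in> carrier X" "snd k \<in> carrier Y" using f(1) by auto
    show "rel.coset (g k) = pure (Poly_Mapping.lookup f k \<odot>\<^bsub>X\<^esub> fst k) (snd k)"
      unfolding pure_scale_left[OF k] g_def single_coset[OF k, symmetric] by (simp only: prod.collapse)
  next
    show "(\<lambda>k. pure (Poly_Mapping.lookup f k \<odot>\<^bsub>X\<^esub> fst k) (snd k)) \<in> ?K \<rightarrow> carrier A"
      using f(1) by (intro Pi_I pure_closed X.scale_closed) auto
  qed (rule refl)
  also have "\<dots> = finsum A (\<lambda>i. pure (Poly_Mapping.lookup f (h i) \<odot>\<^bsub>X\<^esub> fst (h i)) (snd (h i))) {..<card ?K}"
    by (rule real_module_finsum_reindex_bij[OF A.real_module_axioms h, symmetric],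
        intro Pi_I pure_closed X.scale_closed) (use f(1) in auto)
  finally have z: "z = finsum A (\<lambda>i. pure (Poly_Mapping.lookup f (h i) \<odot>\<^bsub>X\<^esub> fst (h i)) (snd (h i))) {..<card ?K}" .
  have hi: "h i \<in> carrier X \<times> carrier Y" if "i < card ?K" for i
    using bij_betw_apply[OF h] f(1) that by blast
  show ?thesis
    by (rule that[OF _ _ z]) (simp_all only: X.scale_closed hi[unfolded mem_Times_iff])
qed

text \<open>The universal property for scalar forms: the linear extension of \<beta> to the free
  module vanishes on the bilinearity relations, so it descends to cosets.\<close>

lemma bilinear_lift:
  assumes \<beta>: "bilinear_on X Y \<beta>"
  obtains l where "lin_functional A l" "\<And>x y. x \<in> carrier X \<Longrightarrow> y \<in> carrier Y \<Longrightarrow> l (pure x y) = \<beta> x y"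
proof -
  define ev where "ev = (\<lambda>f :: 'a \<times> 'b \<Rightarrow>\<^sub>0 real. \<Sum>k\<in>Poly_Mapping.keys f. Poly_Mapping.lookup f k * \<beta> (fst k) (snd k))"
  have ev: "ev f = (\<Sum>k\<in>S. Poly_Mapping.lookup f k * \<beta> (fst k) (snd k))" if "finite S" "Poly_Mapping.keys f \<subseteq> S" for f S
    unfolding ev_def using that by (intro sum.mono_neutral_left) (auto simp: in_keys_iff)
  have ev_add: "ev (f + g) = ev f + ev g" for f g
  proof -
    let ?S = "Poly_Mapping.keys f \<union> Poly_Mapping.keys g"
    have "Poly_Mapping.keys (f + g) \<subseteq> ?S" by (rule keys_add_subset) auto
    thus ?thesis using ev[of ?S f] ev[of ?S g] ev[of ?S "f + g"]
      by (simp add: lookup_add distrib_right sum.distrib)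
  qed
  have ev_scale: "ev (Poly_Mapping.map ((*) c) f) = c * ev f" for c f
  proof -
    let ?S = "Poly_Mapping.keys f"
    have "ev (Poly_Mapping.map ((*) c) f) =
        (\<Sum>k\<in>?S. Poly_Mapping.lookup (Poly_Mapping.map ((*) c) f) k * \<beta> (fst k) (snd k))"
      by (rule ev[OF finite_keys keys_map_mult_subset[OF subset_refl]])
    also have "\<dots> = (\<Sum>k\<in>?S. c * (Poly_Mapping.lookup f k * \<beta> (fst k) (snd k)))"
      by (simp only: lookup_map_mult mult.assoc)
    also have "\<dots> = c * ev f" by (simp only: ev_def sum_distrib_left)
    finally show ?thesis .
  qed
  have ev_diff: "ev (f - g) = ev f - ev g" for f g
  proof -
    have "ev (f - g) + ev g = ev f" using ev_add[of "f - g" g] by simp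
    thus ?thesis by simp
  qed
  have ev_single: "ev (Poly_Mapping.single (x, y) c) = c * \<beta> x y" for x y c
    using ev[of "{(x, y)}" "Poly_Mapping.single (x, y) c"] by simp
  have lin1: "lin_functional X (\<lambda>x. \<beta> x y)" if "y \<in> carrier Y" for y
    using \<beta> that unfolding bilinear_on_def by (elim conjE) (erule bspec)
  have lin2: "lin_functional Y (\<beta> x)" if "x \<in> carrier X" for x
    using \<beta> that unfolding bilinear_on_def by (elim conjE) (erule bspec)
  note \<beta>1 = X.lin_functionalD(1,2)[OF lin1] and \<beta>2 = Y.lin_functionalD(1,2)[OF lin2]
  let ?H = "{f \<in> carrier F. ev f = 0}"
  have "submodule ?H real_scalars F"
    by (rule rel.real_submoduleI) (auto simp: ev_add ev_scale keys_add_subset keys_map_mult_subset, simp add: ev_def)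
  moreover have "bilinear_relations X Y \<subseteq> ?H"
  proof
    fix f assume f: "f \<in> bilinear_relations X Y"
    hence "ev f = 0"
      unfolding bilinear_relations_def Let_def Un_iff mem_Collect_eq
      by (elim disjE exE conjE) (simp_all only: ev_diff ev_single \<beta>1 \<beta>2 mult_1 add_diff_cancel_left' diff_self)
    thus "f \<in> ?H" using f bilinear_relations_subset by blast
  qed
  ultimately have ker: "tensor_relations X Y \<subseteq> ?H"
    unfolding tensor_relations_def by (rule submodule_submodule_hull(3)[OF real_module_free bilinear_relations_subset])
  define l where "l = (\<lambda>z. ev (SOME f. f \<in> carrier F \<and> z = rel.coset f))"
  have l: "l (rel.coset f) = ev f" if f: "f \<in> carrier F" for f
  proof -
    define g where "g = (SOME g. g \<in> carrier F \<and> rel.coset f = rel.coset g)"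
    have g: "g \<in> carrier F" "rel.coset f = rel.coset g"
      using someI[of "\<lambda>g. g \<in> carrier F \<and> rel.coset f = rel.coset g" f] f by (simp_all only: g_def)
    hence "f \<ominus>\<^bsub>F\<^esub> g \<in> tensor_relations X Y" using rel.coset_eq_iff f by blast
    hence "f - g \<in> ?H" using ker g(1) by (auto simp: free_module_diff)
    hence "ev f = ev g" by (simp add: ev_diff)
    thus ?thesis by (simp add: l_def g_def)
  qed
  have lin: "lin_functional A l"
    unfolding lin_functional_def
  proof (intro conjI ballI allI)
    fix z w assume z: "z \<in> carrier A" and w: "w \<in> carrier A"
    obtain f where f: "f \<in> carrier F" "z = rel.coset f" by (rule alg_tensor_cosetE[OF z])
    obtain g where g: "g \<in> carrier F" "w = rel.coset g" by (rule alg_tensor_cosetE[OF w])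
    note fg = f g
    have "f \<oplus>\<^bsub>F\<^esub> g \<in> carrier F" using fg by (simp add: keys_add_subset)
    moreover have "z \<oplus>\<^bsub>A\<^esub> w = rel.coset (f \<oplus>\<^bsub>F\<^esub> g)"
      unfolding alg_tensor_quot fg(2,4) by (rule rel.quot_add[OF fg(1,3)])
    ultimately have "l (z \<oplus>\<^bsub>A\<^esub> w) = ev (f \<oplus>\<^bsub>F\<^esub> g)" by (simp only: l)
    thus "l (z \<oplus>\<^bsub>A\<^esub> w) = l z + l w"
      unfolding fg(2,4) l[OF fg(1)] l[OF fg(3)] by (simp only: ev_add free_module_simps)
  next
    fix c z assume z: "z \<in> carrier A"
    obtain f where f: "f \<in> carrier F" "z = rel.coset f" by (rule alg_tensor_cosetE[OF z])
    have "c \<odot>\<^bsub>F\<^esub> f \<in> carrier F" using f by (simp add: keys_map_mult_subset)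
    moreover have "c \<odot>\<^bsub>A\<^esub> z = rel.coset (c \<odot>\<^bsub>F\<^esub> f)"
      unfolding alg_tensor_quot f(2) by (rule rel.quot_scale[OF f(1)])
    ultimately have "l (c \<odot>\<^bsub>A\<^esub> z) = ev (c \<odot>\<^bsub>F\<^esub> f)" by (simp only: l)
    thus "l (c \<odot>\<^bsub>A\<^esub> z) = c * l z"
      unfolding f(2) l[OF f(1)] by (simp only: ev_scale free_module_simps)
  qed
  have lp: "l (pure x y) = \<beta> x y" if xy: "x \<in> carrier X" "y \<in> carrier Y" for x y
  proof -
    have "Poly_Mapping.single (x, y) 1 \<in> carrier F" using xy by simp
    from l[OF this] show ?thesis unfolding pure_tensor_def by (simp only: ev_single mult_1)
  qed
  show ?thesis by (rule that[OF lin lp])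
qed

end

section \<open>The projective norm\<close>

context tensor_pair
begin

lemma proj_norm_le:
  assumes S: "finite S" and x: "\<And>k. k \<in> S \<Longrightarrow> x k \<in> carrier X" and y: "\<And>k. k \<in> S \<Longrightarrow> y k \<in> carrier Y"
    and z: "z = finsum A (\<lambda>k. pure (x k) (y k)) S"
  shows "proj_norm X Y z \<le> (\<Sum>k\<in>S. vnorm X (x k) * vnorm Y (y k))"
proof -
  obtain h where h: "bij_betw h {..<card S} S"
    using ex_bij_betw_nat_finite[OF S] by (auto simp: atLeast0LessThan)
  have hS: "h i \<in> S" if "i < card S" for i using bij_betw_apply[OF h] that by simp
  have "(\<lambda>k. pure (x k) (y k)) \<in> S \<rightarrow> carrier A" using x y by simp
  hence z': "z = finsum A (\<lambda>i. pure (x (h i)) (y (h i))) {..<card S}"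
    unfolding z by (rule real_module_finsum_reindex_bij[OF A.real_module_axioms h, symmetric])
  have s: "(\<Sum>k\<in>S. vnorm X (x k) * vnorm Y (y k)) = (\<Sum>i<card S. vnorm X (x (h i)) * vnorm Y (y (h i)))"
    by (rule sum.reindex_bij_betw[OF h, symmetric])
  show ?thesis
    unfolding proj_norm_def s
  proof (rule cInf_lower)
    show "bdd_below {\<Sum>i<N. vnorm X (x i) * vnorm Y (y i) | (N :: nat) x y.
        (\<forall>i<N. x i \<in> carrier X \<and> y i \<in> carrier Y) \<and> z = finsum A (\<lambda>i. pure (x i) (y i)) {..<N}}"
      by (rule bdd_belowI[of _ 0]) (auto intro!: sum_nonneg mult_nonneg_nonneg X.vnorm_nonneg Y.vnorm_nonneg)
    show "(\<Sum>i<card S. vnorm X (x (h i)) * vnorm Y (y (h i))) \<in> {\<Sum>i<N. vnorm X (x i) * vnorm Y (y i) | (N :: nat) x y.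
        (\<forall>i<N. x i \<in> carrier X \<and> y i \<in> carrier Y) \<and> z = finsum A (\<lambda>i. pure (x i) (y i)) {..<N}}"
      using hS x y z' by (intro CollectI exI[of _ "card S"] exI[of _ "\<lambda>i. x (h i)"] exI[of _ "\<lambda>i. y (h i)"]) auto
  qed
qed

lemma proj_norm_costs_nonempty:
  assumes "z \<in> carrier A"
  shows "{\<Sum>i<N. vnorm X (x i) * vnorm Y (y i) | (N :: nat) x y.
        (\<forall>i<N. x i \<in> carrier X \<and> y i \<in> carrier Y) \<and> z = finsum A (\<lambda>i. pure (x i) (y i)) {..<N}} \<noteq> {}"
proof -
  obtain N :: nat and x y where "\<And>i. i < N \<Longrightarrow> x i \<in> carrier X" "\<And>i. i < N \<Longrightarrow> y i \<in> carrier Y"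
    "z = finsum A (\<lambda>i. pure (x i) (y i)) {..<N}"
    by (rule alg_tensor_elem[OF assms]) (rule that)
  thus ?thesis by blast
qed

lemma proj_norm_nonneg: "z \<in> carrier A \<Longrightarrow> 0 \<le> proj_norm X Y z"
  unfolding proj_norm_def
  by (rule cInf_greatest[OF proj_norm_costs_nonempty])
    (auto intro!: sum_nonneg mult_nonneg_nonneg X.vnorm_nonneg Y.vnorm_nonneg)

lemma proj_norm_rep:
  assumes "z \<in> carrier A" "0 < e"
  obtains N :: nat and x y where "\<And>i. i < N \<Longrightarrow> x i \<in> carrier X" "\<And>i. i < N \<Longrightarrow> y i \<in> carrier Y"
    "z = finsum A (\<lambda>i. pure (x i) (y i)) {..<N}"
    "(\<Sum>i<N. vnorm X (x i) * vnorm Y (y i)) < proj_norm X Y z + e"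
proof -
  define r where "r = proj_norm X Y z + e"
  have "proj_norm X Y z < r" using assms by (simp add: r_def)
  from cInf_lessD[OF proj_norm_costs_nonempty[OF assms(1)] this[unfolded proj_norm_def]]
  obtain s where s: "s \<in> {\<Sum>i<N. vnorm X (x i) * vnorm Y (y i) | (N :: nat) x y.
        (\<forall>i<N. x i \<in> carrier X \<and> y i \<in> carrier Y) \<and> z = finsum A (\<lambda>i. pure (x i) (y i)) {..<N}}"
    "s < r" by (elim bexE) (rule that)
  from s(1) obtain N :: nat and x y where "s = (\<Sum>i<N. vnorm X (x i) * vnorm Y (y i))"
    "\<forall>i<N. x i \<in> carrier X \<and> y i \<in> carrier Y" "z = finsum A (\<lambda>i. pure (x i) (y i)) {..<N}"
    by (elim CollectE exE conjE) (rule that)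
  with s(2) show ?thesis unfolding r_def by (intro that[of N x y]) auto
qed

lemma proj_norm_pure_le: "x \<in> carrier X \<Longrightarrow> y \<in> carrier Y \<Longrightarrow> proj_norm X Y (pure x y) \<le> vnorm X x * vnorm Y y"
  using proj_norm_le[of "{()}" "\<lambda>_. x" "\<lambda>_. y" "pure x y"] by simp

lemma proj_norm_zero: "proj_norm X Y \<zero>\<^bsub>A\<^esub> = 0"
  using proj_norm_le[of "{}" undefined undefined "\<zero>\<^bsub>A\<^esub>"] proj_norm_nonneg[of "\<zero>\<^bsub>A\<^esub>"] by simp

lemma proj_norm_add_le:
  assumes z: "z \<in> carrier A" and w: "w \<in> carrier A"
  shows "proj_norm X Y (z \<oplus>\<^bsub>A\<^esub> w) \<le> proj_norm X Y z + proj_norm X Y w"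
proof (rule field_le_epsilon)
  fix e :: real assume e: "0 < e"
  have e2: "0 < e / 2" using e by simp
  obtain N :: nat and x y where r: "\<And>i. i < N \<Longrightarrow> x i \<in> carrier X" "\<And>i. i < N \<Longrightarrow> y i \<in> carrier Y"
    "z = finsum A (\<lambda>i. pure (x i) (y i)) {..<N}"
    "(\<Sum>i<N. vnorm X (x i) * vnorm Y (y i)) < proj_norm X Y z + e / 2"
    by (rule proj_norm_rep[OF z e2]) (rule that)
  obtain M :: nat and u v where s: "\<And>i. i < M \<Longrightarrow> u i \<in> carrier X" "\<And>i. i < M \<Longrightarrow> v i \<in> carrier Y"
    "w = finsum A (\<lambda>i. pure (u i) (v i)) {..<M}"
    "(\<Sum>i<M. vnorm X (u i) * vnorm Y (v i)) < proj_norm X Y w + e / 2"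
    by (rule proj_norm_rep[OF w e2]) (rule that)
  let ?S = "Sum_Type.Plus {..<N} {..<M}"
  have "finsum A (case_sum (\<lambda>i. pure (x i) (y i)) (\<lambda>i. pure (u i) (v i))) ?S = z \<oplus>\<^bsub>A\<^esub> w"
    unfolding r(3) s(3) using r s by (intro real_module_finsum_Plus[OF A.real_module_axioms]) simp_all
  moreover have "case_sum (\<lambda>i. pure (x i) (y i)) (\<lambda>i. pure (u i) (v i)) =
      (\<lambda>k. pure (case_sum x u k) (case_sum y v k))"
    by (rule ext) (simp split: sum.split)
  ultimately have eq: "z \<oplus>\<^bsub>A\<^esub> w = finsum A (\<lambda>k. pure (case_sum x u k) (case_sum y v k)) ?S" by simp
  have "proj_norm X Y (z \<oplus>\<^bsub>A\<^esub> w) \<le> (\<Sum>k\<in>?S. vnorm X (case_sum x u k) * vnorm Y (case_sum y v k))"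
    by (rule proj_norm_le[OF _ _ _ eq]) (use r s in \<open>auto split: sum.split\<close>)
  also have "\<dots> = (\<Sum>i<N. vnorm X (x i) * vnorm Y (y i)) + (\<Sum>i<M. vnorm X (u i) * vnorm Y (v i))"
    by (subst sum.Plus) (simp_all add: o_def)
  finally show "proj_norm X Y (z \<oplus>\<^bsub>A\<^esub> w) \<le> proj_norm X Y z + proj_norm X Y w + e" using r(4) s(4) by linarith
qed

lemma proj_norm_scale_le:
  assumes z: "z \<in> carrier A"
  shows "proj_norm X Y (c \<odot>\<^bsub>A\<^esub> z) \<le> \<bar>c\<bar> * proj_norm X Y z"
proof (rule field_le_epsilon)
  fix e :: real assume e: "0 < e"
  have e2: "0 < e / (\<bar>c\<bar> + 1)" using e by simp
  obtain N :: nat and x y where r: "\<And>i. i < N \<Longrightarrow> x i \<in> carrier X" "\<And>i. i < N \<Longrightarrow> y i \<in> carrier Y"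
    "z = finsum A (\<lambda>i. pure (x i) (y i)) {..<N}"
    "(\<Sum>i<N. vnorm X (x i) * vnorm Y (y i)) < proj_norm X Y z + e / (\<bar>c\<bar> + 1)"
    by (rule proj_norm_rep[OF z e2]) (rule that)
  have "c \<odot>\<^bsub>A\<^esub> z = finsum A (\<lambda>i. c \<odot>\<^bsub>A\<^esub> pure (x i) (y i)) {..<N}"
    unfolding r(3) by (rule A.scale_finsum) (use r in simp_all)
  also have "\<dots> = finsum A (\<lambda>i. pure (c \<odot>\<^bsub>X\<^esub> x i) (y i)) {..<N}"
    by (rule A.finsum_cong') (use r in \<open>simp_all add: pure_scale_left\<close>)
  finally have eq: "c \<odot>\<^bsub>A\<^esub> z = finsum A (\<lambda>i. pure (c \<odot>\<^bsub>X\<^esub> x i) (y i)) {..<N}" .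
  have "proj_norm X Y (c \<odot>\<^bsub>A\<^esub> z) \<le> (\<Sum>i<N. vnorm X (c \<odot>\<^bsub>X\<^esub> x i) * vnorm Y (y i))"
    by (rule proj_norm_le[OF _ _ _ eq]) (use r in auto)
  also have "\<dots> = \<bar>c\<bar> * (\<Sum>i<N. vnorm X (x i) * vnorm Y (y i))"
    unfolding sum_distrib_left by (rule sum.cong) (use r in \<open>auto simp: X.vnorm_scale\<close>)
  also have "\<dots> \<le> \<bar>c\<bar> * (proj_norm X Y z + e / (\<bar>c\<bar> + 1))"
    using r(4) by (intro mult_left_mono) auto
  also have "\<dots> \<le> \<bar>c\<bar> * proj_norm X Y z + e"
    using e by (simp add: distrib_left pos_divide_le_eq)
  finally show "proj_norm X Y (c \<odot>\<^bsub>A\<^esub> z) \<le> \<bar>c\<bar> * proj_norm X Y z + e" .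
qed

lemma seminormed_alg_normed: "seminormed (alg_normed X Y)"
proof (rule seminormed.intro)
  show "real_module (alg_normed X Y)"
  proof (rule real_moduleD, rule real_moduleI)
    show "abelian_group (alg_normed X Y)"
      by (rule abelian_groupI) (auto simp: A.M.a_ac intro: bexI[of _ "\<ominus>\<^bsub>A\<^esub> _"] A.M.l_neg)
  qed (auto simp: A.scale_add_left A.scale_add_right A.scale_scale)
  show "seminormed_axioms (alg_normed X Y)"
  proof
    fix z c assume z: "z \<in> carrier (alg_normed X Y)"
    have "\<bar>c\<bar> * proj_norm X Y z \<le> proj_norm X Y (c \<odot>\<^bsub>A\<^esub> z)"
    proof (cases "c = 0")
      case False
      have "z = inverse c \<odot>\<^bsub>A\<^esub> (c \<odot>\<^bsub>A\<^esub> z)" using z False by (simp add: A.scale_scale)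
      hence "proj_norm X Y z \<le> \<bar>inverse c\<bar> * proj_norm X Y (c \<odot>\<^bsub>A\<^esub> z)"
        using proj_norm_scale_le[of "c \<odot>\<^bsub>A\<^esub> z" "inverse c"] z by simp
      hence "\<bar>c\<bar> * proj_norm X Y z \<le> \<bar>c\<bar> * (\<bar>inverse c\<bar> * proj_norm X Y (c \<odot>\<^bsub>A\<^esub> z))"
        by (rule mult_left_mono) simp
      also have "\<bar>c\<bar> * (\<bar>inverse c\<bar> * proj_norm X Y (c \<odot>\<^bsub>A\<^esub> z)) = proj_norm X Y (c \<odot>\<^bsub>A\<^esub> z)"
        using False by simp
      finally show ?thesis .
    qed (use z proj_norm_zero in simp)
    thus "vnorm (alg_normed X Y) (c \<odot>\<^bsub>alg_normed X Y\<^esub> z) = \<bar>c\<bar> * vnorm (alg_normed X Y) z"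
      using proj_norm_scale_le[of z c] z by simp
  qed (simp add: proj_norm_add_le)
qed

text \<open>A nearly optimal representation passes the bound on pure tensors to their sum; dividing
  the slack by \<kappa> + 1 covers \<kappa> = 0.\<close>

lemma lin_functional_bound:
  assumes l: "lin_functional A l" and "0 \<le> \<kappa>"
    and b: "\<And>x y. x \<in> carrier X \<Longrightarrow> y \<in> carrier Y \<Longrightarrow> \<bar>l (pure x y)\<bar> \<le> \<kappa> * (vnorm X x * vnorm Y y)"
    and z: "z \<in> carrier A"
  shows "\<bar>l z\<bar> \<le> \<kappa> * proj_norm X Y z"
proof (rule field_le_epsilon)
  fix e :: real assume e: "0 < e"
  have e2: "0 < e / (\<kappa> + 1)" using e assms(2) by simp
  obtain N :: nat and x y where r: "\<And>i. i < N \<Longrightarrow> x i \<in> carrier X" "\<And>i. i < N \<Longrightarrow> y i \<in> carrier Y"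
    "z = finsum A (\<lambda>i. pure (x i) (y i)) {..<N}"
    "(\<Sum>i<N. vnorm X (x i) * vnorm Y (y i)) < proj_norm X Y z + e / (\<kappa> + 1)"
    by (rule proj_norm_rep[OF z e2]) (rule that)
  have "l z = (\<Sum>i<N. l (pure (x i) (y i)))"
    unfolding r(3) by (rule A.lin_functional_finsum[OF l]) (use r in simp_all)
  hence "\<bar>l z\<bar> \<le> (\<Sum>i<N. \<bar>l (pure (x i) (y i))\<bar>)" by simp
  also have "\<dots> \<le> (\<Sum>i<N. \<kappa> * (vnorm X (x i) * vnorm Y (y i)))"
    by (intro sum_mono b r) auto
  also have "\<dots> \<le> \<kappa> * (proj_norm X Y z + e / (\<kappa> + 1))"
    unfolding sum_distrib_left[symmetric] using r(4) assms(2) by (intro mult_left_mono) auto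
  also have "\<dots> \<le> \<kappa> * proj_norm X Y z + e"
    using e assms(2) by (simp add: distrib_left pos_divide_le_eq)
  finally show "\<bar>l z\<bar> \<le> \<kappa> * proj_norm X Y z + e" .
qed

lemma bounded_bilinear_lift:
  assumes \<beta>: "bilinear_on X Y \<beta>" and \<kappa>: "0 \<le> \<kappa>"
    and b: "\<And>x y. x \<in> carrier X \<Longrightarrow> y \<in> carrier Y \<Longrightarrow> \<bar>\<beta> x y\<bar> \<le> \<kappa> * (vnorm X x * vnorm Y y)"
  obtains l where "lin_functional (alg_normed X Y) l"
    "\<And>x y. x \<in> carrier X \<Longrightarrow> y \<in> carrier Y \<Longrightarrow> l (pure x y) = \<beta> x y"
    "\<And>z. z \<in> carrier A \<Longrightarrow> \<bar>l z\<bar> \<le> \<kappa> * proj_norm X Y z"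
proof -
  obtain l where l: "lin_functional A l" "\<And>x y. x \<in> carrier X \<Longrightarrow> y \<in> carrier Y \<Longrightarrow> l (pure x y) = \<beta> x y"
    by (rule bilinear_lift[OF \<beta>]) (rule that)
  show ?thesis
  proof (rule that[OF _ l(2)])
    show "lin_functional (alg_normed X Y) l" using l(1) by (simp add: lin_functional_def)
    show "\<bar>l z\<bar> \<le> \<kappa> * proj_norm X Y z" if "z \<in> carrier A" for z
      by (rule lin_functional_bound[OF l(1) \<kappa> _ that]) (simp only: l(2) b)
  qed
qed

text \<open>If some \<open>x j\<close> is nonzero, a functional \<open>\<phi>\<close> with \<open>\<phi> (x j) \<noteq> 0\<close> forces
  \<open>\<Sum>k. \<phi> (x k) y k = 0\<close>, which expresses \<open>y j\<close> by the other \<open>y k\<close> and shortens the sum.\<close>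

lemma finsum_pure_eq_zero:
  assumes sep: "separated X" "separated Y" and S: "finite S"
    and xy: "\<And>k. k \<in> S \<Longrightarrow> x k \<in> carrier X" "\<And>k. k \<in> S \<Longrightarrow> y k \<in> carrier Y"
    and vanish: "\<And>\<phi> \<psi>. bounded_functional X \<phi> \<Longrightarrow> bounded_functional Y \<psi> \<Longrightarrow> (\<Sum>k\<in>S. \<phi> (x k) * \<psi> (y k)) = 0"
  shows "finsum A (\<lambda>k. pure (x k) (y k)) S = \<zero>\<^bsub>A\<^esub>"
  using S xy vanish
proof (induction S arbitrary: x rule: finite_psubset_induct)
  case (psubset S x)
  note xc = psubset.prems(1) and yc = psubset.prems(2)
  show ?case
  proof (cases "\<forall>k\<in>S. x k = \<zero>\<^bsub>X\<^esub>")
    case True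
    have "finsum A (\<lambda>k. pure (x k) (y k)) S = finsum A (\<lambda>k. \<zero>\<^bsub>A\<^esub>) S"
      by (rule A.finsum_cong') (use True yc in \<open>simp_all add: pure_zero_left\<close>)
    thus ?thesis by simp
  next
    case False
    then obtain j where j: "j \<in> S" "x j \<noteq> \<zero>\<^bsub>X\<^esub>" by blast
    then obtain \<phi> where \<phi>: "bounded_functional X \<phi>" "\<phi> (x j) \<noteq> 0"
      using sep(1) xc[OF j(1)] unfolding separated_def by blast
    have \<phi>l: "lin_functional X \<phi>" using \<phi>(1) by (simp add: bounded_functional_def)
    let ?R = "S - {j}"
    have R: "finite ?R" "?R \<subset> S" "S = insert j ?R" "j \<notin> ?R" using psubset.hyps j by auto
    define a where "a = (\<lambda>k. \<phi> (x k) / \<phi> (x j))"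
    define u where "u = finsum Y (\<lambda>k. a k \<odot>\<^bsub>Y\<^esub> y k) S"
    have ay: "(\<lambda>k. a k \<odot>\<^bsub>Y\<^esub> y k) \<in> S \<rightarrow> carrier Y" using yc by simp
    have sums: "(\<Sum>k\<in>S. a k * \<psi> (y k)) = 0" if \<psi>: "bounded_functional Y \<psi>" for \<psi>
    proof -
      have "(\<Sum>k\<in>S. a k * \<psi> (y k)) = (\<Sum>k\<in>S. \<phi> (x k) * \<psi> (y k)) / \<phi> (x j)"
        by (simp add: a_def sum_divide_distrib)
      thus ?thesis using psubset.prems(3)[OF \<phi>(1) \<psi>] by simp
    qed
    have "\<psi> u = 0" if \<psi>: "bounded_functional Y \<psi>" for \<psi>
    proof -
      have l: "lin_functional Y \<psi>" using \<psi> by (simp add: bounded_functional_def)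
      have "\<psi> u = (\<Sum>k\<in>S. \<psi> (a k \<odot>\<^bsub>Y\<^esub> y k))"
        unfolding u_def by (rule Y.lin_functional_finsum[OF l psubset.hyps(1) ay])
      also have "\<dots> = (\<Sum>k\<in>S. a k * \<psi> (y k))"
        by (rule sum.cong) (simp_all add: Y.lin_functionalD(2)[OF l] yc)
      finally show ?thesis using sums[OF \<psi>] by simp
    qed
    moreover have uc: "u \<in> carrier Y" unfolding u_def by (rule Y.finsum_closed[OF ay])
    ultimately have u0: "u = \<zero>\<^bsub>Y\<^esub>" using sep(2) unfolding separated_def by blast
    define x' where "x' = (\<lambda>k. x k \<ominus>\<^bsub>X\<^esub> a k \<odot>\<^bsub>X\<^esub> x j)"
    have x': "x' k \<in> carrier X" if "k \<in> S" for k using xc[OF that] xc[OF j(1)] by (simp add: x'_def)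
    have x'j: "x' j = \<zero>\<^bsub>X\<^esub>" using \<phi>(2) xc[OF j(1)] by (simp add: x'_def a_def a_minus_def X.M.r_neg)
    have split: "pure (x k) (y k) = pure (x' k) (y k) \<oplus>\<^bsub>A\<^esub> pure (x j) (a k \<odot>\<^bsub>Y\<^esub> y k)" if k: "k \<in> S" for k
    proof -
      have "x k = x' k \<oplus>\<^bsub>X\<^esub> a k \<odot>\<^bsub>X\<^esub> x j"
        using xc[OF k] xc[OF j(1)] by (simp add: x'_def a_minus_def X.M.a_assoc X.M.l_neg)
      hence "pure (x k) (y k) = pure (x' k) (y k) \<oplus>\<^bsub>A\<^esub> pure (a k \<odot>\<^bsub>X\<^esub> x j) (y k)"
        using pure_add_left[OF x'[OF k] _ yc[OF k], of "a k \<odot>\<^bsub>X\<^esub> x j"] xc[OF j(1)] by simp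
      thus ?thesis using xc[OF j(1)] yc[OF k] by (simp add: pure_scale_left pure_scale_right)
    qed
    have "finsum A (\<lambda>k. pure (x k) (y k)) S = finsum A (\<lambda>k. pure (x' k) (y k) \<oplus>\<^bsub>A\<^esub> pure (x j) (a k \<odot>\<^bsub>Y\<^esub> y k)) S"
      by (rule A.finsum_cong') (use x' yc xc j split in simp_all)
    also have "\<dots> = finsum A (\<lambda>k. pure (x' k) (y k)) S \<oplus>\<^bsub>A\<^esub> finsum A (\<lambda>k. pure (x j) (a k \<odot>\<^bsub>Y\<^esub> y k)) S"
      by (rule A.finsum_addf) (use x' yc xc j in simp_all)
    also have "finsum A (\<lambda>k. pure (x j) (a k \<odot>\<^bsub>Y\<^esub> y k)) S = pure (x j) u"
      unfolding u_def by (rule pure_finsum_right[OF xc[OF j(1)] psubset.hyps(1) ay, symmetric])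
    also have "pure (x j) u = \<zero>\<^bsub>A\<^esub>" unfolding u0 by (rule pure_zero_right[OF xc[OF j(1)]])
    also have "finsum A (\<lambda>k. pure (x' k) (y k)) S = \<zero>\<^bsub>A\<^esub>"
    proof -
      have fR: "finsum A (\<lambda>k. pure (x' k) (y k)) ?R = \<zero>\<^bsub>A\<^esub>"
      proof (rule psubset.IH[OF R(2)])
        fix \<phi>' \<psi> assume p: "bounded_functional X \<phi>'" and q: "bounded_functional Y \<psi>"
        have l: "lin_functional X \<phi>'" using p by (simp add: bounded_functional_def)
        have e: "\<phi>' (x' k) = \<phi>' (x k) - a k * \<phi>' (x j)" if "k \<in> S" for k
          using xc[OF that] xc[OF j(1)] by (simp add: x'_def X.lin_functionalD[OF l])
        have "(\<Sum>k\<in>S. \<phi>' (x' k) * \<psi> (y k)) = (\<Sum>k\<in>S. \<phi>' (x k) * \<psi> (y k) - \<phi>' (x j) * (a k * \<psi> (y k)))"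
          by (rule sum.cong) (simp_all add: e algebra_simps)
        also have "\<dots> = (\<Sum>k\<in>S. \<phi>' (x k) * \<psi> (y k)) - \<phi>' (x j) * (\<Sum>k\<in>S. a k * \<psi> (y k))"
          by (simp only: sum_subtractf sum_distrib_left)
        also have "\<dots> = 0" unfolding psubset.prems(3)[OF p q] sums[OF q] by simp
        finally have t: "(\<Sum>k\<in>S. \<phi>' (x' k) * \<psi> (y k)) = 0" .
        have "\<phi>' (x' j) = 0" unfolding x'j by (rule X.lin_functionalD(3)[OF l])
        thus "(\<Sum>k\<in>?R. \<phi>' (x' k) * \<psi> (y k)) = 0"
          using t sum.remove[OF psubset.hyps(1) j(1), of "\<lambda>k. \<phi>' (x' k) * \<psi> (y k)"] by simp
      qed (use x' yc in auto)
      have "finsum A (\<lambda>k. pure (x' k) (y k)) (insert j ?R) =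
          pure (x' j) (y j) \<oplus>\<^bsub>A\<^esub> finsum A (\<lambda>k. pure (x' k) (y k)) ?R"
        by (rule A.finsum_insert[OF R(1) R(4)]) (use x' yc j in auto)
      thus ?thesis unfolding R(3)[symmetric] fR x'j using yc[OF j(1)] by (simp add: pure_zero_left)
    qed
    finally show ?thesis by simp
  qed
qed

text \<open>A product of bounded functionals is a bounded bilinear form, so its lift vanishes at
  every z of projective norm 0. Then \<open>finsum_pure_eq_zero\<close> applies to any
  representation of z.\<close>

lemma real_normed_space_alg_normed:
  assumes sep: "separated X" "separated Y"
  shows "real_normed_space (alg_normed X Y)"
proof -
  interpret N: seminormed "alg_normed X Y" by (rule seminormed_alg_normed)
  have "z = \<zero>\<^bsub>A\<^esub>" if z: "z \<in> carrier A" and z0: "proj_norm X Y z = 0" for z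
  proof -
    obtain N :: nat and x y where r: "\<And>i. i < N \<Longrightarrow> x i \<in> carrier X" "\<And>i. i < N \<Longrightarrow> y i \<in> carrier Y"
      "z = finsum A (\<lambda>i. pure (x i) (y i)) {..<N}"
      by (rule alg_tensor_elem[OF z]) (rule that)
    have "finsum A (\<lambda>i. pure (x i) (y i)) {..<N} = \<zero>\<^bsub>A\<^esub>"
    proof (rule finsum_pure_eq_zero[OF sep])
      fix \<phi> \<psi> assume p: "bounded_functional X \<phi>" and q: "bounded_functional Y \<psi>"
      have lin: "lin_functional X \<phi>" "lin_functional Y \<psi>" using p q by (simp_all add: bounded_functional_def)
      obtain \<kappa> where \<kappa>: "0 \<le> \<kappa>" "\<And>x. x \<in> carrier X \<Longrightarrow> \<bar>\<phi> x\<bar> \<le> \<kappa> * vnorm X x"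
        using p unfolding bounded_functional_def by blast
      obtain \<mu> where \<mu>: "0 \<le> \<mu>" "\<And>y. y \<in> carrier Y \<Longrightarrow> \<bar>\<psi> y\<bar> \<le> \<mu> * vnorm Y y"
        using q unfolding bounded_functional_def by blast
      have bil: "bilinear_on X Y (\<lambda>x y. \<phi> x * \<psi> y)"
        unfolding bilinear_on_def lin_functional_def
        by (simp add: X.lin_functionalD[OF lin(1)] Y.lin_functionalD[OF lin(2)] algebra_simps)
      have b: "\<bar>\<phi> x * \<psi> y\<bar> \<le> (\<kappa> * \<mu>) * (vnorm X x * vnorm Y y)" if "x \<in> carrier X" "y \<in> carrier Y" for x y
      proof -
        have "\<bar>\<phi> x * \<psi> y\<bar> \<le> (\<kappa> * vnorm X x) * (\<mu> * vnorm Y y)"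
          unfolding abs_mult using that \<kappa> \<mu> by (intro mult_mono) (simp_all add: X.vnorm_nonneg)
        thus ?thesis by (simp add: mult_ac)
      qed
      have km: "0 \<le> \<kappa> * \<mu>" using \<kappa> \<mu> by simp
      obtain l where l: "lin_functional (alg_normed X Y) l"
        "\<And>x y. x \<in> carrier X \<Longrightarrow> y \<in> carrier Y \<Longrightarrow> l (pure x y) = \<phi> x * \<psi> y"
        "\<And>z. z \<in> carrier A \<Longrightarrow> \<bar>l z\<bar> \<le> (\<kappa> * \<mu>) * proj_norm X Y z"
        by (rule bounded_bilinear_lift[OF bil km b]) (assumption | rule that)+
      have lA: "lin_functional A l" using l(1) by (simp add: lin_functional_def)
      have "l z = (\<Sum>i<N. l (pure (x i) (y i)))"
        unfolding r(3) by (rule A.lin_functional_finsum[OF lA]) (use r in simp_all)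
      also have "\<dots> = (\<Sum>i<N. \<phi> (x i) * \<psi> (y i))" by (rule sum.cong) (use r l(2) in simp_all)
      finally show "(\<Sum>i<N. \<phi> (x i) * \<psi> (y i)) = 0" using l(3)[OF z] z0 by simp
    qed (use r in auto)
    thus ?thesis using r(3) by simp
  qed
  thus ?thesis
    by unfold_locales (use proj_norm_zero N.vnorm_add_le N.vnorm_scale in auto)
qed

end

section \<open>The space of cube-summable sequences\<close>

definition ell3 :: "(nat \<Rightarrow> real) normed_rec" where
  "ell3 = \<lparr>carrier = {x. summable (\<lambda>n. \<bar>x n\<bar> ^ 3)}, monoid.mult = undefined, one = undefined,
     zero = (\<lambda>_. 0), add = (\<lambda>x y n. x n + y n), module.smult = (\<lambda>c x n. c * x n),
     vnorm = (\<lambda>x. root 3 (suminf (\<lambda>n. \<bar>x n\<bar> ^ 3)))\<rparr>"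

lemma ell3_simps [simp]:
  "x \<oplus>\<^bsub>ell3\<^esub> y = (\<lambda>n. x n + y n)" "\<zero>\<^bsub>ell3\<^esub> = (\<lambda>_. 0)" "c \<odot>\<^bsub>ell3\<^esub> x = (\<lambda>n. c * x n)"
  by (simp_all add: ell3_def)

lemma ell3_mem_iff: "x \<in> carrier ell3 \<longleftrightarrow> summable (\<lambda>n. \<bar>x n\<bar> ^ 3)"
  by (simp add: ell3_def)

lemma vnorm_ell3: "vnorm ell3 x = root 3 (suminf (\<lambda>n. \<bar>x n\<bar> ^ 3))"
  by (simp add: ell3_def)

lemma norm3_tendsto: "x \<in> carrier ell3 \<Longrightarrow> (\<lambda>n. norm3 {..<n} x) \<longlonglongrightarrow> vnorm ell3 x"
  unfolding ell3_mem_iff vnorm_ell3 norm3_def by (intro tendsto_real_root summable_LIMSEQ)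

lemma norm3_le_ell3: "x \<in> carrier ell3 \<Longrightarrow> norm3 {..<n} x \<le> vnorm ell3 x"
  unfolding ell3_mem_iff vnorm_ell3 norm3_def by (intro real_root_le_mono sum_le_suminf) auto

lemma ell3I:
  assumes "\<And>n. norm3 {..<n} x \<le> B"
  shows "x \<in> carrier ell3" "vnorm ell3 x \<le> B"
proof -
  have "(\<Sum>i<n. \<bar>x i\<bar> ^ 3) \<le> B ^ 3" for n
    unfolding norm3_cube[symmetric] by (intro power_mono assms norm3_nonneg)
  hence "summable (\<lambda>n. \<bar>x n\<bar> ^ 3)" by (intro summableI_nonneg_bounded[of _ "B ^ 3"]) auto
  thus *: "x \<in> carrier ell3" by (simp add: ell3_mem_iff)
  show "vnorm ell3 x \<le> B" by (rule LIMSEQ_le_const2[OF norm3_tendsto[OF *]]) (use assms in auto)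
qed

lemma ell3_add:
  assumes "x \<in> carrier ell3" "y \<in> carrier ell3"
  shows "(\<lambda>n. x n + y n) \<in> carrier ell3" "vnorm ell3 (\<lambda>n. x n + y n) \<le> vnorm ell3 x + vnorm ell3 y"
proof -
  have *: "norm3 {..<n} (\<lambda>n. x n + y n) \<le> vnorm ell3 x + vnorm ell3 y" for n
    using norm3_triangle[of "{..<n}" x y] norm3_le_ell3[OF assms(1), of n] norm3_le_ell3[OF assms(2), of n] by simp
  show "(\<lambda>n. x n + y n) \<in> carrier ell3" by (rule ell3I(1)[OF *])
  show "vnorm ell3 (\<lambda>n. x n + y n) \<le> vnorm ell3 x + vnorm ell3 y" by (rule ell3I(2)[OF *])
qed

lemma ell3_scale:
  assumes "x \<in> carrier ell3"
  shows "(\<lambda>n. c * x n) \<in> carrier ell3" "vnorm ell3 (\<lambda>n. c * x n) = \<bar>c\<bar> * vnorm ell3 x"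
proof -
  have *: "norm3 {..<n} (\<lambda>n. c * x n) \<le> \<bar>c\<bar> * vnorm ell3 x" for n
    unfolding norm3_scale by (intro mult_left_mono norm3_le_ell3 assms) simp
  show m: "(\<lambda>n. c * x n) \<in> carrier ell3" by (rule ell3I(1)[OF *])
  have "(\<lambda>n. norm3 {..<n} (\<lambda>n. c * x n)) \<longlonglongrightarrow> \<bar>c\<bar> * vnorm ell3 x"
    unfolding norm3_scale by (intro tendsto_mult_left norm3_tendsto assms)
  thus "vnorm ell3 (\<lambda>n. c * x n) = \<bar>c\<bar> * vnorm ell3 x" by (rule LIMSEQ_unique[OF norm3_tendsto[OF m]])
qed

lemma ell3_zero: "(\<lambda>_. 0) \<in> carrier ell3"
  by (simp add: ell3_mem_iff)

lemma abs_le_vnorm_ell3: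
  assumes "x \<in> carrier ell3"
  shows "\<bar>x n\<bar> \<le> vnorm ell3 x"
proof -
  have "\<bar>x n\<bar> = norm3 {n} x" by (simp add: norm3_def real_root_power_cancel)
  also have "\<dots> \<le> norm3 {..<Suc n} x" by (rule norm3_subset) auto
  also have "\<dots> \<le> vnorm ell3 x" by (rule norm3_le_ell3[OF assms])
  finally show ?thesis .
qed

interpretation ell3: real_normed_space ell3
proof (rule real_normed_space.intro)
  show "Module.module real_scalars ell3"
  proof (rule real_moduleI)
    show "abelian_group ell3"
    proof (rule abelian_groupI)
      fix x assume "x \<in> carrier ell3"
      thus "\<exists>y\<in>carrier ell3. y \<oplus>\<^bsub>ell3\<^esub> x = \<zero>\<^bsub>ell3\<^esub>"
        using ell3_scale(1)[of x "-1"] by (intro bexI[of _ "\<lambda>n. -1 * x n"]) auto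
    qed (auto simp: ell3_add ell3_zero add_ac)
  qed (auto simp: ell3_scale algebra_simps)
  show "real_normed_space_axioms ell3"
  proof
    fix x assume x: "x \<in> carrier ell3"
    show "vnorm ell3 x = 0 \<longleftrightarrow> x = \<zero>\<^bsub>ell3\<^esub>"
    proof
      assume "vnorm ell3 x = 0"
      hence "x n = 0" for n using abs_le_vnorm_ell3[OF x, of n] by simp
      thus "x = \<zero>\<^bsub>ell3\<^esub>" by auto
    qed (simp add: vnorm_ell3)
  qed (simp_all add: ell3_add ell3_scale)
qed

lemma ell3_diff: "y \<in> carrier ell3 \<Longrightarrow> x \<ominus>\<^bsub>ell3\<^esub> y = (\<lambda>n. x n - y n)"
  by (simp add: a_minus_def flip: ell3.scale_minus_one)

lemma ell3_finsum:
  "finite S \<Longrightarrow> f \<in> S \<rightarrow> carrier ell3 \<Longrightarrow> finsum ell3 f S = (\<lambda>n. \<Sum>k\<in>S. f k n)"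
proof (induction S rule: finite_induct)
  case (insert k S)
  hence "f \<in> S \<rightarrow> carrier ell3" "f k \<in> carrier ell3" by auto
  thus ?case using insert by simp
qed simp

text \<open>Coordinatewise limits exist; bounds on initial segments pass to the limit, and
  \<open>ell3I\<close> turns them into norm bounds.\<close>

lemma banach_space_ell3: "banach_space ell3"
  unfolding banach_space_def
proof
  interpret Metric_space "carrier ell3" "vdist ell3" by (rule ell3.Metric_space_vdist)
  show "mcomplete"
    unfolding mcomplete_def
  proof (intro allI impI)
    fix \<sigma> assume "MCauchy \<sigma>"
    hence s: "ell3.cauchy \<sigma>" by (simp add: ell3.MCauchy_iff)
    note sc = ell3.cauchy_carrier[OF s]
    have "convergent (\<lambda>m. \<sigma> m n)" for n
    proof -
      have "Cauchy (\<lambda>m. \<sigma> m n)"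
      proof (rule CauchyI)
        fix e :: real assume "0 < e"
        then obtain K where K: "\<And>i j. K \<le> i \<Longrightarrow> K \<le> j \<Longrightarrow> vnorm ell3 (\<sigma> i \<ominus>\<^bsub>ell3\<^esub> \<sigma> j) < e"
          using ell3.cauchyD[OF s] by blast
        have "norm (\<sigma> i n - \<sigma> j n) < e" if "K \<le> i" "K \<le> j" for i j
        proof -
          have "\<sigma> i \<ominus>\<^bsub>ell3\<^esub> \<sigma> j \<in> carrier ell3" by (simp add: sc)
          from abs_le_vnorm_ell3[OF this, of n] K[OF that] show ?thesis by (simp add: ell3_diff sc)
        qed
        thus "\<exists>K. \<forall>i\<ge>K. \<forall>j\<ge>K. norm (\<sigma> i n - \<sigma> j n) < e" by blast
      qed
      thus ?thesis by (simp add: Cauchy_convergent_iff)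
    qed
    then obtain x where x: "(\<lambda>m. \<sigma> m n) \<longlonglongrightarrow> x n" for n unfolding convergent_def by metis
    have tail: "\<exists>K. \<forall>n\<ge>K. (\<lambda>j. x j - \<sigma> n j) \<in> carrier ell3 \<and> vnorm ell3 (\<lambda>j. x j - \<sigma> n j) \<le> e" if e: "0 < e" for e
    proof -
      obtain K where K: "\<And>i j. K \<le> i \<Longrightarrow> K \<le> j \<Longrightarrow> vnorm ell3 (\<sigma> i \<ominus>\<^bsub>ell3\<^esub> \<sigma> j) < e"
        using ell3.cauchyD[OF s e] by blast
      have "norm3 {..<L} (\<lambda>j. x j - \<sigma> n j) \<le> e" if n: "K \<le> n" for L n
      proof (rule LIMSEQ_le_const2)
        show "(\<lambda>m. norm3 {..<L} (\<lambda>j. \<sigma> m j - \<sigma> n j)) \<longlonglongrightarrow> norm3 {..<L} (\<lambda>j. x j - \<sigma> n j)"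
          unfolding norm3_def by (intro tendsto_intros x)
        show "\<exists>N. \<forall>m\<ge>N. norm3 {..<L} (\<lambda>j. \<sigma> m j - \<sigma> n j) \<le> e"
        proof (intro exI allI impI)
          fix m assume "K \<le> m"
          hence "vnorm ell3 (\<sigma> m \<ominus>\<^bsub>ell3\<^esub> \<sigma> n) < e" using K n by simp
          moreover have "norm3 {..<L} (\<sigma> m \<ominus>\<^bsub>ell3\<^esub> \<sigma> n) \<le> vnorm ell3 (\<sigma> m \<ominus>\<^bsub>ell3\<^esub> \<sigma> n)"
            by (rule norm3_le_ell3) (simp add: sc)
          ultimately show "norm3 {..<L} (\<lambda>j. \<sigma> m j - \<sigma> n j) \<le> e" using sc[of n] by (simp add: ell3_diff)
        qed
      qed
      hence "(\<lambda>j. x j - \<sigma> n j) \<in> carrier ell3 \<and> vnorm ell3 (\<lambda>j. x j - \<sigma> n j) \<le> e" if n: "K \<le> n" for n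
        using ell3I[of "\<lambda>j. x j - \<sigma> n j" e] n by blast
      thus ?thesis by blast
    qed
    have xc: "x \<in> carrier ell3"
    proof -
      from tail[of 1] obtain K where "(\<lambda>j. x j - \<sigma> K j) \<in> carrier ell3" by auto
      from ell3_add(1)[OF this sc[of K]] show ?thesis by simp
    qed
    have "limitin mtopology \<sigma> x sequentially"
      unfolding limitin_metric
    proof (intro conjI allI impI)
      fix e :: real assume "0 < e"
      then obtain K where K: "\<And>n. K \<le> n \<Longrightarrow> vnorm ell3 (\<lambda>j. x j - \<sigma> n j) \<le> e / 2"
        using tail[of "e / 2"] by auto
      show "\<forall>\<^sub>F n in sequentially. \<sigma> n \<in> carrier ell3 \<and> vdist ell3 (\<sigma> n) x < e"
      proof (rule eventually_sequentiallyI[of K])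
        fix n assume "K \<le> n"
        thus "\<sigma> n \<in> carrier ell3 \<and> vdist ell3 (\<sigma> n) x < e"
          using K[of n] \<open>0 < e\<close> sc[of n] xc ell3.vnorm_diff_commute[of "\<sigma> n" x] by (simp add: vdist_def ell3_diff)
      qed
    qed (rule xc)
    thus "\<exists>x. limitin mtopology \<sigma> x sequentially" by blast
  qed
qed (rule ell3.real_normed_space_axioms)

lemma bounded_functional_coordinate: "bounded_functional ell3 (\<lambda>x. x n)"
  unfolding bounded_functional_def lin_functional_def
  by (auto intro!: exI[of _ 1] abs_le_vnorm_ell3)

lemma separated_ell3: "separated ell3"
  unfolding separated_def using bounded_functional_coordinate by auto

section \<open>Truncation of sequences\<close>

definition trunc :: "nat \<Rightarrow> (nat \<Rightarrow> real) \<Rightarrow> nat \<Rightarrow> real" where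
  "trunc N x = (\<lambda>n. if n < N then x n else 0)"

lemma norm3_trunc_le: "norm3 {..<n} (trunc N x) \<le> norm3 {..<N} x"
proof -
  have "norm3 {..<n} (trunc N x) \<le> norm3 {..<max n N} (trunc N x)" by (rule norm3_subset) auto
  also have "\<dots> = norm3 {..<N} x"
    unfolding norm3_def by (rule arg_cong, rule sum.mono_neutral_cong_right) (auto simp: trunc_def)
  finally show ?thesis .
qed

lemma trunc_closed [simp]: "trunc N x \<in> carrier ell3"
  by (rule ell3I(1)[OF norm3_trunc_le])

lemma vnorm_trunc: "vnorm ell3 (trunc N x) = norm3 {..<N} x"
proof (rule antisym)
  show "vnorm ell3 (trunc N x) \<le> norm3 {..<N} x" by (rule ell3I(2)[OF norm3_trunc_le])
  have "norm3 {..<N} x = norm3 {..<N} (trunc N x)" by (rule norm3_cong) (simp add: trunc_def)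
  thus "norm3 {..<N} x \<le> vnorm ell3 (trunc N x)" using norm3_le_ell3[of "trunc N x" N] by simp
qed

lemma vnorm_trunc_le: "x \<in> carrier ell3 \<Longrightarrow> vnorm ell3 (trunc N x) \<le> vnorm ell3 x"
  unfolding vnorm_trunc by (rule norm3_le_ell3)

lemma trunc_tendsto:
  assumes x: "x \<in> carrier ell3"
  shows "(\<lambda>N. vnorm ell3 (x \<ominus>\<^bsub>ell3\<^esub> trunc N x)) \<longlonglongrightarrow> 0"
proof -
  have s: "summable (\<lambda>n. \<bar>x n\<bar> ^ 3)" using x by (simp add: ell3_mem_iff)
  have "suminf (\<lambda>n. \<bar>x n - trunc N x n\<bar> ^ 3) = suminf (\<lambda>n. \<bar>x n\<bar> ^ 3) - (\<Sum>n<N. \<bar>x n\<bar> ^ 3)" for N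
  proof -
    have "(\<lambda>n. if n \<in> {..<N} then \<bar>x n\<bar> ^ 3 else 0) sums (\<Sum>n<N. \<bar>x n\<bar> ^ 3)"
      by (rule sums_If_finite_set) simp
    hence "(\<lambda>n. \<bar>x n\<bar> ^ 3 - (if n \<in> {..<N} then \<bar>x n\<bar> ^ 3 else 0)) sums (suminf (\<lambda>n. \<bar>x n\<bar> ^ 3) - (\<Sum>n<N. \<bar>x n\<bar> ^ 3))"
      by (rule sums_diff[OF summable_sums[OF s]])
    moreover have "(\<lambda>n. \<bar>x n\<bar> ^ 3 - (if n \<in> {..<N} then \<bar>x n\<bar> ^ 3 else 0)) = (\<lambda>n. \<bar>x n - trunc N x n\<bar> ^ 3)"
      by (auto simp: trunc_def)
    ultimately show ?thesis by (simp add: sums_iff)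
  qed
  hence eq: "vnorm ell3 (x \<ominus>\<^bsub>ell3\<^esub> trunc N x) = root 3 (suminf (\<lambda>n. \<bar>x n\<bar> ^ 3) - (\<Sum>n<N. \<bar>x n\<bar> ^ 3))" for N
    by (simp add: ell3_diff vnorm_ell3)
  have "(\<lambda>N. root 3 (suminf (\<lambda>n. \<bar>x n\<bar> ^ 3) - (\<Sum>n<N. \<bar>x n\<bar> ^ 3))) \<longlonglongrightarrow> root 3 (suminf (\<lambda>n. \<bar>x n\<bar> ^ 3) - suminf (\<lambda>n. \<bar>x n\<bar> ^ 3))"
    by (intro tendsto_real_root tendsto_diff tendsto_const summable_LIMSEQ s)
  thus ?thesis unfolding eq by simp
qed

definition unit_seq :: "nat \<Rightarrow> nat \<Rightarrow> real" where
  "unit_seq a = (\<lambda>n. if n = a then 1 else 0)"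

lemma unit_seq_closed [simp]: "unit_seq a \<in> carrier ell3"
proof -
  have "unit_seq a = trunc (Suc a) (unit_seq a)" by (auto simp: unit_seq_def trunc_def)
  thus ?thesis using trunc_closed by metis
qed

lemma trunc_eq_finsum: "trunc N x = finsum ell3 (\<lambda>a. x a \<odot>\<^bsub>ell3\<^esub> unit_seq a) {..<N}"
proof -
  have "finsum ell3 (\<lambda>a. x a \<odot>\<^bsub>ell3\<^esub> unit_seq a) {..<N} = (\<lambda>n. \<Sum>a<N. x a * unit_seq a n)"
    by (subst ell3_finsum) (use ell3.scale_closed[OF unit_seq_closed] in auto)
  also have "\<dots> = trunc N x"
    by (rule ext) (simp add: unit_seq_def trunc_def if_distrib [of "\<lambda>t. _ * t"] cong: if_cong)
  finally show ?thesis by simp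
qed

section \<open>Cotype 6 of the projective square\<close>

context real_normed_space
begin

lemma completion_finsum:
  assumes "finite I" "\<And>i. i \<in> I \<Longrightarrow> cauchy (\<sigma> i)"
  shows "cauchy (\<lambda>m. finsum V (\<lambda>i. \<sigma> i m) I)"
    "finsum (completion V) (\<lambda>i. cls (\<sigma> i)) I = cls (\<lambda>m. finsum V (\<lambda>i. \<sigma> i m) I)"
proof -
  interpret C: seminormed "completion V" by (rule seminormed_completion)
  have "cauchy (\<lambda>m. finsum V (\<lambda>i. \<sigma> i m) I) \<and>
      finsum (completion V) (\<lambda>i. cls (\<sigma> i)) I = cls (\<lambda>m. finsum V (\<lambda>i. \<sigma> i m) I)"
    using assms
  proof (induction I rule: finite_induct)
    case empty
    show ?case by (simp add: cauchy_const completion_zero)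
  next
    case (insert i I)
    have c: "cauchy (\<sigma> j)" if "j \<in> I" for j using insert.prems that by simp
    have ci: "cauchy (\<sigma> i)" using insert.prems by simp
    have eq: "(\<lambda>m. finsum V (\<lambda>i. \<sigma> i m) (insert i I)) = (\<lambda>m. \<sigma> i m \<oplus> finsum V (\<lambda>i. \<sigma> i m) I)"
      by (rule ext, rule M.finsum_insert) (use insert.hyps c ci in \<open>auto simp: cauchy_carrier\<close>)
    have IH: "cauchy (\<lambda>m. finsum V (\<lambda>i. \<sigma> i m) I)"
      "finsum (completion V) (\<lambda>i. cls (\<sigma> i)) I = cls (\<lambda>m. finsum V (\<lambda>i. \<sigma> i m) I)"
      using insert.IH[OF c] by simp_all
    have "finsum (completion V) (\<lambda>i. cls (\<sigma> i)) (insert i I) =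
        cls (\<sigma> i) \<oplus>\<^bsub>completion V\<^esub> finsum (completion V) (\<lambda>i. cls (\<sigma> i)) I"
      by (rule C.M.finsum_insert) (use insert.hyps c ci in auto)
    thus ?case unfolding eq IH(2) using cauchy_add[OF ci IH(1)] completion_add[OF ci IH(1)] by simp
  qed
  thus "cauchy (\<lambda>m. finsum V (\<lambda>i. \<sigma> i m) I)"
    "finsum (completion V) (\<lambda>i. cls (\<sigma> i)) I = cls (\<lambda>m. finsum V (\<lambda>i. \<sigma> i m) I)" by simp_all
qed

text \<open>Both sides are continuous in finitely many vectors, so the inequality passes to the
  limit along representing sequences.\<close>

lemma completion_cotype_6:
  assumes V: "\<And>z. (\<And>i. i < n \<Longrightarrow> z i \<in> carrier V) \<Longrightarrow>
      root 6 (\<Sum>i<n. vnorm V (z i) ^ 6) \<le> C * sign_avg n (\<lambda>\<epsilon>. vnorm V (finsum V (\<lambda>i. \<epsilon> i \<odot> z i) {..<n}))"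
    and x: "\<And>i. i < n \<Longrightarrow> x i \<in> carrier (completion V)"
  shows "root 6 (\<Sum>i<n. vnorm (completion V) (x i) ^ 6) \<le>
    C * sign_avg n (\<lambda>\<epsilon>. vnorm (completion V) (finsum (completion V) (\<lambda>i. \<epsilon> i \<odot>\<^bsub>completion V\<^esub> x i) {..<n}))"
proof -
  interpret C: seminormed "completion V" by (rule seminormed_completion)
  have "\<exists>\<sigma>. cauchy \<sigma> \<and> x i = cls \<sigma>" if "i < n" for i
    using x[OF that] unfolding carrier_completion by blast
  then obtain \<sigma> where s: "\<And>i. i < n \<Longrightarrow> cauchy (\<sigma> i)" "\<And>i. i < n \<Longrightarrow> x i = cls (\<sigma> i)"
    by metis
  have left: "(\<lambda>m. root 6 (\<Sum>i<n. vnorm V (\<sigma> i m) ^ 6)) \<longlonglongrightarrow> root 6 (\<Sum>i<n. vnorm (completion V) (x i) ^ 6)"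
    by (intro tendsto_real_root tendsto_sum tendsto_power) (use completion_norm s in auto)
  have "(\<lambda>m. vnorm V (finsum V (\<lambda>i. \<epsilon> i \<odot> \<sigma> i m) {..<n})) \<longlonglongrightarrow>
      vnorm (completion V) (finsum (completion V) (\<lambda>i. \<epsilon> i \<odot>\<^bsub>completion V\<^esub> x i) {..<n})" for \<epsilon>
  proof -
    have c: "cauchy (\<lambda>m. \<epsilon> i \<odot> \<sigma> i m)" if "i \<in> {..<n}" for i using that s(1) by (simp add: cauchy_scale)
    have "finsum (completion V) (\<lambda>i. \<epsilon> i \<odot>\<^bsub>completion V\<^esub> x i) {..<n} =
        finsum (completion V) (\<lambda>i. cls (\<lambda>m. \<epsilon> i \<odot> \<sigma> i m)) {..<n}"
      by (rule C.M.finsum_cong') (use s c in \<open>auto simp: completion_scale\<close>)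
    also have "\<dots> = cls (\<lambda>m. finsum V (\<lambda>i. \<epsilon> i \<odot> \<sigma> i m) {..<n})"
      by (rule completion_finsum(2)) (use c in auto)
    finally have eq: "finsum (completion V) (\<lambda>i. \<epsilon> i \<odot>\<^bsub>completion V\<^esub> x i) {..<n} =
        cls (\<lambda>m. finsum V (\<lambda>i. \<epsilon> i \<odot> \<sigma> i m) {..<n})" .
    show ?thesis unfolding eq by (rule completion_norm[OF completion_finsum(1)]) (use c in auto)
  qed
  hence right: "(\<lambda>m. C * sign_avg n (\<lambda>\<epsilon>. vnorm V (finsum V (\<lambda>i. \<epsilon> i \<odot> \<sigma> i m) {..<n}))) \<longlonglongrightarrow>
      C * sign_avg n (\<lambda>\<epsilon>. vnorm (completion V) (finsum (completion V) (\<lambda>i. \<epsilon> i \<odot>\<^bsub>completion V\<^esub> x i) {..<n}))"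
    unfolding sign_avg_def by (intro tendsto_mult_left tendsto_divide tendsto_sum tendsto_const) simp_all
  show ?thesis
    by (rule LIMSEQ_le[OF left right]) (use V s cauchy_carrier in auto)
qed

end

lemma expectation_signs:
  "measure_pmf.expectation (pmf_of_set ({..<n} \<rightarrow>\<^sub>E {-1, 1 :: real})) f = sign_avg n f"
proof -
  have "signs n \<noteq> {}" using card_signs[of n] by force
  thus ?thesis using integral_pmf_of_set[of "signs n" f] card_signs[of n]
    by (simp add: sign_avg_def) (simp add: signs_def)
qed

text \<open>A bound by the first moment is stronger than cotype, since the quadratic mean dominates
  the mean.\<close>

lemma has_cotype_6I:
  assumes C: "0 < C" and nonneg: "\<And>x. x \<in> carrier V \<Longrightarrow> 0 \<le> vnorm V x"
    and V: "\<And>n x. (\<And>i. i < n \<Longrightarrow> x i \<in> carrier V) \<Longrightarrow>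
      root 6 (\<Sum>i<n. vnorm V (x i) ^ 6) \<le> C * sign_avg n (\<lambda>\<epsilon>. vnorm V (finsum V (\<lambda>i. \<epsilon> i \<odot>\<^bsub>V\<^esub> x i) {..<n}))"
  shows "has_cotype 6 V"
  unfolding has_cotype_def expectation_signs
proof (intro exI[of _ C] conjI allI impI C)
  fix n :: nat and x assume x: "\<forall>i<n. x i \<in> carrier V"
  let ?F = "\<lambda>\<epsilon>. vnorm V (finsum V (\<lambda>i. \<epsilon> i \<odot>\<^bsub>V\<^esub> x i) {..<n})"
  have "(\<Sum>i<n. vnorm V (x i) powr 6) = (\<Sum>i<n. vnorm V (x i) ^ 6)"
    by (rule sum.cong) (use x nonneg in \<open>auto simp: powr_numeral\<close>)
  hence "(\<Sum>i<n. vnorm V (x i) powr 6) powr (1 / 6) = root 6 (\<Sum>i<n. vnorm V (x i) ^ 6)"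
    by (simp add: root_powr_inverse sum_nonneg)
  also have "\<dots> \<le> C * sign_avg n ?F" using V x by blast
  also have "sign_avg n ?F \<le> sqrt (sign_avg n (\<lambda>\<epsilon>. (?F \<epsilon>)\<^sup>2))" by (rule real_le_rsqrt[OF sign_avg_square_le])
  finally show "(\<Sum>i<n. vnorm V (x i) powr 6) powr (1 / 6) \<le> C * sqrt (sign_avg n (\<lambda>\<epsilon>. (?F \<epsilon>)\<^sup>2))"
    using C by simp
qed

section \<open>Matrices in the algebraic square\<close>

interpretation E2: tensor_pair ell3 ell3
  by (rule tensor_pair.intro) (rule ell3.seminormed_axioms)+

interpretation P2: real_normed_space "alg_normed ell3 ell3"
  by (rule E2.real_normed_space_alg_normed[OF separated_ell3 separated_ell3])

text \<open>The product of two coordinate functionals, lifted to the algebraic square.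
  \<open>SOME\<close> fixes one bounded lift for each pair of indices, so that it becomes a function
  of them.\<close>

definition matrix_entry :: "nat \<Rightarrow> nat \<Rightarrow> ((nat \<Rightarrow> real) \<times> (nat \<Rightarrow> real) \<Rightarrow>\<^sub>0 real) set \<Rightarrow> real" where
  "matrix_entry a b = (SOME l. lin_functional (alg_normed ell3 ell3) l \<and>
     (\<forall>x\<in>carrier ell3. \<forall>y\<in>carrier ell3. l (pure_tensor ell3 ell3 x y) = x a * y b) \<and>
     (\<forall>z\<in>carrier (alg_tensor ell3 ell3). \<bar>l z\<bar> \<le> 1 * proj_norm ell3 ell3 z))"

lemma matrix_entry:
  shows "lin_functional (alg_normed ell3 ell3) (matrix_entry a b)"
    and matrix_entry_pure: "\<And>x y. x \<in> carrier ell3 \<Longrightarrow> y \<in> carrier ell3 \<Longrightarrow> matrix_entry a b (E2.pure x y) = x a * y b"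
    and matrix_entry_bound: "\<And>z. z \<in> carrier E2.A \<Longrightarrow> \<bar>matrix_entry a b z\<bar> \<le> 1 * proj_norm ell3 ell3 z"
proof -
  have bil: "bilinear_on ell3 ell3 (\<lambda>x y. x a * y b)"
    by (simp add: bilinear_on_def lin_functional_def algebra_simps)
  have b: "\<bar>x a * y b\<bar> \<le> 1 * (vnorm ell3 x * vnorm ell3 y)" if "x \<in> carrier ell3" "y \<in> carrier ell3" for x y
    unfolding abs_mult mult_1 by (intro mult_mono abs_le_vnorm_ell3 that ell3.vnorm_nonneg abs_ge_zero)
  let ?P = "\<lambda>l. lin_functional (alg_normed ell3 ell3) l \<and>
     (\<forall>x\<in>carrier ell3. \<forall>y\<in>carrier ell3. l (E2.pure x y) = x a * y b) \<and>
     (\<forall>z\<in>carrier E2.A. \<bar>l z\<bar> \<le> 1 * proj_norm ell3 ell3 z)"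
  obtain l where l: "lin_functional (alg_normed ell3 ell3) l"
    "\<And>x y. x \<in> carrier ell3 \<Longrightarrow> y \<in> carrier ell3 \<Longrightarrow> l (E2.pure x y) = x a * y b"
    "\<And>z. z \<in> carrier E2.A \<Longrightarrow> \<bar>l z\<bar> \<le> 1 * proj_norm ell3 ell3 z"
    by (rule E2.bounded_bilinear_lift[OF bil zero_le_one b]) (assumption, assumption, rule that)
  have "?P l" by (intro conjI ballI l)
  hence *: "?P (matrix_entry a b)" unfolding matrix_entry_def by (rule someI[of ?P])
  show "lin_functional (alg_normed ell3 ell3) (matrix_entry a b)" using * by (rule conjunct1)
  show "matrix_entry a b (E2.pure x y) = x a * y b" if "x \<in> carrier ell3" "y \<in> carrier ell3" for x y
    using * that by (elim conjE) (drule bspec, assumption, drule bspec)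
  show "\<bar>matrix_entry a b z\<bar> \<le> 1 * proj_norm ell3 ell3 z" if "z \<in> carrier E2.A" for z
    using * that by (elim conjE) (erule (1) bspec)
qed

lemma matrix_entry_finsum:
  assumes "finite S" "\<And>k. k \<in> S \<Longrightarrow> x k \<in> carrier ell3" "\<And>k. k \<in> S \<Longrightarrow> y k \<in> carrier ell3"
  shows "matrix_entry a b (finsum E2.A (\<lambda>k. E2.pure (x k) (y k)) S) = (\<Sum>k\<in>S. x k a * y k b)"
proof -
  have l: "lin_functional E2.A (matrix_entry a b)" using matrix_entry(1)[of a b] by (simp add: lin_functional_def)
  have "matrix_entry a b (finsum E2.A (\<lambda>k. E2.pure (x k) (y k)) S) = (\<Sum>k\<in>S. matrix_entry a b (E2.pure (x k) (y k)))"
    by (rule E2.A.lin_functional_finsum[OF l assms(1)]) (use assms in simp)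
  also have "\<dots> = (\<Sum>k\<in>S. x k a * y k b)" by (rule sum.cong) (use assms in \<open>simp_all add: matrix_entry_pure\<close>)
  finally show ?thesis .
qed

definition of_matrix :: "nat \<Rightarrow> (nat \<Rightarrow> nat \<Rightarrow> real) \<Rightarrow> ((nat \<Rightarrow> real) \<times> (nat \<Rightarrow> real) \<Rightarrow>\<^sub>0 real) set" where
  "of_matrix N M = finsum E2.A (\<lambda>a. finsum E2.A (\<lambda>b. M a b \<odot>\<^bsub>E2.A\<^esub> E2.pure (unit_seq a) (unit_seq b)) {..<N}) {..<N}"

lemma of_matrix_row_closed:
  "finsum E2.A (\<lambda>b. M a b \<odot>\<^bsub>E2.A\<^esub> E2.pure (unit_seq a) (unit_seq b)) {..<N} \<in> carrier E2.A"
  by (intro E2.A.finsum_closed Pi_I E2.A.scale_closed E2.pure_closed unit_seq_closed)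

lemma of_matrix_closed [simp]: "of_matrix N M \<in> carrier E2.A"
  unfolding of_matrix_def by (intro E2.A.finsum_closed Pi_I of_matrix_row_closed)

lemma of_matrix_cong:
  assumes "\<And>a b. a < N \<Longrightarrow> b < N \<Longrightarrow> M a b = M' a b"
  shows "of_matrix N M = of_matrix N M'"
  unfolding of_matrix_def
proof (intro E2.A.finsum_cong' refl Pi_I of_matrix_row_closed)
  fix a b assume "a \<in> {..<N}" "b \<in> {..<N}"
  thus "M a b \<odot>\<^bsub>E2.A\<^esub> E2.pure (unit_seq a) (unit_seq b) = M' a b \<odot>\<^bsub>E2.A\<^esub> E2.pure (unit_seq a) (unit_seq b)"
    using assms by simp
qed (intro E2.A.scale_closed E2.pure_closed unit_seq_closed)

lemma of_matrix_zero: "of_matrix N (\<lambda>_ _. 0) = \<zero>\<^bsub>E2.A\<^esub>"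
  unfolding of_matrix_def by simp

lemma of_matrix_add: "of_matrix N (\<lambda>a b. M a b + M' a b) = of_matrix N M \<oplus>\<^bsub>E2.A\<^esub> of_matrix N M'"
proof -
  let ?e = "\<lambda>M a b. M a b \<odot>\<^bsub>E2.A\<^esub> E2.pure (unit_seq a) (unit_seq b)"
  have c: "?e M a b \<in> carrier E2.A" for M a b by simp
  have r: "finsum E2.A (?e (\<lambda>a b. M a b + M' a b) a) {..<N} = finsum E2.A (?e M a) {..<N} \<oplus>\<^bsub>E2.A\<^esub> finsum E2.A (?e M' a) {..<N}" for a
  proof -
    have "finsum E2.A (?e (\<lambda>a b. M a b + M' a b) a) {..<N} = finsum E2.A (\<lambda>b. ?e M a b \<oplus>\<^bsub>E2.A\<^esub> ?e M' a b) {..<N}"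
      by (rule E2.A.finsum_cong') (simp_all add: E2.A.scale_add_left)
    also have "\<dots> = finsum E2.A (?e M a) {..<N} \<oplus>\<^bsub>E2.A\<^esub> finsum E2.A (?e M' a) {..<N}"
      by (rule E2.A.finsum_addf) (intro Pi_I c)+
    finally show ?thesis .
  qed
  show ?thesis
    unfolding of_matrix_def r by (rule E2.A.finsum_addf) (intro Pi_I of_matrix_row_closed)+
qed

lemma of_matrix_rank_one:
  "of_matrix N (\<lambda>a b. x a * y b) = E2.pure (trunc N x) (trunc N y)"
proof -
  have "E2.pure (trunc N x) (trunc N y) = finsum E2.A (\<lambda>a. E2.pure (x a \<odot>\<^bsub>ell3\<^esub> unit_seq a) (trunc N y)) {..<N}"
    unfolding trunc_eq_finsum[of N x] by (rule E2.pure_finsum_left) (simp_all del: ell3_simps)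
  also have "\<dots> = of_matrix N (\<lambda>a b. x a * y b)"
    unfolding of_matrix_def
  proof (rule E2.A.finsum_cong')
    fix a assume "a \<in> {..<N}"
    have "E2.pure (x a \<odot>\<^bsub>ell3\<^esub> unit_seq a) (trunc N y) =
        finsum E2.A (\<lambda>b. E2.pure (x a \<odot>\<^bsub>ell3\<^esub> unit_seq a) (y b \<odot>\<^bsub>ell3\<^esub> unit_seq b)) {..<N}"
      unfolding trunc_eq_finsum[of N y] by (rule E2.pure_finsum_right) (simp_all del: ell3_simps)
    also have "\<dots> = finsum E2.A (\<lambda>b. (x a * y b) \<odot>\<^bsub>E2.A\<^esub> E2.pure (unit_seq a) (unit_seq b)) {..<N}"
    proof (rule E2.A.finsum_cong')
      fix b
      have "E2.pure (x a \<odot>\<^bsub>ell3\<^esub> unit_seq a) (y b \<odot>\<^bsub>ell3\<^esub> unit_seq b) =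
          y b \<odot>\<^bsub>E2.A\<^esub> (x a \<odot>\<^bsub>E2.A\<^esub> E2.pure (unit_seq a) (unit_seq b))"
        by (simp only: E2.pure_scale_left E2.pure_scale_right unit_seq_closed ell3.scale_closed)
      thus "E2.pure (x a \<odot>\<^bsub>ell3\<^esub> unit_seq a) (y b \<odot>\<^bsub>ell3\<^esub> unit_seq b) =
          (x a * y b) \<odot>\<^bsub>E2.A\<^esub> E2.pure (unit_seq a) (unit_seq b)"
        by (simp only: E2.A.scale_scale E2.pure_closed unit_seq_closed mult.commute[of "y b"])
    qed simp_all
    finally show "E2.pure (x a \<odot>\<^bsub>ell3\<^esub> unit_seq a) (trunc N y) =
        finsum E2.A (\<lambda>b. (x a * y b) \<odot>\<^bsub>E2.A\<^esub> E2.pure (unit_seq a) (unit_seq b)) {..<N}" .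
  qed simp_all
  finally show ?thesis by simp
qed

lemma of_matrix_sum:
  "finite S \<Longrightarrow> of_matrix N (\<lambda>a b. \<Sum>k\<in>S. x k a * y k b) = finsum E2.A (\<lambda>k. E2.pure (trunc N (x k)) (trunc N (y k))) S"
proof (induction S rule: finite_induct)
  case (insert k S)
  have "of_matrix N (\<lambda>a b. \<Sum>k\<in>insert k S. x k a * y k b) =
      of_matrix N (\<lambda>a b. x k a * y k b) \<oplus>\<^bsub>E2.A\<^esub> of_matrix N (\<lambda>a b. \<Sum>k\<in>S. x k a * y k b)"
    unfolding of_matrix_add[symmetric] sum.insert[OF insert.hyps] ..
  also have "\<dots> = E2.pure (trunc N (x k)) (trunc N (y k)) \<oplus>\<^bsub>E2.A\<^esub>
      finsum E2.A (\<lambda>k. E2.pure (trunc N (x k)) (trunc N (y k))) S"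
    by (simp only: of_matrix_rank_one insert.IH)
  also have "\<dots> = finsum E2.A (\<lambda>k. E2.pure (trunc N (x k)) (trunc N (y k))) (insert k S)"
    by (rule E2.A.finsum_insert[symmetric]) (use insert.hyps in simp_all)
  finally show ?case .
qed (simp add: of_matrix_zero)

text \<open>A representation over the first N indices, extended by zeros, represents the same
  element of the square at the same cost.\<close>

lemma proj_norm_of_matrix_le:
  assumes "proj_le {..<N} M r"
  shows "proj_norm ell3 ell3 (of_matrix N M) \<le> r"
proof -
  obtain K :: nat and x y where M: "\<forall>a\<in>{..<N}. \<forall>b\<in>{..<N}. M a b = (\<Sum>k<K. x k a * y k b)"
    "(\<Sum>k<K. norm3 {..<N} (x k) * norm3 {..<N} (y k)) \<le> r"
    using assms unfolding proj_le_def by blast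
  have "of_matrix N M = of_matrix N (\<lambda>a b. \<Sum>k<K. x k a * y k b)" by (rule of_matrix_cong) (simp only: M(1) lessThan_iff)
  also have "\<dots> = finsum E2.A (\<lambda>k. E2.pure (trunc N (x k)) (trunc N (y k))) {..<K}"
    by (rule of_matrix_sum) simp
  finally have eq: "of_matrix N M = finsum E2.A (\<lambda>k. E2.pure (trunc N (x k)) (trunc N (y k))) {..<K}" .
  have "proj_norm ell3 ell3 (of_matrix N M) \<le> (\<Sum>k<K. vnorm ell3 (trunc N (x k)) * vnorm ell3 (trunc N (y k)))"
    by (rule E2.proj_norm_le[OF _ _ _ eq]) simp_all
  thus ?thesis using M(2) by (simp add: vnorm_trunc)
qed

text \<open>Restricting the factors of a representation to N coordinates does not increase their
  norms. The slack d > 0 accounts for an infimum that need not be attained.\<close>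

lemma proj_le_matrix_entry:
  assumes z: "z \<in> carrier E2.A" and d: "0 < d"
  shows "proj_le {..<N} (\<lambda>a b. matrix_entry a b z) (proj_norm ell3 ell3 z + d)"
proof -
  obtain K :: nat and x y where r: "\<And>i. i < K \<Longrightarrow> x i \<in> carrier ell3" "\<And>i. i < K \<Longrightarrow> y i \<in> carrier ell3"
    "z = finsum E2.A (\<lambda>i. E2.pure (x i) (y i)) {..<K}"
    "(\<Sum>i<K. vnorm ell3 (x i) * vnorm ell3 (y i)) < proj_norm ell3 ell3 z + d"
    by (rule E2.proj_norm_rep[OF z d]) (rule that)
  have "(\<Sum>i<K. norm3 {..<N} (x i) * norm3 {..<N} (y i)) \<le> (\<Sum>i<K. vnorm ell3 (x i) * vnorm ell3 (y i))"
    by (intro sum_mono mult_mono norm3_le_ell3 norm3_nonneg ell3.vnorm_nonneg r) auto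
  moreover have "matrix_entry a b z = (\<Sum>k<K. x k a * y k b)" for a b
    unfolding r(3) by (rule matrix_entry_finsum) (use r in auto)
  ultimately show ?thesis using r(4) by (intro proj_leI[of "{..<K}" _ _ x y]) auto
qed

text \<open>Telescoping with the truncation P: x \<otimes> y - P x \<otimes> P y = (x - P x)
  \<otimes> y + P x \<otimes> (y - P y), and truncations converge in \<open>ell3\<close>. One finite
  representation of z serves all N.\<close>

lemma of_matrix_entry_tendsto:
  assumes z: "z \<in> carrier E2.A"
  shows "(\<lambda>N. proj_norm ell3 ell3 (z \<ominus>\<^bsub>E2.A\<^esub> of_matrix N (\<lambda>a b. matrix_entry a b z))) \<longlonglongrightarrow> 0"
proof -
  obtain K :: nat and x y where r: "\<And>i. i < K \<Longrightarrow> x i \<in> carrier ell3" "\<And>i. i < K \<Longrightarrow> y i \<in> carrier ell3"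
    "z = finsum E2.A (\<lambda>i. E2.pure (x i) (y i)) {..<K}"
    by (rule E2.alg_tensor_elem[OF z]) (rule that)
  have e: "matrix_entry a b z = (\<Sum>k<K. x k a * y k b)" for a b
    unfolding r(3) by (rule matrix_entry_finsum) (use r in auto)
  define u where "u = (\<lambda>N k. x k \<ominus>\<^bsub>ell3\<^esub> trunc N (x k))"
  define v where "v = (\<lambda>N k. y k \<ominus>\<^bsub>ell3\<^esub> trunc N (y k))"
  have uv: "u N k \<in> carrier ell3" "v N k \<in> carrier ell3" if "k < K" for N k
    using r that by (simp_all add: u_def v_def)
  define B where "B = (\<lambda>N. \<Sum>k<K. vnorm ell3 (u N k) * vnorm ell3 (y k) + vnorm ell3 (x k) * vnorm ell3 (v N k))"
  have le: "proj_norm ell3 ell3 (z \<ominus>\<^bsub>E2.A\<^esub> of_matrix N (\<lambda>a b. matrix_entry a b z)) \<le> B N" for N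
  proof -
    let ?d = "\<lambda>k. E2.pure (u N k) (y k) \<oplus>\<^bsub>E2.A\<^esub> E2.pure (trunc N (x k)) (v N k)"
    let ?t = "\<lambda>k. E2.pure (trunc N (x k)) (trunc N (y k))"
    have split: "E2.pure (x k) (y k) = ?d k \<oplus>\<^bsub>E2.A\<^esub> ?t k" if k: "k < K" for k
    proof -
      have x: "x k = u N k \<oplus>\<^bsub>ell3\<^esub> trunc N (x k)" and y: "y k = v N k \<oplus>\<^bsub>ell3\<^esub> trunc N (y k)"
        using r(1,2)[OF k] by (simp_all add: u_def v_def ell3_diff)
      have px: "E2.pure (u N k \<oplus>\<^bsub>ell3\<^esub> trunc N (x k)) (y k) = E2.pure (u N k) (y k) \<oplus>\<^bsub>E2.A\<^esub> E2.pure (trunc N (x k)) (y k)"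
        by (rule E2.pure_add_left[OF uv(1)[OF k] trunc_closed r(2)[OF k]])
      have py: "E2.pure (trunc N (x k)) (v N k \<oplus>\<^bsub>ell3\<^esub> trunc N (y k)) = E2.pure (trunc N (x k)) (v N k) \<oplus>\<^bsub>E2.A\<^esub> ?t k"
        by (rule E2.pure_add_right[OF trunc_closed uv(2)[OF k] trunc_closed])
      have "E2.pure (u N k) (y k) \<oplus>\<^bsub>E2.A\<^esub> (E2.pure (trunc N (x k)) (v N k) \<oplus>\<^bsub>E2.A\<^esub> ?t k) = ?d k \<oplus>\<^bsub>E2.A\<^esub> ?t k"
        by (rule E2.A.M.a_assoc[symmetric])
          (rule E2.pure_closed uv(1)[OF k] uv(2)[OF k] r(2)[OF k] trunc_closed)+
      thus ?thesis unfolding py[symmetric] y[symmetric] px[symmetric] x[symmetric] .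
    qed
    have dk: "?d k \<in> carrier E2.A" if "k < K" for k
      using uv[OF that, of N] r(2)[OF that] by simp
    hence dc: "?d \<in> {..<K} \<rightarrow> carrier E2.A" by simp
    have tc: "?t \<in> {..<K} \<rightarrow> carrier E2.A" by (intro Pi_I E2.pure_closed trunc_closed)
    have "z = finsum E2.A (\<lambda>k. ?d k \<oplus>\<^bsub>E2.A\<^esub> ?t k) {..<K}"
      unfolding r(3)
    proof (rule E2.A.finsum_cong'[OF refl])
      show "(\<lambda>k. ?d k \<oplus>\<^bsub>E2.A\<^esub> ?t k) \<in> {..<K} \<rightarrow> carrier E2.A" using dk by simp
      show "E2.pure (x k) (y k) = ?d k \<oplus>\<^bsub>E2.A\<^esub> ?t k" if "k \<in> {..<K}" for k
        by (rule split) (use that in simp)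
    qed
    hence zsum: "z = finsum E2.A ?d {..<K} \<oplus>\<^bsub>E2.A\<^esub> finsum E2.A ?t {..<K}"
      unfolding E2.A.finsum_addf[OF dc tc] .
    have m: "of_matrix N (\<lambda>a b. matrix_entry a b z) = finsum E2.A ?t {..<K}"
      unfolding e by (rule of_matrix_sum) simp
    have "finsum E2.A ?t {..<K} \<in> carrier E2.A" by (rule E2.A.finsum_closed[OF tc])
    hence "(finsum E2.A ?d {..<K} \<oplus>\<^bsub>E2.A\<^esub> finsum E2.A ?t {..<K}) \<ominus>\<^bsub>E2.A\<^esub> finsum E2.A ?t {..<K} = finsum E2.A ?d {..<K}"
      using E2.A.finsum_closed[OF dc] by (simp add: a_minus_def E2.A.M.a_assoc E2.A.M.r_neg)
    hence eq: "z \<ominus>\<^bsub>E2.A\<^esub> of_matrix N (\<lambda>a b. matrix_entry a b z) = finsum E2.A ?d {..<K}"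
      unfolding m zsum[symmetric] .
    have "proj_norm ell3 ell3 (finsum E2.A ?d {..<K}) \<le> (\<Sum>k<K. proj_norm ell3 ell3 (?d k))"
      using P2.vnorm_finsum_le[of "{..<K}" ?d] dc by (simp add: alg_normed_finsum)
    also have "\<dots> \<le> B N"
      unfolding B_def
    proof (rule sum_mono)
      fix k assume "k \<in> {..<K}"
      hence k: "k < K" by simp
      have "proj_norm ell3 ell3 (?d k) \<le> proj_norm ell3 ell3 (E2.pure (u N k) (y k)) + proj_norm ell3 ell3 (E2.pure (trunc N (x k)) (v N k))"
        by (intro E2.proj_norm_add_le E2.pure_closed uv r(1,2) k trunc_closed)
      also have "\<dots> \<le> vnorm ell3 (u N k) * vnorm ell3 (y k) + vnorm ell3 (trunc N (x k)) * vnorm ell3 (v N k)"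
        by (intro add_mono E2.proj_norm_pure_le uv r(1,2) k trunc_closed)
      also have "vnorm ell3 (trunc N (x k)) * vnorm ell3 (v N k) \<le> vnorm ell3 (x k) * vnorm ell3 (v N k)"
        by (intro mult_right_mono vnorm_trunc_le ell3.vnorm_nonneg uv r(1,2) k)
      finally show "proj_norm ell3 ell3 (?d k) \<le> vnorm ell3 (u N k) * vnorm ell3 (y k) + vnorm ell3 (x k) * vnorm ell3 (v N k)"
        by simp
    qed
    finally show ?thesis unfolding eq .
  qed
  have "B \<longlonglongrightarrow> (\<Sum>k<K. 0 * vnorm ell3 (y k) + vnorm ell3 (x k) * 0)"
    unfolding B_def u_def v_def
    by (intro tendsto_sum tendsto_add tendsto_mult tendsto_const trunc_tendsto r(1,2)) (simp_all only: lessThan_iff)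
  hence B: "B \<longlonglongrightarrow> 0" by simp
  show ?thesis
  proof (rule Lim_null_comparison[OF always_eventually B], rule allI)
    fix N
    have "0 \<le> proj_norm ell3 ell3 (z \<ominus>\<^bsub>E2.A\<^esub> of_matrix N (\<lambda>a b. matrix_entry a b z))"
      by (rule E2.proj_norm_nonneg) (simp add: z)
    thus "norm (proj_norm ell3 ell3 (z \<ominus>\<^bsub>E2.A\<^esub> of_matrix N (\<lambda>a b. matrix_entry a b z))) \<le> B N"
      using le[of N] by (simp only: real_norm_def abs_of_nonneg)
  qed
qed

text \<open>\<open>proj_le_cotype_6\<close> applies to the N by N corners with a constant that does
  not depend on N. Then N tends to infinity on the left and the slack d to 0 on the right.\<close>

lemma alg_tensor_cotype_6:
  assumes z: "\<And>i. i < n \<Longrightarrow> z i \<in> carrier E2.A"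
  shows "root 6 (\<Sum>i<n. proj_norm ell3 ell3 (z i) ^ 6) \<le> 97 * exp (1/2) *
    sign_avg n (\<lambda>\<epsilon>. proj_norm ell3 ell3 (finsum E2.A (\<lambda>i. \<epsilon> i \<odot>\<^bsub>E2.A\<^esub> z i) {..<n}))"
proof -
  let ?w = "\<lambda>\<epsilon>. finsum E2.A (\<lambda>i. \<epsilon> i \<odot>\<^bsub>E2.A\<^esub> z i) {..<n}"
  let ?S = "sign_avg n (\<lambda>\<epsilon>. proj_norm ell3 ell3 (?w \<epsilon>))"
  define p where "p = (\<lambda>N i. proj_norm ell3 ell3 (of_matrix N (\<lambda>a b. matrix_entry a b (z i))))"
  have wc: "?w \<epsilon> \<in> carrier E2.A" for \<epsilon> by (rule E2.A.finsum_closed) (use z in simp)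
  have step: "root 6 (\<Sum>i<n. p N i ^ 6) \<le> 97 * exp (1/2) * (?S + d)" if d: "0 < d" for N d
  proof -
    have "root 6 (\<Sum>i<n. p N i ^ 6) \<le> 97 * exp (1/2) * sign_avg n (\<lambda>\<epsilon>. proj_norm ell3 ell3 (?w \<epsilon>) + d)"
    proof (rule proj_le_cotype_6[of "{..<N}" n "\<lambda>i a b. matrix_entry a b (z i)"])
      show "p N i \<le> s" if "i < n" "proj_le {..<N} (\<lambda>a b. matrix_entry a b (z i)) s" for i s
        unfolding p_def by (rule proj_norm_of_matrix_le[OF that(2)])
      show "0 \<le> p N i" for i unfolding p_def by (simp add: E2.proj_norm_nonneg)
      show "proj_le {..<N} (\<lambda>a b. \<Sum>i<n. \<epsilon> i * matrix_entry a b (z i)) (proj_norm ell3 ell3 (?w \<epsilon>) + d)" for \<epsilon>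
      proof (rule proj_le_cong[OF proj_le_matrix_entry[OF wc d]])
        fix a b
        have l: "lin_functional E2.A (matrix_entry a b)" using matrix_entry(1)[of a b] by (simp add: lin_functional_def)
        have "matrix_entry a b (?w \<epsilon>) = (\<Sum>i<n. matrix_entry a b (\<epsilon> i \<odot>\<^bsub>E2.A\<^esub> z i))"
          by (rule E2.A.lin_functional_finsum[OF l]) (use z in auto)
        also have "\<dots> = (\<Sum>i<n. \<epsilon> i * matrix_entry a b (z i))"
          by (rule sum.cong) (use z in \<open>auto simp: E2.A.lin_functionalD(2)[OF l]\<close>)
        finally show "(\<Sum>i<n. \<epsilon> i * matrix_entry a b (z i)) = matrix_entry a b (?w \<epsilon>)" by simp
      qed
    qed simp_all
    thus ?thesis by (simp add: sign_avg_add)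
  qed
  have lim: "(\<lambda>N. p N i) \<longlonglongrightarrow> proj_norm ell3 ell3 (z i)" if "i < n" for i
  proof -
    have "(\<lambda>N. p N i - proj_norm ell3 ell3 (z i)) \<longlonglongrightarrow> 0"
    proof (rule Lim_null_comparison[OF _ of_matrix_entry_tendsto[OF z[OF that]]], intro always_eventually allI)
      fix N
      let ?m = "of_matrix N (\<lambda>a b. matrix_entry a b (z i))"
      have m: "z i \<ominus>\<^bsub>alg_normed ell3 ell3\<^esub> ?m = z i \<ominus>\<^bsub>E2.A\<^esub> ?m"
        using P2.scale_minus_one[of ?m] E2.A.scale_minus_one[of ?m] by (simp add: a_minus_def)
      have "\<bar>proj_norm ell3 ell3 (z i) - p N i\<bar> \<le> proj_norm ell3 ell3 (z i \<ominus>\<^bsub>E2.A\<^esub> ?m)"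
        using P2.vnorm_triangle_diff[of "z i" ?m] z[OF that] unfolding p_def by (simp add: m)
      thus "norm (p N i - proj_norm ell3 ell3 (z i)) \<le> proj_norm ell3 ell3 (z i \<ominus>\<^bsub>E2.A\<^esub> ?m)"
        by (simp add: abs_minus_commute)
    qed
    thus ?thesis by (simp add: LIM_zero_iff)
  qed
  have lim2: "(\<lambda>N. root 6 (\<Sum>i<n. p N i ^ 6)) \<longlonglongrightarrow> root 6 (\<Sum>i<n. proj_norm ell3 ell3 (z i) ^ 6)"
    by (intro tendsto_real_root tendsto_sum tendsto_power) (use lim in auto)
  have "root 6 (\<Sum>i<n. proj_norm ell3 ell3 (z i) ^ 6) \<le> 97 * exp (1/2) * ?S + e" if e: "0 < e" for e
  proof -
    have "0 < e / (97 * exp (1/2))" using e by simp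
    from step[OF this] have "root 6 (\<Sum>i<n. p N i ^ 6) \<le> 97 * exp (1/2) * ?S + e" for N
      by (simp add: distrib_left)
    thus ?thesis by (intro LIMSEQ_le_const2[OF lim2]) auto
  qed
  thus ?thesis by (rule field_le_epsilon)
qed

lemma has_cotype_6_proj_tensor: "has_cotype 6 (proj_tensor ell3 ell3)"
  unfolding proj_tensor_eq
proof (rule has_cotype_6I)
  interpret C: seminormed "completion (alg_normed ell3 ell3)" by (rule P2.seminormed_completion)
  show "0 < 97 * exp (1/2::real)" by simp
  show "0 \<le> vnorm (completion (alg_normed ell3 ell3)) x" if "x \<in> carrier (completion (alg_normed ell3 ell3))" for x
    using that by (rule C.vnorm_nonneg)
  show "root 6 (\<Sum>i<n. vnorm (completion (alg_normed ell3 ell3)) (x i) ^ 6) \<le> 97 * exp (1/2) *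
      sign_avg n (\<lambda>\<epsilon>. vnorm (completion (alg_normed ell3 ell3))
        (finsum (completion (alg_normed ell3 ell3)) (\<lambda>i. \<epsilon> i \<odot>\<^bsub>completion (alg_normed ell3 ell3)\<^esub> x i) {..<n}))"
    if "\<And>i. i < n \<Longrightarrow> x i \<in> carrier (completion (alg_normed ell3 ell3))" for n x
  proof (rule P2.completion_cotype_6[OF _ that])
    fix z assume z: "\<And>i. i < n \<Longrightarrow> z i \<in> carrier (alg_normed ell3 ell3)"
    show "root 6 (\<Sum>i<n. vnorm (alg_normed ell3 ell3) (z i) ^ 6) \<le> 97 * exp (1/2) *
        sign_avg n (\<lambda>\<epsilon>. vnorm (alg_normed ell3 ell3) (finsum (alg_normed ell3 ell3) (\<lambda>i. \<epsilon> i \<odot>\<^bsub>alg_normed ell3 ell3\<^esub> z i) {..<n}))"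
      using alg_tensor_cotype_6[of n z] z by (simp add: alg_normed_finsum)
  qed
qed

section \<open>Coordinates on the completed square\<close>

lemma alg_normed_diff: "z \<ominus>\<^bsub>alg_normed X Y\<^esub> w = z \<ominus>\<^bsub>alg_tensor X Y\<^esub> w"
  by (simp add: a_minus_def a_inv_def m_inv_def)

abbreviation W where "W \<equiv> completion (alg_normed ell3 ell3)"

interpretation W: seminormed W
  by (rule P2.seminormed_completion)

definition coord2 :: "nat \<Rightarrow> nat \<Rightarrow> (nat \<Rightarrow> ((nat \<Rightarrow> real) \<times> (nat \<Rightarrow> real) \<Rightarrow>\<^sub>0 real) set) set \<Rightarrow> real" where
  "coord2 a b = (SOME l. lin_functional W l \<and> (\<forall>z\<in>carrier W. \<bar>l z\<bar> \<le> 1 * vnorm W z) \<and>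
     (\<forall>\<sigma>. P2.cauchy \<sigma> \<longrightarrow> (\<lambda>n. matrix_entry a b (\<sigma> n)) \<longlonglongrightarrow> l (P2.cls \<sigma>)))"

lemma coord2:
  shows coord2_linear: "lin_functional W (coord2 a b)"
    and coord2_bound: "\<And>z. z \<in> carrier W \<Longrightarrow> \<bar>coord2 a b z\<bar> \<le> 1 * vnorm W z"
    and coord2_cls: "\<And>\<sigma>. P2.cauchy \<sigma> \<Longrightarrow> (\<lambda>n. matrix_entry a b (\<sigma> n)) \<longlonglongrightarrow> coord2 a b (P2.cls \<sigma>)"
proof -
  let ?P = "\<lambda>l. lin_functional W l \<and> (\<forall>z\<in>carrier W. \<bar>l z\<bar> \<le> 1 * vnorm W z) \<and>
     (\<forall>\<sigma>. P2.cauchy \<sigma> \<longrightarrow> (\<lambda>n. matrix_entry a b (\<sigma> n)) \<longlonglongrightarrow> l (P2.cls \<sigma>))"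
  have b: "\<bar>matrix_entry a b z\<bar> \<le> 1 * vnorm (alg_normed ell3 ell3) z" if "z \<in> carrier (alg_normed ell3 ell3)" for z
    using matrix_entry_bound[of z a b] that by simp
  obtain l where l: "lin_functional W l" "\<And>z. z \<in> carrier W \<Longrightarrow> \<bar>l z\<bar> \<le> 1 * vnorm W z"
    "\<And>\<sigma>. P2.cauchy \<sigma> \<Longrightarrow> (\<lambda>n. matrix_entry a b (\<sigma> n)) \<longlonglongrightarrow> l (P2.cls \<sigma>)"
    by (rule P2.lin_functional_completion[OF matrix_entry(1) b]) (assumption, rule that)
  have "?P l" by (intro conjI ballI allI impI l)
  hence *: "?P (coord2 a b)" unfolding coord2_def by (rule someI[of ?P])
  show "lin_functional W (coord2 a b)" using * by (rule conjunct1)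
  show "\<bar>coord2 a b z\<bar> \<le> 1 * vnorm W z" if "z \<in> carrier W" for z
    using * that by (elim conjE) (erule (1) bspec)
  show "(\<lambda>n. matrix_entry a b (\<sigma> n)) \<longlonglongrightarrow> coord2 a b (P2.cls \<sigma>)" if "P2.cauchy \<sigma>" for \<sigma>
    using * that by (elim conjE) (drule spec, erule (1) mp)
qed

lemma coord2_const: "z \<in> carrier E2.A \<Longrightarrow> coord2 a b (P2.cls (\<lambda>_. z)) = matrix_entry a b z"
proof -
  assume "z \<in> carrier E2.A"
  hence "P2.cauchy (\<lambda>_. z)" by (intro P2.cauchy_const) simp
  from LIMSEQ_unique[OF tendsto_const coord2_cls[OF this]] show ?thesis by simp
qed

lemma proj_norm_of_matrix_entry_le:
  assumes z: "z \<in> carrier E2.A"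
  shows "proj_norm ell3 ell3 (of_matrix N (\<lambda>a b. matrix_entry a b z)) \<le> proj_norm ell3 ell3 z"
  by (rule field_le_epsilon, rule proj_norm_of_matrix_le, rule proj_le_matrix_entry[OF z])

lemma proj_norm_of_matrix_tendsto_0:
  assumes M: "\<And>a b. a < N \<Longrightarrow> b < N \<Longrightarrow> (\<lambda>m. M m a b) \<longlonglongrightarrow> 0"
  shows "(\<lambda>m. proj_norm ell3 ell3 (of_matrix N (M m))) \<longlonglongrightarrow> 0"
proof -
  let ?p = "\<lambda>a b. E2.pure (unit_seq a) (unit_seq b)"
  let ?B = "\<lambda>m. \<Sum>a<N. \<Sum>b<N. \<bar>M m a b\<bar> * proj_norm ell3 ell3 (?p a b)"
  have le: "proj_norm ell3 ell3 (of_matrix N (M m)) \<le> ?B m" for m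
  proof -
    have pc: "M m a b \<odot>\<^bsub>E2.A\<^esub> ?p a b \<in> carrier E2.A" for a b by simp
    have "proj_norm ell3 ell3 (of_matrix N (M m)) \<le>
        (\<Sum>a<N. proj_norm ell3 ell3 (finsum E2.A (\<lambda>b. M m a b \<odot>\<^bsub>E2.A\<^esub> ?p a b) {..<N}))"
      using P2.vnorm_finsum_le[of "{..<N}" "\<lambda>a. finsum E2.A (\<lambda>b. M m a b \<odot>\<^bsub>E2.A\<^esub> ?p a b) {..<N}"]
        of_matrix_row_closed by (simp add: alg_normed_finsum of_matrix_def)
    also have "\<dots> \<le> ?B m"
    proof (rule sum_mono)
      fix a
      have "proj_norm ell3 ell3 (finsum E2.A (\<lambda>b. M m a b \<odot>\<^bsub>E2.A\<^esub> ?p a b) {..<N}) \<le>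
          (\<Sum>b<N. proj_norm ell3 ell3 (M m a b \<odot>\<^bsub>E2.A\<^esub> ?p a b))"
        using P2.vnorm_finsum_le[of "{..<N}" "\<lambda>b. M m a b \<odot>\<^bsub>E2.A\<^esub> ?p a b"] pc
        by (simp add: alg_normed_finsum)
      also have "\<dots> = (\<Sum>b<N. \<bar>M m a b\<bar> * proj_norm ell3 ell3 (?p a b))"
        using P2.vnorm_scale by (intro sum.cong refl) simp
      finally show "proj_norm ell3 ell3 (finsum E2.A (\<lambda>b. M m a b \<odot>\<^bsub>E2.A\<^esub> ?p a b) {..<N}) \<le>
          (\<Sum>b<N. \<bar>M m a b\<bar> * proj_norm ell3 ell3 (?p a b))" .
    qed
    finally show ?thesis .
  qed
  have "?B \<longlonglongrightarrow> (\<Sum>a<N. \<Sum>b<N. \<bar>0\<bar> * proj_norm ell3 ell3 (?p a b))"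
    by (intro tendsto_sum tendsto_mult_right tendsto_rabs M) (simp_all only: lessThan_iff)
  hence B: "?B \<longlonglongrightarrow> 0" by simp
  show ?thesis
  proof (rule Lim_null_comparison[OF always_eventually B], rule allI)
    fix m
    have "0 \<le> proj_norm ell3 ell3 (of_matrix N (M m))" by (rule E2.proj_norm_nonneg) simp
    thus "norm (proj_norm ell3 ell3 (of_matrix N (M m))) \<le> ?B m"
      using le[of m] by (simp only: real_norm_def abs_of_nonneg)
  qed
qed

text \<open>Truncation to an \<open>N \<times> N\<close> matrix is a contraction that tends pointwise to the identity,
  so a Cauchy sequence all of whose entries tend to 0 is a null sequence.\<close>

lemma separated_W: "separated W"
  unfolding separated_def
proof (intro ballI impI)
  fix w assume w: "w \<in> carrier W" and vanish: "\<forall>l. bounded_functional W l \<longrightarrow> l w = 0"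
  obtain \<sigma> where s: "P2.cauchy \<sigma>" "w = P2.cls \<sigma>" using w unfolding P2.carrier_completion by blast
  have sc: "\<sigma> n \<in> carrier E2.A" for n using P2.cauchy_carrier[OF s(1)] by simp
  have entry: "(\<lambda>m. matrix_entry a b (\<sigma> m)) \<longlonglongrightarrow> 0" for a b
  proof -
    have "bounded_functional W (coord2 a b)"
      unfolding bounded_functional_def
      by (intro conjI coord2_linear exI[of _ 1] ballI coord2_bound zero_le_one)
    hence "coord2 a b (P2.cls \<sigma>) = 0" using vanish s(2) by simp
    thus ?thesis using coord2_cls[OF s(1), of a b] by simp
  qed
  let ?T = "\<lambda>N z. of_matrix N (\<lambda>a b. matrix_entry a b z)"
  \<comment> \<open>3 * e is made of e for the distance from \<sigma> n to z = \<sigma> K, e for z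
    minus its N by N corner, and e for that corner, which is compared with the corners of later
    \<sigma> m, whose entries tend to 0.\<close>
  have small: "\<exists>K. \<forall>n\<ge>K. proj_norm ell3 ell3 (\<sigma> n) \<le> 3 * e" if e: "0 < e" for e
  proof -
    obtain K where K: "\<And>n m. K \<le> n \<Longrightarrow> K \<le> m \<Longrightarrow> proj_norm ell3 ell3 (\<sigma> n \<ominus>\<^bsub>E2.A\<^esub> \<sigma> m) < e"
      using P2.cauchyD[OF s(1) e] by (auto simp: alg_normed_diff)
    define z where "z = \<sigma> K"
    have z: "z \<in> carrier E2.A" by (simp add: z_def sc)
    have "eventually (\<lambda>N. proj_norm ell3 ell3 (z \<ominus>\<^bsub>E2.A\<^esub> ?T N z) < e) sequentially"
      by (rule order_tendstoD(2)[OF of_matrix_entry_tendsto[OF z] e])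
    then obtain N where N: "proj_norm ell3 ell3 (z \<ominus>\<^bsub>E2.A\<^esub> ?T N z) < e"
      by (auto simp: eventually_sequentially)
    have "proj_norm ell3 ell3 (?T N z) \<le> e"
    proof (rule LIMSEQ_le_const)
      show "(\<lambda>m. e + proj_norm ell3 ell3 (?T N (\<sigma> m))) \<longlonglongrightarrow> e"
        using tendsto_add[OF tendsto_const proj_norm_of_matrix_tendsto_0[OF entry], of e N] by simp
      show "\<exists>L. \<forall>m\<ge>L. proj_norm ell3 ell3 (?T N z) \<le> e + proj_norm ell3 ell3 (?T N (\<sigma> m))"
      proof (intro exI allI impI)
        fix m assume m: "K \<le> m"
        let ?d = "z \<ominus>\<^bsub>E2.A\<^esub> \<sigma> m"
        have d: "?d \<in> carrier E2.A" using z sc by simp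
        have "matrix_entry a b z = matrix_entry a b ?d + matrix_entry a b (\<sigma> m)" for a b
          using P2.lin_functionalD(4)[OF matrix_entry(1), of z "\<sigma> m" a b] z sc by (simp add: alg_normed_diff)
        hence "?T N z = ?T N ?d \<oplus>\<^bsub>E2.A\<^esub> ?T N (\<sigma> m)"
          unfolding of_matrix_add[symmetric] by (intro of_matrix_cong)
        hence "proj_norm ell3 ell3 (?T N z) \<le> proj_norm ell3 ell3 (?T N ?d) + proj_norm ell3 ell3 (?T N (\<sigma> m))"
          using E2.proj_norm_add_le[OF of_matrix_closed of_matrix_closed] by (simp only:)
        also have "proj_norm ell3 ell3 (?T N ?d) \<le> e"
          using proj_norm_of_matrix_entry_le[OF d, of N] K[of K m] m unfolding z_def by simp
        finally show "proj_norm ell3 ell3 (?T N z) \<le> e + proj_norm ell3 ell3 (?T N (\<sigma> m))" by simp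
      qed
    qed
    moreover have "proj_norm ell3 ell3 z \<le> proj_norm ell3 ell3 (z \<ominus>\<^bsub>E2.A\<^esub> ?T N z) + proj_norm ell3 ell3 (?T N z)"
      using P2.vnorm_triangle_diff[of z "?T N z"] z by (simp add: alg_normed_diff)
    ultimately have z2: "proj_norm ell3 ell3 z \<le> 2 * e" using N by linarith
    have "proj_norm ell3 ell3 (\<sigma> n) \<le> 3 * e" if n: "K \<le> n" for n
      using P2.vnorm_triangle_diff[of "\<sigma> n" z] K[of n K] n z sc z2 unfolding z_def by (simp add: alg_normed_diff)
    thus ?thesis by blast
  qed
  have "(\<lambda>n. proj_norm ell3 ell3 (\<sigma> n)) \<longlonglongrightarrow> 0"
  proof (rule LIMSEQ_I)
    fix r :: real assume "0 < r"
    then obtain K where "\<forall>n\<ge>K. proj_norm ell3 ell3 (\<sigma> n) \<le> 3 * (r / 4)" using small[of "r / 4"] by auto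
    hence "norm (proj_norm ell3 ell3 (\<sigma> n) - 0) < r" if "K \<le> n" for n
      using that \<open>0 < r\<close> E2.proj_norm_nonneg[OF sc[of n]] by force
    thus "\<exists>K. \<forall>n\<ge>K. norm (proj_norm ell3 ell3 (\<sigma> n) - 0) < r" by blast
  qed
  moreover have "\<sigma> n \<ominus>\<^bsub>E2.A\<^esub> \<zero>\<^bsub>E2.A\<^esub> = \<sigma> n" for n using sc by (simp add: a_minus_def)
  ultimately have "(\<lambda>n. vnorm (alg_normed ell3 ell3) (\<sigma> n \<ominus>\<^bsub>alg_normed ell3 ell3\<^esub> \<zero>\<^bsub>alg_normed ell3 ell3\<^esub>)) \<longlonglongrightarrow> 0"
    by (simp add: alg_normed_diff)
  hence "P2.cls \<sigma> = P2.cls (\<lambda>_. \<zero>\<^bsub>alg_normed ell3 ell3\<^esub>)"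
    by (subst P2.cls_eq_iff[OF s(1) P2.cauchy_const]) simp_all
  thus "w = \<zero>\<^bsub>W\<^esub>" by (simp add: s(2) P2.completion_zero)
qed

lemma matrix_entry_of_matrix:
  assumes "a < N" "b < N"
  shows "matrix_entry a b (of_matrix N M) = M a b"
proof -
  have l: "lin_functional E2.A (matrix_entry a b)" using matrix_entry(1)[of a b] by (simp add: lin_functional_def)
  have e: "matrix_entry a b (M a' b' \<odot>\<^bsub>E2.A\<^esub> E2.pure (unit_seq a') (unit_seq b')) =
      (if b' = b then if a' = a then M a b else 0 else 0)" for a' b'
    using E2.A.lin_functionalD(2)[OF l, of "E2.pure (unit_seq a') (unit_seq b')" "M a' b'"]
    by (simp add: matrix_entry_pure) (simp add: unit_seq_def)
  have "matrix_entry a b (of_matrix N M) =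
      (\<Sum>a'<N. matrix_entry a b (finsum E2.A (\<lambda>b'. M a' b' \<odot>\<^bsub>E2.A\<^esub> E2.pure (unit_seq a') (unit_seq b')) {..<N}))"
    unfolding of_matrix_def by (rule E2.A.lin_functional_finsum[OF l]) (intro finite_lessThan Pi_I of_matrix_row_closed)+
  also have "\<dots> = (\<Sum>a'<N. \<Sum>b'<N. matrix_entry a b (M a' b' \<odot>\<^bsub>E2.A\<^esub> E2.pure (unit_seq a') (unit_seq b')))"
    by (intro sum.cong refl E2.A.lin_functional_finsum[OF l]) simp_all
  also have "\<dots> = M a b" unfolding e using assms by simp
  finally show ?thesis .
qed

section \<open>Finite tensors in the completed cube\<close>

interpretation E3: tensor_pair W ell3
  by (rule tensor_pair.intro) (rule W.seminormed_axioms ell3.seminormed_axioms)+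

interpretation P3: real_normed_space "alg_normed W ell3"
  by (rule E3.real_normed_space_alg_normed[OF separated_W separated_ell3])

interpretation V3: seminormed "completion (alg_normed W ell3)"
  by (rule P3.seminormed_completion)

abbreviation embed2 where "embed2 z \<equiv> P2.cls (\<lambda>_. z)"

lemma embed2:
  assumes "z \<in> carrier E2.A"
  shows embed2_closed: "embed2 z \<in> carrier W" and embed2_scale: "embed2 (c \<odot>\<^bsub>E2.A\<^esub> z) = c \<odot>\<^bsub>W\<^esub> embed2 z"
    and embed2_norm: "vnorm W (embed2 z) = proj_norm ell3 ell3 z"
proof -
  have z: "z \<in> carrier (alg_normed ell3 ell3)" using assms by simp
  hence c: "P2.cauchy (\<lambda>_. z)" by (rule P2.cauchy_const)
  show "embed2 z \<in> carrier W" by (rule P2.cls_in_completion[OF c])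
  show "embed2 (c \<odot>\<^bsub>E2.A\<^esub> z) = c \<odot>\<^bsub>W\<^esub> embed2 z" using P2.completion_scale[OF c, of c] by simp
  show "vnorm W (embed2 z) = proj_norm ell3 ell3 z" using P2.completion_norm_const[OF z] by simp
qed

lemma embed2_add:
  assumes "z \<in> carrier E2.A" "w \<in> carrier E2.A"
  shows "embed2 (z \<oplus>\<^bsub>E2.A\<^esub> w) = embed2 z \<oplus>\<^bsub>W\<^esub> embed2 w"
  using P2.completion_add[OF P2.cauchy_const P2.cauchy_const, of z w] assms by simp

lemma of_matrix_scale: "of_matrix N (\<lambda>a b. c * M a b) = c \<odot>\<^bsub>E2.A\<^esub> of_matrix N M"
proof -
  let ?p = "\<lambda>M a b. M a b \<odot>\<^bsub>E2.A\<^esub> E2.pure (unit_seq a) (unit_seq b)"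
  have row: "finsum E2.A (?p (\<lambda>a b. c * M a b) a) {..<N} = c \<odot>\<^bsub>E2.A\<^esub> finsum E2.A (?p M a) {..<N}" for a
  proof -
    have pc: "?p M a \<in> {..<N} \<rightarrow> carrier E2.A" by simp
    have "?p (\<lambda>a b. c * M a b) a = (\<lambda>b. c \<odot>\<^bsub>E2.A\<^esub> ?p M a b)" by (simp add: E2.A.scale_scale)
    thus ?thesis using E2.A.scale_finsum[OF finite_lessThan pc, of c] by (simp only:)
  qed
  have rc: "(\<lambda>a. finsum E2.A (?p M a) {..<N}) \<in> {..<N} \<rightarrow> carrier E2.A"
    by (intro Pi_I of_matrix_row_closed)
  show ?thesis
    unfolding of_matrix_def row by (rule E2.A.scale_finsum[OF finite_lessThan rc, symmetric])
qed

text \<open>Slices in the third index enter the completed square first, because the cube is the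
  iterated product of that square with \<open>ell3\<close>.\<close>

definition of_tensor where
  "of_tensor D t = finsum E3.A (\<lambda>c. E3.pure (embed2 (of_matrix D (\<lambda>a b. t (a, b, c)))) (unit_seq c)) {..<D}"

lemma slice_closed [simp]: "E3.pure (embed2 (of_matrix D M)) (unit_seq c) \<in> carrier E3.A"
  by (intro E3.pure_closed embed2_closed of_matrix_closed unit_seq_closed)

lemma of_tensor_closed [simp]: "of_tensor D t \<in> carrier E3.A"
  unfolding of_tensor_def by (intro E3.A.finsum_closed Pi_I slice_closed)

lemma of_tensor_add: "of_tensor D (\<lambda>p. s p + t p) = of_tensor D s \<oplus>\<^bsub>E3.A\<^esub> of_tensor D t"
proof -
  have slice: "E3.pure (embed2 (of_matrix D (\<lambda>a b. s (a, b, c) + t (a, b, c)))) (unit_seq c) =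
      E3.pure (embed2 (of_matrix D (\<lambda>a b. s (a, b, c)))) (unit_seq c) \<oplus>\<^bsub>E3.A\<^esub>
      E3.pure (embed2 (of_matrix D (\<lambda>a b. t (a, b, c)))) (unit_seq c)" for c
    unfolding of_matrix_add embed2_add[OF of_matrix_closed of_matrix_closed]
    by (rule E3.pure_add_left[OF embed2_closed[OF of_matrix_closed] embed2_closed[OF of_matrix_closed] unit_seq_closed])
  show ?thesis
    unfolding of_tensor_def slice by (rule E3.A.finsum_addf) (intro Pi_I slice_closed)+
qed

lemma of_tensor_scale: "of_tensor D (\<lambda>p. r * t p) = r \<odot>\<^bsub>E3.A\<^esub> of_tensor D t"
proof -
  have slice: "E3.pure (embed2 (of_matrix D (\<lambda>a b. r * t (a, b, c)))) (unit_seq c) =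
      r \<odot>\<^bsub>E3.A\<^esub> E3.pure (embed2 (of_matrix D (\<lambda>a b. t (a, b, c)))) (unit_seq c)" for c
    unfolding of_matrix_scale embed2_scale[OF of_matrix_closed]
    by (rule E3.pure_scale_left[OF embed2_closed[OF of_matrix_closed] unit_seq_closed])
  show ?thesis
    unfolding of_tensor_def slice
    by (rule E3.A.scale_finsum[symmetric]) (intro finite_lessThan Pi_I slice_closed)+
qed

lemma of_tensor_sum:
  "finite I \<Longrightarrow> of_tensor D (\<lambda>p. \<Sum>i\<in>I. \<epsilon> i * t i p) = finsum E3.A (\<lambda>i. \<epsilon> i \<odot>\<^bsub>E3.A\<^esub> of_tensor D (t i)) I"
proof (induction I rule: finite_induct)
  case empty
  show ?case using of_tensor_scale[of D 0 "\<lambda>_. 0"] by simp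
next
  case (insert i I)
  have "of_tensor D (\<lambda>p. \<Sum>i\<in>insert i I. \<epsilon> i * t i p) =
      of_tensor D (\<lambda>p. \<epsilon> i * t i p) \<oplus>\<^bsub>E3.A\<^esub> of_tensor D (\<lambda>p. \<Sum>i\<in>I. \<epsilon> i * t i p)"
    unfolding of_tensor_add[symmetric] sum.insert[OF insert.hyps] ..
  also have "\<dots> = \<epsilon> i \<odot>\<^bsub>E3.A\<^esub> of_tensor D (t i) \<oplus>\<^bsub>E3.A\<^esub> finsum E3.A (\<lambda>i. \<epsilon> i \<odot>\<^bsub>E3.A\<^esub> of_tensor D (t i)) I"
    by (simp only: of_tensor_scale insert.IH)
  also have "\<dots> = finsum E3.A (\<lambda>i. \<epsilon> i \<odot>\<^bsub>E3.A\<^esub> of_tensor D (t i)) (insert i I)"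
    by (rule E3.A.finsum_insert[symmetric]) (use insert.hyps in simp_all)
  finally show ?case .
qed

lemma of_tensor_tensor3:
  "of_tensor D (tensor3 u v w) = E3.pure (embed2 (E2.pure (trunc D u) (trunc D v))) (trunc D w)"
proof -
  let ?z = "E2.pure (trunc D u) (trunc D v)"
  have z: "?z \<in> carrier E2.A" by (intro E2.pure_closed trunc_closed)
  have slice: "E3.pure (embed2 (of_matrix D (\<lambda>a b. tensor3 u v w (a, b, c)))) (unit_seq c) =
      E3.pure (embed2 ?z) (w c \<odot>\<^bsub>ell3\<^esub> unit_seq c)" for c
  proof -
    have "(\<lambda>a b. tensor3 u v w (a, b, c)) = (\<lambda>a b. w c * (u a * v b))" by (simp add: tensor3_def mult_ac)
    hence "of_matrix D (\<lambda>a b. tensor3 u v w (a, b, c)) = w c \<odot>\<^bsub>E2.A\<^esub> ?z"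
      by (simp only: of_matrix_scale of_matrix_rank_one)
    thus ?thesis
      by (simp only: embed2_scale[OF z] E3.pure_scale_left[OF embed2_closed[OF z] unit_seq_closed]
          E3.pure_scale_right[OF embed2_closed[OF z] unit_seq_closed])
  qed
  show ?thesis
    unfolding of_tensor_def slice trunc_eq_finsum[of D w]
    by (rule E3.pure_finsum_right[symmetric])
      (intro embed2_closed z finite_lessThan Pi_I ell3.scale_closed unit_seq_closed)+
qed

text \<open>For fixed w the trilinear form is a functional on the algebraic square, bounded by
  \<kappa> times the norm of w because it is so on pure tensors; limits along Cauchy sequences carry
  the bound over to \<open>W\<close>. The bilinear form on \<open>W\<close> and \<open>ell3\<close>
  obtained in this way lifts to the algebraic cube, where its value at \<open>of_tensor D t\<close>
  is the given sum.\<close>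

lemma of_tensor_functional:
  assumes T: "\<And>u v w. \<bar>\<Sum>p\<in>cube D. T p * tensor3 u v w p\<bar> \<le> \<kappa> * (norm3 {..<D} u * norm3 {..<D} v * norm3 {..<D} w)"
    and \<kappa>: "0 \<le> \<kappa>"
  shows "\<bar>\<Sum>p\<in>cube D. T p * t p\<bar> \<le> \<kappa> * proj_norm W ell3 (of_tensor D t)"
proof -
  define B where "B = (\<lambda>\<omega> w. \<Sum>(a, b, c)\<in>cube D. T (a, b, c) * (coord2 a b \<omega> * w c))"
  have fin: "finite (cube D)" by simp
  have bil: "bilinear_on W ell3 B"
    unfolding bilinear_on_def lin_functional_def
  proof (intro conjI ballI allI)
    fix \<omega> x y assume o: "\<omega> \<in> carrier W"
    show "B \<omega> (x \<oplus>\<^bsub>ell3\<^esub> y) = B \<omega> x + B \<omega> y"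
      unfolding B_def sum.distrib[symmetric] by (rule sum.cong) (auto simp: algebra_simps)
  next
    fix \<omega> r x assume o: "\<omega> \<in> carrier W"
    show "B \<omega> (r \<odot>\<^bsub>ell3\<^esub> x) = r * B \<omega> x"
      unfolding B_def sum_distrib_left by (rule sum.cong) (auto simp: algebra_simps)
  next
    fix w \<omega> \<eta> assume o: "\<omega> \<in> carrier W" "\<eta> \<in> carrier W"
    show "B (\<omega> \<oplus>\<^bsub>W\<^esub> \<eta>) w = B \<omega> w + B \<eta> w"
      unfolding B_def sum.distrib[symmetric]
      by (rule sum.cong) (auto simp: W.lin_functionalD(1)[OF coord2_linear o] algebra_simps)
  next
    fix w r \<omega> assume o: "\<omega> \<in> carrier W"
    show "B (r \<odot>\<^bsub>W\<^esub> \<omega>) w = r * B \<omega> w"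
      unfolding B_def sum_distrib_left
      by (rule sum.cong) (auto simp: W.lin_functionalD(2)[OF coord2_linear o])
  qed
  have bound: "\<bar>B \<omega> w\<bar> \<le> \<kappa> * (vnorm W \<omega> * vnorm ell3 w)" if o: "\<omega> \<in> carrier W" and w: "w \<in> carrier ell3" for \<omega> w
  proof -
    obtain \<sigma> where s: "P2.cauchy \<sigma>" "\<omega> = P2.cls \<sigma>" using o unfolding P2.carrier_completion by blast
    have sc: "\<sigma> n \<in> carrier E2.A" for n using P2.cauchy_carrier[OF s(1)] by simp
    define l where "l = (\<lambda>z. \<Sum>(a, b, c)\<in>cube D. T (a, b, c) * (matrix_entry a b z * w c))"
    have llin: "lin_functional E2.A l"
      unfolding lin_functional_def
    proof (intro conjI ballI allI)
      fix x y assume "x \<in> carrier E2.A" "y \<in> carrier E2.A"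
      hence e: "matrix_entry a b (x \<oplus>\<^bsub>E2.A\<^esub> y) = matrix_entry a b x + matrix_entry a b y" for a b
        using P2.lin_functionalD(1)[OF matrix_entry(1), of x y] by simp
      show "l (x \<oplus>\<^bsub>E2.A\<^esub> y) = l x + l y"
        unfolding l_def sum.distrib[symmetric] e by (rule sum.cong) (auto simp: algebra_simps)
    next
      fix r x assume "x \<in> carrier E2.A"
      hence e: "matrix_entry a b (r \<odot>\<^bsub>E2.A\<^esub> x) = r * matrix_entry a b x" for a b
        using P2.lin_functionalD(2)[OF matrix_entry(1), of x] by simp
      show "l (r \<odot>\<^bsub>E2.A\<^esub> x) = r * l x"
        unfolding l_def sum_distrib_left e by (rule sum.cong) (auto simp: algebra_simps)
    qed
    have lb: "\<bar>l (E2.pure x y)\<bar> \<le> (\<kappa> * vnorm ell3 w) * (vnorm ell3 x * vnorm ell3 y)"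
      if x: "x \<in> carrier ell3" and y: "y \<in> carrier ell3" for x y
    proof -
      have "l (E2.pure x y) = (\<Sum>p\<in>cube D. T p * tensor3 x y w p)"
        unfolding l_def by (rule sum.cong) (auto simp: tensor3_def matrix_entry_pure x y)
      hence "\<bar>l (E2.pure x y)\<bar> \<le> \<kappa> * (norm3 {..<D} x * norm3 {..<D} y * norm3 {..<D} w)"
        using T by simp
      also have "\<dots> \<le> \<kappa> * (vnorm ell3 x * vnorm ell3 y * vnorm ell3 w)"
        by (intro mult_left_mono mult_mono norm3_le_ell3 x y w norm3_nonneg mult_nonneg_nonneg ell3.vnorm_nonneg \<kappa>)
      finally show ?thesis by (simp only: mult_ac)
    qed
    have kw: "0 \<le> \<kappa> * vnorm ell3 w" by (intro mult_nonneg_nonneg \<kappa> ell3.vnorm_nonneg w)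
    have ineq: "\<bar>l (\<sigma> n)\<bar> \<le> (\<kappa> * vnorm ell3 w) * vnorm (alg_normed ell3 ell3) (\<sigma> n)" for n
      unfolding alg_normed_simps by (rule E2.lin_functional_bound[OF llin kw _ sc]) (rule lb)
    have "(\<lambda>n. l (\<sigma> n)) \<longlonglongrightarrow> B \<omega> w"
      unfolding l_def B_def s(2) case_prod_unfold
      by (intro tendsto_sum tendsto_mult tendsto_const coord2_cls[OF s(1)])
    hence lim: "(\<lambda>n. \<bar>l (\<sigma> n)\<bar>) \<longlonglongrightarrow> \<bar>B \<omega> w\<bar>" by (rule tendsto_rabs)
    have lim': "(\<lambda>n. (\<kappa> * vnorm ell3 w) * vnorm (alg_normed ell3 ell3) (\<sigma> n)) \<longlonglongrightarrow> (\<kappa> * vnorm ell3 w) * vnorm W \<omega>"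
      unfolding s(2) by (intro tendsto_mult_left P2.completion_norm[OF s(1)])
    have "\<bar>B \<omega> w\<bar> \<le> (\<kappa> * vnorm ell3 w) * vnorm W \<omega>"
      by (rule LIMSEQ_le[OF lim lim']) (intro exI allI impI ineq)
    thus ?thesis by (simp only: mult_ac)
  qed
  obtain L where L: "lin_functional (alg_normed W ell3) L"
    "\<And>x y. x \<in> carrier W \<Longrightarrow> y \<in> carrier ell3 \<Longrightarrow> L (E3.pure x y) = B x y"
    "\<And>z. z \<in> carrier E3.A \<Longrightarrow> \<bar>L z\<bar> \<le> \<kappa> * proj_norm W ell3 z"
    by (rule E3.bounded_bilinear_lift[OF bil \<kappa> bound]) (assumption, assumption, rule that)
  have lA: "lin_functional E3.A L" using L(1) by (simp add: lin_functional_def)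
  have "L (of_tensor D t) = (\<Sum>c<D. L (E3.pure (embed2 (of_matrix D (\<lambda>a b. t (a, b, c)))) (unit_seq c)))"
    unfolding of_tensor_def by (rule E3.A.lin_functional_finsum[OF lA]) (intro finite_lessThan Pi_I slice_closed)+
  also have "\<dots> = (\<Sum>c<D. B (embed2 (of_matrix D (\<lambda>a b. t (a, b, c)))) (unit_seq c))"
    by (intro sum.cong refl L(2) embed2_closed of_matrix_closed unit_seq_closed)
  also have "\<dots> = (\<Sum>c<D. \<Sum>p\<in>cube D. if c = snd (snd p) then T p * t p else 0)"
    unfolding B_def
  proof (intro sum.cong refl)
    fix c p assume p: "p \<in> cube D"
    obtain a b c' where abc: "p = (a, b, c')" by (cases p)
    have "coord2 a b (embed2 (of_matrix D (\<lambda>a b. t (a, b, c)))) = t (a, b, c)"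
      using p by (simp add: coord2_const matrix_entry_of_matrix abc)
    thus "(case p of (a, b, c') \<Rightarrow> T (a, b, c') * (coord2 a b (embed2 (of_matrix D (\<lambda>a b. t (a, b, c)))) * unit_seq c c')) =
        (if c = snd (snd p) then T p * t p else 0)"
      by (simp add: abc unit_seq_def)
  qed
  also have "\<dots> = (\<Sum>p\<in>cube D. \<Sum>c<D. if c = snd (snd p) then T p * t p else 0)" by (rule sum.swap)
  also have "\<dots> = (\<Sum>p\<in>cube D. T p * t p)" by (rule sum.cong) auto
  finally show ?thesis using L(3)[OF of_tensor_closed, of D t] by simp
qed

lemma tensor3_seminorm_of_tensor: "tensor3_seminorm D (\<lambda>t. proj_norm W ell3 (of_tensor D t))"
  unfolding tensor3_seminorm_def
proof (intro conjI allI impI)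
  show "proj_norm W ell3 (of_tensor D (\<lambda>p. s p + t p)) \<le> proj_norm W ell3 (of_tensor D s) + proj_norm W ell3 (of_tensor D t)" for s t
    unfolding of_tensor_add by (intro E3.proj_norm_add_le of_tensor_closed)
  show "proj_norm W ell3 (of_tensor D (\<lambda>p. c * t p)) = \<bar>c\<bar> * proj_norm W ell3 (of_tensor D t)" for c t
    using P3.vnorm_scale[of "of_tensor D t" c] by (simp add: of_tensor_scale)
  show "proj_norm W ell3 (of_tensor D (tensor3 u v w)) \<le> norm3 {..<D} u * norm3 {..<D} v * norm3 {..<D} w" for u v w
  proof -
    let ?z = "E2.pure (trunc D u) (trunc D v)"
    have z: "?z \<in> carrier E2.A" by (intro E2.pure_closed trunc_closed)
    have "proj_norm W ell3 (of_tensor D (tensor3 u v w)) \<le> vnorm W (embed2 ?z) * vnorm ell3 (trunc D w)"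
      unfolding of_tensor_tensor3 by (intro E3.proj_norm_pure_le embed2_closed z trunc_closed)
    also have "\<dots> \<le> (vnorm ell3 (trunc D u) * vnorm ell3 (trunc D v)) * vnorm ell3 (trunc D w)"
      unfolding embed2_norm[OF z] by (intro mult_right_mono E2.proj_norm_pure_le trunc_closed ell3.vnorm_nonneg)
    finally show ?thesis by (simp only: vnorm_trunc)
  qed
  show "\<bar>\<Sum>p\<in>cube D. T p * t p\<bar> \<le> \<kappa> * proj_norm W ell3 (of_tensor D t)"
    if T: "\<forall>u v w. \<bar>\<Sum>p\<in>cube D. T p * tensor3 u v w p\<bar> \<le> \<kappa> * (norm3 {..<D} u * norm3 {..<D} v * norm3 {..<D} w)"
    for T \<kappa> t
  proof (cases "D = 0")
    case True
    hence "of_tensor D t = \<zero>\<^bsub>E3.A\<^esub>" by (simp add: of_tensor_def)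
    thus ?thesis using True by (simp add: E3.proj_norm_zero)
  next
    case False
    \<comment> \<open>A unit vector forces 0 \<le> \<kappa>; for D = 0 the hypothesis would leave
      the sign of \<kappa> open.\<close>
    let ?e = "\<lambda>i. if i = 0 then 1 else 0 :: real"
    have "norm3 {..<D} ?e = 1" using False by (intro norm3_unit) auto
    hence "0 \<le> \<kappa>" using T[rule_format, of ?e ?e ?e] by simp
    thus ?thesis using T by (intro of_tensor_functional) blast+
  qed
qed

text \<open>Constant sequences preserve norms and signed sums, so a finite family in the algebraic
  cube that violates cotype violates it in the completion.\<close>

lemma not_finite_cotype_proj_tensor3: "\<not> finite_cotype (proj_tensor (proj_tensor ell3 ell3) ell3)"
proof
  let ?V = "completion (alg_normed W ell3)"
  assume "finite_cotype (proj_tensor (proj_tensor ell3 ell3) ell3)"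
  then obtain q C where q: "2 \<le> q" and C: "0 < C"
    and ct: "\<forall>(N :: nat) x. (\<forall>i<N. x i \<in> carrier ?V) \<longrightarrow>
        (\<Sum>i<N. vnorm ?V (x i) powr q) powr (1 / q) \<le>
        C * sqrt (sign_avg N (\<lambda>\<epsilon>. (vnorm ?V (finsum ?V (\<lambda>i. \<epsilon> i \<odot>\<^bsub>?V\<^esub> x i) {..<N}))\<^sup>2))"
    unfolding finite_cotype_def has_cotype_def expectation_signs proj_tensor_eq by blast
  have q1: "1 \<le> q" using q by simp
  obtain n D :: nat and t :: "nat \<Rightarrow> nat \<times> nat \<times> nat \<Rightarrow> real" where lt:
    "\<And>N. tensor3_seminorm D N \<Longrightarrow>
       C * sqrt (sign_avg n (\<lambda>\<epsilon>. (N (\<lambda>p. \<Sum>i<n. \<epsilon> i * t i p))\<^sup>2)) < (\<Sum>i<n. N (t i) powr q) powr (1 / q)"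
    by (rule tensor3_seminorm_no_cotype[OF q1 C]) (rule that)
  define x where "x = (\<lambda>i. P3.cls (\<lambda>_::nat. of_tensor D (t i)))"
  have c: "P3.cauchy (\<lambda>_. z)" if "z \<in> carrier E3.A" for z using that by (intro P3.cauchy_const) simp
  have xc: "x i \<in> carrier ?V" for i unfolding x_def by (intro P3.cls_in_completion c of_tensor_closed)
  have xn: "vnorm ?V (x i) = proj_norm W ell3 (of_tensor D (t i))" for i
    unfolding x_def by (subst P3.completion_norm_const) simp_all
  have sn: "vnorm ?V (finsum ?V (\<lambda>i. \<epsilon> i \<odot>\<^bsub>?V\<^esub> x i) {..<n}) = proj_norm W ell3 (of_tensor D (\<lambda>p. \<Sum>i<n. \<epsilon> i * t i p))" for \<epsilon>
  proof -
    have sc: "\<epsilon> i \<odot>\<^bsub>E3.A\<^esub> of_tensor D (t i) \<in> carrier E3.A" for i by simp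
    have "\<epsilon> i \<odot>\<^bsub>?V\<^esub> x i = P3.cls (\<lambda>_. \<epsilon> i \<odot>\<^bsub>E3.A\<^esub> of_tensor D (t i))" for i
      using P3.completion_scale[OF c[OF of_tensor_closed], of "\<epsilon> i" D "t i"] by (simp add: x_def)
    hence "finsum ?V (\<lambda>i. \<epsilon> i \<odot>\<^bsub>?V\<^esub> x i) {..<n} = finsum ?V (\<lambda>i. P3.cls (\<lambda>_. \<epsilon> i \<odot>\<^bsub>E3.A\<^esub> of_tensor D (t i))) {..<n}"
      by (simp only:)
    also have "\<dots> = P3.cls (\<lambda>_. finsum (alg_normed W ell3) (\<lambda>i. \<epsilon> i \<odot>\<^bsub>E3.A\<^esub> of_tensor D (t i)) {..<n})"
      by (rule P3.completion_finsum(2)) (intro finite_lessThan c sc)+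
    also have "finsum (alg_normed W ell3) (\<lambda>i. \<epsilon> i \<odot>\<^bsub>E3.A\<^esub> of_tensor D (t i)) {..<n} = of_tensor D (\<lambda>p. \<Sum>i<n. \<epsilon> i * t i p)"
      unfolding alg_normed_finsum by (rule of_tensor_sum[symmetric]) simp
    finally show ?thesis by (simp add: P3.completion_norm_const)
  qed
  have "(\<Sum>i<n. vnorm ?V (x i) powr q) powr (1 / q) \<le>
      C * sqrt (sign_avg n (\<lambda>\<epsilon>. (vnorm ?V (finsum ?V (\<lambda>i. \<epsilon> i \<odot>\<^bsub>?V\<^esub> x i) {..<n}))\<^sup>2))"
    using ct xc by blast
  thus False using lt[OF tensor3_seminorm_of_tensor] unfolding xn sn by simp
qed

section \<open>The theorem\<close>

theorem mainTheorem3: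
  shows "\<exists>Y :: (nat \<Rightarrow> real) normed_rec.
           banach_space Y \<and>
           finite_cotype (proj_tensor Y Y) \<and>
           \<not> finite_cotype (proj_tensor (proj_tensor Y Y) Y)"
proof (intro exI conjI)
  show "banach_space ell3" by (rule banach_space_ell3)
  show "finite_cotype (proj_tensor ell3 ell3)"
    unfolding finite_cotype_def using has_cotype_6_proj_tensor by (intro exI[of _ 6]) simp
  show "\<not> finite_cotype (proj_tensor (proj_tensor ell3 ell3) ell3)" by (rule not_finite_cotype_proj_tensor3)
qed

end
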